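(* Let $\mathcal{C}$ be a rigid, pseudo-abelian, $\mathbb{Q}$-linear ACU tensor category with unit object $\mathbb{I}$, let $V\in\mathcal{C}$ and let $r:=\mathrm{rank}(V)=\mathrm{ev}_V^{\tau}\circ C_V\in \mathrm{End}(\mathbb{I})$. For all integers $g\ge i\ge 0$ the following identities hold. (1) As morphisms $\wedge^iV\otimes\wedge^iV^\vee\to\mathbb{I}$, $$\mathrm{ev}_{13,24}\circ(D^{i,g}\otimes D_{i,g})=\binom{g}{g-i}^{-1}\binom{r-i}{g-i}\cdot \mathrm{ev}_{V,a}^{i,\tau}.$$ (2) As morphisms $\wedge^iV^\vee\otimes\wedge^{g-i}V^\vee\to\wedge^gV^\vee$, $$\mathrm{ev}_{13}\circ(D_{i,g}\otimes 1_{\wedge^{g-i}V^\vee})=(-1)^{i(g-i)}\,(\mathrm{ev}_{V,a}^{i}\otimes 1_{\wedge^gV^\vee})\circ(1_{\wedge^iV^\vee}\otimes D_{g-i,g}),$$ and, as morphisms $\wedge^iV\otimes\wedge^{g-i}V\to\wedge^gV^{\vee\vee}$, $$\mathrm{ev}_{13}\circ(D^{i,g}\otimes 1_{\wedge^{g-i}V})=(-1)^{i(g-i)}\,(\mathrm{ev}_{V,a}^{i,\tau}\otimes 1_{\wedge^gV^{\vee\vee}})\circ(1_{\wedge^iV}\otimes D^{g-i,g}).$$ (3) As endomorphisms of $\wedge^iV$, respectively of $\wedge^{g-i}V^\vee$, $$(1_{\wedge^iV}\otimes \mathrm{ev}_{V^\vee,a}^{g,\tau})\circ(D_{g-i,g}\otimes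 1_{\wedge^gV^{\vee\vee}})\circ D^{i,g}=(-1)^{i(g-i)}\binom{g}{g-i}^{-1}\binom{r-i}{g-i},$$ $$(1_{\wedge^{g-i}V^\vee}\otimes \mathrm{ev}_{V^\vee,a}^{g})\circ(D^{i,g}\otimes 1_{\wedge^gV^{\vee}})\circ D_{g-i,g}=(-1)^{i(g-i)}\binom{g}{i}^{-1}\binom{r+i-g}{i}.$$ (4) As morphisms $\wedge^iV\otimes\wedge^{g-i}V\to\wedge^gV^{\vee\vee}$, respectively $\wedge^iV^\vee\otimes\wedge^{g-i}V^\vee\to\wedge^gV^{\vee}$, $$\varphi_{g-i,i}^{13\to\wedge^gV^{\vee\vee}}\circ(D^{i,g}\otimes D^{g-i,g})=\binom{g}{g-i}^{-1}\binom{r-i}{g-i}\cdot i_{\wedge^gV}\circ\varphi_{i,g-i},$$ $$\varphi_{g-i,i}^{13\to\wedge^gV^{\vee}}\circ(D_{i,g}\otimes D_{g-i,g})=\binom{g}{g-i}^{-1}\binom{r-i}{g-i}\cdot\varphi_{i,g-i}.$$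
   Context: ACU tensor category: additive symmetric monoidal category with biadditive $\otimes$ (associativity and unit constraints suppressed, symmetry $\tau_{X,Y}$), with internal homs $\hom(X,Y)$ and evaluations $\mathrm{ev}_{X,Y}:\hom(X,Y)\otimes X\to Y$; $X^\vee=\hom(X,\mathbb{I})$, $\mathrm{ev}_X:X^\vee\otimes X\to\mathbb{I}$. Rigid: the canonical maps $\bigotimes\hom(X_i,Y_i)\to\hom(\bigotimes X_i,\bigotimes Y_i)$ and $i_X:X\to X^{\vee\vee}$ are isomorphisms. Pseudo-abelian: idempotents split. A superscript $\tau$ on an evaluation means precomposition with the symmetry, e.g. $\mathrm{ev}_X^\tau=\mathrm{ev}_X\circ\tau_{X,X^\vee}:X\otimes X^\vee\to\mathbb{I}$. $C_X:\mathbb{I}\to X\otimes X^\vee$ is the coevaluation (Casimir element). $\alpha_{X,Y}:Y\otimes X^\vee\to\hom(X,Y)$ is the canonical isomorphism, corresponding to $1_Y\otimes\mathrm{ev}_X$. Elements of the commutative $\mathbb{Q}$-algebra $\mathrm{End}(\mathbb{I})$ act on every object. $\binom{T}{k}=\frac1{k!}T(T-1)\cdots(T-k+1)\in\mathbb{Q}[T]$ for $k\ge1$, $\binom T0=1$. Alternating algebra: $\wedge^iV$ is the direct factor of $\otimes^iV$ cut out by the antisymmetrizer $\frac1{i!}\sum_{\sigma\in S_i}\varepsilon(\sigma)\sigma$ ($S_i$ acting through $\tau$), with injection $i_V^i:\wedge^iV\to\otimes^iV$ and projection $p_V^i:\otimes^iV\to\wedge^iV$. Multiplication: $\varphi_{i,j}=p_V^{i+j}\circ(i_V^i\otimes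 i_V^j):\wedge^iV\otimes\wedge^jV\to\wedge^{i+j}V$; the same notation is used for $V^\vee$ in place of $V$. Duals: $\mathrm{ev}_V^i:(\otimes^iV^\vee)\otimes(\otimes^iV)\to\mathbb{I}$ pairs the $k$-th factor $V^\vee$ with the $k$-th factor $V$ (after reordering by $\tau$), and $\mathrm{ev}_{V,a}^i=\mathrm{ev}_V^i\circ(i_{V^\vee}^i\otimes i_V^i):\wedge^iV^\vee\otimes\wedge^iV\to\mathbb{I}$. This makes $\wedge^iV^\vee:=\wedge^i(V^\vee)$ the dual of $\wedge^iV$; likewise $\wedge^iV^{\vee\vee}:=\wedge^i(V^{\vee\vee})$ is the dual of $\wedge^iV^\vee$ via $\mathrm{ev}_{V^\vee,a}^i$. The reflexivity isomorphism $i_{\wedge^gV}:\wedge^gV\to\wedge^gV^{\vee\vee}$ is taken with respect to these pairings. Internal multiplications and Poincaré morphisms: for $j\ge i$ let $\iota_{i,j}:\wedge^iV\to\hom(\wedge^jV^\vee,\wedge^{j-i}V^\vee)$ and $\iota^*_{i,j}:\wedge^iV^\vee\to\hom(\wedge^jV,\wedge^{j-i}V)$ correspond by adjunction to $$p_{V^\vee}^{j-i}\circ(\mathrm{ev}_V^{i,\tau}\otimes1_{\otimes^{j-i}V^\vee})\circ(i_V^i\otimes i_{V^\vee}^j),\qquad p_V^{j-i}\circ(\mathrm{ev}_V^i\otimes1_{\otimes^{j-i}V})\circ(i_{V^\vee}^i\otimes i_V^j),$$ where the first $i$ factors of the $j$-fold tensor power are contracted. For $g\ge i$, $$D^{i,g}=\alpha^{-1}\circ\iota_{i,g}:\wedge^iV\to\wedge^{g-i}V^\vee\otimes\wedge^gV^{\vee\vee},\qquad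 D_{i,g}=\alpha^{-1}\circ\iota^*_{i,g}:\wedge^iV^\vee\to\wedge^{g-i}V\otimes\wedge^gV^\vee .$$ $\mathrm{ev}_{13,24}$ denotes the contraction of the 1st with the 3rd and of the 2nd with the 4th tensor factor (after reordering by $\tau$), and $\mathrm{ev}_{13}$ the contraction of the 1st with the 3rd factor leaving the 2nd one. The morphism $\varphi_{g-i,i}^{13\to\wedge^gV^{\vee\vee}}:\wedge^{g-i}V^\vee\otimes\wedge^gV^{\vee\vee}\otimes\wedge^iV^\vee\otimes\wedge^gV^{\vee\vee}\to\wedge^gV^{\vee\vee}$ interchanges the 2nd and 3rd factors, applies $\varphi_{g-i,i}$ to the first two factors obtaining $\wedge^gV^\vee\otimes\wedge^gV^{\vee\vee}\otimes\wedge^gV^{\vee\vee}$, and then applies $\mathrm{ev}_{V^\vee,a}^{g,\tau}\otimes 1$. The morphism $\varphi_{g-i,i}^{13\to\wedge^gV^{\vee}}:\wedge^{g-i}V\otimes\wedge^gV^{\vee}\otimes\wedge^iV\otimes\wedge^gV^{\vee}\to\wedge^gV^{\vee}$ is defined likewise (interchange the 2nd and 3rd factors, multiply the first two to get $\wedge^gV\otimes\wedge^gV^\vee\otimes\wedge^gV^\vee$, apply $\mathrm{ev}_{V,a}^{g,\tau}\otimes1$). *)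

theory Defs
  imports Complex_Main "HOL-Combinatorics.Permutations" "HOL-Algebra.Module"
begin

section \<open>The data of a tensor category\<close>

text \<open>
  Associativity and unit constraints are part of the data, so that no strictness is assumed;
  wherever they are usually suppressed, the coherence isomorphism is written out.
\<close>

record ('o, 'm) tensor_cat =
  Obj  :: "'o set"
  Arr  :: "'m set"
  Dom  :: "'m \<Rightarrow> 'o"
  Cod  :: "'m \<Rightarrow> 'o"
  Id   :: "'o \<Rightarrow> 'm"
  Comp :: "'m \<Rightarrow> 'm \<Rightarrow> 'm"  (infixr "\<cdot>\<index>" 60)
  Zer  :: "'o \<Rightarrow> 'o \<Rightarrow> 'm"
  Add  :: "'m \<Rightarrow> 'm \<Rightarrow> 'm"
  Scl  :: "rat \<Rightarrow> 'm \<Rightarrow> 'm"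
  Ten  :: "'o \<Rightarrow> 'o \<Rightarrow> 'o"  (infixl "\<otimes>\<^sub>o\<index>" 70)
  Tar  :: "'m \<Rightarrow> 'm \<Rightarrow> 'm"  (infixl "\<otimes>\<^sub>a\<index>" 70)
  Unit :: "'o"  ("\<bbbI>\<index>")
  Asc  :: "'o \<Rightarrow> 'o \<Rightarrow> 'o \<Rightarrow> 'm"
  Lun  :: "'o \<Rightarrow> 'm"
  Run  :: "'o \<Rightarrow> 'm"
  Sym  :: "'o \<Rightarrow> 'o \<Rightarrow> 'm"
  Ihom :: "'o \<Rightarrow> 'o \<Rightarrow> 'o"
  Evl  :: "'o \<Rightarrow> 'o \<Rightarrow> 'm"

definition rat_ring :: "rat ring" where
  "rat_ring = \<lparr> carrier = UNIV, mult = (*), one = 1, zero = 0, add = (+) \<rparr>"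

text \<open>In \<^term>\<open>hom_module\<close> the multiplicative fields of the record are irrelevant.\<close>

context
  fixes C :: "('o, 'm) tensor_cat" (structure)
begin

definition Hom :: "'o \<Rightarrow> 'o \<Rightarrow> 'm set" where
  "Hom X Y = {f \<in> Arr C. Dom C f = X \<and> Cod C f = Y}"

definition hom_module :: "'o \<Rightarrow> 'o \<Rightarrow> (rat, 'm) module" where
  "hom_module X Y = \<lparr> carrier = Hom X Y, mult = undefined, one = undefined,
                      zero = Zer C X Y, add = Add C, smult = Scl C \<rparr>"

definition is_inverse :: "'m \<Rightarrow> 'm \<Rightarrow> bool" where
  "is_inverse f g \<longleftrightarrow> g \<in> Hom (Cod C f) (Dom C f) \<and>
     g \<cdot> f = Id C (Dom C f) \<and> f \<cdot> g = Id C (Cod C f)"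

definition is_iso :: "'m \<Rightarrow> bool" where
  "is_iso f \<longleftrightarrow> f \<in> Arr C \<and> (\<exists>g. is_inverse f g)"

definition Inv :: "'m \<Rightarrow> 'm" where
  "Inv f = (THE g. is_inverse f g)"

text \<open>
  For \<open>e : W \<otimes> X \<rightarrow> Y\<close> and \<open>f : Z \<otimes> X \<rightarrow> Y\<close>, the morphism \<open>h : Z \<rightarrow> W\<close> that
  corresponds to \<open>f\<close>, i.e. the one with \<open>e \<circ> (h \<otimes> 1) = f\<close>.
\<close>

definition adjunct :: "'o \<Rightarrow> 'o \<Rightarrow> 'm \<Rightarrow> 'o \<Rightarrow> 'm \<Rightarrow> 'm" where
  "adjunct W X e Z f = (THE h. h \<in> Hom Z W \<and> e \<cdot> (h \<otimes>\<^sub>a Id C X) = f)"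

definition dual :: "'o \<Rightarrow> 'o" where
  "dual X = Ihom C X \<bbbI>"

definition ev :: "'o \<Rightarrow> 'm" where
  "ev X = Evl C X \<bbbI>"

text \<open>For \<open>e : X \<otimes> Y \<rightarrow> Z\<close>, this is \<open>e\<^sup>\<tau> : Y \<otimes> X \<rightarrow> Z\<close>.\<close>

definition twist :: "'o \<Rightarrow> 'o \<Rightarrow> 'm \<Rightarrow> 'm" where
  "twist X Y e = e \<cdot> Sym C Y X"

text \<open>\<open>(X \<otimes> Y) \<otimes> (Z \<otimes> W) \<rightarrow> (X \<otimes> Z) \<otimes> (Y \<otimes> W)\<close>\<close>

definition interchange :: "'o \<Rightarrow> 'o \<Rightarrow> 'o \<Rightarrow> 'o \<Rightarrow> 'm" where
  "interchange X Y Z W =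
     Inv (Asc C X Z (Y \<otimes>\<^sub>o W)) \<cdot>
     (Id C X \<otimes>\<^sub>a (Asc C Z Y W \<cdot> (Sym C Y Z \<otimes>\<^sub>a Id C W) \<cdot> Inv (Asc C Y Z W))) \<cdot>
     Asc C X Y (Z \<otimes>\<^sub>o W)"

text \<open>\<open>X\<^sub>0 \<otimes> \<dots> \<otimes> X\<^sub>n\<^sub>-\<^sub>1\<close>, bracketed as \<open>((\<bbbI> \<otimes> X\<^sub>0) \<otimes> X\<^sub>1) \<otimes> \<dots>\<close>\<close>

primrec tens :: "nat \<Rightarrow> (nat \<Rightarrow> 'o) \<Rightarrow> 'o" where
  "tens 0 X = \<bbbI>"
| "tens (Suc n) X = tens n X \<otimes>\<^sub>o X n"

text \<open>
  \<open>hom(X\<^sub>0,Y\<^sub>0) \<otimes> \<dots> \<otimes> hom(X\<^sub>n\<^sub>-\<^sub>1,Y\<^sub>n\<^sub>-\<^sub>1) \<otimes> X\<^sub>0 \<otimes> \<dots> \<otimes> X\<^sub>n\<^sub>-\<^sub>1 \<rightarrow> Y\<^sub>0 \<otimes> \<dots> \<otimes> Y\<^sub>n\<^sub>-\<^sub>1\<close>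
\<close>

primrec tens_eval :: "nat \<Rightarrow> (nat \<Rightarrow> 'o) \<Rightarrow> (nat \<Rightarrow> 'o) \<Rightarrow> 'm" where
  "tens_eval 0 X Y = Lun C \<bbbI>"
| "tens_eval (Suc n) X Y =
     (tens_eval n X Y \<otimes>\<^sub>a Evl C (X n) (Y n)) \<cdot>
     interchange (tens n (\<lambda>k. Ihom C (X k) (Y k))) (Ihom C (X n) (Y n)) (tens n X) (X n)"

definition tens_hom_map :: "nat \<Rightarrow> (nat \<Rightarrow> 'o) \<Rightarrow> (nat \<Rightarrow> 'o) \<Rightarrow> 'm" where
  "tens_hom_map n X Y =
     adjunct (Ihom C (tens n X) (tens n Y)) (tens n X) (Evl C (tens n X) (tens n Y))
       (tens n (\<lambda>k. Ihom C (X k) (Y k))) (tens_eval n X Y)"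

text \<open>
  The reflexivity morphism \<open>X \<rightarrow> X''\<close> with respect to pairings \<open>e : X' \<otimes> X \<rightarrow> \<bbbI>\<close> and
  \<open>e' : X'' \<otimes> X' \<rightarrow> \<bbbI>\<close>.
\<close>

definition reflexivity :: "'o \<Rightarrow> 'o \<Rightarrow> 'm \<Rightarrow> 'o \<Rightarrow> 'm \<Rightarrow> 'm" where
  "reflexivity X X' e X'' e' = adjunct X'' X' e' X (twist X' X e)"

end


section \<open>Rigid pseudo-abelian Q-linear ACU tensor categories\<close>

locale cat =
  fixes C :: "('o, 'm) tensor_cat" (structure)
  assumes Dom_closed: "f \<in> Arr C \<Longrightarrow> Dom C f \<in> Obj C"
    and Cod_closed: "f \<in> Arr C \<Longrightarrow> Cod C f \<in> Obj C"
    and Id_closed: "X \<in> Obj C \<Longrightarrow> Id C X \<in> Hom C X X"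
    and Comp_closed: "\<lbrakk> f \<in> Hom C X Y; g \<in> Hom C Y Z \<rbrakk> \<Longrightarrow> g \<cdot> f \<in> Hom C X Z"
    and Comp_Id: "f \<in> Hom C X Y \<Longrightarrow> f \<cdot> Id C X = f"
    and Id_Comp: "f \<in> Hom C X Y \<Longrightarrow> Id C Y \<cdot> f = f"
    and Comp_assoc: "\<lbrakk> f \<in> Hom C X Y; g \<in> Hom C Y Z; h \<in> Hom C Z W \<rbrakk>
                      \<Longrightarrow> (h \<cdot> g) \<cdot> f = h \<cdot> (g \<cdot> f)"

locale rat_linear_additive_cat = cat +
  assumes hom_module: "\<lbrakk> X \<in> Obj C; Y \<in> Obj C \<rbrakk> \<Longrightarrow> Module.module rat_ring (hom_module C X Y)"
    and Comp_Add: "\<lbrakk> f \<in> Hom C X Y; f' \<in> Hom C X Y; g \<in> Hom C Y Z \<rbrakk>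
                    \<Longrightarrow> g \<cdot> Add C f f' = Add C (g \<cdot> f) (g \<cdot> f')"
    and Add_Comp: "\<lbrakk> f \<in> Hom C X Y; g \<in> Hom C Y Z; g' \<in> Hom C Y Z \<rbrakk>
                    \<Longrightarrow> Add C g g' \<cdot> f = Add C (g \<cdot> f) (g' \<cdot> f)"
    and Comp_Scl: "\<lbrakk> f \<in> Hom C X Y; g \<in> Hom C Y Z \<rbrakk> \<Longrightarrow> g \<cdot> Scl C q f = Scl C q (g \<cdot> f)"
    and Scl_Comp: "\<lbrakk> f \<in> Hom C X Y; g \<in> Hom C Y Z \<rbrakk> \<Longrightarrow> Scl C q g \<cdot> f = Scl C q (g \<cdot> f)"
    and zero_object: "\<exists>Z \<in> Obj C. Id C Z = Zer C Z Z"
    and biproducts: "\<lbrakk> X \<in> Obj C; Y \<in> Obj C \<rbrakk> \<Longrightarrow>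
          \<exists>Z \<in> Obj C. \<exists>i \<in> Hom C X Z. \<exists>j \<in> Hom C Y Z. \<exists>p \<in> Hom C Z X. \<exists>q \<in> Hom C Z Y.
            p \<cdot> i = Id C X \<and> q \<cdot> j = Id C Y \<and> p \<cdot> j = Zer C Y X \<and> q \<cdot> i = Zer C X Y \<and>
            Add C (i \<cdot> p) (j \<cdot> q) = Id C Z"

locale ACU_tensor_cat = rat_linear_additive_cat +
  assumes Unit_closed: "\<bbbI> \<in> Obj C"
    and Ten_closed: "\<lbrakk> X \<in> Obj C; Y \<in> Obj C \<rbrakk> \<Longrightarrow> X \<otimes>\<^sub>o Y \<in> Obj C"
    and Tar_closed: "\<lbrakk> f \<in> Hom C X X'; g \<in> Hom C Y Y' \<rbrakk> \<Longrightarrow> f \<otimes>\<^sub>a g \<in> Hom C (X \<otimes>\<^sub>o Y) (X' \<otimes>\<^sub>o Y')"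
    and Tar_Id: "\<lbrakk> X \<in> Obj C; Y \<in> Obj C \<rbrakk> \<Longrightarrow> Id C X \<otimes>\<^sub>a Id C Y = Id C (X \<otimes>\<^sub>o Y)"
    and Tar_Comp: "\<lbrakk> f \<in> Hom C X X'; f' \<in> Hom C X' X''; g \<in> Hom C Y Y'; g' \<in> Hom C Y' Y'' \<rbrakk>
                    \<Longrightarrow> (f' \<cdot> f) \<otimes>\<^sub>a (g' \<cdot> g) = (f' \<otimes>\<^sub>a g') \<cdot> (f \<otimes>\<^sub>a g)"
    and Tar_Add_left: "\<lbrakk> f \<in> Hom C X X'; f' \<in> Hom C X X'; g \<in> Hom C Y Y' \<rbrakk>
                    \<Longrightarrow> Add C f f' \<otimes>\<^sub>a g = Add C (f \<otimes>\<^sub>a g) (f' \<otimes>\<^sub>a g)"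
    and Tar_Add_right: "\<lbrakk> f \<in> Hom C X X'; g \<in> Hom C Y Y'; g' \<in> Hom C Y Y' \<rbrakk>
                    \<Longrightarrow> f \<otimes>\<^sub>a Add C g g' = Add C (f \<otimes>\<^sub>a g) (f \<otimes>\<^sub>a g')"
    and Tar_Scl_left: "\<lbrakk> f \<in> Hom C X X'; g \<in> Hom C Y Y' \<rbrakk> \<Longrightarrow> Scl C q f \<otimes>\<^sub>a g = Scl C q (f \<otimes>\<^sub>a g)"
    and Tar_Scl_right: "\<lbrakk> f \<in> Hom C X X'; g \<in> Hom C Y Y' \<rbrakk> \<Longrightarrow> f \<otimes>\<^sub>a Scl C q g = Scl C q (f \<otimes>\<^sub>a g)"
    and Asc_closed: "\<lbrakk> X \<in> Obj C; Y \<in> Obj C; Z \<in> Obj C \<rbrakk>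
                    \<Longrightarrow> Asc C X Y Z \<in> Hom C ((X \<otimes>\<^sub>o Y) \<otimes>\<^sub>o Z) (X \<otimes>\<^sub>o (Y \<otimes>\<^sub>o Z))"
    and Asc_iso: "\<lbrakk> X \<in> Obj C; Y \<in> Obj C; Z \<in> Obj C \<rbrakk> \<Longrightarrow> is_iso C (Asc C X Y Z)"
    and Asc_natural: "\<lbrakk> f \<in> Hom C X X'; g \<in> Hom C Y Y'; h \<in> Hom C Z Z' \<rbrakk>
                    \<Longrightarrow> Asc C X' Y' Z' \<cdot> ((f \<otimes>\<^sub>a g) \<otimes>\<^sub>a h) = (f \<otimes>\<^sub>a (g \<otimes>\<^sub>a h)) \<cdot> Asc C X Y Z"
    and Lun_closed: "X \<in> Obj C \<Longrightarrow> Lun C X \<in> Hom C (\<bbbI> \<otimes>\<^sub>o X) X"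
    and Lun_iso: "X \<in> Obj C \<Longrightarrow> is_iso C (Lun C X)"
    and Lun_natural: "f \<in> Hom C X X' \<Longrightarrow> Lun C X' \<cdot> (Id C \<bbbI> \<otimes>\<^sub>a f) = f \<cdot> Lun C X"
    and Run_closed: "X \<in> Obj C \<Longrightarrow> Run C X \<in> Hom C (X \<otimes>\<^sub>o \<bbbI>) X"
    and Run_iso: "X \<in> Obj C \<Longrightarrow> is_iso C (Run C X)"
    and Run_natural: "f \<in> Hom C X X' \<Longrightarrow> Run C X' \<cdot> (f \<otimes>\<^sub>a Id C \<bbbI>) = f \<cdot> Run C X"
    and pentagon: "\<lbrakk> W \<in> Obj C; X \<in> Obj C; Y \<in> Obj C; Z \<in> Obj C \<rbrakk> \<Longrightarrow>
          Asc C W X (Y \<otimes>\<^sub>o Z) \<cdot> Asc C (W \<otimes>\<^sub>o X) Y Z =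
          (Id C W \<otimes>\<^sub>a Asc C X Y Z) \<cdot> Asc C W (X \<otimes>\<^sub>o Y) Z \<cdot> (Asc C W X Y \<otimes>\<^sub>a Id C Z)"
    and triangle: "\<lbrakk> X \<in> Obj C; Y \<in> Obj C \<rbrakk> \<Longrightarrow>
          (Id C X \<otimes>\<^sub>a Lun C Y) \<cdot> Asc C X \<bbbI> Y = Run C X \<otimes>\<^sub>a Id C Y"
    and Sym_closed: "\<lbrakk> X \<in> Obj C; Y \<in> Obj C \<rbrakk> \<Longrightarrow> Sym C X Y \<in> Hom C (X \<otimes>\<^sub>o Y) (Y \<otimes>\<^sub>o X)"
    and Sym_natural: "\<lbrakk> f \<in> Hom C X X'; g \<in> Hom C Y Y' \<rbrakk>
                    \<Longrightarrow> Sym C X' Y' \<cdot> (f \<otimes>\<^sub>a g) = (g \<otimes>\<^sub>a f) \<cdot> Sym C X Y"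
    and Sym_Sym: "\<lbrakk> X \<in> Obj C; Y \<in> Obj C \<rbrakk> \<Longrightarrow> Sym C Y X \<cdot> Sym C X Y = Id C (X \<otimes>\<^sub>o Y)"
    and hexagon: "\<lbrakk> X \<in> Obj C; Y \<in> Obj C; Z \<in> Obj C \<rbrakk> \<Longrightarrow>
          Asc C Y Z X \<cdot> Sym C X (Y \<otimes>\<^sub>o Z) \<cdot> Asc C X Y Z =
          (Id C Y \<otimes>\<^sub>a Sym C X Z) \<cdot> Asc C Y X Z \<cdot> (Sym C X Y \<otimes>\<^sub>a Id C Z)"
    and Ihom_closed: "\<lbrakk> X \<in> Obj C; Y \<in> Obj C \<rbrakk> \<Longrightarrow> Ihom C X Y \<in> Obj C"
    and Evl_closed: "\<lbrakk> X \<in> Obj C; Y \<in> Obj C \<rbrakk> \<Longrightarrow> Evl C X Y \<in> Hom C (Ihom C X Y \<otimes>\<^sub>o X) Y"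
    and Evl_universal: "\<lbrakk> X \<in> Obj C; Y \<in> Obj C; Z \<in> Obj C; f \<in> Hom C (Z \<otimes>\<^sub>o X) Y \<rbrakk> \<Longrightarrow>
          \<exists>!h. h \<in> Hom C Z (Ihom C X Y) \<and> Evl C X Y \<cdot> (h \<otimes>\<^sub>a Id C X) = f"

locale rigid_pseudo_abelian_tensor_cat = ACU_tensor_cat +
  assumes tens_hom_map_iso: "\<And>n Xs Ys. \<lbrakk> \<And>k. k < n \<Longrightarrow> Xs k \<in> Obj C; \<And>k. k < n \<Longrightarrow> Ys k \<in> Obj C \<rbrakk>
                    \<Longrightarrow> is_iso C (tens_hom_map C n Xs Ys)"
    and reflexivity_iso: "X \<in> Obj C \<Longrightarrow>
          is_iso C (reflexivity C X (dual C X) (ev C X) (dual C (dual C X)) (ev C (dual C X)))"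
    and idempotents_split: "\<lbrakk> e \<in> Hom C X X; e \<cdot> e = e \<rbrakk> \<Longrightarrow>
          \<exists>Y \<in> Obj C. \<exists>s \<in> Hom C Y X. \<exists>p \<in> Hom C X Y. p \<cdot> s = Id C Y \<and> s \<cdot> p = e"


section \<open>Alternating powers and Poincare morphisms\<close>

context
  fixes C :: "('o, 'm) tensor_cat" (structure)
begin

text \<open>Contraction \<open>X \<otimes> (Y \<otimes> Z) \<rightarrow> Z\<close>, resp. \<open>(X \<otimes> Y) \<otimes> Z \<rightarrow> X\<close>, of adjacent factors along \<open>e\<close>.\<close>

definition contract_left :: "'o \<Rightarrow> 'o \<Rightarrow> 'o \<Rightarrow> 'm \<Rightarrow> 'm" where
  "contract_left X Y Z e = Lun C Z \<cdot> (e \<otimes>\<^sub>a Id C Z) \<cdot> Inv C (Asc C X Y Z)"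

definition contract_right :: "'o \<Rightarrow> 'o \<Rightarrow> 'o \<Rightarrow> 'm \<Rightarrow> 'm" where
  "contract_right X Y Z e = Run C X \<cdot> (Id C X \<otimes>\<^sub>a e) \<cdot> Asc C X Y Z"

text \<open>\<open>(X \<otimes> Y) \<otimes> Z \<rightarrow> Y\<close>, for \<open>e : X \<otimes> Z \<rightarrow> \<bbbI>\<close>\<close>

definition ev13 :: "'o \<Rightarrow> 'o \<Rightarrow> 'o \<Rightarrow> 'm \<Rightarrow> 'm" where
  "ev13 X Y Z e = contract_left X Z Y e \<cdot> (Id C X \<otimes>\<^sub>a Sym C Y Z) \<cdot> Asc C X Y Z"

text \<open>\<open>(X \<otimes> Y) \<otimes> (Z \<otimes> W) \<rightarrow> \<bbbI>\<close>, for \<open>e : X \<otimes> Z \<rightarrow> \<bbbI>\<close> and \<open>e' : Y \<otimes> W \<rightarrow> \<bbbI>\<close>\<close>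

definition ev1324 :: "'o \<Rightarrow> 'o \<Rightarrow> 'o \<Rightarrow> 'o \<Rightarrow> 'm \<Rightarrow> 'm \<Rightarrow> 'm" where
  "ev1324 X Y Z W e e' = Lun C \<bbbI> \<cdot> (e \<otimes>\<^sub>a e') \<cdot> interchange C X Y Z W"

text \<open>
  The canonical map \<open>Y \<otimes> X' \<rightarrow> hom(X,Y)\<close>, where \<open>X'\<close> is the dual of \<open>X\<close> via
  \<open>e : X' \<otimes> X \<rightarrow> \<bbbI>\<close>.
\<close>

definition alpha :: "'o \<Rightarrow> 'o \<Rightarrow> 'm \<Rightarrow> 'o \<Rightarrow> 'm" where
  "alpha X X' e Y = adjunct C (Ihom C X Y) X (Evl C X Y) (Y \<otimes>\<^sub>o X') (contract_right Y X' X e)"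

text \<open>The Casimir element, i.e. the image of \<open>1\<^sub>X\<close> under \<open>hom(X,X) \<cong> X \<otimes> X\<^sup>\<or>\<close>.\<close>

definition coev :: "'o \<Rightarrow> 'm" where
  "coev X = Inv C (alpha X (dual C X) (ev C X) X) \<cdot> adjunct C (Ihom C X X) X (Evl C X X) \<bbbI> (Lun C X)"

definition rank :: "'o \<Rightarrow> 'm" where
  "rank X = twist C (dual C X) X (ev C X) \<cdot> coev X"

text \<open>The action of \<open>r \<in> End(\<bbbI>)\<close> on a morphism \<open>f : X \<rightarrow> Y\<close>.\<close>

definition act :: "'m \<Rightarrow> 'm \<Rightarrow> 'm" where
  "act r f = Lun C (Cod C f) \<cdot> (r \<otimes>\<^sub>a f) \<cdot> Inv C (Lun C (Dom C f))"

text \<open>\<open>r + q\<close> in the algebra \<open>End(\<bbbI>)\<close>\<close>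

definition shift :: "'m \<Rightarrow> rat \<Rightarrow> 'm" where
  "shift r q = Add C r (Scl C q (Id C \<bbbI>))"

primrec falling :: "'m \<Rightarrow> nat \<Rightarrow> 'm" where
  "falling r 0 = Id C \<bbbI>"
| "falling r (Suc k) = falling r k \<cdot> shift r (- of_nat k)"

definition ebinom :: "'m \<Rightarrow> nat \<Rightarrow> 'm" where
  "ebinom r k = Scl C (1 / fact k) (falling r k)"

abbreviation tpow :: "nat \<Rightarrow> 'o \<Rightarrow> 'o" where
  "tpow n X \<equiv> tens C n (\<lambda>_. X)"

text \<open>
  The permutation of the factors \<open>k\<close> and \<open>k + 1\<close> of an \<open>n\<close>-fold tensor power; factors are
  counted from \<open>0\<close>, and the value is meaningful for \<open>k + 1 < n\<close>.
\<close>

primrec swap :: "'o \<Rightarrow> nat \<Rightarrow> nat \<Rightarrow> 'm" where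
  "swap X 0 k = Id C \<bbbI>"
| "swap X (Suc n) k =
     (if Suc k = n
      then Inv C (Asc C (tpow k X) X X) \<cdot> (Id C (tpow k X) \<otimes>\<^sub>a Sym C X X) \<cdot> Asc C (tpow k X) X X
      else swap X n k \<otimes>\<^sub>a Id C X)"

text \<open>
  The action of the symmetric group on the \<open>n\<close>-fold tensor power: the homomorphism that
  sends each adjacent transposition to \<^term>\<open>swap\<close>.
\<close>

inductive perm_acts :: "'o \<Rightarrow> nat \<Rightarrow> (nat \<Rightarrow> nat) \<Rightarrow> 'm \<Rightarrow> bool" for X n where
  "perm_acts X n id (Id C (tpow n X))"
| "\<lbrakk> perm_acts X n \<sigma> f; Suc k < n \<rbrakk>
    \<Longrightarrow> perm_acts X n (Transposition.transpose k (Suc k) \<circ> \<sigma>) (swap X n k \<cdot> f)"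

definition perm_mor :: "'o \<Rightarrow> nat \<Rightarrow> (nat \<Rightarrow> nat) \<Rightarrow> 'm" where
  "perm_mor X n \<sigma> = (THE f. perm_acts X n \<sigma> f)"

definition antisym :: "nat \<Rightarrow> 'o \<Rightarrow> 'm" where
  "antisym i X = Scl C (1 / fact i)
     (finsum (hom_module C (tpow i X) (tpow i X))
        (\<lambda>\<sigma>. Scl C (of_int (sign \<sigma>)) (perm_mor X i \<sigma>)) {\<sigma>. \<sigma> permutes {..<i}})"

text \<open>A choice of the direct factor cut out by the antisymmetrizer, with injection and projection.\<close>

definition wedge_splitting :: "nat \<Rightarrow> 'o \<Rightarrow> 'o \<times> 'm \<times> 'm" where
  "wedge_splitting i X = (SOME (W, s, p). W \<in> Obj C \<and> s \<in> Hom C W (tpow i X) \<and>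
     p \<in> Hom C (tpow i X) W \<and> p \<cdot> s = Id C W \<and> s \<cdot> p = antisym i X)"

definition wedge :: "nat \<Rightarrow> 'o \<Rightarrow> 'o" where
  "wedge i X = fst (wedge_splitting i X)"

definition winj :: "nat \<Rightarrow> 'o \<Rightarrow> 'm" where
  "winj i X = fst (snd (wedge_splitting i X))"

definition wprj :: "nat \<Rightarrow> 'o \<Rightarrow> 'm" where
  "wprj i X = snd (snd (wedge_splitting i X))"

text \<open>The coherence isomorphism \<open>\<otimes>\<^sup>iX \<otimes> \<otimes>\<^sup>jX \<rightarrow> \<otimes>\<^sup>i\<^sup>+\<^sup>jX\<close>.\<close>

primrec tpow_add :: "'o \<Rightarrow> nat \<Rightarrow> nat \<Rightarrow> 'm" where
  "tpow_add X i 0 = Run C (tpow i X)"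
| "tpow_add X i (Suc j) = (tpow_add X i j \<otimes>\<^sub>a Id C X) \<cdot> Inv C (Asc C (tpow i X) (tpow j X) X)"

definition wmult :: "'o \<Rightarrow> nat \<Rightarrow> nat \<Rightarrow> 'm" where
  "wmult X i j = wprj (i + j) X \<cdot> tpow_add X i j \<cdot> (winj i X \<otimes>\<^sub>a winj j X)"

text \<open>\<open>(\<otimes>\<^sup>iX\<^sup>\<or>) \<otimes> (\<otimes>\<^sup>iX) \<rightarrow> \<bbbI>\<close>, pairing corresponding factors\<close>

primrec ev_pow :: "nat \<Rightarrow> 'o \<Rightarrow> 'm" where
  "ev_pow 0 X = Lun C \<bbbI>"
| "ev_pow (Suc i) X = ev1324 (tpow i (dual C X)) (dual C X) (tpow i X) X (ev_pow i X) (ev C X)"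

definition ev_alt :: "nat \<Rightarrow> 'o \<Rightarrow> 'm" where
  "ev_alt i X = ev_pow i X \<cdot> (winj i (dual C X) \<otimes>\<^sub>a winj i X)"

definition ev_pow_tw :: "nat \<Rightarrow> 'o \<Rightarrow> 'm" where
  "ev_pow_tw i X = twist C (tpow i (dual C X)) (tpow i X) (ev_pow i X)"

definition ev_alt_tw :: "nat \<Rightarrow> 'o \<Rightarrow> 'm" where
  "ev_alt_tw i X = twist C (wedge i (dual C X)) (wedge i X) (ev_alt i X)"

definition wrefl :: "nat \<Rightarrow> 'o \<Rightarrow> 'm" where
  "wrefl g X = reflexivity C (wedge g X) (wedge g (dual C X)) (ev_alt g X)
                 (wedge g (dual C (dual C X))) (ev_alt g (dual C X))"

text \<open>
  For \<open>i \<le> j\<close> and \<open>e : \<otimes>\<^sup>iY \<otimes> \<otimes>\<^sup>iX \<rightarrow> \<bbbI>\<close>, the morphism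
  \<open>\<and>\<^sup>iY \<otimes> \<and>\<^sup>jX \<rightarrow> \<and>\<^sup>j\<^sup>-\<^sup>iX\<close> that contracts the first \<open>i\<close> of the \<open>j\<close> factors.
\<close>

definition wcontract :: "'o \<Rightarrow> 'o \<Rightarrow> 'm \<Rightarrow> nat \<Rightarrow> nat \<Rightarrow> 'm" where
  "wcontract Y X e i j =
     wprj (j - i) X \<cdot> contract_left (tpow i Y) (tpow i X) (tpow (j - i) X) e \<cdot>
     (winj i Y \<otimes>\<^sub>a (Inv C (tpow_add X i (j - i)) \<cdot> winj j X))"

text \<open>The internal multiplications \<open>\<iota>\<^sub>i\<^sub>,\<^sub>j\<close> and \<open>\<iota>\<^sup>*\<^sub>i\<^sub>,\<^sub>j\<close>.\<close>

definition iota :: "'o \<Rightarrow> nat \<Rightarrow> nat \<Rightarrow> 'm" where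
  "iota X i j =
     (let A = wedge j (dual C X); B = wedge (j - i) (dual C X)
      in adjunct C (Ihom C A B) A (Evl C A B) (wedge i X) (wcontract X (dual C X) (ev_pow_tw i X) i j))"

definition iota_star :: "'o \<Rightarrow> nat \<Rightarrow> nat \<Rightarrow> 'm" where
  "iota_star X i j =
     (let A = wedge j X; B = wedge (j - i) X
      in adjunct C (Ihom C A B) A (Evl C A B) (wedge i (dual C X)) (wcontract (dual C X) X (ev_pow i X) i j))"

text \<open>The Poincare morphisms \<open>D\<^sup>i\<^sup>,\<^sup>g\<close> (upper indices) and \<open>D\<^sub>i\<^sub>,\<^sub>g\<close> (lower indices).\<close>

definition Dup :: "'o \<Rightarrow> nat \<Rightarrow> nat \<Rightarrow> 'm" where
  "Dup X i g =
     Inv C (alpha (wedge g (dual C X)) (wedge g (dual C (dual C X))) (ev_alt g (dual C X))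
              (wedge (g - i) (dual C X))) \<cdot> iota X i g"

definition Dlow :: "'o \<Rightarrow> nat \<Rightarrow> nat \<Rightarrow> 'm" where
  "Dlow X i g =
     Inv C (alpha (wedge g X) (wedge g (dual C X)) (ev_alt g X) (wedge (g - i) X)) \<cdot> iota_star X i g"

text \<open>
  \<open>\<phi>\<^sub>j\<^sub>,\<^sub>i\<^sup>1\<^sup>3 : (\<and>\<^sup>jX \<otimes> \<and>\<^sup>gX\<^sup>\<or>) \<otimes> (\<and>\<^sup>iX \<otimes> \<and>\<^sup>gX\<^sup>\<or>) \<rightarrow> \<and>\<^sup>gX\<^sup>\<or>\<close> with \<open>g = j + i\<close>; it is used for \<open>X = V\<close>
  and for \<open>X = V\<^sup>\<or>\<close>.
\<close>

definition wmult13 :: "'o \<Rightarrow> nat \<Rightarrow> nat \<Rightarrow> 'm" where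
  "wmult13 X j i =
     (let W = wedge (j + i) X; W' = wedge (j + i) (dual C X)
      in contract_left W W' W' (ev_alt_tw (j + i) X) \<cdot>
         (wmult X j i \<otimes>\<^sub>a Id C (W' \<otimes>\<^sub>o W')) \<cdot>
         interchange C (wedge j X) W' (wedge i X) W')"

end

end

theory Submission
  imports Defs
begin

text \<open>
  Iterating the one-strand identity \<open>tr\<^sub>X(A\<^sub>n\<^sub>+\<^sub>1) = (r - n)/(n + 1) \<cdot> A\<^sub>n\<close> for the antisymmetrizers \<open>A\<^sub>n\<close>, the trace of
  \<open>A\<^sub>i\<^sub>+\<^sub>j\<close> over its last \<open>j\<close> factors is \<open>binom(r - i, j)/binom(i + j, j) \<cdot> A\<^sub>i\<close>. Contraction by an element of
  \<open>\<and>\<^sup>i\<close> is the transpose of exterior multiplication, so both Poincare morphisms are bent exterior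
  products: \<open>D\<^sub>i\<^sub>,\<^sub>g\<close> is multiplication \<open>\<and>\<^sup>iV\<^sup>\<or> \<otimes> \<and>\<^sup>g\<^sup>-\<^sup>iV\<^sup>\<or> \<rightarrow> \<and>\<^sup>gV\<^sup>\<or>\<close> with one leg moved by the Casimir element, and
  \<open>D\<^sup>i\<^sup>,\<^sup>g\<close> is the same on the dual side. Straightening the strings reduces (2) to the
  graded commutativity of the exterior product and (1), (3), (4) to the trace formula. As the
  tensor product is not strict, diagrams are manipulated in a calculus that hides all coherence
  isomorphisms.
\<close>

section \<open>Linear and monoidal preliminaries\<close>

text \<open>The factor (r - n)/(n + 1) is a count in the symmetric group on n + 1 strands. Closing
  the last strand of a permutation that fixes it produces a loop, hence r; each of the other n * n!
  permutations can be written with a single crossing at the last strand, and the closure of a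
  crossing is a straight strand, so only a sign remains. The sum is (n! r - n n!)/(n + 1)!. Rigidity
  speaks about canonical maps being invertible, and \<open>alpha\<close>, \<open>adjunct\<close> and
  \<open>wrefl\<close> are given by universal properties. All of this is translated into one notion,
  \<open>perf\<close>: a pairing with a Casimir element that satisfies both zigzag identities. It
  passes to tensor powers and, because antisymmetrizers are their own transposes, to their direct
  factors. Beyond that, (1), (3) and (4) use only one scalar equation (two multiplications traced
  over a common factor give a multiple of a pairing) and a sign rule. They are therefore derived for
  arbitrary multiplications \<open>m\<close>, \<open>m'\<close>, and the reflexivity map enters only
  as a morphism \<open>\<rho>\<close> after a multiplication.\<close>

context cat
begin

lemma in_Hom_iff: "f \<in> Hom C X Y \<longleftrightarrow> f \<in> Arr C \<and> Dom C f = X \<and> Cod C f = Y"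
  by (simp add: Hom_def)

lemma Id_simps [simp]:
  assumes "X \<in> Obj C"
  shows "Id C X \<in> Arr C" "Dom C (Id C X) = X" "Cod C (Id C X) = X"
  using Id_closed[OF assms] by (simp_all add: in_Hom_iff)

lemma Comp_simps [simp]:
  assumes "f \<in> Arr C" "g \<in> Arr C" "Cod C f = Dom C g"
  shows "g \<cdot> f \<in> Arr C" "Dom C (g \<cdot> f) = Dom C f" "Cod C (g \<cdot> f) = Cod C g"
  using Comp_closed[of f "Dom C f" "Cod C f" g "Cod C g"] assms by (simp_all add: in_Hom_iff)

lemma Dom_Cod_Obj [simp]: "f \<in> Arr C \<Longrightarrow> Dom C f \<in> Obj C" "f \<in> Arr C \<Longrightarrow> Cod C f \<in> Obj C"
  by (simp_all add: Dom_closed Cod_closed)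

lemma Comp_Id_right [simp]: "f \<in> Arr C \<Longrightarrow> Dom C f = X \<Longrightarrow> f \<cdot> Id C X = f"
  using Comp_Id[of f X "Cod C f"] by (simp add: in_Hom_iff)

lemma Comp_Id_left [simp]: "f \<in> Arr C \<Longrightarrow> Cod C f = X \<Longrightarrow> Id C X \<cdot> f = f"
  using Id_Comp[of f "Dom C f" X] by (simp add: in_Hom_iff)

lemma Comp_assoc_Arr [simp]:
  "\<lbrakk>f \<in> Arr C; g \<in> Arr C; h \<in> Arr C; Cod C f = Dom C g; Cod C g = Dom C h\<rbrakk>
     \<Longrightarrow> (h \<cdot> g) \<cdot> f = h \<cdot> (g \<cdot> f)"
  using Comp_assoc[of f "Dom C f" "Cod C f" g "Cod C g" h "Cod C h"] by (simp add: in_Hom_iff)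

lemma Comp_cong_assoc:
  assumes "g \<cdot> f = h \<cdot> k" "f \<in> Arr C" "g \<in> Arr C" "Cod C f = Dom C g" "h \<in> Arr C" "k \<in> Arr C"
    "Cod C k = Dom C h" "u \<in> Arr C" "Cod C u = Dom C f" "Dom C f = Dom C k"
  shows "g \<cdot> (f \<cdot> u) = h \<cdot> (k \<cdot> u)"
  using assms by (metis Comp_assoc_Arr)

lemma Inv_eqI:
  assumes "f \<in> Arr C" "g \<in> Hom C (Cod C f) (Dom C f)" "g \<cdot> f = Id C (Dom C f)" "f \<cdot> g = Id C (Cod C f)"
  shows "Inv C f = g"
  unfolding Inv_def
proof (rule the_equality)
  show "is_inverse C f g"
    using assms by (simp add: is_inverse_def)
  fix h assume h: "is_inverse C f h"
  then have "h = h \<cdot> (f \<cdot> g)"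
    using assms by (simp add: is_inverse_def in_Hom_iff)
  also have "\<dots> = (h \<cdot> f) \<cdot> g"
    by (rule Comp_assoc_Arr[symmetric]) (use h assms in \<open>simp_all add: is_inverse_def in_Hom_iff\<close>)
  also have "\<dots> = g"
    using h assms by (simp add: is_inverse_def in_Hom_iff del: Comp_assoc_Arr)
  finally show "h = g" .
qed

lemma is_isoI:
  assumes "f \<in> Arr C" "g \<in> Hom C (Cod C f) (Dom C f)" "g \<cdot> f = Id C (Dom C f)" "f \<cdot> g = Id C (Cod C f)"
  shows "is_iso C f"
  using assms by (auto simp: is_iso_def is_inverse_def)

lemma is_iso_Inv [simp]:
  assumes "is_iso C f"
  shows "Inv C f \<in> Arr C" "Dom C (Inv C f) = Cod C f" "Cod C (Inv C f) = Dom C f"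
    "Inv C f \<cdot> f = Id C (Dom C f)" "f \<cdot> Inv C f = Id C (Cod C f)"
proof -
  obtain g where "is_inverse C f g" "f \<in> Arr C" using assms by (auto simp: is_iso_def)
  moreover from this have "Inv C f = g"
    by (intro Inv_eqI) (auto simp: is_inverse_def)
  ultimately show "Inv C f \<in> Arr C" "Dom C (Inv C f) = Cod C f" "Cod C (Inv C f) = Dom C f"
    "Inv C f \<cdot> f = Id C (Dom C f)" "f \<cdot> Inv C f = Id C (Cod C f)"
    by (auto simp: is_inverse_def in_Hom_iff)
qed

lemma is_iso_Arr: "is_iso C f \<Longrightarrow> f \<in> Arr C"
  by (simp add: is_iso_def)

lemma Inv_Comp_assoc [simp]:
  assumes "is_iso C f" "u \<in> Arr C" "Cod C u = Dom C f"
  shows "Inv C f \<cdot> (f \<cdot> u) = u"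
  using assms is_iso_Arr[OF assms(1)] Comp_assoc_Arr[of u f "Inv C f"] by simp

lemma Comp_Inv_assoc [simp]:
  assumes "is_iso C f" "u \<in> Arr C" "Cod C u = Cod C f"
  shows "f \<cdot> (Inv C f \<cdot> u) = u"
  using assms is_iso_Arr[OF assms(1)] Comp_assoc_Arr[of u "Inv C f" f] by simp

lemma iso_cancel_left:
  assumes "is_iso C f" "u \<in> Arr C" "Cod C u = Dom C f" "v \<in> Arr C" "Cod C v = Dom C f" "f \<cdot> u = f \<cdot> v"
  shows "u = v"
  using assms by (metis Inv_Comp_assoc)

lemma iso_cancel_right:
  assumes "is_iso C f" "u \<in> Arr C" "Dom C u = Cod C f" "v \<in> Arr C" "Dom C v = Cod C f" "u \<cdot> f = v \<cdot> f"
  shows "u = v"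
proof -
  have "u = (u \<cdot> f) \<cdot> Inv C f" "v = (v \<cdot> f) \<cdot> Inv C f"
    using assms(1-5) is_iso_Arr[OF assms(1)] by simp_all
  then show ?thesis using assms(6) by simp
qed

end

section \<open>Rational vector spaces of morphisms\<close>

context rat_linear_additive_cat
begin

lemma hom_abelian_group: "X \<in> Obj C \<Longrightarrow> Y \<in> Obj C \<Longrightarrow> abelian_group (hom_module C X Y)"
  using hom_module[of X Y] by (simp add: Module.module_def)

lemma hom_module_simps [simp]:
  "carrier (hom_module C X Y) = Hom C X Y" "add (hom_module C X Y) = Add C"
  "smult (hom_module C X Y) = Scl C" "zero (hom_module C X Y) = Zer C X Y"
  by (simp_all add: hom_module_def)

lemma rat_ring_simps [simp]:
  "carrier rat_ring = UNIV" "mult rat_ring = (*)" "one rat_ring = 1" "zero rat_ring = 0" "add rat_ring = (+)"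
  by (simp_all add: rat_ring_def)

lemma Scl_simps [simp]:
  assumes "f \<in> Arr C"
  shows "Scl C q f \<in> Arr C" "Dom C (Scl C q f) = Dom C f" "Cod C (Scl C q f) = Cod C f"
    "Scl C 1 f = f" "Scl C p (Scl C q f) = Scl C (p * q) f"
proof -
  interpret M: Module.module rat_ring "hom_module C (Dom C f) (Cod C f)"
    using assms by (intro hom_module) auto
  have f: "f \<in> carrier (hom_module C (Dom C f) (Cod C f))"
    using assms by (simp add: in_Hom_iff)
  show "Scl C q f \<in> Arr C" "Dom C (Scl C q f) = Dom C f" "Cod C (Scl C q f) = Cod C f"
    using M.smult_closed[OF _ f, of q] by (simp_all add: in_Hom_iff)
  show "Scl C 1 f = f" "Scl C p (Scl C q f) = Scl C (p * q) f"
    using M.smult_one[OF f] M.smult_assoc1[OF _ _ f, of p q] by simp_all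
qed

lemma Scl_add:
  assumes "f \<in> Arr C"
  shows "Add C (Scl C p f) (Scl C q f) = Scl C (p + q) f"
proof -
  interpret M: Module.module rat_ring "hom_module C (Dom C f) (Cod C f)"
    using assms by (intro hom_module) auto
  show ?thesis using M.smult_l_distr[of p q f] assms by (simp add: in_Hom_iff)
qed

lemma Add_simps [simp]:
  assumes "f \<in> Arr C" "g \<in> Arr C" "Dom C f = Dom C g" "Cod C f = Cod C g"
  shows "Add C f g \<in> Arr C" "Dom C (Add C f g) = Dom C g" "Cod C (Add C f g) = Cod C g"
    "Scl C q (Add C f g) = Add C (Scl C q f) (Scl C q g)"
proof -
  interpret M: Module.module rat_ring "hom_module C (Dom C f) (Cod C f)"
    using assms by (intro hom_module) auto
  have f: "f \<in> carrier (hom_module C (Dom C f) (Cod C f))" "g \<in> carrier (hom_module C (Dom C f) (Cod C f))"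
    using assms by (simp_all add: in_Hom_iff)
  show "Add C f g \<in> Arr C" "Dom C (Add C f g) = Dom C g" "Cod C (Add C f g) = Cod C g"
    using M.M.a_closed[OF f] assms by (simp_all add: in_Hom_iff)
  show "Scl C q (Add C f g) = Add C (Scl C q f) (Scl C q g)"
    using M.smult_r_distr[OF _ f, of q] by simp
qed

lemma Comp_Scl_Arr [simp]:
  "f \<in> Arr C \<Longrightarrow> g \<in> Arr C \<Longrightarrow> Cod C f = Dom C g \<Longrightarrow> g \<cdot> Scl C q f = Scl C q (g \<cdot> f)"
  "f \<in> Arr C \<Longrightarrow> g \<in> Arr C \<Longrightarrow> Cod C f = Dom C g \<Longrightarrow> Scl C q g \<cdot> f = Scl C q (g \<cdot> f)"
  using Comp_Scl[of f "Dom C f" "Cod C f" g "Cod C g" q] Scl_Comp[of f "Dom C f" "Cod C f" g "Cod C g" q]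
  by (simp_all add: in_Hom_iff)

end

section \<open>The monoidal structure and consequences of the coherence axioms\<close>

context ACU_tensor_cat
begin

lemmas [simp] = Unit_closed Ten_closed Asc_iso Lun_iso Run_iso

lemma Tar_simps [simp]:
  assumes "f \<in> Arr C" "g \<in> Arr C"
  shows "f \<otimes>\<^sub>a g \<in> Arr C" "Dom C (f \<otimes>\<^sub>a g) = Dom C f \<otimes>\<^sub>o Dom C g" "Cod C (f \<otimes>\<^sub>a g) = Cod C f \<otimes>\<^sub>o Cod C g"
  using Tar_closed[of f "Dom C f" "Cod C f" g "Dom C g" "Cod C g"] assms by (simp_all add: in_Hom_iff)

lemma Asc_simps [simp]:
  assumes "X \<in> Obj C" "Y \<in> Obj C" "Z \<in> Obj C"
  shows "Asc C X Y Z \<in> Arr C" "Dom C (Asc C X Y Z) = (X \<otimes>\<^sub>o Y) \<otimes>\<^sub>o Z" "Cod C (Asc C X Y Z) = X \<otimes>\<^sub>o (Y \<otimes>\<^sub>o Z)"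
  using Asc_closed[OF assms] by (simp_all add: in_Hom_iff)

lemma Sym_simps [simp]:
  assumes "X \<in> Obj C" "Y \<in> Obj C"
  shows "Sym C X Y \<in> Arr C" "Dom C (Sym C X Y) = X \<otimes>\<^sub>o Y" "Cod C (Sym C X Y) = Y \<otimes>\<^sub>o X"
  using Sym_closed[OF assms] by (simp_all add: in_Hom_iff)

lemma Lun_Run_simps [simp]:
  assumes "X \<in> Obj C"
  shows "Lun C X \<in> Arr C" "Dom C (Lun C X) = \<bbbI> \<otimes>\<^sub>o X" "Cod C (Lun C X) = X"
    "Run C X \<in> Arr C" "Dom C (Run C X) = X \<otimes>\<^sub>o \<bbbI>" "Cod C (Run C X) = X"
  using Lun_closed[OF assms] Run_closed[OF assms] by (simp_all add: in_Hom_iff)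

lemma Tar_Id_Id [simp]: "X \<in> Obj C \<Longrightarrow> Y \<in> Obj C \<Longrightarrow> Id C X \<otimes>\<^sub>a Id C Y = Id C (X \<otimes>\<^sub>o Y)"
  by (rule Tar_Id)

lemma Tar_Comp_Arr:
  assumes "f \<in> Arr C" "f' \<in> Arr C" "Cod C f = Dom C f'" "g \<in> Arr C" "g' \<in> Arr C" "Cod C g = Dom C g'"
  shows "(f' \<otimes>\<^sub>a g') \<cdot> (f \<otimes>\<^sub>a g) = (f' \<cdot> f) \<otimes>\<^sub>a (g' \<cdot> g)"
  using Tar_Comp[of f "Dom C f" "Cod C f" f' "Cod C f'" g "Dom C g" "Cod C g" g' "Cod C g'"] assms
  by (simp add: in_Hom_iff)

lemma Tar_Comp_assoc:
  assumes "f \<in> Arr C" "f' \<in> Arr C" "Cod C f = Dom C f'" "g \<in> Arr C" "g' \<in> Arr C" "Cod C g = Dom C g'"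
    "u \<in> Arr C" "Cod C u = Dom C f \<otimes>\<^sub>o Dom C g"
  shows "(f' \<otimes>\<^sub>a g') \<cdot> ((f \<otimes>\<^sub>a g) \<cdot> u) = ((f' \<cdot> f) \<otimes>\<^sub>a (g' \<cdot> g)) \<cdot> u"
  using assms by (simp flip: Comp_assoc_Arr add: Tar_Comp_Arr)

lemma Asc_nat:
  assumes "f \<in> Arr C" "g \<in> Arr C" "h \<in> Arr C" "Dom C f = X" "Dom C g = Y" "Dom C h = Z"
    "Cod C f = X'" "Cod C g = Y'" "Cod C h = Z'"
  shows "Asc C X' Y' Z' \<cdot> ((f \<otimes>\<^sub>a g) \<otimes>\<^sub>a h) = (f \<otimes>\<^sub>a (g \<otimes>\<^sub>a h)) \<cdot> Asc C X Y Z"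
  using assms by (intro Asc_natural) (simp_all add: in_Hom_iff)

lemma Asc_nat_Arr:
  "\<lbrakk>f \<in> Arr C; g \<in> Arr C; h \<in> Arr C\<rbrakk> \<Longrightarrow> Asc C (Cod C f) (Cod C g) (Cod C h) \<cdot> ((f \<otimes>\<^sub>a g) \<otimes>\<^sub>a h)
     = (f \<otimes>\<^sub>a (g \<otimes>\<^sub>a h)) \<cdot> Asc C (Dom C f) (Dom C g) (Dom C h)"
  by (intro Asc_nat) simp_all

lemma Lun_nat: "f \<in> Arr C \<Longrightarrow> Lun C (Cod C f) \<cdot> (Id C \<bbbI> \<otimes>\<^sub>a f) = f \<cdot> Lun C (Dom C f)"
  by (intro Lun_natural) (simp add: in_Hom_iff)

lemma Run_nat: "f \<in> Arr C \<Longrightarrow> Run C (Cod C f) \<cdot> (f \<otimes>\<^sub>a Id C \<bbbI>) = f \<cdot> Run C (Dom C f)"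
  by (intro Run_natural) (simp add: in_Hom_iff)

lemma Sym_nat: "f \<in> Arr C \<Longrightarrow> g \<in> Arr C \<Longrightarrow>
    Sym C (Cod C f) (Cod C g) \<cdot> (f \<otimes>\<^sub>a g) = (g \<otimes>\<^sub>a f) \<cdot> Sym C (Dom C f) (Dom C g)"
  by (intro Sym_natural) (simp_all add: in_Hom_iff)

lemma Tar_iso:
  assumes "is_iso C f" "is_iso C g"
  shows "is_iso C (f \<otimes>\<^sub>a g)"
  using assms is_iso_Arr[OF assms(1)] is_iso_Arr[OF assms(2)]
  by (intro is_isoI[where g = "Inv C f \<otimes>\<^sub>a Inv C g"]) (simp_all add: in_Hom_iff Tar_Comp_Arr)

lemma Tar_Scl [simp]:
  "f \<in> Arr C \<Longrightarrow> g \<in> Arr C \<Longrightarrow> Scl C q f \<otimes>\<^sub>a g = Scl C q (f \<otimes>\<^sub>a g)"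
  "f \<in> Arr C \<Longrightarrow> g \<in> Arr C \<Longrightarrow> f \<otimes>\<^sub>a Scl C q g = Scl C q (f \<otimes>\<^sub>a g)"
  using Tar_Scl_left[of f "Dom C f" "Cod C f" g "Dom C g" "Cod C g" q]
    Tar_Scl_right[of f "Dom C f" "Cod C f" g "Dom C g" "Cod C g" q]
  by (simp_all add: in_Hom_iff)

text \<open>Naturality of \<open>Lun\<close> recovers \<open>f\<close> from
  \<open>Id C \<bbbI> \<otimes>\<^sub>a f\<close>, since \<open>Lun\<close> is invertible. Equations
  between constraints can thus be tested after tensoring with the unit, where pentagon and triangle
  apply.\<close>

lemma Tar_Unit_left_faithful:
  assumes "f \<in> Arr C" "g \<in> Arr C" "Dom C f = Dom C g" "Cod C f = Cod C g" "Id C \<bbbI> \<otimes>\<^sub>a f = Id C \<bbbI> \<otimes>\<^sub>a g"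
  shows "f = g"
  using assms Lun_nat[of f] Lun_nat[of g]
  by (intro iso_cancel_right[of "Lun C (Dom C f)" f g]) simp_all

lemma Tar_Unit_right_faithful:
  assumes "f \<in> Arr C" "g \<in> Arr C" "Dom C f = Dom C g" "Cod C f = Cod C g" "f \<otimes>\<^sub>a Id C \<bbbI> = g \<otimes>\<^sub>a Id C \<bbbI>"
  shows "f = g"
  using assms Run_nat[of f] Run_nat[of g]
  by (intro iso_cancel_right[of "Run C (Dom C f)" f g]) simp_all

text \<open>Kelly's derivation of the second triangle identity from the pentagon.\<close>

lemma Lun_Asc:
  assumes X: "X \<in> Obj C" and Y: "Y \<in> Obj C"
  shows "Lun C (X \<otimes>\<^sub>o Y) \<cdot> Asc C \<bbbI> X Y = Lun C X \<otimes>\<^sub>a Id C Y"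
proof (rule Tar_Unit_left_faithful)
  let ?I = "\<bbbI>" and ?i = "Id C \<bbbI>"
  \<comment> \<open>With \<open>?h\<close> in front, the associator on the left becomes one side of
    the pentagon for I, I, X, Y. Both factors of \<open>?h\<close> are invertible and are cancelled
    at the end.\<close>
  let ?h = "Asc C ?I (?I \<otimes>\<^sub>o X) Y \<cdot> (Asc C ?I ?I X \<otimes>\<^sub>a Id C Y)"
  have "(?i \<otimes>\<^sub>a (Lun C (X \<otimes>\<^sub>o Y) \<cdot> Asc C ?I X Y)) \<cdot> ?h
      = (?i \<otimes>\<^sub>a Lun C (X \<otimes>\<^sub>o Y)) \<cdot> ((?i \<otimes>\<^sub>a Asc C ?I X Y) \<cdot> ?h)"
    using X Y by (simp add: Tar_Comp_assoc)
  also have "(?i \<otimes>\<^sub>a Asc C ?I X Y) \<cdot> ?h = Asc C ?I ?I (X \<otimes>\<^sub>o Y) \<cdot> Asc C (?I \<otimes>\<^sub>o ?I) X Y"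
    using X Y by (simp add: pentagon)
  also have "(?i \<otimes>\<^sub>a Lun C (X \<otimes>\<^sub>o Y)) \<cdot> \<dots> = (Run C ?I \<otimes>\<^sub>a Id C (X \<otimes>\<^sub>o Y)) \<cdot> Asc C (?I \<otimes>\<^sub>o ?I) X Y"
    using X Y triangle[of ?I "X \<otimes>\<^sub>o Y"] by (simp flip: Comp_assoc_Arr)
  also have "\<dots> = Asc C ?I X Y \<cdot> ((Run C ?I \<otimes>\<^sub>a Id C X) \<otimes>\<^sub>a Id C Y)"
    using X Y Asc_nat[of "Run C ?I" "Id C X" "Id C Y"] by simp
  also have "Run C ?I \<otimes>\<^sub>a Id C X = (?i \<otimes>\<^sub>a Lun C X) \<cdot> Asc C ?I ?I X"
    using X by (simp add: triangle)
  also have "\<dots> \<otimes>\<^sub>a Id C Y = ((?i \<otimes>\<^sub>a Lun C X) \<otimes>\<^sub>a Id C Y) \<cdot> (Asc C ?I ?I X \<otimes>\<^sub>a Id C Y)"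
    using X Y by (simp add: Tar_Comp_Arr)
  also have "Asc C ?I X Y \<cdot> \<dots> = (?i \<otimes>\<^sub>a (Lun C X \<otimes>\<^sub>a Id C Y)) \<cdot> ?h"
    using X Y Asc_nat[of ?i "Lun C X" "Id C Y"] by (simp flip: Comp_assoc_Arr)
  finally have "(?i \<otimes>\<^sub>a (Lun C (X \<otimes>\<^sub>o Y) \<cdot> Asc C ?I X Y)) \<cdot> ?h = (?i \<otimes>\<^sub>a (Lun C X \<otimes>\<^sub>a Id C Y)) \<cdot> ?h" .
  then have "((?i \<otimes>\<^sub>a (Lun C (X \<otimes>\<^sub>o Y) \<cdot> Asc C ?I X Y)) \<cdot> Asc C ?I (?I \<otimes>\<^sub>o X) Y) \<cdot> (Asc C ?I ?I X \<otimes>\<^sub>a Id C Y)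
      = ((?i \<otimes>\<^sub>a (Lun C X \<otimes>\<^sub>a Id C Y)) \<cdot> Asc C ?I (?I \<otimes>\<^sub>o X) Y) \<cdot> (Asc C ?I ?I X \<otimes>\<^sub>a Id C Y)"
    using X Y by simp
  moreover have "is_iso C (Asc C ?I ?I X \<otimes>\<^sub>a Id C Y)"
    using X Y by (intro Tar_iso is_isoI[of "Id C Y" "Id C Y"]) (simp_all add: in_Hom_iff)
  ultimately have "(?i \<otimes>\<^sub>a (Lun C (X \<otimes>\<^sub>o Y) \<cdot> Asc C ?I X Y)) \<cdot> Asc C ?I (?I \<otimes>\<^sub>o X) Y
      = (?i \<otimes>\<^sub>a (Lun C X \<otimes>\<^sub>a Id C Y)) \<cdot> Asc C ?I (?I \<otimes>\<^sub>o X) Y"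
    using X Y by (elim iso_cancel_right[rotated -1]) simp_all
  then show "?i \<otimes>\<^sub>a (Lun C (X \<otimes>\<^sub>o Y) \<cdot> Asc C ?I X Y) = ?i \<otimes>\<^sub>a (Lun C X \<otimes>\<^sub>a Id C Y)"
    using X Y by (elim iso_cancel_right[rotated -1]) simp_all
qed (use assms in simp_all)

text \<open>Naturality of \<open>Lun\<close> at the morphism \<open>Lun C X\<close> says that both
  sides agree after composition with \<open>Lun C X\<close>, which is invertible.\<close>

lemma Lun_Unit_left:
  assumes X: "X \<in> Obj C"
  shows "Id C \<bbbI> \<otimes>\<^sub>a Lun C X = Lun C (\<bbbI> \<otimes>\<^sub>o X)"
  using X Lun_nat[of "Lun C X"]
  by (intro iso_cancel_left[of "Lun C X" "Id C \<bbbI> \<otimes>\<^sub>a Lun C X"]) simp_all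

text \<open>After tensoring with the unit on the right, \<open>Lun_Asc\<close> and
  \<open>triangle\<close> express the two sides by the same morphism, thanks to
  \<open>Lun_Unit_left\<close>.\<close>

lemma Lun_eq_Run_Unit: "Lun C \<bbbI> = Run C \<bbbI>"
proof (rule Tar_Unit_right_faithful)
  have "Lun C \<bbbI> \<otimes>\<^sub>a Id C \<bbbI> = Lun C (\<bbbI> \<otimes>\<^sub>o \<bbbI>) \<cdot> Asc C \<bbbI> \<bbbI> \<bbbI>"
    by (simp add: Lun_Asc)
  also have "\<dots> = Run C \<bbbI> \<otimes>\<^sub>a Id C \<bbbI>"
    by (simp add: Lun_Unit_left flip: triangle)
  finally show "Lun C \<bbbI> \<otimes>\<^sub>a Id C \<bbbI> = Run C \<bbbI> \<otimes>\<^sub>a Id C \<bbbI>" .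
qed simp_all

lemma Sym_iso [simp]: "X \<in> Obj C \<Longrightarrow> Y \<in> Obj C \<Longrightarrow> is_iso C (Sym C X Y)"
  by (rule is_isoI[of _ "Sym C Y X"]) (simp_all add: in_Hom_iff Sym_Sym)

text \<open>By the hexagon for \<open>X, \<bbbI>, \<bbbI>\<close>, up to cancelling the isomorphism \<open>Sym\<close>.\<close>

lemma Lun_Sym:
  assumes X: "X \<in> Obj C"
  shows "Lun C X \<cdot> Sym C X \<bbbI> = Run C X"
proof (rule Tar_Unit_right_faithful)
  let ?I = "\<bbbI>" and ?i = "Id C \<bbbI>"
  have a: "Lun C (X \<otimes>\<^sub>o ?I) \<cdot> (Asc C ?I X ?I \<cdot> (Sym C X ?I \<otimes>\<^sub>a ?i)) = (Lun C X \<cdot> Sym C X ?I) \<otimes>\<^sub>a ?i"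
    using X by (simp flip: Comp_assoc_Arr add: Lun_Asc Tar_Comp_Arr)
  have "Sym C X ?I \<cdot> (Lun C (X \<otimes>\<^sub>o ?I) \<cdot> (Asc C ?I X ?I \<cdot> (Sym C X ?I \<otimes>\<^sub>a ?i)))
     = Lun C (?I \<otimes>\<^sub>o X) \<cdot> ((?i \<otimes>\<^sub>a Sym C X ?I) \<cdot> (Asc C ?I X ?I \<cdot> (Sym C X ?I \<otimes>\<^sub>a ?i)))"
    using X Lun_nat[of "Sym C X ?I"] by (simp flip: Comp_assoc_Arr)
  also have "(?i \<otimes>\<^sub>a Sym C X ?I) \<cdot> (Asc C ?I X ?I \<cdot> (Sym C X ?I \<otimes>\<^sub>a ?i))
     = Asc C ?I ?I X \<cdot> (Sym C X (?I \<otimes>\<^sub>o ?I) \<cdot> Asc C X ?I ?I)"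
    using X by (simp add: hexagon)
  also have "Lun C (?I \<otimes>\<^sub>o X) \<cdot> \<dots> = (Lun C ?I \<otimes>\<^sub>a Id C X) \<cdot> (Sym C X (?I \<otimes>\<^sub>o ?I) \<cdot> Asc C X ?I ?I)"
    using X by (simp flip: Comp_assoc_Arr add: Lun_Asc)
  also have "\<dots> = Sym C X ?I \<cdot> ((Id C X \<otimes>\<^sub>a Lun C ?I) \<cdot> Asc C X ?I ?I)"
    using X Sym_nat[of "Id C X" "Lun C ?I"] by (simp flip: Comp_assoc_Arr)
  also have "(Id C X \<otimes>\<^sub>a Lun C ?I) \<cdot> Asc C X ?I ?I = Run C X \<otimes>\<^sub>a ?i"
    using X by (simp add: triangle)
  finally show "(Lun C X \<cdot> Sym C X ?I) \<otimes>\<^sub>a ?i = Run C X \<otimes>\<^sub>a ?i"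
    unfolding a using X by (elim iso_cancel_left[rotated -1]) simp_all
qed (use X in simp_all)

end

section \<open>String diagrams\<close>

text \<open>
  A tree is a bracketed tensor product with leaves \<open>lv t\<close>; a box is a morphism between two such
  products; a state is a list of objects together with a morphism into their right-nested product.
  \<open>ap k b s\<close> composes the state \<open>s\<close> with the box \<open>b\<close> acting on the consecutive factors from
  number \<open>k\<close> on. As the coherence isomorphisms are hidden in \<open>ap\<close>, an equation between states is an
  equation between string diagrams.
\<close>

datatype 'o tree = Lf 'o | Ut | Tn "'o tree" "'o tree"

primrec lv :: "'o tree \<Rightarrow> 'o list" where
  "lv (Lf X) = [X]"
| "lv Ut = []"
| "lv (Tn a b) = lv a @ lv b"

definition rt :: "'o list \<Rightarrow> 'o tree" where
  "rt xs = foldr (\<lambda>X t. Tn (Lf X) t) xs Ut"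

lemma rt_simps [simp]: "rt [] = Ut" "rt (X # xs) = Tn (Lf X) (rt xs)"
  by (simp_all add: rt_def)

lemma lv_rt [simp]: "lv (rt xs) = xs"
  by (induction xs) auto

type_synonym ('o, 'm) box = "'o tree \<times> 'o tree \<times> 'm"

definition ins :: "('o, 'm) box \<Rightarrow> 'o list" where "ins b = lv (fst b)"
definition outs :: "('o, 'm) box \<Rightarrow> 'o list" where "outs b = lv (fst (snd b))"

lemma ins_outs_simps [simp]: "ins (t, t', f) = lv t" "outs (t, t', f) = lv t'"
  by (simp_all add: ins_def outs_def)

definition fits :: "nat \<Rightarrow> ('o, 'm) box \<Rightarrow> 'o list \<Rightarrow> bool" where
  "fits k b xs \<longleftrightarrow> k \<le> length xs \<and> take (length (ins b)) (drop k xs) = ins b"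

definition res :: "nat \<Rightarrow> ('o, 'm) box \<Rightarrow> 'o list \<Rightarrow> 'o list" where
  "res k b xs = take k xs @ outs b @ drop (k + length (ins b)) xs"

lemma fits_iff: "fits k b xs \<longleftrightarrow> (\<exists>P R. xs = P @ ins b @ R \<and> length P = k)"
proof
  assume a: "fits k b xs"
  then have "xs = take k xs @ ins b @ drop (length (ins b)) (drop k xs)"
    unfolding fits_def by (metis append_take_drop_id)
  then show "\<exists>P R. xs = P @ ins b @ R \<and> length P = k"
    using a unfolding fits_def by (metis length_take min_absorb2)
qed (auto simp: fits_def)

lemma res_append [simp]: "length P = k \<Longrightarrow> res k b (P @ ins b @ R) = P @ outs b @ R"
  by (simp add: res_def)

section \<open>Boxes acting on right-nested products\<close>

context ACU_tensor_cat
begin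

primrec ob :: "'a tree \<Rightarrow> 'a" where
  "ob (Lf X) = X"
| "ob Ut = \<bbbI>"
| "ob (Tn a b) = ob a \<otimes>\<^sub>o ob b"

text \<open>The tail \<open>Z\<close> is a parameter so that concatenation of lists becomes
  \<open>nest xs (nest ys Z)\<close> on the nose, with no associator.\<close>

definition nest :: "'a list \<Rightarrow> 'a \<Rightarrow> 'a" where
  "nest xs Z = foldr (\<lambda>X Y. X \<otimes>\<^sub>o Y) xs Z"

definition lift :: "'a list \<Rightarrow> 'b \<Rightarrow> 'b" where
  "lift xs m = foldr (\<lambda>X m. Id C X \<otimes>\<^sub>a m) xs m"

text \<open>The coherence isomorphism
  \<open>ob t \<otimes>\<^sub>o Z \<rightarrow> nest (lv t) Z\<close> that removes a bracketing.
  Boxes act through conjugation by it, so that only the list of leaves remains visible.\<close>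

primrec un :: "'a tree \<Rightarrow> 'a \<Rightarrow> 'b" where
  "un (Lf X) Z = Id C (X \<otimes>\<^sub>o Z)"
| "un Ut Z = Lun C Z"
| "un (Tn a b) Z = un a (nest (lv b) Z) \<cdot> (Id C (ob a) \<otimes>\<^sub>a un b Z) \<cdot> Asc C (ob a) (ob b) Z"

abbreviation nu :: "'a tree \<Rightarrow> 'a \<Rightarrow> 'b" where
  "nu t Z \<equiv> Inv C (un t Z)"

definition bx :: "('a, 'b) box \<Rightarrow> 'a \<Rightarrow> 'b" where
  "bx b Z = (case b of (t, t', f) \<Rightarrow> un t' Z \<cdot> (f \<otimes>\<^sub>a Id C Z) \<cdot> nu t Z)"

abbreviation objs :: "'a list \<Rightarrow> bool" where
  "objs xs \<equiv> set xs \<subseteq> Obj C"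

definition wb :: "('a, 'b) box \<Rightarrow> bool" where
  "wb b \<longleftrightarrow> (case b of (t, t', f) \<Rightarrow> objs (lv t) \<and> objs (lv t') \<and> f \<in> Arr C \<and> Dom C f = ob t \<and> Cod C f = ob t')"

lemma wb_simps [simp]:
  "wb (t, t', f) \<longleftrightarrow> objs (lv t) \<and> objs (lv t') \<and> f \<in> Arr C \<and> Dom C f = ob t \<and> Cod C f = ob t'"
  by (simp add: wb_def)

lemma wb_objs [simp]: "wb b \<Longrightarrow> objs (ins b)" "wb b \<Longrightarrow> objs (outs b)"
  by (auto simp: wb_def ins_def outs_def split: prod.splits)

lemma nest_simps [simp]:
  "nest [] Z = Z" "nest (X # xs) Z = X \<otimes>\<^sub>o nest xs Z" "nest (xs @ ys) Z = nest xs (nest ys Z)"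
  by (simp_all add: nest_def)

lemma lift_simps [simp]:
  "lift [] m = m" "lift (X # xs) m = Id C X \<otimes>\<^sub>a lift xs m" "lift (xs @ ys) m = lift xs (lift ys m)"
  by (simp_all add: lift_def)

lemma nest_Obj [simp]: "objs xs \<Longrightarrow> Z \<in> Obj C \<Longrightarrow> nest xs Z \<in> Obj C"
  by (induction xs) auto

lemma ob_Obj [simp]: "objs (lv t) \<Longrightarrow> ob t \<in> Obj C"
  by (induction t) auto

lemma ob_rt [simp]: "ob (rt xs) = nest xs \<bbbI>"
  by (induction xs) auto

lemma lift_Arr [simp]:
  assumes "objs xs" "m \<in> Arr C"
  shows "lift xs m \<in> Arr C" "Dom C (lift xs m) = nest xs (Dom C m)" "Cod C (lift xs m) = nest xs (Cod C m)"
  using assms by (induction xs) auto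

lemma lift_Id [simp]: "objs xs \<Longrightarrow> Z \<in> Obj C \<Longrightarrow> lift xs (Id C Z) = Id C (nest xs Z)"
  by (induction xs) auto

lemma whisk_left: "X \<in> Obj C \<Longrightarrow> f \<in> Arr C \<Longrightarrow> g \<in> Arr C \<Longrightarrow> Cod C f = Dom C g \<Longrightarrow>
    Id C X \<otimes>\<^sub>a (g \<cdot> f) = (Id C X \<otimes>\<^sub>a g) \<cdot> (Id C X \<otimes>\<^sub>a f)"
  by (simp add: Tar_Comp_Arr)

lemma whisk_right: "X \<in> Obj C \<Longrightarrow> f \<in> Arr C \<Longrightarrow> g \<in> Arr C \<Longrightarrow> Cod C f = Dom C g \<Longrightarrow>
    (g \<cdot> f) \<otimes>\<^sub>a Id C X = (g \<otimes>\<^sub>a Id C X) \<cdot> (f \<otimes>\<^sub>a Id C X)"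
  by (simp add: Tar_Comp_Arr)

lemma lift_Comp:
  "objs xs \<Longrightarrow> f \<in> Arr C \<Longrightarrow> g \<in> Arr C \<Longrightarrow> Cod C f = Dom C g \<Longrightarrow> lift xs (g \<cdot> f) = lift xs g \<cdot> lift xs f"
  by (induction xs) (auto simp: whisk_left)

lemma lift_Scl:
  "objs xs \<Longrightarrow> f \<in> Arr C \<Longrightarrow> lift xs (Scl C q f) = Scl C q (lift xs f)"
  by (induction xs) auto

lemma un_Arr [simp]:
  assumes "objs (lv t)" "Z \<in> Obj C"
  shows "un t Z \<in> Arr C" "Dom C (un t Z) = ob t \<otimes>\<^sub>o Z" "Cod C (un t Z) = nest (lv t) Z"
proof -
  have "un t Z \<in> Arr C \<and> Dom C (un t Z) = ob t \<otimes>\<^sub>o Z \<and> Cod C (un t Z) = nest (lv t) Z"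
    using assms by (induction t arbitrary: Z) auto
  then show "un t Z \<in> Arr C" "Dom C (un t Z) = ob t \<otimes>\<^sub>o Z" "Cod C (un t Z) = nest (lv t) Z" by auto
qed

lemma Id_iso [simp]: "X \<in> Obj C \<Longrightarrow> is_iso C (Id C X)"
  by (rule is_isoI[of _ "Id C X"]) (simp_all add: in_Hom_iff)

lemma Comp_iso:
  assumes "is_iso C f" "is_iso C g" "Cod C f = Dom C g"
  shows "is_iso C (g \<cdot> f)"
  using assms is_iso_Arr[OF assms(1)] is_iso_Arr[OF assms(2)]
  by (intro is_isoI[of _ "Inv C f \<cdot> Inv C g"]) (simp_all add: in_Hom_iff)

lemma un_iso [simp]: "objs (lv t) \<Longrightarrow> Z \<in> Obj C \<Longrightarrow> is_iso C (un t Z)"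
  by (induction t arbitrary: Z) (auto simp: un.simps(3) intro!: Comp_iso Tar_iso)

text \<open>Removing a bracketing does not interact with what happens in the tail. This is the
  source of the interchange law for boxes on disjoint strands.\<close>

lemma un_nat:
  assumes "objs (lv t)" "h \<in> Arr C"
  shows "un t (Cod C h) \<cdot> (Id C (ob t) \<otimes>\<^sub>a h) = lift (lv t) h \<cdot> un t (Dom C h)"
  using assms
proof (induction t arbitrary: h)
  case (Tn a b)
  let ?Z = "Dom C h" and ?Z' = "Cod C h"
  have "un (Tn a b) ?Z' \<cdot> (Id C (ob (Tn a b)) \<otimes>\<^sub>a h)
      = un a (nest (lv b) ?Z') \<cdot> ((Id C (ob a) \<otimes>\<^sub>a un b ?Z') \<cdot> ((Id C (ob a) \<otimes>\<^sub>a (Id C (ob b) \<otimes>\<^sub>a h)) \<cdot> Asc C (ob a) (ob b) ?Z))"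
    using Tn.prems Asc_nat_Arr[of "Id C (ob a)" "Id C (ob b)" h] by simp
  also have "\<dots> = un a (nest (lv b) ?Z') \<cdot> ((Id C (ob a) \<otimes>\<^sub>a lift (lv b) h) \<cdot> ((Id C (ob a) \<otimes>\<^sub>a un b ?Z) \<cdot> Asc C (ob a) (ob b) ?Z))"
    using Tn.prems by (simp add: Tar_Comp_assoc Tn.IH(2))
  also have "\<dots> = lift (lv a) (lift (lv b) h) \<cdot> (un a (nest (lv b) ?Z) \<cdot> ((Id C (ob a) \<otimes>\<^sub>a un b ?Z) \<cdot> Asc C (ob a) (ob b) ?Z))"
    using Tn.prems Tn.IH(1)[of "lift (lv b) h"] by (simp flip: Comp_assoc_Arr)
  finally show ?case using Tn.prems by simp
qed (auto simp: Lun_nat)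

declare un.simps(3) [simp del]

lemma bx_Arr [simp]:
  assumes "wb b" "Z \<in> Obj C"
  shows "bx b Z \<in> Arr C" "Dom C (bx b Z) = nest (ins b) Z" "Cod C (bx b Z) = nest (outs b) Z"
  using assms by (auto simp: bx_def split: prod.splits)

lemma nu_nat:
  assumes "objs (lv t)" "h \<in> Arr C"
  shows "nu t (Cod C h) \<cdot> lift (lv t) h = (Id C (ob t) \<otimes>\<^sub>a h) \<cdot> nu t (Dom C h)"
proof (rule iso_cancel_left[of "un t (Cod C h)"])
  have "un t (Cod C h) \<cdot> ((Id C (ob t) \<otimes>\<^sub>a h) \<cdot> nu t (Dom C h)) = lift (lv t) h \<cdot> (un t (Dom C h) \<cdot> nu t (Dom C h))"
    using assms un_nat[of t h] by (simp flip: Comp_assoc_Arr del: is_iso_Inv(4,5))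
  then show "un t (Cod C h) \<cdot> (nu t (Cod C h) \<cdot> lift (lv t) h)
    = un t (Cod C h) \<cdot> ((Id C (ob t) \<otimes>\<^sub>a h) \<cdot> nu t (Dom C h))"
    using assms by simp
qed (use assms in simp_all)

lemma bx_nat:
  assumes "wb b" "h \<in> Arr C"
  shows "bx b (Cod C h) \<cdot> lift (ins b) h = lift (outs b) h \<cdot> bx b (Dom C h)"
proof (cases b)
  case (fields t t' f)
  have "bx b (Cod C h) \<cdot> lift (ins b) h
     = un t' (Cod C h) \<cdot> ((f \<otimes>\<^sub>a Id C (Cod C h)) \<cdot> ((Id C (ob t) \<otimes>\<^sub>a h) \<cdot> nu t (Dom C h)))"
    using assms fields nu_nat[of t h] by (simp add: bx_def)
  also have "\<dots> = un t' (Cod C h) \<cdot> ((Id C (ob t') \<otimes>\<^sub>a h) \<cdot> ((f \<otimes>\<^sub>a Id C (Dom C h)) \<cdot> nu t (Dom C h)))"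
    using assms fields by (simp add: Tar_Comp_assoc)
  also have "\<dots> = lift (outs b) h \<cdot> bx b (Dom C h)"
    using assms fields un_nat[of t' h] by (simp flip: Comp_assoc_Arr add: bx_def)
  finally show ?thesis .
qed

lemma bx_Comp:
  assumes "wb (t1, t2, f)" "wb (t2, t3, g)" "Z \<in> Obj C"
  shows "bx (t1, t3, g \<cdot> f) Z = bx (t2, t3, g) Z \<cdot> bx (t1, t2, f) Z"
  using assms by (simp add: bx_def whisk_right)

lemma bx_Id:
  assumes "objs (lv t)" "Z \<in> Obj C"
  shows "bx (t, t, Id C (ob t)) Z = Id C (nest (lv t) Z)"
  using assms by (simp add: bx_def)

text \<open>A constraint only changes bracketings. If it is compatible with the two unfoldings,
  conjugation makes it the identity, and this is what hides coherence in diagrams.\<close>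

lemma bx_structural:
  assumes "objs (lv t)" "objs (lv t')" "Z \<in> Obj C" "f \<in> Arr C" "Dom C f = ob t" "Cod C f = ob t'" "lv t = lv t'"
    "un t' Z \<cdot> (f \<otimes>\<^sub>a Id C Z) = un t Z"
  shows "bx (t, t', f) Z = Id C (nest (lv t) Z)"
  using assms by (simp add: bx_def flip: Comp_assoc_Arr)

text \<open>Compatibility with the unfoldings is the pentagon, once the unfolding of
  \<open>c\<close> has been moved past the associator by naturality. For the unit constraints the
  same role is played by \<open>Lun_Asc\<close> and \<open>triangle\<close>.\<close>

lemma bx_Asc:
  assumes "objs (lv a)" "objs (lv b)" "objs (lv c)" "Z \<in> Obj C"
  shows "bx (Tn (Tn a b) c, Tn a (Tn b c), Asc C (ob a) (ob b) (ob c)) Z = Id C (nest (lv a @ lv b @ lv c) Z)"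
proof -
  let ?A = "ob a" and ?B = "ob b" and ?D = "ob c"
  let ?uc = "un c Z" and ?ub = "un b (nest (lv c) Z)" and ?ua = "un a (nest (lv b) (nest (lv c) Z))"
  have "un (Tn (Tn a b) c) Z = ?ua \<cdot> ((Id C ?A \<otimes>\<^sub>a ?ub) \<cdot> (Asc C ?A ?B (nest (lv c) Z) \<cdot>
      (((Id C ?A \<otimes>\<^sub>a Id C ?B) \<otimes>\<^sub>a ?uc) \<cdot> Asc C (?A \<otimes>\<^sub>o ?B) ?D Z)))"
    using assms by (simp add: un.simps(3))
  also have "Asc C ?A ?B (nest (lv c) Z) \<cdot> (((Id C ?A \<otimes>\<^sub>a Id C ?B) \<otimes>\<^sub>a ?uc) \<cdot> Asc C (?A \<otimes>\<^sub>o ?B) ?D Z)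
    = (Id C ?A \<otimes>\<^sub>a (Id C ?B \<otimes>\<^sub>a ?uc)) \<cdot> (Asc C ?A ?B (?D \<otimes>\<^sub>o Z) \<cdot> Asc C (?A \<otimes>\<^sub>o ?B) ?D Z)"
    using assms Asc_nat_Arr[of "Id C ?A" "Id C ?B" ?uc] by (simp flip: Comp_assoc_Arr)
  also have "Asc C ?A ?B (?D \<otimes>\<^sub>o Z) \<cdot> Asc C (?A \<otimes>\<^sub>o ?B) ?D Z
    = (Id C ?A \<otimes>\<^sub>a Asc C ?B ?D Z) \<cdot> (Asc C ?A (?B \<otimes>\<^sub>o ?D) Z \<cdot> (Asc C ?A ?B ?D \<otimes>\<^sub>a Id C Z))"
    using assms by (simp add: pentagon)
  finally have "un (Tn a (Tn b c)) Z \<cdot> (Asc C ?A ?B ?D \<otimes>\<^sub>a Id C Z) = un (Tn (Tn a b) c) Z"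
    using assms by (simp add: whisk_left un.simps(3))
  then show ?thesis
    using assms by (subst bx_structural) simp_all
qed

lemma bx_Lun:
  assumes "objs (lv a)" "Z \<in> Obj C"
  shows "bx (Tn Ut a, a, Lun C (ob a)) Z = Id C (nest (lv a) Z)"
proof -
  have "un (Tn Ut a) Z = un a Z \<cdot> (Lun C (ob a) \<otimes>\<^sub>a Id C Z)"
    using assms Lun_nat[of "un a Z"] by (simp flip: Comp_assoc_Arr add: un.simps(3)) (simp add: Lun_Asc)
  then show ?thesis
    using assms by (subst bx_structural) simp_all
qed

lemma bx_Run:
  assumes "objs (lv a)" "Z \<in> Obj C"
  shows "bx (Tn a Ut, a, Run C (ob a)) Z = Id C (nest (lv a) Z)"
  using assms by (subst bx_structural) (simp_all add: triangle un.simps(3))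

lemma bx_Inv:
  assumes "wb (t, t', f)" "is_iso C f" "Z \<in> Obj C" "lv t = lv t'" "bx (t, t', f) Z = Id C (nest (lv t) Z)"
  shows "bx (t', t, Inv C f) Z = Id C (nest (lv t') Z)"
proof -
  have "bx (t', t, Inv C f) Z = bx (t', t, Inv C f) Z \<cdot> bx (t, t', f) Z"
    using assms by simp
  also have "\<dots> = bx (t, t, Inv C f \<cdot> f) Z"
    using assms by (subst bx_Comp) auto
  also have "\<dots> = Id C (nest (lv t') Z)"
    using assms by (simp add: bx_Id)
  finally show ?thesis .
qed

text \<open>The idle factor \<open>b\<close> to the right of a box is merely a part of its tail; an
  idle factor to the left is a whiskering, as in \<open>bx_Id_Tar\<close>. Together they split a
  tensor product of boxes into two separate boxes.\<close>

lemma bx_Tar_Id: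
  assumes "wb (a, c, f)" "objs (lv b)" "Z \<in> Obj C"
  shows "bx (Tn a b, Tn c b, f \<otimes>\<^sub>a Id C (ob b)) Z = bx (a, c, f) (nest (lv b) Z)"
proof -
  let ?A = "ob a" and ?B = "ob b" and ?Z = "nest (lv b) Z"
  have "un (Tn c b) Z \<cdot> ((f \<otimes>\<^sub>a Id C ?B) \<otimes>\<^sub>a Id C Z)
     = un c ?Z \<cdot> ((Id C (ob c) \<otimes>\<^sub>a un b Z) \<cdot> ((f \<otimes>\<^sub>a Id C (?B \<otimes>\<^sub>o Z)) \<cdot> Asc C ?A ?B Z))"
    using assms Asc_nat_Arr[of f "Id C ?B" "Id C Z"] by (simp add: un.simps(3))
  also have "\<dots> = un c ?Z \<cdot> ((f \<otimes>\<^sub>a Id C ?Z) \<cdot> ((Id C ?A \<otimes>\<^sub>a un b Z) \<cdot> Asc C ?A ?B Z))"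
    using assms by (simp add: Tar_Comp_assoc)
  also have "\<dots> = un c ?Z \<cdot> ((f \<otimes>\<^sub>a Id C ?Z) \<cdot> (nu a ?Z \<cdot> (un a ?Z \<cdot> ((Id C ?A \<otimes>\<^sub>a un b Z) \<cdot> Asc C ?A ?B Z))))"
    using assms by simp
  also have "\<dots> = bx (a, c, f) ?Z \<cdot> un (Tn a b) Z"
    using assms by (simp add: bx_def un.simps(3))
  finally have e: "un (Tn c b) Z \<cdot> ((f \<otimes>\<^sub>a Id C ?B) \<otimes>\<^sub>a Id C Z) = bx (a, c, f) ?Z \<cdot> un (Tn a b) Z" .
  have "bx (Tn a b, Tn c b, f \<otimes>\<^sub>a Id C (ob b)) Z = (un (Tn c b) Z \<cdot> ((f \<otimes>\<^sub>a Id C ?B) \<otimes>\<^sub>a Id C Z)) \<cdot> nu (Tn a b) Z"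
    unfolding bx_def prod.case by (rule Comp_assoc_Arr[symmetric]) (use assms in simp_all)
  also have "\<dots> = bx (a, c, f) ?Z \<cdot> (un (Tn a b) Z \<cdot> nu (Tn a b) Z)"
    unfolding e by (rule Comp_assoc_Arr) (use assms in simp_all)
  also have "un (Tn a b) Z \<cdot> nu (Tn a b) Z = Id C (nest (lv (Tn a b)) Z)"
    using assms by (subst is_iso_Inv(5)) simp_all
  finally show ?thesis using assms by simp
qed

lemma bx_Id_Tar:
  assumes "objs (lv a)" "wb (b, d, g)" "Z \<in> Obj C"
  shows "bx (Tn a b, Tn a d, Id C (ob a) \<otimes>\<^sub>a g) Z = lift (lv a) (bx (b, d, g) Z)"
proof -
  let ?A = "ob a" and ?B = "ob b" and ?D = "ob d"
  have "un (Tn a d) Z \<cdot> ((Id C ?A \<otimes>\<^sub>a g) \<otimes>\<^sub>a Id C Z)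
     = un a (nest (lv d) Z) \<cdot> ((Id C ?A \<otimes>\<^sub>a un d Z) \<cdot> ((Id C ?A \<otimes>\<^sub>a (g \<otimes>\<^sub>a Id C Z)) \<cdot> Asc C ?A ?B Z))"
    using assms Asc_nat_Arr[of "Id C ?A" g "Id C Z"] by (simp add: un.simps(3))
  also have "\<dots> = un a (nest (lv d) Z) \<cdot> ((Id C ?A \<otimes>\<^sub>a (un d Z \<cdot> ((g \<otimes>\<^sub>a Id C Z) \<cdot> (nu b Z \<cdot> un b Z)))) \<cdot> Asc C ?A ?B Z)"
    using assms by (simp add: Tar_Comp_assoc)
  also have "\<dots> = un a (nest (lv d) Z) \<cdot> ((Id C ?A \<otimes>\<^sub>a bx (b, d, g) Z) \<cdot> ((Id C ?A \<otimes>\<^sub>a un b Z) \<cdot> Asc C ?A ?B Z))"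
    using assms by (simp add: bx_def Tar_Comp_assoc del: is_iso_Inv(4))
  also have "\<dots> = lift (lv a) (bx (b, d, g) Z) \<cdot> un (Tn a b) Z"
    using assms un_nat[of a "bx (b, d, g) Z"] by (simp flip: Comp_assoc_Arr add: un.simps(3))
  finally have e: "un (Tn a d) Z \<cdot> ((Id C ?A \<otimes>\<^sub>a g) \<otimes>\<^sub>a Id C Z) = lift (lv a) (bx (b, d, g) Z) \<cdot> un (Tn a b) Z" .
  have "bx (Tn a b, Tn a d, Id C ?A \<otimes>\<^sub>a g) Z = (un (Tn a d) Z \<cdot> ((Id C ?A \<otimes>\<^sub>a g) \<otimes>\<^sub>a Id C Z)) \<cdot> nu (Tn a b) Z"
    unfolding bx_def prod.case by (rule Comp_assoc_Arr[symmetric]) (use assms in simp_all)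
  also have "\<dots> = lift (lv a) (bx (b, d, g) Z) \<cdot> (un (Tn a b) Z \<cdot> nu (Tn a b) Z)"
    unfolding e by (rule Comp_assoc_Arr) (use assms in simp_all)
  also have "un (Tn a b) Z \<cdot> nu (Tn a b) Z = Id C (nest (lv (Tn a b)) Z)"
    using assms by (subst is_iso_Inv(5)) simp_all
  finally show ?thesis using assms by simp
qed

text \<open>Two ways of unfolding agree: \<open>t\<close> against the tail \<open>R\<close> and then
  the whole list against \<open>Z\<close>, or \<open>t\<close> and \<open>R\<close> separately
  against \<open>Z\<close>. The case of a product is the pentagon.\<close>

lemma un_rt_un:
  assumes "objs (lv t)" "objs R" "Z \<in> Obj C"
  shows "un (rt (lv t @ R)) Z \<cdot> (un t (nest R \<bbbI>) \<otimes>\<^sub>a Id C Z)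
    = un t (nest R Z) \<cdot> ((Id C (ob t) \<otimes>\<^sub>a un (rt R) Z) \<cdot> Asc C (ob t) (nest R \<bbbI>) Z)"
  using assms
proof (induction t arbitrary: R)
  case Ut
  then show ?case
    using Lun_nat[of "un (rt R) Z"] by (simp flip: Comp_assoc_Arr add: un.simps(3)) (simp add: Lun_Asc)
next
  case (Tn a b)
  let ?A = "ob a" and ?B = "ob b" and ?N = "nest R \<bbbI>"
  have "un (rt (lv (Tn a b) @ R)) Z \<cdot> (un (Tn a b) ?N \<otimes>\<^sub>a Id C Z)
    = (un (rt (lv a @ (lv b @ R))) Z \<cdot> (un a (nest (lv b @ R) \<bbbI>) \<otimes>\<^sub>a Id C Z)) \<cdot>
       (((Id C ?A \<otimes>\<^sub>a un b ?N) \<otimes>\<^sub>a Id C Z) \<cdot> (Asc C ?A ?B ?N \<otimes>\<^sub>a Id C Z))"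
    using Tn.prems by (simp add: whisk_right un.simps(3))
  also have "\<dots> = un a (nest (lv b @ R) Z) \<cdot> ((Id C ?A \<otimes>\<^sub>a un (rt (lv b @ R)) Z) \<cdot>
      (Asc C ?A (nest (lv b @ R) \<bbbI>) Z \<cdot> (((Id C ?A \<otimes>\<^sub>a un b ?N) \<otimes>\<^sub>a Id C Z) \<cdot> (Asc C ?A ?B ?N \<otimes>\<^sub>a Id C Z))))"
    using Tn.prems by (subst Tn.IH(1)) simp_all
  also have "Asc C ?A (nest (lv b @ R) \<bbbI>) Z \<cdot> (((Id C ?A \<otimes>\<^sub>a un b ?N) \<otimes>\<^sub>a Id C Z) \<cdot> (Asc C ?A ?B ?N \<otimes>\<^sub>a Id C Z))
     = (Id C ?A \<otimes>\<^sub>a (un b ?N \<otimes>\<^sub>a Id C Z)) \<cdot> (Asc C ?A (?B \<otimes>\<^sub>o ?N) Z \<cdot> (Asc C ?A ?B ?N \<otimes>\<^sub>a Id C Z))"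
    using Tn.prems Asc_nat_Arr[of "Id C ?A" "un b ?N" "Id C Z"] by (simp flip: Comp_assoc_Arr)
  also have "(Id C ?A \<otimes>\<^sub>a un (rt (lv b @ R)) Z) \<cdot> \<dots>
     = (Id C ?A \<otimes>\<^sub>a un b (nest R Z)) \<cdot> ((Id C ?A \<otimes>\<^sub>a (Id C ?B \<otimes>\<^sub>a un (rt R) Z)) \<cdot>
       ((Id C ?A \<otimes>\<^sub>a Asc C ?B ?N Z) \<cdot> (Asc C ?A (?B \<otimes>\<^sub>o ?N) Z \<cdot> (Asc C ?A ?B ?N \<otimes>\<^sub>a Id C Z))))"
    using Tn.prems by (simp add: Tar_Comp_assoc Tn.IH(2))
  also have "(Id C ?A \<otimes>\<^sub>a Asc C ?B ?N Z) \<cdot> (Asc C ?A (?B \<otimes>\<^sub>o ?N) Z \<cdot> (Asc C ?A ?B ?N \<otimes>\<^sub>a Id C Z))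
     = Asc C ?A ?B (?N \<otimes>\<^sub>o Z) \<cdot> Asc C (?A \<otimes>\<^sub>o ?B) ?N Z"
    using Tn.prems by (simp add: pentagon)
  also have "(Id C ?A \<otimes>\<^sub>a (Id C ?B \<otimes>\<^sub>a un (rt R) Z)) \<cdot> \<dots>
     = Asc C ?A ?B (nest R Z) \<cdot> ((Id C (?A \<otimes>\<^sub>o ?B) \<otimes>\<^sub>a un (rt R) Z) \<cdot> Asc C (?A \<otimes>\<^sub>o ?B) ?N Z)"
    using Tn.prems Asc_nat_Arr[of "Id C ?A" "Id C ?B" "un (rt R) Z"] by (simp flip: Comp_assoc_Arr)
  finally show ?case using Tn.prems by (simp add: un.simps(3))
qed (auto simp: un.simps(3))

text \<open>A box acts at a tensor context in the same way whether the trailing factors are part of the context or of \<open>Z\<close>.\<close>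

lemma bx_rt:
  assumes "wb b" "objs P" "objs R" "Z \<in> Obj C"
  shows "bx (rt (P @ ins b @ R), rt (P @ outs b @ R), lift P (bx b (nest R \<bbbI>))) Z = lift P (bx b (nest R Z))"
  using assms(2)
proof (induction P)
  case Nil
  obtain t t' f where b: "b = (t, t', f)" by (cases b)
  let ?N = "nest R \<bbbI>" and ?M = "nest R Z"
  have nu: "((Id C (ob t) \<otimes>\<^sub>a un (rt R) Z) \<cdot> (Asc C (ob t) ?N Z \<cdot> (nu t ?N \<otimes>\<^sub>a Id C Z)))
      = nu t ?M \<cdot> un (rt (lv t @ R)) Z"
  proof (rule iso_cancel_left[of "un t ?M"])
    have "un t ?M \<cdot> ((Id C (ob t) \<otimes>\<^sub>a un (rt R) Z) \<cdot> (Asc C (ob t) ?N Z \<cdot> (nu t ?N \<otimes>\<^sub>a Id C Z)))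
       = (un (rt (lv t @ R)) Z \<cdot> (un t ?N \<otimes>\<^sub>a Id C Z)) \<cdot> (nu t ?N \<otimes>\<^sub>a Id C Z)"
      unfolding un_rt_un[of t R Z, OF _ assms(3,4)] using assms b by (subst un_rt_un) simp_all
    then show "un t ?M \<cdot> ((Id C (ob t) \<otimes>\<^sub>a un (rt R) Z) \<cdot> (Asc C (ob t) ?N Z \<cdot> (nu t ?N \<otimes>\<^sub>a Id C Z)))
      = un t ?M \<cdot> (nu t ?M \<cdot> un (rt (lv t @ R)) Z)"
      using assms b by (simp add: Tar_Comp_Arr)
  qed (use assms b in simp_all)
  have "un (rt (lv t' @ R)) Z \<cdot> (bx b ?N \<otimes>\<^sub>a Id C Z)
     = (un (rt (lv t' @ R)) Z \<cdot> (un t' ?N \<otimes>\<^sub>a Id C Z)) \<cdot> (((f \<otimes>\<^sub>a Id C ?N) \<otimes>\<^sub>a Id C Z) \<cdot> (nu t ?N \<otimes>\<^sub>a Id C Z))"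
    using assms b by (simp add: bx_def whisk_right)
  also have "\<dots> = un t' ?M \<cdot> ((Id C (ob t') \<otimes>\<^sub>a un (rt R) Z) \<cdot> (Asc C (ob t') ?N Z \<cdot>
       (((f \<otimes>\<^sub>a Id C ?N) \<otimes>\<^sub>a Id C Z) \<cdot> (nu t ?N \<otimes>\<^sub>a Id C Z))))"
    using assms b by (subst un_rt_un) simp_all
  also have "Asc C (ob t') ?N Z \<cdot> (((f \<otimes>\<^sub>a Id C ?N) \<otimes>\<^sub>a Id C Z) \<cdot> (nu t ?N \<otimes>\<^sub>a Id C Z))
     = (f \<otimes>\<^sub>a Id C (?N \<otimes>\<^sub>o Z)) \<cdot> (Asc C (ob t) ?N Z \<cdot> (nu t ?N \<otimes>\<^sub>a Id C Z))"
    using assms b Asc_nat_Arr[of f "Id C ?N" "Id C Z"] by (simp flip: Comp_assoc_Arr)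
  also have "(Id C (ob t') \<otimes>\<^sub>a un (rt R) Z) \<cdot> \<dots>
     = (f \<otimes>\<^sub>a Id C ?M) \<cdot> ((Id C (ob t) \<otimes>\<^sub>a un (rt R) Z) \<cdot> (Asc C (ob t) ?N Z \<cdot> (nu t ?N \<otimes>\<^sub>a Id C Z)))"
    using assms b by (simp add: Tar_Comp_assoc)
  finally have "un (rt (lv t' @ R)) Z \<cdot> (bx b ?N \<otimes>\<^sub>a Id C Z) = bx b ?M \<cdot> un (rt (lv t @ R)) Z"
    unfolding nu using assms b by (simp add: bx_def)
  then have "bx (rt (ins b @ R), rt (outs b @ R), bx b ?N) Z = (bx b ?M \<cdot> un (rt (lv t @ R)) Z) \<cdot> nu (rt (lv t @ R)) Z"
    using assms b by (subst bx_def) (simp flip: Comp_assoc_Arr)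
  then show ?case using assms b by simp
next
  case (Cons X P)
  have "bx (rt ((X # P) @ ins b @ R), rt ((X # P) @ outs b @ R), lift (X # P) (bx b (nest R \<bbbI>))) Z
     = bx (Tn (Lf X) (rt (P @ ins b @ R)), Tn (Lf X) (rt (P @ outs b @ R)), Id C (ob (Lf X)) \<otimes>\<^sub>a lift P (bx b (nest R \<bbbI>))) Z"
    by simp
  also have "\<dots> = lift [X] (bx (rt (P @ ins b @ R), rt (P @ outs b @ R), lift P (bx b (nest R \<bbbI>))) Z)"
    using Cons.prems assms by (subst bx_Id_Tar) simp_all
  finally show ?case using Cons by simp
qed

end

text \<open>A diagram is recorded as a program, a list of boxes with their positions. Shifting the
  positions places the diagram to the right of \<open>k\<close> additional strands.\<close>

definition sh :: "nat \<Rightarrow> (nat \<times> 'b) list \<Rightarrow> (nat \<times> 'b) list" where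
  "sh k p = map (\<lambda>(j, b). (k + j, b)) p"

lemma sh_simps [simp]: "sh k [] = []" "sh k ((j, b) # p) = (k + j, b) # sh k p"
  by (simp_all add: sh_def)

section \<open>States, programs and local rewriting\<close>

context ACU_tensor_cat
begin

text \<open>Only the codomain is tied to the list of strands; the domain is free and is kept by
  every box, see \<open>Dom_ap\<close>.\<close>

definition vs :: "'a list \<times> 'b \<Rightarrow> bool" where
  "vs s \<longleftrightarrow> objs (fst s) \<and> snd s \<in> Arr C \<and> Cod C (snd s) = nest (fst s) \<bbbI>"

definition start :: "'a list \<Rightarrow> 'a list \<times> 'b" where
  "start xs = (xs, Id C (nest xs \<bbbI>))"

definition ap :: "nat \<Rightarrow> ('a, 'b) box \<Rightarrow> 'a list \<times> 'b \<Rightarrow> 'a list \<times> 'b" where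
  "ap k b s = (res k b (fst s),
     lift (take k (fst s)) (bx b (nest (drop (k + length (ins b)) (fst s)) \<bbbI>)) \<cdot> snd s)"

definition sscl :: "rat \<Rightarrow> 'a list \<times> 'b \<Rightarrow> 'a list \<times> 'b" where
  "sscl q s = (fst s, Scl C q (snd s))"

lemma fst_ap [simp]: "fst (ap k b s) = res k b (fst s)"
  by (simp add: ap_def)

lemma fst_start [simp]: "fst (start xs) = xs"
  by (simp add: start_def)

lemma vs_start [simp]: "vs (start xs) \<longleftrightarrow> objs xs"
  by (auto simp: vs_def start_def)

lemma snd_start [simp]: "snd (start xs) = Id C (nest xs \<bbbI>)"
  by (simp add: start_def)

lemma objs_res [simp]: "objs xs \<Longrightarrow> wb b \<Longrightarrow> objs (res k b xs)"
  using wb_objs(2)[of b] by (auto simp: res_def dest: in_set_takeD in_set_dropD)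

lemma ap_append:
  assumes "length P = k"
  shows "ap k b (P @ ins b @ R, u) = (P @ outs b @ R, lift P (bx b (nest R \<bbbI>)) \<cdot> u)"
  using assms by (simp add: ap_def)

lemma ap_append2:
  assumes "length P = k" "xs = ins b"
  shows "ap k b (P @ xs @ R, u) = (P @ outs b @ R, lift P (bx b (nest R \<bbbI>)) \<cdot> u)"
  using assms ap_append by simp

lemma fitsE:
  assumes "vs s" "fits k b (fst s)"
  obtains P R u where "s = (P @ ins b @ R, u)" "length P = k" "objs P" "objs R" "u \<in> Arr C"
    "Cod C u = nest (P @ ins b @ R) \<bbbI>"
  using assms by (cases s) (auto simp: fits_iff vs_def)

lemma vs_ap [simp]:
  assumes "wb b" "fits k b (fst s)" "vs s"
  shows "vs (ap k b s)"
  using assms(3,2)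
proof (rule fitsE)
  fix P R u assume "s = (P @ ins b @ R, u)" "length P = k" "objs P" "objs R" "u \<in> Arr C"
    "Cod C u = nest (P @ ins b @ R) \<bbbI>"
  then show ?thesis using assms(1) wb_objs[OF assms(1)] by (simp add: ap_append vs_def)
qed

lemma Dom_ap:
  assumes "wb b" "fits k b (fst s)" "vs s"
  shows "Dom C (snd (ap k b s)) = Dom C (snd s)"
  using assms(3,2)
proof (rule fitsE)
  fix P R u assume "s = (P @ ins b @ R, u)" "length P = k" "objs P" "objs R" "u \<in> Arr C"
    "Cod C u = nest (P @ ins b @ R) \<bbbI>"
  then show ?thesis using assms(1) wb_objs[OF assms(1)] by (simp add: ap_append)
qed

lemma ap_sscl:
  assumes "wb b" "fits k b (fst s)" "vs s"
  shows "ap k b (sscl q s) = sscl q (ap k b s)"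
  using assms(3,2)
proof (rule fitsE)
  fix P R u assume "s = (P @ ins b @ R, u)" "length P = k" "objs P" "objs R" "u \<in> Arr C"
    "Cod C u = nest (P @ ins b @ R) \<bbbI>"
  then show ?thesis using assms(1) by (simp add: ap_append sscl_def)
qed

lemma sscl_sscl [simp]: "vs s \<Longrightarrow> sscl p (sscl q s) = sscl (p * q) s"
  by (simp add: sscl_def vs_def)

lemma sscl_1 [simp]: "vs s \<Longrightarrow> sscl 1 s = s"
  by (simp add: sscl_def vs_def)

text \<open>Interchange law, obtained from \<open>bx_nat\<close> with the whiskered box
  \<open>g\<close> as morphism in the tail of \<open>f\<close>. Applying \<open>f\<close> first
  changes the number of strands to the left of \<open>g\<close>; the subtraction does not truncate
  because \<open>l\<close> is at least \<open>length (ins f)\<close>.\<close>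

lemma comm:
  assumes "wb f" "wb g" "vs s" "fits k f (fst s)" "fits l g (fst s)" "k + length (ins f) \<le> l"
  shows "ap k f (ap l g s) = ap (l + length (outs f) - length (ins f)) g (ap k f s)"
proof -
  obtain P T u where s: "s = (P @ ins f @ T, u)" "length P = k" "objs P" "objs T" "u \<in> Arr C"
    "Cod C u = nest (P @ ins f @ T) \<bbbI>"
    using fitsE[OF assms(3,4)] by metis
  define n where "n = l - (k + length (ins f))"
  have l: "l = length (P @ ins f) + n" using assms(6) s(2) by (simp add: n_def)
  have "n \<le> length T" "take (length (ins g)) (drop n T) = ins g"
    using assms(5) s(1) l by (simp_all add: fits_def)
  then have "fits n g T" by (simp add: fits_def)
  then obtain M R where T: "T = M @ ins g @ R" "length M = n" by (auto simp: fits_iff)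
  have o: "objs M" "objs R" using s(4) T by auto
  have 1: "ap l g s = (P @ ins f @ M @ outs g @ R, lift (P @ ins f @ M) (bx g (nest R \<bbbI>)) \<cdot> u)"
    using ap_append[of "P @ ins f @ M" l g R u] s l T by simp
  have 2: "ap k f s = (P @ outs f @ M @ ins g @ R, lift P (bx f (nest (M @ ins g @ R) \<bbbI>)) \<cdot> u)"
    using ap_append[of P k f "M @ ins g @ R" u] s T by simp
  have "lift P (bx f (nest (M @ outs g @ R) \<bbbI>)) \<cdot> lift (P @ ins f @ M) (bx g (nest R \<bbbI>))
      = lift P (bx f (Cod C (lift M (bx g (nest R \<bbbI>)))) \<cdot> lift (ins f) (lift M (bx g (nest R \<bbbI>))))"
    using assms s o by (subst lift_Comp) simp_all
  also have "\<dots> = lift P (lift (outs f) (lift M (bx g (nest R \<bbbI>))) \<cdot> bx f (nest (M @ ins g @ R) \<bbbI>))"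
    using assms s o by (subst bx_nat) simp_all
  also have "\<dots> = lift (P @ outs f @ M) (bx g (nest R \<bbbI>)) \<cdot> lift P (bx f (nest (M @ ins g @ R) \<bbbI>))"
    using assms s o by (subst lift_Comp) simp_all
  finally have 3: "lift P (bx f (nest (M @ outs g @ R) \<bbbI>)) \<cdot> (lift (P @ ins f @ M) (bx g (nest R \<bbbI>)) \<cdot> u)
     = lift (P @ outs f @ M) (bx g (nest R \<bbbI>)) \<cdot> (lift P (bx f (nest (M @ ins g @ R) \<bbbI>)) \<cdot> u)"
    using assms s T o by (intro Comp_cong_assoc) simp_all
  have l': "l + length (outs f) - length (ins f) = length (P @ outs f @ M)"
    using l s T by simp
  show ?thesis
    unfolding 1 2 l' using ap_append[of P k f "M @ outs g @ R"] ap_append[of "P @ outs f @ M" _ g R] 3 s(2) by simp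
qed

lemma ap_Comp:
  assumes "wb (t1, t2, f)" "wb (t2, t3, g)" "vs s" "fits k (t1, t2, f) (fst s)"
  shows "ap k (t1, t3, g \<cdot> f) s = ap k (t2, t3, g) (ap k (t1, t2, f) s)"
  using assms(3,4)
proof (rule fitsE)
  fix P R u assume "s = (P @ ins (t1, t2, f) @ R, u)" "length P = k" "objs P" "objs R" "u \<in> Arr C"
    "Cod C u = nest (P @ ins (t1, t2, f) @ R) \<bbbI>"
  then show ?thesis using assms(1,2) by (simp add: ap_append2 bx_Comp[of t1 t2 f t3 g] lift_Comp)
qed

lemma ap_trivial:
  assumes "\<And>Z. Z \<in> Obj C \<Longrightarrow> bx (t, t', f) Z = Id C (nest (lv t) Z)" "lv t = lv t'" "vs s" "fits k (t, t', f) (fst s)"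
  shows "ap k (t, t', f) s = s"
  using assms(3,4)
proof (rule fitsE)
  fix P R u assume a: "s = (P @ ins (t, t', f) @ R, u)" "length P = k" "objs P" "objs R" "u \<in> Arr C"
    "Cod C u = nest (P @ ins (t, t', f) @ R) \<bbbI>"
  then show ?thesis using assms by (simp add: ap_append2 vs_def)
qed

lemma ap_Id [simp]: "vs s \<Longrightarrow> fits k (t, t, Id C (ob t)) (fst s) \<Longrightarrow> objs (lv t) \<Longrightarrow> ap k (t, t, Id C (ob t)) s = s"
  by (rule ap_trivial) (simp_all add: bx_Id)

lemma ap_Asc [simp]:
  assumes "objs (lv a)" "objs (lv b)" "objs (lv c)" "vs s"
  shows "fits k (Tn (Tn a b) c, Tn a (Tn b c), f) (fst s) \<Longrightarrow> f = Asc C (ob a) (ob b) (ob c) \<Longrightarrow>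
      ap k (Tn (Tn a b) c, Tn a (Tn b c), f) s = s"
    "fits k (Tn a (Tn b c), Tn (Tn a b) c, f) (fst s) \<Longrightarrow> f = Inv C (Asc C (ob a) (ob b) (ob c)) \<Longrightarrow>
      ap k (Tn a (Tn b c), Tn (Tn a b) c, f) s = s"
proof -
  have 1: "\<And>Z. Z \<in> Obj C \<Longrightarrow> bx (Tn (Tn a b) c, Tn a (Tn b c), Asc C (ob a) (ob b) (ob c)) Z = Id C (nest (lv (Tn (Tn a b) c)) Z)"
    using assms by (simp add: bx_Asc)
  then have 2: "\<And>Z. Z \<in> Obj C \<Longrightarrow> bx (Tn a (Tn b c), Tn (Tn a b) c, Inv C (Asc C (ob a) (ob b) (ob c))) Z
      = Id C (nest (lv (Tn a (Tn b c))) Z)"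
    using assms by (intro bx_Inv) simp_all
  show "fits k (Tn (Tn a b) c, Tn a (Tn b c), f) (fst s) \<Longrightarrow> f = Asc C (ob a) (ob b) (ob c) \<Longrightarrow>
      ap k (Tn (Tn a b) c, Tn a (Tn b c), f) s = s"
    using assms(4) by (elim ssubst, intro ap_trivial[OF 1]) (simp_all add: fits_def)
  show "fits k (Tn a (Tn b c), Tn (Tn a b) c, f) (fst s) \<Longrightarrow> f = Inv C (Asc C (ob a) (ob b) (ob c)) \<Longrightarrow>
      ap k (Tn a (Tn b c), Tn (Tn a b) c, f) s = s"
    using assms(4) by (elim ssubst, intro ap_trivial[OF 2]) (simp_all add: fits_def)
qed

lemma ap_Lun [simp]:
  assumes "objs (lv a)" "vs s"
  shows "fits k (Tn Ut a, a, f) (fst s) \<Longrightarrow> f = Lun C (ob a) \<Longrightarrow> ap k (Tn Ut a, a, f) s = s"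
    "fits k (a, Tn Ut a, f) (fst s) \<Longrightarrow> f = Inv C (Lun C (ob a)) \<Longrightarrow> ap k (a, Tn Ut a, f) s = s"
proof -
  have 1: "\<And>Z. Z \<in> Obj C \<Longrightarrow> bx (Tn Ut a, a, Lun C (ob a)) Z = Id C (nest (lv (Tn Ut a)) Z)"
    using assms by (simp add: bx_Lun)
  then have 2: "\<And>Z. Z \<in> Obj C \<Longrightarrow> bx (a, Tn Ut a, Inv C (Lun C (ob a))) Z = Id C (nest (lv a) Z)"
    using assms by (intro bx_Inv) simp_all
  show "fits k (Tn Ut a, a, f) (fst s) \<Longrightarrow> f = Lun C (ob a) \<Longrightarrow> ap k (Tn Ut a, a, f) s = s"
    using assms(2) by (elim ssubst, intro ap_trivial[OF 1]) (simp_all add: fits_def)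
  show "fits k (a, Tn Ut a, f) (fst s) \<Longrightarrow> f = Inv C (Lun C (ob a)) \<Longrightarrow> ap k (a, Tn Ut a, f) s = s"
    using assms(2) by (elim ssubst, intro ap_trivial[OF 2]) (simp_all add: fits_def)
qed

lemma ap_Run [simp]:
  assumes "objs (lv a)" "vs s"
  shows "fits k (Tn a Ut, a, f) (fst s) \<Longrightarrow> f = Run C (ob a) \<Longrightarrow> ap k (Tn a Ut, a, f) s = s"
    "fits k (a, Tn a Ut, f) (fst s) \<Longrightarrow> f = Inv C (Run C (ob a)) \<Longrightarrow> ap k (a, Tn a Ut, f) s = s"
proof -
  have 1: "\<And>Z. Z \<in> Obj C \<Longrightarrow> bx (Tn a Ut, a, Run C (ob a)) Z = Id C (nest (lv (Tn a Ut)) Z)"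
    using assms by (simp add: bx_Run)
  then have 2: "\<And>Z. Z \<in> Obj C \<Longrightarrow> bx (a, Tn a Ut, Inv C (Run C (ob a))) Z = Id C (nest (lv a) Z)"
    using assms by (intro bx_Inv) simp_all
  show "fits k (Tn a Ut, a, f) (fst s) \<Longrightarrow> f = Run C (ob a) \<Longrightarrow> ap k (Tn a Ut, a, f) s = s"
    using assms(2) by (elim ssubst, intro ap_trivial[OF 1]) (simp_all add: fits_def)
  show "fits k (a, Tn a Ut, f) (fst s) \<Longrightarrow> f = Inv C (Run C (ob a)) \<Longrightarrow> ap k (a, Tn a Ut, f) s = s"
    using assms(2) by (elim ssubst, intro ap_trivial[OF 2]) (simp_all add: fits_def)
qed

text \<open>Factoring \<open>f \<otimes>\<^sub>a g\<close> with \<open>g\<close> applied first keeps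
  the position of \<open>g\<close> independent of the number of outputs of \<open>f\<close>.\<close>

lemma ap_Tar:
  assumes "wb (a, c, f)" "wb (b, d, g)" "vs s" "fits k (Tn a b, Tn c d, f \<otimes>\<^sub>a g) (fst s)"
  shows "ap k (Tn a b, Tn c d, f \<otimes>\<^sub>a g) s = ap k (a, c, f) (ap (k + length (lv a)) (b, d, g) s)"
  using assms(3,4)
proof (rule fitsE)
  fix P R u assume "s = (P @ ins (Tn a b, Tn c d, f \<otimes>\<^sub>a g) @ R, u)" and k: "length P = k" and o: "objs P" "objs R"
    and u: "u \<in> Arr C" "Cod C u = nest (P @ ins (Tn a b, Tn c d, f \<otimes>\<^sub>a g) @ R) \<bbbI>"
  then have s: "s = (P @ lv a @ lv b @ R, u)" by simp
  have 1: "ap (k + length (lv a)) (b, d, g) s = (P @ lv a @ lv d @ R, lift P (lift (lv a) (bx (b, d, g) (nest R \<bbbI>))) \<cdot> u)"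
    using s k ap_append2[of "P @ lv a" "k + length (lv a)" "lv b" "(b, d, g)" R u] by simp
  have 2: "ap k (Tn a b, Tn c d, f \<otimes>\<^sub>a g) s = (P @ (lv c @ lv d) @ R, lift P (bx (Tn a b, Tn c d, f \<otimes>\<^sub>a g) (nest R \<bbbI>)) \<cdot> u)"
    using s k ap_append2[of P k "lv a @ lv b" "(Tn a b, Tn c d, f \<otimes>\<^sub>a g)" R u] by simp
  have 3: "f \<otimes>\<^sub>a g = (f \<otimes>\<^sub>a Id C (ob d)) \<cdot> (Id C (ob a) \<otimes>\<^sub>a g)"
    using assms by (simp add: Tar_Comp_Arr)
  have "bx (Tn a b, Tn c d, f \<otimes>\<^sub>a g) (nest R \<bbbI>)
      = bx (Tn a d, Tn c d, f \<otimes>\<^sub>a Id C (ob d)) (nest R \<bbbI>) \<cdot> bx (Tn a b, Tn a d, Id C (ob a) \<otimes>\<^sub>a g) (nest R \<bbbI>)"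
    using assms o unfolding 3 by (subst bx_Comp[of _ "Tn a d"]) simp_all
  also have "\<dots> = bx (a, c, f) (nest (lv d) (nest R \<bbbI>)) \<cdot> lift (lv a) (bx (b, d, g) (nest R \<bbbI>))"
    using assms o by (simp add: bx_Id_Tar bx_Tar_Id)
  finally show ?thesis
    unfolding 1 2 using k o u assms(1,2) ap_append2[of P k "lv a" "(a, c, f)" "lv d @ R"] by (simp add: lift_Comp)
qed

lemma ap_Scl:
  assumes "wb (t, t', f)" "vs s" "fits k (t, t', f) (fst s)"
  shows "ap k (t, t', Scl C q f) s = sscl q (ap k (t, t', f) s)"
  using assms(2,3)
proof (rule fitsE)
  fix P R u assume "s = (P @ ins (t, t', f) @ R, u)" "length P = k" "objs P" "objs R" "u \<in> Arr C"
    "Cod C u = nest (P @ ins (t, t', f) @ R) \<bbbI>"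
  then show ?thesis using assms(1) by (simp add: ap_append2 bx_def lift_Scl sscl_def)
qed

primrec run :: "(nat \<times> ('a, 'b) box) list \<Rightarrow> 'a list \<times> 'b \<Rightarrow> 'a list \<times> 'b" where
  "run [] s = s"
| "run (x # p) s = run p (ap (fst x) (snd x) s)"

primrec wfp :: "(nat \<times> ('a, 'b) box) list \<Rightarrow> 'a list \<Rightarrow> bool" where
  "wfp [] xs = True"
| "wfp (x # p) xs = (wb (snd x) \<and> fits (fst x) (snd x) xs \<and> wfp p (res (fst x) (snd x) xs))"

lemma vs_run: "wfp p (fst s) \<Longrightarrow> vs s \<Longrightarrow> vs (run p s)"
  by (induction p arbitrary: s) auto

lemma Dom_run: "wfp p (fst s) \<Longrightarrow> vs s \<Longrightarrow> Dom C (snd (run p s)) = Dom C (snd s)"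
  by (induction p arbitrary: s) (simp_all add: Dom_ap)

lemma ap_start:
  assumes "wb b" "fits k b (fst s)" "vs s"
  shows "ap k b s = (fst (ap k b (start (fst s))), snd (ap k b (start (fst s))) \<cdot> snd s)"
proof -
  obtain P R u where s: "s = (P @ ins b @ R, u)" "length P = k" "objs P" "objs R" "u \<in> Arr C"
    "Cod C u = nest (P @ ins b @ R) \<bbbI>"
    using fitsE[OF assms(3,2)] by metis
  then show ?thesis using assms(1) by (simp add: ap_append start_def)
qed

text \<open>Every box composes on the left, so a program run on any state is the program run on the
  identity diagram, followed by one composition.\<close>

lemma run_start:
  assumes "wfp p (fst s)" "vs s"
  shows "run p s = (fst (run p (start (fst s))), snd (run p (start (fst s))) \<cdot> snd s)"
  using assms
proof (induction p arbitrary: s)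
  case Nil
  then show ?case by (cases s) (simp add: start_def vs_def)
next
  case (Cons x p)
  let ?xs = "fst s" let ?s' = "ap (fst x) (snd x) s" let ?t = "ap (fst x) (snd x) (start ?xs)"
  let ?r = "run p (start (fst ?s'))"
  have o: "objs ?xs" using Cons.prems by (simp add: vs_def)
  have v: "vs ?s'" "vs ?t" "vs (start (fst ?s'))" using Cons.prems o by simp_all
  then have v': "vs ?r" using Cons.prems by (intro vs_run) simp_all
  have d: "Dom C (snd ?r) = nest (fst ?s') \<bbbI>"
    using Dom_run[of p "start (fst ?s')"] Cons.prems v by (simp add: vs_def)
  have "run (x # p) s = (fst ?r, snd ?r \<cdot> snd ?s')"
    using Cons.IH[of ?s'] Cons.prems v by simp
  also have "snd ?s' = snd ?t \<cdot> snd s"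
    using ap_start[of "snd x" "fst x" s] Cons.prems by simp
  also have "snd ?r \<cdot> (snd ?t \<cdot> snd s) = (snd ?r \<cdot> snd ?t) \<cdot> snd s"
  proof (rule Comp_assoc_Arr[symmetric])
    have e: "?s' = (fst ?t, snd ?t \<cdot> snd s)" using ap_start[of "snd x" "fst x" s] Cons.prems by simp
    show "snd s \<in> Arr C" "snd ?t \<in> Arr C" "snd ?r \<in> Arr C" using v v' Cons.prems by (simp_all add: vs_def)
    show "Cod C (snd ?t) = Dom C (snd ?r)" using d v by (simp add: vs_def)
    have "Dom C (snd ?t) = nest ?xs \<bbbI>"
      using Dom_ap[of "snd x" "fst x" "start ?xs"] Cons.prems o by simp
    then show "Cod C (snd s) = Dom C (snd ?t)" using Cons.prems by (simp add: vs_def)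
  qed
  also have "(fst ?r, (snd ?r \<cdot> snd ?t) \<cdot> snd s) = (fst (run (x # p) (start ?xs)), snd (run (x # p) (start ?xs)) \<cdot> snd s)"
    using Cons.IH[of ?t] Cons.prems v by simp
  finally show ?case .
qed

text \<open>A box inside a block \<open>xs\<close> of strands may be replaced by a compound box on
  the whole block; this is where \<open>bx_rt\<close> is used. Iterated, it collapses a program on a
  block to a single box.\<close>

lemma ap_in_context:
  assumes "vs s" "fst s = P @ xs @ R" "length P = k" "wb b" "fits j b xs"
  shows "ap (k + j) b s = ap k (rt xs, rt (res j b xs), snd (ap j b (start xs))) s"
    "wb (rt xs, rt (res j b xs), snd (ap j b (start xs)))"
proof -
  obtain P' R' where xs: "xs = P' @ ins b @ R'" "length P' = j" using assms by (auto simp: fits_iff)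
  have o: "objs P" "objs P'" "objs R'" "objs R" and u: "snd s \<in> Arr C" "Cod C (snd s) = nest (P @ xs @ R) \<bbbI>"
    using assms xs by (auto simp: vs_def)
  have 1: "snd (ap j b (start xs)) = lift P' (bx b (nest R' \<bbbI>))"
    using xs assms o by (simp add: start_def ap_append)
  have 2: "res j b xs = P' @ outs b @ R'" using xs by simp
  show "wb (rt xs, rt (res j b xs), snd (ap j b (start xs)))"
    unfolding 1 2 using xs o assms by simp
  have s: "s = (P @ xs @ R, snd s)" using assms by (cases s) simp
  have "ap (k + j) b s = ((P @ P') @ outs b @ R' @ R, lift (P @ P') (bx b (nest (R' @ R) \<bbbI>)) \<cdot> snd s)"
    using ap_append[of "P @ P'" "k + j" b "R' @ R" "snd s"] s xs assms by simp
  also have "\<dots> = ap k (rt xs, rt (res j b xs), snd (ap j b (start xs))) s"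
    unfolding 1 2 using ap_append2[of P k xs "(rt xs, rt (P' @ outs b @ R'), lift P' (bx b (nest R' \<bbbI>)))" R "snd s"]
      s xs assms o bx_rt[of b P' R' "nest R \<bbbI>"] by simp
  finally show "ap (k + j) b s = ap k (rt xs, rt (res j b xs), snd (ap j b (start xs))) s" .
qed

lemma run_in_context:
  assumes "vs s" "fst s = P @ xs @ R" "length P = k" "wfp p xs"
  shows "run (sh k p) s = ap k (rt xs, rt (fst (run p (start xs))), snd (run p (start xs))) s"
  using assms
proof (induction p arbitrary: xs s)
  case Nil
  have "ap k (rt xs, rt xs, Id C (nest xs \<bbbI>)) s = s"
    using Nil ap_Id[of s k "rt xs"] by (auto simp: vs_def fits_iff)
  then show ?case by (simp add: start_def)
next
  case (Cons x p)
  obtain j b where x: "x = (j, b)" by (cases x)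
  let ?ys = "res j b xs" and ?t = "ap j b (start xs)"
  have o: "objs xs" using Cons.prems by (auto simp: vs_def)
  have w: "wb b" "fits j b xs" "wfp p ?ys" using Cons.prems x by simp_all
  note c = ap_in_context[OF Cons.prems(1-3) w(1,2)]
  have m: "fits k (rt xs, rt ?ys, snd ?t) (fst s)" using Cons.prems by (auto simp: fits_iff)
  have v: "vs (ap k (rt xs, rt ?ys, snd ?t) s)"
    using Cons.prems c(2) m by (intro vs_ap) auto
  have vt: "vs ?t" using w o by simp
  have r: "run p ?t = (fst (run p (start ?ys)), snd (run p (start ?ys)) \<cdot> snd ?t)"
    using run_start[of p ?t] w vt by simp
  have oy: "objs ?ys" using vt by (simp add: vs_def)
  have vr: "vs (run p (start ?ys))" using w oy by (intro vs_run) simp_all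
  have d: "Dom C (snd (run p (start ?ys))) = nest ?ys \<bbbI>"
    using Dom_run[of p "start ?ys"] w oy by simp
  have "run (sh k (x # p)) s = run (sh k p) (ap k (rt xs, rt ?ys, snd ?t) s)"
    using c x by simp
  also have "\<dots> = ap k (rt ?ys, rt (fst (run p (start ?ys))), snd (run p (start ?ys))) (ap k (rt xs, rt ?ys, snd ?t) s)"
    using Cons.IH[of "ap k (rt xs, rt ?ys, snd ?t) s" ?ys] v w Cons.prems by (simp add: res_def)
  also have "\<dots> = ap k (rt xs, rt (fst (run p (start ?ys))), snd (run p (start ?ys)) \<cdot> snd ?t) s"
    using c(2) Cons.prems(1) m oy d vr by (subst ap_Comp[of _ "rt ?ys"]) (simp_all add: vs_def)
  also have "\<dots> = ap k (rt xs, rt (fst (run (x # p) (start xs))), snd (run (x # p) (start xs))) s"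
    using r x by simp
  finally show ?case .
qed

text \<open>Both programs collapse to the same compound box on the block \<open>xs\<close>. Hence an
  equation of diagrams, once proved on its own strands, may be applied anywhere inside a larger
  diagram; all later local moves rest on this.\<close>

theorem transfer:
  assumes "run p (start xs) = run q (start xs)" "wfp p xs" "wfp q xs"
    "vs s" "k \<le> length (fst s)" "take (length xs) (drop k (fst s)) = xs"
  shows "run (sh k p) s = run (sh k q) s"
proof -
  have "fst s = take k (fst s) @ xs @ drop (length xs) (drop k (fst s))"
    using assms(6) by (metis append_take_drop_id)
  moreover have "length (take k (fst s)) = k" using assms(5) by simp
  ultimately show ?thesis
    using run_in_context[OF assms(4) _ _ assms(2)] run_in_context[OF assms(4) _ _ assms(3)] assms(1) by metis
qed

theorem transfer_sscl:
  assumes "run p (start xs) = sscl c (run q (start xs))" "wfp p xs" "wfp q xs"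
    "vs s" "k \<le> length (fst s)" "take (length xs) (drop k (fst s)) = xs"
  shows "run (sh k p) s = sscl c (run (sh k q) s)"
proof -
  have e: "fst s = take k (fst s) @ xs @ drop (length xs) (drop k (fst s))"
    using assms(6) by (metis append_take_drop_id)
  have l: "length (take k (fst s)) = k" using assms(5) by simp
  let ?r = "run q (start xs)"
  have o: "objs xs" using assms(4) e by (metis Un_subset_iff set_append vs_def)
  have v: "vs ?r" using assms(3) o by (intro vs_run) simp_all
  have "run (sh k p) s = ap k (rt xs, rt (fst ?r), Scl C c (snd ?r)) s"
    using run_in_context[OF assms(4) e l assms(2)] assms(1) by (simp add: sscl_def)
  moreover have "run (sh k q) s = ap k (rt xs, rt (fst ?r), snd ?r) s"
    using run_in_context[OF assms(4) e l assms(3)] .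
  moreover have "Dom C (snd ?r) = nest xs \<bbbI>"
    using Dom_run[of q "start xs"] assms(3) o by simp
  ultimately show ?thesis
    using v o assms ap_Scl[of "rt xs" "rt (fst ?r)" "snd ?r" s k c] by (auto simp: vs_def fits_def)
qed

text \<open>The way back from diagrams to morphisms: conjugation by invertible unfoldings loses
  nothing, and neither does tensoring with the unit object. The trees \<open>t\<close> and
  \<open>t'\<close> may be chosen freely, so a compound object may be drawn as one strand or as
  several.\<close>

theorem faithful:
  assumes "wb (t, t', f)" "wb (t, t', g)" "ap 0 (t, t', f) (start (lv t)) = ap 0 (t, t', g) (start (lv t))"
  shows "f = g"
proof -
  have "un t' \<bbbI> \<cdot> ((f \<otimes>\<^sub>a Id C \<bbbI>) \<cdot> nu t \<bbbI>) = un t' \<bbbI> \<cdot> ((g \<otimes>\<^sub>a Id C \<bbbI>) \<cdot> nu t \<bbbI>)"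
    using assms by (simp add: ap_def start_def bx_def)
  then have "(f \<otimes>\<^sub>a Id C \<bbbI>) \<cdot> nu t \<bbbI> = (g \<otimes>\<^sub>a Id C \<bbbI>) \<cdot> nu t \<bbbI>"
    using assms by (elim iso_cancel_left[rotated -1]) simp_all
  then have "((f \<otimes>\<^sub>a Id C \<bbbI>) \<cdot> nu t \<bbbI>) \<cdot> un t \<bbbI> = ((g \<otimes>\<^sub>a Id C \<bbbI>) \<cdot> nu t \<bbbI>) \<cdot> un t \<bbbI>"
    by simp
  then have "f \<otimes>\<^sub>a Id C \<bbbI> = g \<otimes>\<^sub>a Id C \<bbbI>" using assms by simp
  then show ?thesis using assms by (elim Tar_Unit_right_faithful[rotated -1]) simp_all
qed

section \<open>Crossings, and strands sliding across boxes\<close>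

abbreviation Sw :: "'a \<Rightarrow> 'a \<Rightarrow> ('a, 'b) box" where
  "Sw X Y \<equiv> (Tn (Lf X) (Lf Y), Tn (Lf Y) (Lf X), Sym C X Y)"

abbreviation b20 :: "'a \<Rightarrow> 'a \<Rightarrow> 'b \<Rightarrow> ('a, 'b) box" where
  "b20 X Y e \<equiv> (Tn (Lf X) (Lf Y), Ut, e)"

abbreviation b02 :: "'a \<Rightarrow> 'a \<Rightarrow> 'b \<Rightarrow> ('a, 'b) box" where
  "b02 X Y c \<equiv> (Ut, Tn (Lf X) (Lf Y), c)"

abbreviation b21 :: "'a \<Rightarrow> 'a \<Rightarrow> 'a \<Rightarrow> 'b \<Rightarrow> ('a, 'b) box" where
  "b21 X Y Z m \<equiv> (Tn (Lf X) (Lf Y), Lf Z, m)"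

abbreviation b12 :: "'a \<Rightarrow> 'a \<Rightarrow> 'a \<Rightarrow> 'b \<Rightarrow> ('a, 'b) box" where
  "b12 X Y Z m \<equiv> (Lf X, Tn (Lf Y) (Lf Z), m)"

abbreviation b11 :: "'a \<Rightarrow> 'a \<Rightarrow> 'b \<Rightarrow> ('a, 'b) box" where
  "b11 X Y f \<equiv> (Lf X, Lf Y, f)"

definition pos :: "nat \<Rightarrow> 'a list \<Rightarrow> 'a list \<times> 'b \<Rightarrow> bool" where
  "pos k xs s \<longleftrightarrow> vs s \<and> k \<le> length (fst s) \<and> take (length xs) (drop k (fst s)) = xs"

lemma posE:
  assumes "pos k xs s"
  obtains P R where "vs s" "fst s = P @ xs @ R" "length P = k"
proof
  show "fst s = take k (fst s) @ xs @ drop (length xs) (drop k (fst s))"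
    using assms unfolding pos_def by (metis append_take_drop_id)
qed (use assms in \<open>auto simp: pos_def\<close>)

lemma Sym_Sym_ap:
  assumes "pos k [X, Y] s"
  shows "ap k (Sw Y X) (ap k (Sw X Y) s) = s"
proof -
  obtain P R where s: "vs s" "fst s = P @ [X, Y] @ R" "length P = k" using assms by (rule posE)
  then have o: "X \<in> Obj C" "Y \<in> Obj C" by (auto simp: vs_def)
  have "ap k (Tn (Lf X) (Lf Y), Tn (Lf X) (Lf Y), Sym C Y X \<cdot> Sym C X Y) s = ap k (Sw Y X) (ap k (Sw X Y) s)"
    using s o by (subst ap_Comp) (auto simp: fits_iff)
  moreover have "Sym C Y X \<cdot> Sym C X Y = Id C (ob (Tn (Lf X) (Lf Y)))" using o by (simp add: Sym_Sym)
  ultimately show ?thesis using s o ap_Id[of s k "Tn (Lf X) (Lf Y)"] by (auto simp: fits_iff)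
qed

primrec mvR :: "'a \<Rightarrow> nat \<Rightarrow> 'a list \<Rightarrow> 'a list \<times> 'b \<Rightarrow> 'a list \<times> 'b" where
  "mvR X k [] s = s"
| "mvR X k (y # ys) s = mvR X (Suc k) ys (ap k (Sw X y) s)"

text \<open>The inverse of \<open>mvR\<close>: the strand \<open>X\<close> stands behind
  \<open>ys\<close> and is pulled back to position \<open>k\<close>, so the crossing with the last
  entry of \<open>ys\<close> has to be performed first.\<close>

primrec mvL :: "'a \<Rightarrow> nat \<Rightarrow> 'a list \<Rightarrow> 'a list \<times> 'b \<Rightarrow> 'a list \<times> 'b" where
  "mvL X k [] s = s"
| "mvL X k (y # ys) s = ap k (Sw y X) (mvL X (Suc k) ys s)"

lemma mvR_append: "mvR X k (ys @ zs) s = mvR X (k + length ys) zs (mvR X k ys s)"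
  by (induction ys arbitrary: k s) auto

lemma mvR_wf:
  assumes "vs s" "fst s = P @ (X # ys) @ R" "length P = k"
  shows "vs (mvR X k ys s)" "fst (mvR X k ys s) = P @ (ys @ [X]) @ R"
proof -
  have "vs (mvR X k ys s) \<and> fst (mvR X k ys s) = P @ (ys @ [X]) @ R"
    using assms
  proof (induction ys arbitrary: P k s)
    case (Cons y ys)
    let ?s = "ap k (Sw X y) s"
    have o: "X \<in> Obj C" "y \<in> Obj C" using Cons.prems by (auto simp: vs_def)
    have "vs ?s" using Cons.prems o by (intro vs_ap) (auto simp: fits_iff)
    moreover have "fst ?s = (P @ [y]) @ (X # ys) @ R"
      using Cons.prems res_append[of P k "Sw X y" "ys @ R"] by simp
    ultimately show ?case using Cons.IH[of ?s "P @ [y]" "Suc k"] Cons.prems by simp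
  qed simp
  then show "vs (mvR X k ys s)" "fst (mvR X k ys s) = P @ (ys @ [X]) @ R" by auto
qed

lemma mvL_mvR:
  assumes "vs s" "fst s = P @ (X # ys) @ R" "length P = k"
  shows "mvL X k ys (mvR X k ys s) = s"
  using assms
proof (induction ys arbitrary: P k s)
  case (Cons y ys)
  let ?s = "ap k (Sw X y) s"
  have o: "X \<in> Obj C" "y \<in> Obj C" using Cons.prems by (auto simp: vs_def)
  have "vs ?s" using Cons.prems o by (intro vs_ap) (auto simp: fits_iff)
  moreover have "fst ?s = (P @ [y]) @ (X # ys) @ R"
    using Cons.prems res_append[of P k "Sw X y" "ys @ R"] by simp
  ultimately show ?case
    using Cons.IH[of ?s "P @ [y]" "Suc k"] Cons.prems Sym_Sym_ap[of k X y s] by (simp add: pos_def)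
qed simp

lemma mvL_wf:
  assumes "vs s" "fst s = P @ (ys @ [X]) @ R" "length P = k"
  shows "vs (mvL X k ys s)" "fst (mvL X k ys s) = P @ (X # ys) @ R" "mvR X k ys (mvL X k ys s) = s"
proof -
  have "vs (mvL X k ys s) \<and> fst (mvL X k ys s) = P @ (X # ys) @ R \<and> mvR X k ys (mvL X k ys s) = s"
    using assms
  proof (induction ys arbitrary: P k)
    case (Cons y ys)
    let ?t = "mvL X (Suc k) ys s"
    have t: "vs ?t" "fst ?t = (P @ [y]) @ (X # ys) @ R" "mvR X (Suc k) ys ?t = s"
      using Cons.IH[of "P @ [y]" "Suc k"] Cons.prems by auto
    have o: "X \<in> Obj C" "y \<in> Obj C" using Cons.prems by (auto simp: vs_def)
    have "vs (ap k (Sw y X) ?t)" using t o Cons.prems by (intro vs_ap) (auto simp: fits_iff)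
    moreover have "fst (ap k (Sw y X) ?t) = P @ (X # y # ys) @ R"
      using t Cons.prems res_append[of P k "Sw y X" "ys @ R"] by simp
    ultimately show ?case
      using t Cons.prems Sym_Sym_ap[of k y X ?t] by (simp add: pos_def)
  qed simp
  then show "vs (mvL X k ys s)" "fst (mvL X k ys s) = P @ (X # ys) @ R" "mvR X k ys (mvL X k ys s) = s"
    by auto
qed

lemma Sym_Tn:
  assumes "X \<in> Obj C" "A \<in> Obj C" "B \<in> Obj C"
  shows "Sym C X (A \<otimes>\<^sub>o B) = Inv C (Asc C A B X) \<cdot> ((Id C A \<otimes>\<^sub>a Sym C X B) \<cdot>
     (Asc C A X B \<cdot> ((Sym C X A \<otimes>\<^sub>a Id C B) \<cdot> Inv C (Asc C X A B))))"
proof -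
  have "Inv C (Asc C A B X) \<cdot> ((Id C A \<otimes>\<^sub>a Sym C X B) \<cdot> (Asc C A X B \<cdot> ((Sym C X A \<otimes>\<^sub>a Id C B) \<cdot> Inv C (Asc C X A B))))
    = Inv C (Asc C A B X) \<cdot> (((Id C A \<otimes>\<^sub>a Sym C X B) \<cdot> (Asc C A X B \<cdot> (Sym C X A \<otimes>\<^sub>a Id C B))) \<cdot> Inv C (Asc C X A B))"
    using assms by simp
  also have "\<dots> = Sym C X (A \<otimes>\<^sub>o B)"
    using assms hexagon[of X A B, symmetric] by simp
  finally show ?thesis by simp
qed

lemma Sym_Unit:
  assumes "X \<in> Obj C"
  shows "Sym C X \<bbbI> = Inv C (Lun C X) \<cdot> Run C X"
  using assms by (simp flip: Lun_Sym)

text \<open>The hexagon, in the solved form \<open>Sym_Tn\<close>, resolves the crossing of a strand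
  with a product into crossings with the factors; \<open>Sym_Unit\<close> says that crossing an
  empty product does nothing.\<close>

lemma ap_Sym_tree:
  assumes "vs s" "fst s = P @ (X # lv t) @ R" "length P = k"
  shows "ap k (Tn (Lf X) t, Tn t (Lf X), Sym C X (ob t)) s = mvR X k (lv t) s"
  using assms
proof (induction t arbitrary: P R k s)
  case Ut
  then have o: "X \<in> Obj C" by (auto simp: vs_def)
  have m: "fits k (Tn (Lf X) Ut, b) (fst s)" "fits k (Lf X, b) (fst s)" for b :: "'a tree \<times> 'b"
    using Ut by (auto simp: fits_iff ins_def)
  have "ap k (Tn (Lf X) Ut, Tn Ut (Lf X), Inv C (Lun C X) \<cdot> Run C X) s
     = ap k (Lf X, Tn Ut (Lf X), Inv C (Lun C X)) (ap k (Tn (Lf X) Ut, Lf X, Run C X) s)"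
    using Ut o m by (subst ap_Comp[of _ "Lf X"]) simp_all
  also have "ap k (Tn (Lf X) Ut, Lf X, Run C X) s = s" using o Ut m by (subst ap_Run) simp_all
  also have "ap k (Lf X, Tn Ut (Lf X), Inv C (Lun C X)) s = s" using o Ut m by (subst ap_Lun) simp_all
  finally show ?case using o by (simp add: Sym_Unit)
next
  case (Tn a b)
  let ?A = "ob a" and ?B = "ob b"
  have o: "X \<in> Obj C" "objs (lv a)" "objs (lv b)" using Tn.prems by (auto simp: vs_def)
  have m: "fits k (Tn (Lf X) (Tn a b), q) (fst s)" "fits k (Tn (Tn (Lf X) a) b, q) (fst s)" for q :: "'a tree \<times> 'b"
    using Tn.prems by (auto simp: fits_iff ins_def)
  let ?s = "mvR X k (lv a) s" let ?t = "mvR X (k + length (lv a)) (lv b) ?s"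
  have s: "vs ?s" "fst ?s = P @ (lv a @ [X]) @ (lv b @ R)"
    using mvR_wf[of s P X "lv a" "lv b @ R" k] Tn.prems by simp_all
  have t: "vs ?t" "fst ?t = (P @ lv a) @ (lv b @ [X]) @ R"
    using mvR_wf[of ?s "P @ lv a" X "lv b" R "k + length (lv a)"] s Tn.prems by simp_all
  have ms: "fits k (Tn (Tn a (Lf X)) b, q) (fst ?s)" "fits k (Tn a (Tn (Lf X) b), q) (fst ?s)" for q :: "'a tree \<times> 'b"
    using s Tn.prems by (auto simp: fits_iff ins_def)
  have mt: "fits k (Tn a (Tn b (Lf X)), q) (fst ?t)" for q :: "'a tree \<times> 'b"
    using t Tn.prems by (auto simp: fits_iff ins_def)
  have 1: "ap k (Tn (Lf X) (Tn a b), Tn (Tn (Lf X) a) b, Inv C (Asc C X ?A ?B)) s = s"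
    using ap_Asc(2)[of "Lf X" a b s k] m o Tn.prems by simp
  have "ap k (Tn (Tn (Lf X) a) b, Tn (Tn a (Lf X)) b, Sym C X ?A \<otimes>\<^sub>a Id C ?B) s
      = ap k (Tn (Lf X) a, Tn a (Lf X), Sym C X ?A) (ap (k + length (lv (Tn (Lf X) a))) (b, b, Id C ?B) s)"
    using o m Tn.prems by (intro ap_Tar) simp_all
  also have "ap (k + length (lv (Tn (Lf X) a))) (b, b, Id C ?B) s = s"
    using o Tn.prems by (intro ap_Id) (auto simp: fits_def)
  also have "ap k (Tn (Lf X) a, Tn a (Lf X), Sym C X ?A) s = ?s"
    using Tn.IH(1)[of s P "lv b @ R" k] Tn.prems by simp
  finally have 2: "ap k (Tn (Tn (Lf X) a) b, Tn (Tn a (Lf X)) b, Sym C X ?A \<otimes>\<^sub>a Id C ?B) s = ?s" .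
  have 3: "ap k (Tn (Tn a (Lf X)) b, Tn a (Tn (Lf X) b), Asc C ?A X ?B) ?s = ?s"
    using ap_Asc(1)[of a "Lf X" b ?s k] ms o s by simp
  have "ap k (Tn a (Tn (Lf X) b), Tn a (Tn b (Lf X)), Id C ?A \<otimes>\<^sub>a Sym C X ?B) ?s
     = ap k (a, a, Id C ?A) (ap (k + length (lv a)) (Tn (Lf X) b, Tn b (Lf X), Sym C X ?B) ?s)"
    using o ms s by (intro ap_Tar) simp_all
  also have "ap (k + length (lv a)) (Tn (Lf X) b, Tn b (Lf X), Sym C X ?B) ?s = ?t"
    using Tn.IH(2)[of ?s "P @ lv a" R "k + length (lv a)"] s Tn.prems by simp
  also have "ap k (a, a, Id C ?A) ?t = ?t"
    using o t Tn.prems by (intro ap_Id) (auto simp: fits_def)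
  finally have 4: "ap k (Tn a (Tn (Lf X) b), Tn a (Tn b (Lf X)), Id C ?A \<otimes>\<^sub>a Sym C X ?B) ?s = ?t" .
  have 5: "ap k (Tn a (Tn b (Lf X)), Tn (Tn a b) (Lf X), Inv C (Asc C ?A ?B X)) ?t = ?t"
    using ap_Asc(2)[of a b "Lf X" ?t k] mt o t by simp
  have "ap k (Tn (Lf X) (Tn a b), Tn (Tn a b) (Lf X), Sym C X (ob (Tn a b))) s = ?t"
    using o m ms mt Tn.prems s t 1 2 3 4 5
    by (simp add: Sym_Tn ap_Comp[of _ "Tn a (Tn b (Lf X))"] ap_Comp[of _ "Tn a (Tn (Lf X) b)"]
        ap_Comp[of _ "Tn (Tn a (Lf X)) b"] ap_Comp[of _ "Tn (Tn (Lf X) a) b"])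
  then show ?case by (simp add: mvR_append)
qed simp

text \<open>Naturality of the symmetry as a move of diagrams. \<open>ap_Sym_tree\<close> turns the
  compound crossings before and after the box into sequences of elementary ones.\<close>

theorem slide:
  assumes "wb b" "vs s" "fst s = P @ (X # ins b) @ R" "length P = k"
  shows "mvR X k (outs b) (ap (Suc k) b s) = ap k b (mvR X k (ins b) s)"
proof -
  obtain t t' f where b: "b = (t, t', f)" by (cases b)
  have o: "X \<in> Obj C" "objs (lv t)" "objs (lv t')" using assms b by (auto simp: vs_def)
  have m: "fits k (Tn (Lf X) t, q) (fst s)" "fits (Suc k) (t, q) (fst s)" for q :: "'a tree \<times> 'b"
    using assms b by (auto simp: fits_def ins_def)
  let ?s = "mvR X k (lv t) s" and ?t = "ap (Suc k) (t, t', f) s"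
  have s: "vs ?s" "fst ?s = P @ (lv t @ [X]) @ R" using mvR_wf[of s P X "lv t" R k] assms b by simp_all
  have t: "vs ?t" "fst ?t = P @ (X # lv t') @ R"
    using assms b m res_append[of "P @ [X]" "Suc k" "(t, t', f)" R] by simp_all
  have "Sym C X (ob t') \<cdot> (Id C X \<otimes>\<^sub>a f) = (f \<otimes>\<^sub>a Id C X) \<cdot> Sym C X (ob t)"
    using Sym_nat[of "Id C X" f] o assms b by simp
  then have "ap k (Tn (Lf X) t, Tn t' (Lf X), Sym C X (ob t') \<cdot> (Id C X \<otimes>\<^sub>a f)) s
     = ap k (Tn (Lf X) t, Tn t' (Lf X), (f \<otimes>\<^sub>a Id C X) \<cdot> Sym C X (ob t)) s" by simp
  moreover have "ap k (Tn (Lf X) t, Tn t' (Lf X), Sym C X (ob t') \<cdot> (Id C X \<otimes>\<^sub>a f)) s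
     = ap k (Tn (Lf X) t', Tn t' (Lf X), Sym C X (ob t')) (ap k (Tn (Lf X) t, Tn (Lf X) t', Id C X \<otimes>\<^sub>a f) s)"
    using o assms b m by (intro ap_Comp) simp_all
  moreover have "ap k (Tn (Lf X) t, Tn (Lf X) t', Id C X \<otimes>\<^sub>a f) s = ap k (Lf X, Lf X, Id C X) (ap (k + length (lv (Lf X))) (t, t', f) s)"
    using o assms b m by (intro ap_Tar) simp_all
  moreover have "\<dots> = ?t"
    using o t assms ap_Id[of ?t k "Lf X"] by (simp add: fits_def)
  moreover have "ap k (Tn (Lf X) t', Tn t' (Lf X), Sym C X (ob t')) ?t = mvR X k (lv t') ?t"
    using ap_Sym_tree[of ?t P X t' R k] t assms by simp
  moreover have "ap k (Tn (Lf X) t, Tn t' (Lf X), (f \<otimes>\<^sub>a Id C X) \<cdot> Sym C X (ob t)) s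
     = ap k (Tn t (Lf X), Tn t' (Lf X), f \<otimes>\<^sub>a Id C X) (ap k (Tn (Lf X) t, Tn t (Lf X), Sym C X (ob t)) s)"
    using o assms b m by (intro ap_Comp) simp_all
  moreover have "ap k (Tn (Lf X) t, Tn t (Lf X), Sym C X (ob t)) s = ?s"
    using ap_Sym_tree[of s P X t R k] assms b by simp
  moreover have "ap k (Tn t (Lf X), Tn t' (Lf X), f \<otimes>\<^sub>a Id C X) ?s = ap k (t, t', f) (ap (k + length (lv t)) (Lf X, Lf X, Id C X) ?s)"
    using o assms b s by (intro ap_Tar) (simp_all add: fits_def)
  moreover have "ap (k + length (lv t)) (Lf X, Lf X, Id C X) ?s = ?s"
    using o s assms ap_Id[of ?s "k + length (lv t)" "Lf X"] by (simp add: fits_def)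
  ultimately show ?thesis using b by simp
qed

text \<open>The mirror image of \<open>slide\<close>. Since \<open>mvL\<close> inverts
  \<open>mvR\<close>, it follows by applying \<open>slide\<close> to the state in which
  \<open>X\<close> has been moved back to the left.\<close>

theorem slideL:
  assumes "wb b" "vs s" "fst s = P @ (ins b @ [X]) @ R" "length P = k"
  shows "ap (Suc k) b (mvL X k (ins b) s) = mvL X k (outs b) (ap k b s)"
proof -
  let ?t = "mvL X k (ins b) s"
  note t = mvL_wf[OF assms(2,3,4)]
  have 1: "mvR X k (outs b) (ap (Suc k) b ?t) = ap k b s"
    using slide[OF assms(1) t(1,2) assms(4)] t(3) by simp
  have "vs (ap (Suc k) b ?t)" using t assms by (intro vs_ap) (simp_all add: fits_def)
  moreover have "fst (ap (Suc k) b ?t) = P @ (X # outs b) @ R"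
    using t assms res_append[of "P @ [X]" "Suc k" b R] by simp
  ultimately show ?thesis using mvL_mvR[of "ap (Suc k) b ?t" P X "outs b" R k] 1 assms(4) by simp
qed

end

declare fits_def [simp] res_def [simp]

context ACU_tensor_cat
begin

lemma pos_objs: "pos k xs s \<Longrightarrow> objs xs"
  by (elim posE) (simp add: vs_def)

lemma pos_transfer:
  assumes "pos k xs s" "run p (start xs) = run q (start xs)" "wfp p xs" "wfp q xs"
  shows "run (sh k p) s = run (sh k q) s"
  using transfer[OF assms(2-4)] assms(1) by (simp add: pos_def)

lemma pos_transfer_sscl:
  assumes "pos k xs s" "run p (start xs) = sscl c (run q (start xs))" "wfp p xs" "wfp q xs"
  shows "run (sh k p) s = sscl c (run (sh k q) s)"
  using transfer_sscl[OF assms(2-4)] assms(1) by (simp add: pos_def)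

lemma slide_pos:
  assumes "wb b" "pos k (X # ins b) s"
  shows "mvR X k (outs b) (ap (Suc k) b s) = ap k b (mvR X k (ins b) s)"
  using assms(2) by (rule posE) (rule slide[OF assms(1)])

lemma slideL_pos:
  assumes "wb b" "pos k (ins b @ [X]) s"
  shows "ap (Suc k) b (mvL X k (ins b) s) = mvL X k (outs b) (ap k b s)"
  using assms(2) by (rule posE) (rule slideL[OF assms(1)])

text \<open>This and the next lemmas instantiate the slides by the shape of the box; the digits
  count its inputs and outputs.\<close>

lemma slideR_20:
  assumes "pos k [X, A, B] s" "e \<in> Hom C (A \<otimes>\<^sub>o B) \<bbbI>" "l = Suc k"
  shows "ap k (b20 A B e) (ap l (Sw X B) (ap k (Sw X A) s)) = ap l (b20 A B e) s"
  using slide_pos[of "b20 A B e" k X s] assms pos_objs[OF assms(1)] by (simp add: in_Hom_iff)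

lemma slideL_20:
  assumes "pos k [A, B, X] s" "e \<in> Hom C (A \<otimes>\<^sub>o B) \<bbbI>" "l = Suc k"
  shows "ap l (b20 A B e) (ap k (Sw A X) (ap l (Sw B X) s)) = ap k (b20 A B e) s"
  using slideL_pos[of "b20 A B e" k X s] assms pos_objs[OF assms(1)] by (simp add: in_Hom_iff)

lemma slideR_02:
  assumes "pos k [X] s" "c \<in> Hom C \<bbbI> (A \<otimes>\<^sub>o B)" "l = Suc k" "A \<in> Obj C" "B \<in> Obj C"
  shows "ap l (Sw X B) (ap k (Sw X A) (ap l (b02 A B c) s)) = ap k (b02 A B c) s"
  using slide_pos[of "b02 A B c" k X s] assms pos_objs[OF assms(1)] by (simp add: in_Hom_iff)

lemma slideL_02:
  assumes "pos k [X] s" "c \<in> Hom C \<bbbI> (A \<otimes>\<^sub>o B)" "l = Suc k" "A \<in> Obj C" "B \<in> Obj C"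
  shows "ap k (Sw A X) (ap l (Sw B X) (ap k (b02 A B c) s)) = ap l (b02 A B c) s"
  using slideL_pos[of "b02 A B c" k X s] assms pos_objs[OF assms(1)] by (simp add: in_Hom_iff)

lemma slideR_21:
  assumes "pos k [X, A, B] s" "m \<in> Hom C (A \<otimes>\<^sub>o B) D" "l = Suc k" "D \<in> Obj C"
  shows "ap k (Sw X D) (ap l (b21 A B D m) s) = ap k (b21 A B D m) (ap l (Sw X B) (ap k (Sw X A) s))"
  using slide_pos[of "b21 A B D m" k X s] assms pos_objs[OF assms(1)] by (simp add: in_Hom_iff)

lemma slideL_21:
  assumes "pos k [A, B, X] s" "m \<in> Hom C (A \<otimes>\<^sub>o B) D" "l = Suc k" "D \<in> Obj C"
  shows "ap k (Sw D X) (ap k (b21 A B D m) s) = ap l (b21 A B D m) (ap k (Sw A X) (ap l (Sw B X) s))"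
  using slideL_pos[of "b21 A B D m" k X s] assms pos_objs[OF assms(1)] by (simp add: in_Hom_iff)

lemma slideR_11:
  assumes "pos k [X, A] s" "m \<in> Hom C A D" "l = Suc k" "D \<in> Obj C"
  shows "ap k (Sw X D) (ap l (b11 A D m) s) = ap k (b11 A D m) (ap k (Sw X A) s)"
  using slide_pos[of "b11 A D m" k X s] assms pos_objs[OF assms(1)] by (simp add: in_Hom_iff)

lemma slideL_11:
  assumes "pos k [A, X] s" "m \<in> Hom C A D" "l = Suc k" "D \<in> Obj C"
  shows "ap k (Sw D X) (ap k (b11 A D m) s) = ap l (b11 A D m) (ap k (Sw A X) s)"
  using slideL_pos[of "b11 A D m" k X s] assms pos_objs[OF assms(1)] by (simp add: in_Hom_iff)

text \<open>A strand slides across the box \<open>Sw Y Z\<close>, itself a crossing.\<close>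

lemma yang_baxter:
  assumes "pos k [X, Y, Z] s" "l = Suc k"
  shows "ap l (Sw X Y) (ap k (Sw X Z) (ap l (Sw Y Z) s)) = ap k (Sw Y Z) (ap l (Sw X Z) (ap k (Sw X Y) s))"
  using slide_pos[of "Sw Y Z" k X s] assms pos_objs[OF assms(1)] by simp

lemma Sw_Sw:
  assumes "pos k [X, Y] s"
  shows "ap k (Sw Y X) (ap k (Sw X Y) s) = s"
  using assms by (rule Sym_Sym_ap)

text \<open>An endomorphism of the unit has neither inputs nor outputs, so a strand slides across it
  with no crossing at all. Scalars are therefore always collected at position 0.\<close>

lemma b00_move:
  assumes "vs s" "k \<le> length (fst s)" "r \<in> Hom C \<bbbI> \<bbbI>"
  shows "ap k (Ut, Ut, r) s = ap 0 (Ut, Ut, r) s"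
  using assms(2)
proof (induction k)
  case (Suc k)
  have "ap (Suc k) (Ut, Ut, r) s = ap k (Ut, Ut, r) s"
    using slide_pos[of "(Ut, Ut, r)" k "fst s ! k" s] Suc.prems assms(1,3)
    by (simp add: in_Hom_iff pos_def take_Suc_conv_app_nth hd_drop_conv_nth flip: hd_drop_conv_nth)
  then show ?case using Suc by simp
qed simp

lemma b00_comm:
  assumes "vs s" "wb b" "fits k b (fst s)" "r \<in> Hom C \<bbbI> \<bbbI>"
  shows "ap k b (ap 0 (Ut, Ut, r) s) = ap 0 (Ut, Ut, r) (ap k b s)"
  using comm[of "(Ut, Ut, r)" b s 0 k] assms by (simp add: in_Hom_iff)

lemma contract_left_Hom:
  assumes "X \<in> Obj C" "Y \<in> Obj C" "Z \<in> Obj C" "e \<in> Hom C (X \<otimes>\<^sub>o Y) \<bbbI>"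
  shows "contract_left C X Y Z e \<in> Hom C (X \<otimes>\<^sub>o (Y \<otimes>\<^sub>o Z)) Z"
  using assms by (simp add: in_Hom_iff contract_left_def)

lemma contract_right_Hom:
  assumes "X \<in> Obj C" "Y \<in> Obj C" "Z \<in> Obj C" "e \<in> Hom C (Y \<otimes>\<^sub>o Z) \<bbbI>"
  shows "contract_right C X Y Z e \<in> Hom C ((X \<otimes>\<^sub>o Y) \<otimes>\<^sub>o Z) X"
  using assms by (simp add: in_Hom_iff contract_right_def)

lemma interchange_Hom:
  assumes "X \<in> Obj C" "Y \<in> Obj C" "Z \<in> Obj C" "W \<in> Obj C"
  shows "interchange C X Y Z W \<in> Hom C ((X \<otimes>\<^sub>o Y) \<otimes>\<^sub>o (Z \<otimes>\<^sub>o W)) ((X \<otimes>\<^sub>o Z) \<otimes>\<^sub>o (Y \<otimes>\<^sub>o W))"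
  using assms by (simp add: in_Hom_iff interchange_def)

lemma ev13_Hom:
  assumes "X \<in> Obj C" "Y \<in> Obj C" "Z \<in> Obj C" "e \<in> Hom C (X \<otimes>\<^sub>o Z) \<bbbI>"
  shows "ev13 C X Y Z e \<in> Hom C ((X \<otimes>\<^sub>o Y) \<otimes>\<^sub>o Z) Y"
  using assms contract_left_Hom[of X Z Y e] by (simp add: in_Hom_iff ev13_def)

lemma ev1324_Hom:
  assumes "X \<in> Obj C" "Y \<in> Obj C" "Z \<in> Obj C" "W \<in> Obj C" "e \<in> Hom C (X \<otimes>\<^sub>o Z) \<bbbI>" "e' \<in> Hom C (Y \<otimes>\<^sub>o W) \<bbbI>"
  shows "ev1324 C X Y Z W e e' \<in> Hom C ((X \<otimes>\<^sub>o Y) \<otimes>\<^sub>o (Z \<otimes>\<^sub>o W)) \<bbbI>"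
  using assms interchange_Hom[of X Y Z W] by (simp add: in_Hom_iff ev1324_def)

lemma twist_Hom:
  assumes "X \<in> Obj C" "Y \<in> Obj C" "e \<in> Hom C (X \<otimes>\<^sub>o Y) \<bbbI>"
  shows "twist C X Y e \<in> Hom C (Y \<otimes>\<^sub>o X) \<bbbI>"
  using assms by (simp add: in_Hom_iff twist_def)

lemma ap_contract_left:
  assumes "pos k [X, Y, Z] s" "e \<in> Hom C (X \<otimes>\<^sub>o Y) \<bbbI>"
  shows "ap k (Tn (Lf X) (Tn (Lf Y) (Lf Z)), Lf Z, contract_left C X Y Z e) s = ap k (b20 X Y e) s"
proof -
  have o: "X \<in> Obj C" "Y \<in> Obj C" "Z \<in> Obj C" using pos_objs[OF assms(1)] by auto
  have 1: "ap (Suc (Suc 0)) (b11 Z Z (Id C Z)) (start [X, Y, Z]) = start [X, Y, Z]"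
    using o ap_Id[of "start [X, Y, Z]" 2 "Lf Z"] by (simp add: numeral_2_eq_2)
  have "ap 0 (Tn (Lf X) (Tn (Lf Y) (Lf Z)), Lf Z, contract_left C X Y Z e) (start [X, Y, Z]) = ap 0 (b20 X Y e) (start [X, Y, Z])"
    using o assms(2) 1 unfolding in_Hom_iff contract_left_def
    by (simp add: ap_Comp[of _ "Tn Ut (Lf Z)"] ap_Comp[of _ "Tn (Tn (Lf X) (Lf Y)) (Lf Z)"] ap_Tar)
  then show ?thesis
    using pos_transfer[OF assms(1), of "[(0, (Tn (Lf X) (Tn (Lf Y) (Lf Z)), Lf Z, contract_left C X Y Z e))]" "[(0, b20 X Y e)]"]
      contract_left_Hom[of X Y Z e] o assms(2) by (simp add: in_Hom_iff)
qed

lemma ap_contract_right: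
  assumes "pos k [X, Y, Z] s" "e \<in> Hom C (Y \<otimes>\<^sub>o Z) \<bbbI>"
  shows "ap k (Tn (Tn (Lf X) (Lf Y)) (Lf Z), Lf X, contract_right C X Y Z e) s = ap (Suc k) (b20 Y Z e) s"
proof -
  have o: "X \<in> Obj C" "Y \<in> Obj C" "Z \<in> Obj C" using pos_objs[OF assms(1)] by auto
  let ?s = "ap (Suc 0) (b20 Y Z e) (start [X, Y, Z])"
  have s: "vs ?s" "fst ?s = [X]" using o assms(2) by (simp_all add: in_Hom_iff)
  have 1: "ap 0 (b11 X X (Id C X)) ?s = ?s"
    using o s ap_Id[of ?s 0 "Lf X"] by simp
  have "ap 0 (Tn (Tn (Lf X) (Lf Y)) (Lf Z), Lf X, contract_right C X Y Z e) (start [X, Y, Z]) = ?s"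
    using o assms(2) 1 unfolding in_Hom_iff contract_right_def
    by (simp add: ap_Comp[of _ "Tn (Lf X) Ut"] ap_Comp[of _ "Tn (Lf X) (Tn (Lf Y) (Lf Z))"] ap_Tar)
  then show ?thesis
    using pos_transfer[OF assms(1), of "[(0, (Tn (Tn (Lf X) (Lf Y)) (Lf Z), Lf X, contract_right C X Y Z e))]" "[(1, b20 Y Z e)]"]
      contract_right_Hom[of X Y Z e] o assms(2) by (simp add: in_Hom_iff)
qed

declare fits_def [simp del] res_def [simp del]

text \<open>All associators in \<open>interchange\<close> become invisible, and only the crossing of
  the two middle blocks survives.\<close>

lemma ap_interchange_gen:
  assumes "pos k (lv a @ lv b @ lv c @ lv d) s"
  shows "ap k (Tn (Tn a b) (Tn c d), Tn (Tn a c) (Tn b d), interchange C (ob a) (ob b) (ob c) (ob d)) s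
      = ap (k + length (lv a)) (Tn b c, Tn c b, Sym C (ob b) (ob c)) s"
proof -
  have o: "objs (lv a)" "objs (lv b)" "objs (lv c)" "objs (lv d)" using pos_objs[OF assms(1)] by auto
  obtain P R where s: "vs s" "fst s = P @ (lv a @ lv b @ lv c @ lv d) @ R" "length P = k" using assms by (rule posE)
  let ?A = "ob a" and ?Y = "ob b" and ?B = "ob c" and ?D = "ob d"
  let ?k = "k + length (lv a)"
  let ?t = "ap ?k (Tn b c, Tn c b, Sym C ?Y ?B) s"
  have t: "vs ?t" "fst ?t = (P @ lv a) @ (lv c @ lv b) @ (lv d @ R)"
    using s o by (auto simp: fits_def res_def intro!: vs_ap)
  let ?m = "Asc C ?B ?Y ?D \<cdot> ((Sym C ?Y ?B \<otimes>\<^sub>a Id C ?D) \<cdot> Inv C (Asc C ?Y ?B ?D))"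
  have m: "fits k (Tn (Tn a b) (Tn c d), q) (fst s)" "fits k (Tn a (Tn b (Tn c d)), q) (fst s)"
    "fits ?k (Tn b (Tn c d), q) (fst s)" "fits ?k (Tn (Tn b c) d, q) (fst s)"
    "fits (?k + (length (lv b) + length (lv c))) (d, q) (fst s)" for q :: "'a tree \<times> 'b"
    using s by (auto simp: ins_def fits_def)
  have mt: "fits k (Tn a (Tn c (Tn b d)), q) (fst ?t)" "fits ?k (Tn (Tn c b) d, q) (fst ?t)"
    "fits k (a, q) (fst ?t)" for q :: "'a tree \<times> 'b"
    using t s by (auto simp: ins_def fits_def)
  have "ap ?k (Tn b (Tn c d), Tn (Tn b c) d, Inv C (Asc C ?Y ?B ?D)) s = s"
    using o s(1) m by (intro ap_Asc(2)) simp_all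
  moreover have "ap ?k (Tn (Tn b c) d, Tn (Tn c b) d, Sym C ?Y ?B \<otimes>\<^sub>a Id C ?D) s = ?t"
    using ap_Tar[of "Tn b c" "Tn c b" "Sym C ?Y ?B" d d "Id C ?D" s ?k] o s(1) m
      ap_Id[of s "?k + (length (lv b) + length (lv c))" d] by simp
  moreover have "ap ?k (Tn (Tn c b) d, Tn c (Tn b d), Asc C ?B ?Y ?D) ?t = ?t"
    using o t(1) mt by (intro ap_Asc(1)) simp_all
  ultimately have 1: "ap ?k (Tn b (Tn c d), Tn c (Tn b d), ?m) s = ?t"
    using o s(1) m by (simp add: ap_Comp[of _ "Tn (Tn c b) d"] ap_Comp[of _ "Tn (Tn b c) d"])
  have 2: "ap k (Tn (Tn a b) (Tn c d), Tn a (Tn b (Tn c d)), Asc C ?A ?Y (?B \<otimes>\<^sub>o ?D)) s = s"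
    using o s(1) m by (intro ap_Asc(1)) simp_all
  have 3: "ap k (Tn a (Tn b (Tn c d)), Tn a (Tn c (Tn b d)), Id C ?A \<otimes>\<^sub>a ?m) s = ?t"
    using ap_Tar[of a a "Id C ?A" "Tn b (Tn c d)" "Tn c (Tn b d)" ?m s k] o s(1) m 1 ap_Id[of ?t k a] t(1) mt by simp
  have 4: "ap k (Tn a (Tn c (Tn b d)), Tn (Tn a c) (Tn b d), Inv C (Asc C ?A ?B (?Y \<otimes>\<^sub>o ?D))) ?t = ?t"
    using o t(1) mt by (intro ap_Asc(2)) simp_all
  show ?thesis
    unfolding interchange_def using o s(1) m 2 3 4
    by (simp add: ap_Comp[of _ "Tn a (Tn c (Tn b d))"] ap_Comp[of _ "Tn a (Tn b (Tn c d))"])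
qed

lemma ap_interchange_tree:
  assumes s: "pos k (lv a @ [Y] @ lv c @ lv d) s"
  shows "ap k (Tn (Tn a (Lf Y)) (Tn c d), Tn (Tn a c) (Tn (Lf Y) d), interchange C (ob a) Y (ob c) (ob d)) s
      = mvR Y (k + length (lv a)) (lv c) s"
proof -
  obtain P R where "vs s" "fst s = P @ (lv a @ [Y] @ lv c @ lv d) @ R" "length P = k" using s by (rule posE)
  then show ?thesis
    using ap_interchange_gen[of k a "Lf Y" c d s] ap_Sym_tree[of s "P @ lv a" Y c "lv d @ R" "k + length (lv a)"] s by simp
qed

declare fits_def [simp] res_def [simp]

lemma ap_interchange:
  assumes "pos k [X, Y, Z, W] s"
  shows "ap k (Tn (Tn (Lf X) (Lf Y)) (Tn (Lf Z) (Lf W)), Tn (Tn (Lf X) (Lf Z)) (Tn (Lf Y) (Lf W)), interchange C X Y Z W) s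
      = ap (Suc k) (Sw Y Z) s"
  using ap_interchange_tree[of k "Lf X" Y "Lf Z" "Lf W" s] assms by simp

end

section \<open>Duality\<close>

context ACU_tensor_cat
begin

declare ap_Id [simp del]

lemma ap_Id' [simp]:
  "vs s \<Longrightarrow> fits k (t, t, f) (fst s) \<Longrightarrow> objs (lv t) \<Longrightarrow> f = Id C (ob t) \<Longrightarrow> ap k (t, t, f) s = s"
  using ap_Id[of s k t] by simp

lemma ap_twist:
  assumes "pos k [Y, X] s" "e \<in> Hom C (X \<otimes>\<^sub>o Y) \<bbbI>"
  shows "ap k (b20 Y X (twist C X Y e)) s = ap k (b20 X Y e) (ap k (Sw Y X) s)"
  using assms pos_objs[OF assms(1)] unfolding twist_def
  by (simp add: ap_Comp[of _ "Tn (Lf X) (Lf Y)"] pos_def in_Hom_iff)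

lemma ap_Sym_02:
  assumes "pos k [] s" "c \<in> Hom C \<bbbI> (X \<otimes>\<^sub>o Y)" "X \<in> Obj C" "Y \<in> Obj C"
  shows "ap k (b02 Y X (Sym C X Y \<cdot> c)) s = ap k (Sw X Y) (ap k (b02 X Y c) s)"
  using assms by (simp add: ap_Comp[of _ "Tn (Lf X) (Lf Y)"] pos_def in_Hom_iff)

lemma ap_ev13:
  assumes "pos k [X, Y, Z] s" "e \<in> Hom C (X \<otimes>\<^sub>o Z) \<bbbI>"
  shows "ap k (Tn (Tn (Lf X) (Lf Y)) (Lf Z), Lf Y, ev13 C X Y Z e) s = ap k (b20 X Z e) (ap (Suc k) (Sw Y Z) s)"
proof -
  have o: "X \<in> Obj C" "Y \<in> Obj C" "Z \<in> Obj C" using pos_objs[OF assms(1)] by auto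
  let ?s = "ap (Suc 0) (Sw Y Z) (start [X, Y, Z])"
  have s: "vs ?s" "fst ?s = [X, Z, Y]" using o by simp_all
  have "ap 0 (Tn (Tn (Lf X) (Lf Y)) (Lf Z), Lf Y, ev13 C X Y Z e) (start [X, Y, Z]) = ap 0 (b20 X Z e) ?s"
    using o assms(2) contract_left_Hom[of X Z Y e] unfolding in_Hom_iff ev13_def
    by (simp add: ap_Comp[of _ "Tn (Lf X) (Tn (Lf Z) (Lf Y))"] ap_Comp[of _ "Tn (Lf X) (Tn (Lf Y) (Lf Z))"] ap_Tar
      ap_contract_left pos_def in_Hom_iff)
  then show ?thesis
    using pos_transfer[OF assms(1), of "[(0, (Tn (Tn (Lf X) (Lf Y)) (Lf Z), Lf Y, ev13 C X Y Z e))]" "[(1, Sw Y Z), (0, b20 X Z e)]"]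
      ev13_Hom[of X Y Z e] o assms(2) by (simp add: in_Hom_iff)
qed

lemma ap_ev1324:
  assumes "pos k [X, Y, Z, W] s" "e \<in> Hom C (X \<otimes>\<^sub>o Z) \<bbbI>" "e' \<in> Hom C (Y \<otimes>\<^sub>o W) \<bbbI>"
  shows "ap k (Tn (Tn (Lf X) (Lf Y)) (Tn (Lf Z) (Lf W)), Ut, ev1324 C X Y Z W e e') s
     = ap k (b20 X Z e) (ap (Suc (Suc k)) (b20 Y W e') (ap (Suc k) (Sw Y Z) s))"
proof -
  have o: "X \<in> Obj C" "Y \<in> Obj C" "Z \<in> Obj C" "W \<in> Obj C" using pos_objs[OF assms(1)] by auto
  have "ap 0 (Tn (Tn (Lf X) (Lf Y)) (Tn (Lf Z) (Lf W)), Ut, ev1324 C X Y Z W e e') (start [X, Y, Z, W])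
    = ap 0 (b20 X Z e) (ap (Suc (Suc 0)) (b20 Y W e') (ap (Suc 0) (Sw Y Z) (start [X, Y, Z, W])))"
    using o assms(2,3) interchange_Hom[of X Y Z W] unfolding in_Hom_iff ev1324_def
    by (simp add: ap_Comp[of _ "Tn Ut Ut"] ap_Comp[of _ "Tn (Tn (Lf X) (Lf Z)) (Tn (Lf Y) (Lf W))"] ap_Tar
      ap_interchange pos_def in_Hom_iff)
  then show ?thesis
    using pos_transfer[OF assms(1), of "[(0, (Tn (Tn (Lf X) (Lf Y)) (Tn (Lf Z) (Lf W)), Ut, ev1324 C X Y Z W e e'))]"
        "[(1, Sw Y Z), (Suc (Suc 0), b20 Y W e'), (0, b20 X Z e)]"]
      ev1324_Hom[of X Y Z W e e'] o assms(2,3) by (simp add: in_Hom_iff)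
qed

lemma act_simps [simp]:
  assumes "r \<in> Arr C" "Dom C r = \<bbbI>" "Cod C r = \<bbbI>" "f \<in> Arr C"
  shows "act C r f \<in> Arr C" "Dom C (act C r f) = Dom C f" "Cod C (act C r f) = Cod C f"
  using assms by (simp_all add: act_def)

text \<open>The unit constraints in \<open>act\<close> are invisible, so acting by \<open>r\<close>
  means putting a free-floating scalar into the diagram.\<close>

lemma ap_act:
  assumes "wb (t, t', f)" "vs s" "fits k (t, t', f) (fst s)" "r \<in> Hom C \<bbbI> \<bbbI>"
  shows "ap k (t, t', act C r f) s = ap 0 (Ut, Ut, r) (ap k (t, t', f) s)"
proof -
  have "ap k (t, t', act C r f) s = ap k (Tn Ut t', t', Lun C (ob t')) (ap k (Tn Ut t, Tn Ut t', r \<otimes>\<^sub>a f)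
      (ap k (t, Tn Ut t, Inv C (Lun C (ob t))) s))"
    using assms unfolding act_def by (simp add: ap_Comp[of _ "Tn Ut t'"] ap_Comp[of _ "Tn Ut t"] in_Hom_iff)
  also have "ap k (t, Tn Ut t, Inv C (Lun C (ob t))) s = s"
    using assms by (intro ap_Lun) simp_all
  also have "ap k (Tn Ut t, Tn Ut t', r \<otimes>\<^sub>a f) s = ap k (Ut, Ut, r) (ap k (t, t', f) s)"
    using assms ap_Tar[of Ut Ut r t t' f s k] by (simp add: in_Hom_iff)
  also have "ap k (Tn Ut t', t', Lun C (ob t')) \<dots> = \<dots>"
    using assms by (intro ap_Lun) (simp_all add: in_Hom_iff)
  also have "\<dots> = ap 0 (Ut, Ut, r) (ap k (t, t', f) s)"
    using assms by (intro b00_move) simp_all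
  finally show ?thesis .
qed

text \<open>The pairing \<open>e\<close> is perfect, with Casimir element \<open>c\<close>.\<close>

definition perf :: "'a \<Rightarrow> 'a \<Rightarrow> 'b \<Rightarrow> 'b \<Rightarrow> bool" where
  "perf X X' e c \<longleftrightarrow> X \<in> Obj C \<and> X' \<in> Obj C \<and> e \<in> Hom C (X' \<otimes>\<^sub>o X) \<bbbI> \<and> c \<in> Hom C \<bbbI> (X \<otimes>\<^sub>o X') \<and>
     ap (Suc 0) (b20 X' X e) (ap 0 (b02 X X' c) (start [X])) = start [X] \<and>
     ap 0 (b20 X' X e) (ap (Suc 0) (b02 X X' c) (start [X'])) = start [X']"

lemma perfD:
  assumes "perf X X' e c"
  shows "X \<in> Obj C" "X' \<in> Obj C" "e \<in> Hom C (X' \<otimes>\<^sub>o X) \<bbbI>" "c \<in> Hom C \<bbbI> (X \<otimes>\<^sub>o X')"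
  using assms by (auto simp: perf_def)

lemma zigzag1:
  assumes "perf X X' e c" "pos k [X] s" "l = Suc k"
  shows "ap l (b20 X' X e) (ap k (b02 X X' c) s) = s"
  using pos_transfer[OF assms(2), of "[(0, b02 X X' c), (1, b20 X' X e)]" "[]"] perfD[OF assms(1)] assms
  by (simp add: perf_def in_Hom_iff)

lemma zigzag2:
  assumes "perf X X' e c" "pos k [X'] s" "l = Suc k"
  shows "ap k (b20 X' X e) (ap l (b02 X X' c) s) = s"
  using pos_transfer[OF assms(2), of "[(1, b02 X X' c), (0, b20 X' X e)]" "[]"] perfD[OF assms(1)] assms
  by (simp add: perf_def in_Hom_iff)

text \<open>In a symmetric category a left dual is also a right dual. The zigzag for the twisted
  pairing contains loops of crossings; sliding the evaluation and the Casimir element across the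
  strand and one Yang-Baxter move make them cancel in pairs, and the given zigzag remains.\<close>

lemma perf_twist:
  assumes p: "perf X X' e c"
  shows "perf X' X (twist C X' X e) (Sym C X X' \<cdot> c)"
proof -
  note o = perfD[OF p]
  note o' = o(1,2) o(3,4)[unfolded in_Hom_iff]
  let ?S = "Suc 0"
  let ?e = "b20 X' X e" and ?c = "b02 X X' c"
  let ?s = "start [X']"
  define L where "L = ap ?S ?e (ap ?S (Sw X X') (ap 0 (Sw X X') (ap 0 ?c ?s)))"
  have "L = ap 0 ?e (ap ?S (Sw X' X) (ap 0 (Sw X' X') (ap ?S (Sw X X') (ap 0 (Sw X X') (ap 0 ?c ?s)))))"
    unfolding L_def using o' o(3) by (subst slideR_20) (simp_all add: pos_def)
  also have "ap 0 ?c ?s = ap ?S (Sw X' X') (ap 0 (Sw X' X) (ap ?S ?c ?s))"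
    using o' o(4) by (subst slideR_02) (simp_all add: pos_def)
  also have "ap 0 (Sw X' X') (ap ?S (Sw X X') (ap 0 (Sw X X') (ap ?S (Sw X' X') (ap 0 (Sw X' X) (ap ?S ?c ?s)))))
     = ap ?S (Sw X X') (ap 0 (Sw X X') (ap ?S (Sw X' X') (ap ?S (Sw X' X') (ap 0 (Sw X' X) (ap ?S ?c ?s)))))"
    using o' by (subst yang_baxter[symmetric]) (simp_all add: pos_def)
  also have "\<dots> = ap ?S (Sw X X') (ap ?S ?c ?s)"
    using o' by (simp add: Sw_Sw pos_def)
  also have "ap 0 ?e (ap ?S (Sw X' X) (ap ?S (Sw X X') (ap ?S ?c ?s))) = ?s"
    using o' p by (simp add: Sw_Sw zigzag2 pos_def)
  finally have 1: "ap ?S (b20 X X' (twist C X' X e)) (ap 0 (b02 X' X (Sym C X X' \<cdot> c)) ?s) = ?s"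
    using o' o by (simp add: ap_Sym_02 ap_twist pos_def L_def)
  let ?t = "start [X]"
  define M where "M = ap 0 ?e (ap 0 (Sw X X') (ap ?S (Sw X X') (ap ?S ?c ?t)))"
  have "M = ap ?S ?e (ap 0 (Sw X' X) (ap ?S (Sw X X) (ap 0 (Sw X X') (ap ?S (Sw X X') (ap ?S ?c ?t)))))"
    unfolding M_def using o' o(3) by (subst slideL_20) (simp_all add: pos_def)
  also have "ap ?S ?c ?t = ap 0 (Sw X X) (ap ?S (Sw X' X) (ap 0 ?c ?t))"
    using o' o(4) by (subst slideL_02) (simp_all add: pos_def)
  also have "ap ?S (Sw X X) (ap 0 (Sw X X') (ap ?S (Sw X X') (ap 0 (Sw X X) (ap ?S (Sw X' X) (ap 0 ?c ?t)))))
    = ap 0 (Sw X X') (ap ?S (Sw X X') (ap 0 (Sw X X) (ap 0 (Sw X X) (ap ?S (Sw X' X) (ap 0 ?c ?t)))))"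
    using o' by (subst yang_baxter) (simp_all add: pos_def)
  also have "\<dots> = ap 0 (Sw X X') (ap 0 ?c ?t)"
    using o' by (simp add: Sw_Sw pos_def)
  also have "ap ?S ?e (ap 0 (Sw X' X) (ap 0 (Sw X X') (ap 0 ?c ?t))) = ?t"
    using o' p by (simp add: Sw_Sw zigzag1 pos_def)
  finally have 2: "ap 0 (b20 X X' (twist C X' X e)) (ap ?S (b02 X' X (Sym C X X' \<cdot> c)) ?t) = ?t"
    using o' o by (simp add: ap_Sym_02 ap_twist pos_def M_def)
  show ?thesis
    using o' 1 2 by (simp add: perf_def in_Hom_iff twist_def)
qed

section \<open>Internal homs and the existence of Casimir elements\<close>

lemma Evl_simps [simp]:
  assumes "X \<in> Obj C" "Y \<in> Obj C"
  shows "Evl C X Y \<in> Arr C" "Dom C (Evl C X Y) = Ihom C X Y \<otimes>\<^sub>o X" "Cod C (Evl C X Y) = Y"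
  using Evl_closed[OF assms] by (simp_all add: in_Hom_iff)

lemmas [simp] = Ihom_closed

lemma Ihom_adjunct:
  assumes "X \<in> Obj C" "Y \<in> Obj C" "Z \<in> Obj C" "f \<in> Hom C (Z \<otimes>\<^sub>o X) Y"
  shows "adjunct C (Ihom C X Y) X (Evl C X Y) Z f \<in> Hom C Z (Ihom C X Y)"
    "Evl C X Y \<cdot> (adjunct C (Ihom C X Y) X (Evl C X Y) Z f \<otimes>\<^sub>a Id C X) = f"
  using theI'[OF Evl_universal[OF assms]] by (simp_all add: adjunct_def)

lemma Ihom_adjunct_eqI:
  assumes "X \<in> Obj C" "Y \<in> Obj C" "h \<in> Hom C Z (Ihom C X Y)" "Evl C X Y \<cdot> (h \<otimes>\<^sub>a Id C X) = f"
  shows "adjunct C (Ihom C X Y) X (Evl C X Y) Z f = h"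
proof -
  have "Z \<in> Obj C" "f \<in> Hom C (Z \<otimes>\<^sub>o X) Y" using assms(1-3) unfolding assms(4)[symmetric] by (auto simp: in_Hom_iff)
  then show ?thesis using Evl_universal[OF assms(1,2)] assms(3,4) unfolding adjunct_def by blast
qed

lemma Evl_cancel:
  assumes "X \<in> Obj C" "Y \<in> Obj C" "h \<in> Hom C Z (Ihom C X Y)" "h' \<in> Hom C Z (Ihom C X Y)"
    "Evl C X Y \<cdot> (h \<otimes>\<^sub>a Id C X) = Evl C X Y \<cdot> (h' \<otimes>\<^sub>a Id C X)"
  shows "h = h'"
  using Ihom_adjunct_eqI[OF assms(1,2,3) assms(5)] Ihom_adjunct_eqI[OF assms(1,2,4) refl] by simp

end

context rigid_pseudo_abelian_tensor_cat
begin

lemma dual_simps [simp]: "X \<in> Obj C \<Longrightarrow> dual C X \<in> Obj C"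
  by (simp add: dual_def)

lemma ev_simps [simp]:
  assumes "X \<in> Obj C"
  shows "ev C X \<in> Arr C" "Dom C (ev C X) = dual C X \<otimes>\<^sub>o X" "Cod C (ev C X) = \<bbbI>"
  using assms by (simp_all add: ev_def dual_def)

text \<open>Only the surjectivity of \<open>hom(\<bbbI>,X) \<otimes> hom(X,\<bbbI>) \<rightarrow> hom(\<bbbI> \<otimes> X, X \<otimes> \<bbbI>)\<close> is used.\<close>

lemma ev_perf:
  assumes X: "X \<in> Obj C"
  shows "\<exists>c. perf X (dual C X) (ev C X) c"
proof -
  let ?I = "\<bbbI>" let ?h = "Ihom C \<bbbI> X" let ?X' = "Ihom C X \<bbbI>"
  \<comment> \<open>The two-term family with Hom objects hom(I,X) and hom(X,I): an element of their
    product that acts as the identity of X is already a Casimir element, up to hom(I,X) being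
    X.\<close>
  define Xs where "Xs = (\<lambda>k::nat. if k = 0 then \<bbbI> else X)"
  define Ys where "Ys = (\<lambda>k::nat. if k = 0 then X else \<bbbI>)"
  let ?P = "(?I \<otimes>\<^sub>o ?I) \<otimes>\<^sub>o X" and ?Q = "(?I \<otimes>\<^sub>o X) \<otimes>\<^sub>o ?I" let ?H = "(?I \<otimes>\<^sub>o ?h) \<otimes>\<^sub>o ?X'"
  let ?E = "tens_eval C 2 Xs Ys"
  define t1 where "t1 = (Lun C ?I \<otimes>\<^sub>a Evl C ?I X) \<cdot> interchange C ?I ?h ?I ?I"
  have E: "?E = (t1 \<otimes>\<^sub>a Evl C X ?I) \<cdot> interchange C (?I \<otimes>\<^sub>o ?h) ?X' (?I \<otimes>\<^sub>o ?I) X"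
    by (simp add: numeral_2_eq_2 Xs_def Ys_def t1_def)
  have t1: "t1 \<in> Hom C ((?I \<otimes>\<^sub>o ?h) \<otimes>\<^sub>o (?I \<otimes>\<^sub>o ?I)) (?I \<otimes>\<^sub>o X)"
    unfolding t1_def using X interchange_Hom[of ?I ?h ?I ?I] by (simp add: in_Hom_iff)
  have EH: "?E \<in> Hom C (?H \<otimes>\<^sub>o ?P) ?Q"
    unfolding E using X t1 interchange_Hom[of "?I \<otimes>\<^sub>o ?h" ?X' "?I \<otimes>\<^sub>o ?I" X] by (simp add: in_Hom_iff)
  define F where "F = tens_hom_map C 2 Xs Ys"
  have F_eq: "F = adjunct C (Ihom C ?P ?Q) ?P (Evl C ?P ?Q) ?H ?E"
    by (simp add: F_def tens_hom_map_def numeral_2_eq_2 Xs_def Ys_def)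
  have F: "F \<in> Hom C ?H (Ihom C ?P ?Q)" "Evl C ?P ?Q \<cdot> (F \<otimes>\<^sub>a Id C ?P) = ?E"
    unfolding F_eq using X EH by (auto intro!: Ihom_adjunct)
  have Fiso: "is_iso C F"
    unfolding F_def using X by (intro tens_hom_map_iso) (auto simp: Xs_def Ys_def)
  \<comment> \<open>The coherence isomorphism from \<open>?P\<close> to \<open>?Q\<close>, that is,
    the identity of X with units attached. The preimage \<open>d\<close> of its name under the
    canonical isomorphism \<open>F\<close> is the Casimir element in disguise.\<close>
  define th where "th = Inv C (Run C (?I \<otimes>\<^sub>o X)) \<cdot> ((Lun C ?I \<otimes>\<^sub>a Id C X) \<cdot> Lun C ?P)"
  have th: "th \<in> Hom C (?I \<otimes>\<^sub>o ?P) ?Q" using X by (simp add: th_def in_Hom_iff)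
  define h where "h = adjunct C (Ihom C ?P ?Q) ?P (Evl C ?P ?Q) ?I th"
  have h: "h \<in> Hom C ?I (Ihom C ?P ?Q)" "Evl C ?P ?Q \<cdot> (h \<otimes>\<^sub>a Id C ?P) = th"
    unfolding h_def using X th by (auto intro!: Ihom_adjunct)
  define d where "d = Inv C F \<cdot> h"
  have d: "d \<in> Hom C ?I ?H" "F \<cdot> d = h"
    using F(1) h(1) Fiso by (simp_all add: d_def in_Hom_iff)
  have key: "?E \<cdot> (d \<otimes>\<^sub>a Id C ?P) = th"
  proof -
    have "?E \<cdot> (d \<otimes>\<^sub>a Id C ?P) = Evl C ?P ?Q \<cdot> ((F \<otimes>\<^sub>a Id C ?P) \<cdot> (d \<otimes>\<^sub>a Id C ?P))"
      using X d(1) F by (simp add: in_Hom_iff flip: F(2))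
    then show ?thesis using X d F h by (simp add: in_Hom_iff Tar_Comp_Arr)
  qed
  \<comment> \<open>Evaluation at the unit turns hom(I,X) into X.\<close>
  define c where "c = ((Evl C ?I X \<cdot> Inv C (Run C ?h)) \<otimes>\<^sub>a Id C ?X') \<cdot> ((Lun C ?h \<otimes>\<^sub>a Id C ?X') \<cdot> d)"
  have c: "c \<in> Hom C ?I (X \<otimes>\<^sub>o ?X')"
    using X d(1) by (simp add: c_def in_Hom_iff)
  let ?j = "(Tn (Lf ?h) Ut, Lf X, Evl C ?I X)" and ?d = "(Ut, Tn (Tn Ut (Lf ?h)) (Lf ?X'), d)"
  have ap_c: "ap k (b02 X ?X' c) s = ap k ?j (ap k ?d s)" if "vs s" "k \<le> length (fst s)" for k s
    unfolding c_def using that X d(1)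
    by (simp add: in_Hom_iff ap_Comp[of _ "Tn (Lf ?h) (Lf ?X')"] ap_Comp[of _ "Tn (Tn Ut (Lf ?h)) (Lf ?X')"]
      ap_Comp[of _ "Tn (Lf ?h) Ut"] ap_Tar)
  have t1_ap: "ap 0 (Tn (Tn Ut (Lf ?h)) (Tn Ut Ut), Tn Ut (Lf X), t1) s = ap 0 ?j s" if "vs s" "fst s = ?h # xs" for s xs
    unfolding t1_def using that X interchange_Hom[of ?I ?h ?I ?I] ap_interchange_tree[of 0 Ut ?h Ut Ut s]
    by (simp add: in_Hom_iff ap_Comp[of _ "Tn (Tn Ut Ut) (Tn (Lf ?h) Ut)"] ap_Tar pos_def)
  let ?s = "start [X]"
  let ?T = "Tn (Tn Ut Ut) (Lf X)"
  have v: "vs ?s" using X by simp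
  have E1: "ap 0 (Tn (Tn (Tn Ut (Lf ?h)) (Lf ?X')) ?T, Tn (Tn Ut (Lf X)) Ut, ?E) s = ap 0 ?j (ap (Suc 0) (b20 ?X' X (Evl C X ?I)) s)"
    if "vs s" "fst s = [?h, ?X', X]" for s
    unfolding E using that X t1 interchange_Hom[of "?I \<otimes>\<^sub>o ?h" ?X' "?I \<otimes>\<^sub>o ?I" X]
      ap_interchange_tree[of 0 "Tn Ut (Lf ?h)" ?X' "Tn Ut Ut" "Lf X" s]
    by (simp add: in_Hom_iff ap_Comp[of _ "Tn (Tn (Tn Ut (Lf ?h)) (Tn Ut Ut)) (Tn (Lf ?X') (Lf X))"] ap_Tar t1_ap pos_def)
  have "ap 0 (Tn Ut ?T, Tn (Tn Ut (Lf X)) Ut, ?E \<cdot> (d \<otimes>\<^sub>a Id C ?P)) ?s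
     = ap 0 (Tn (Tn (Tn Ut (Lf ?h)) (Lf ?X')) ?T, Tn (Tn Ut (Lf X)) Ut, ?E) (ap 0 ?d ?s)"
    using X d(1) EH by (simp add: in_Hom_iff ap_Comp[of _ "Tn (Tn (Tn Ut (Lf ?h)) (Lf ?X')) ?T"] ap_Tar)
  also have "\<dots> = ap 0 ?j (ap (Suc 0) (b20 ?X' X (Evl C X ?I)) (ap 0 ?d ?s))"
    using X d(1) by (intro E1) (simp_all add: in_Hom_iff)
  also have "\<dots> = ap (Suc 0) (b20 ?X' X (Evl C X ?I)) (ap 0 ?j (ap 0 ?d ?s))"
    using X d(1) comm[of ?j "b20 ?X' X (Evl C X ?I)" "ap 0 ?d ?s" 0 "Suc 0"] by (simp add: in_Hom_iff)
  also have "ap 0 ?j (ap 0 ?d ?s) = ap 0 (b02 X ?X' c) ?s"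
    using v by (simp add: ap_c)
  finally have 1: "ap (Suc 0) (b20 ?X' X (Evl C X ?I)) (ap 0 (b02 X ?X' c) ?s) = ap 0 (Tn Ut ?T, Tn (Tn Ut (Lf X)) Ut, th) ?s"
    by (simp add: key)
  also have "\<dots> = ?s"
    unfolding th_def using X v by (simp add: ap_Comp[of _ "Tn Ut (Lf X)"] ap_Comp[of _ ?T] ap_Tar)
  finally have z1: "ap (Suc 0) (b20 ?X' X (Evl C X ?I)) (ap 0 (b02 X ?X' c) ?s) = ?s" .
  \<comment> \<open>The composite of the second zigzag, an endomorphism of the dual. By the first
    zigzag, evaluation cannot tell it from the identity, and the universal property of
    \<open>Evl\<close> makes it the identity.\<close>
  define z where "z = Lun C ?X' \<cdot> ((Evl C X ?I \<otimes>\<^sub>a Id C ?X') \<cdot> (Inv C (Asc C ?X' X ?X') \<cdot> ((Id C ?X' \<otimes>\<^sub>a c) \<cdot> Inv C (Run C ?X'))))"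
  have z: "z \<in> Hom C ?X' ?X'" unfolding z_def using X c by (simp add: in_Hom_iff)
  have ap_z: "ap 0 (b11 ?X' ?X' z) s = ap 0 (b20 ?X' X (Evl C X ?I)) (ap (Suc 0) (b02 X ?X' c) s)"
    if "vs s" "fst s = ?X' # xs" for s xs
    unfolding z_def using that X c
    by (simp add: in_Hom_iff ap_Comp[of _ "Tn Ut (Lf ?X')"] ap_Comp[of _ "Tn (Tn (Lf ?X') (Lf X)) (Lf ?X')"]
      ap_Comp[of _ "Tn (Lf ?X') (Tn (Lf X) (Lf ?X'))"] ap_Comp[of _ "Tn (Lf ?X') Ut"] ap_Tar)
  have "z = Id C ?X'"
  proof (rule Evl_cancel[of X ?I])
    let ?u = "start [?X', X]"
    let ?e = "b20 ?X' X (Evl C X ?I)"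
    have "ap 0 (Tn (Lf ?X') (Lf X), Ut, Evl C X ?I \<cdot> (z \<otimes>\<^sub>a Id C X)) ?u
       = ap 0 ?e (ap 0 ?e (ap (Suc 0) (b02 X ?X' c) ?u))"
      using X z by (simp add: in_Hom_iff ap_Comp[of _ "Tn (Lf ?X') (Lf X)"] ap_Tar ap_z)
    also have "\<dots> = ap 0 ?e (ap (Suc (Suc 0)) ?e (ap (Suc 0) (b02 X ?X' c) ?u))"
      using X c comm[of ?e ?e "ap (Suc 0) (b02 X ?X' c) ?u" 0 "Suc (Suc 0)"] by (simp add: in_Hom_iff)
    also have "ap (Suc (Suc 0)) ?e (ap (Suc 0) (b02 X ?X' c) ?u) = ?u"
      using X c pos_transfer[of "Suc 0" "[X]" ?u "[(0, b02 X ?X' c), (1, ?e)]" "[]"] z1 by (simp add: in_Hom_iff pos_def pos_def)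
    finally have "ap 0 (Tn (Lf ?X') (Lf X), Ut, Evl C X ?I \<cdot> (z \<otimes>\<^sub>a Id C X)) ?u
       = ap 0 (Tn (Lf ?X') (Lf X), Ut, Evl C X ?I \<cdot> (Id C ?X' \<otimes>\<^sub>a Id C X)) ?u" using X by simp
    then show "Evl C X ?I \<cdot> (z \<otimes>\<^sub>a Id C X) = Evl C X ?I \<cdot> (Id C ?X' \<otimes>\<^sub>a Id C X)"
      using X z by (intro faithful[of "Tn (Lf ?X') (Lf X)" Ut]) (simp_all add: in_Hom_iff)
  qed (use X z in \<open>simp_all add: in_Hom_iff\<close>)
  then have z2: "ap 0 (b20 ?X' X (Evl C X ?I)) (ap (Suc 0) (b02 X ?X' c) (start [?X'])) = start [?X']"
    using ap_z[of "start [?X']" "[]"] X by simp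
  have "perf X ?X' (Evl C X ?I) c"
    using X c z1 z2 by (simp add: perf_def in_Hom_iff)
  then show ?thesis unfolding dual_def ev_def by blast
qed

end

section \<open>Permutations of tensor factors\<close>

text \<open>
  Both the symmetric group and the endomorphisms of a tensor power satisfy the Coxeter relations.
  Every \<open>\<sigma> \<in> S\<^sub>n\<^sub>+\<^sub>1\<close> is the composite of a cycle \<open>s\<^sub>k \<dots> s\<^sub>n\<^sub>-\<^sub>1\<close> and some \<open>\<tau> \<in> S\<^sub>n\<close>. As the relations
  determine how a generator acts on such normal forms, \<^const>\<open>perm_acts\<close> is a functional relation.
\<close>

locale coxeter =
  fixes M :: "'x set" and mul :: "'x \<Rightarrow> 'x \<Rightarrow> 'x" (infixr "\<bullet>" 70) and one :: 'x and s :: "nat \<Rightarrow> 'x" and N :: nat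
  assumes mul_closed [simp]: "a \<in> M \<Longrightarrow> b \<in> M \<Longrightarrow> a \<bullet> b \<in> M"
    and one_closed [simp]: "one \<in> M"
    and s_closed [simp]: "j < N \<Longrightarrow> s j \<in> M"
    and assoc: "a \<in> M \<Longrightarrow> b \<in> M \<Longrightarrow> c \<in> M \<Longrightarrow> (a \<bullet> b) \<bullet> c = a \<bullet> (b \<bullet> c)"
    and one_mul: "a \<in> M \<Longrightarrow> one \<bullet> a = a"
    and mul_one: "a \<in> M \<Longrightarrow> a \<bullet> one = a"
    and square: "j < N \<Longrightarrow> s j \<bullet> s j = one"
    and braid: "Suc j < N \<Longrightarrow> s j \<bullet> s (Suc j) \<bullet> s j = s (Suc j) \<bullet> s j \<bullet> s (Suc j)"
    and far: "Suc i < j \<Longrightarrow> j < N \<Longrightarrow> s i \<bullet> s j = s j \<bullet> s i"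
begin

definition cyc :: "nat \<Rightarrow> 'x" where
  "cyc k = foldr (\<lambda>j a. s j \<bullet> a) [k..<N] one"

lemma cyc_N [simp]: "cyc N = one"
  by (simp add: cyc_def)

lemma cyc_Suc: "k < N \<Longrightarrow> cyc k = s k \<bullet> cyc (Suc k)"
  by (simp add: cyc_def upt_conv_Cons)

lemma cyc_closed [simp]: "k \<le> N \<Longrightarrow> cyc k \<in> M"
  by (induction rule: inc_induct) (simp_all add: cyc_Suc)

lemma s_cyc: "k < N \<Longrightarrow> s k \<bullet> cyc k = cyc (Suc k)"
  by (simp add: cyc_Suc square one_mul flip: assoc)

lemma s_cyc_below:
  assumes "Suc j < k" "k \<le> N"
  shows "s j \<bullet> cyc k = cyc k \<bullet> s j"
  using assms(2,1)
proof (induction rule: inc_induct)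
  case base
  then show ?case by (simp add: one_mul mul_one)
next
  case (step k)
  have "s j \<bullet> cyc k = (s j \<bullet> s k) \<bullet> cyc (Suc k)" using step by (simp add: cyc_Suc assoc)
  also have "\<dots> = (s k \<bullet> s j) \<bullet> cyc (Suc k)" using far[of j k] step by simp
  also have "\<dots> = s k \<bullet> (s j \<bullet> cyc (Suc k))" using step by (simp add: assoc)
  also have "\<dots> = (s k \<bullet> cyc (Suc k)) \<bullet> s j" using step by (simp add: assoc)
  finally show ?case using step by (simp add: cyc_Suc)
qed

text \<open>A generator to the right of the start of the cycle passes through it with its index
  lowered by one. The braid relation does this when the cycle starts at \<open>j\<close>; earlier
  letters commute with \<open>s (Suc j)\<close>.\<close>

lemma s_cyc_above:
  assumes "k \<le> j" "Suc j < N"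
  shows "s (Suc j) \<bullet> cyc k = cyc k \<bullet> s j"
  using assms(1)
proof (induction rule: inc_induct)
  case base
  have "s (Suc j) \<bullet> cyc j = (s (Suc j) \<bullet> s j \<bullet> s (Suc j)) \<bullet> cyc (Suc (Suc j))"
    using assms by (simp add: cyc_Suc assoc)
  also have "s (Suc j) \<bullet> s j \<bullet> s (Suc j) = s j \<bullet> s (Suc j) \<bullet> s j"
    using assms by (simp add: braid)
  also have "\<dots> \<bullet> cyc (Suc (Suc j)) = s j \<bullet> (s (Suc j) \<bullet> (s j \<bullet> cyc (Suc (Suc j))))"
    using assms by (simp add: assoc)
  also have "s j \<bullet> cyc (Suc (Suc j)) = cyc (Suc (Suc j)) \<bullet> s j"
    using assms by (intro s_cyc_below) simp_all
  also have "s j \<bullet> (s (Suc j) \<bullet> \<dots>) = cyc j \<bullet> s j"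
    using assms by (simp add: cyc_Suc[of j] cyc_Suc[of "Suc j"] assoc)
  finally show ?case .
next
  case (step k)
  have "s (Suc j) \<bullet> cyc k = (s (Suc j) \<bullet> s k) \<bullet> cyc (Suc k)" using step assms by (simp add: cyc_Suc assoc)
  also have "\<dots> = (s k \<bullet> s (Suc j)) \<bullet> cyc (Suc k)" using far[of k "Suc j"] step assms by simp
  also have "\<dots> = s k \<bullet> (s (Suc j) \<bullet> cyc (Suc k))" using step assms by (simp add: assoc)
  also have "\<dots> = (s k \<bullet> cyc (Suc k)) \<bullet> s j" using step assms by (simp add: assoc)
  finally show ?case using step assms by (simp add: cyc_Suc)
qed

end

abbreviation adj :: "nat \<Rightarrow> nat \<Rightarrow> nat" where
  "adj k \<equiv> Transposition.transpose k (Suc k)"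

interpretation PC: coxeter UNIV "(\<circ>)" id adj N for N
  by unfold_locales (auto simp: fun_eq_iff Transposition.transpose_def)

definition cp :: "nat \<Rightarrow> nat \<Rightarrow> nat \<Rightarrow> nat" where
  "cp n k = coxeter.cyc (\<circ>) id adj n k"

lemma cp_last_id [simp]: "cp n n = id"
  unfolding cp_def by (rule PC.cyc_N)

lemma cp_Suc: "k < n \<Longrightarrow> cp n k = adj k \<circ> cp n (Suc k)"
  unfolding cp_def by (rule PC.cyc_Suc)

lemma cp_adj: "k < n \<Longrightarrow> adj k \<circ> cp n k = cp n (Suc k)"
  unfolding cp_def by (rule PC.s_cyc)

lemma cp_adj_below: "Suc j < k \<Longrightarrow> k \<le> n \<Longrightarrow> adj j \<circ> cp n k = cp n k \<circ> adj j"
  unfolding cp_def by (rule PC.s_cyc_below)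

lemma cp_adj_above: "k \<le> j \<Longrightarrow> Suc j < n \<Longrightarrow> adj (Suc j) \<circ> cp n k = cp n k \<circ> adj j"
  unfolding cp_def by (rule PC.s_cyc_above)

text \<open>The starting point of the cycle in a normal form can be read off from the image of
  \<open>n\<close>, as the remaining factor fixes \<open>n\<close>.\<close>

lemma cp_last: "k \<le> n \<Longrightarrow> cp n k n = k"
  by (induction rule: inc_induct) (simp_all add: cp_Suc)

lemma adj_permutes: "Suc k < n \<Longrightarrow> adj k permutes {..<n}"
  by (rule permutes_swap_id) auto

lemma cp_permutes:
  assumes "k \<le> n"
  shows "cp n k permutes {..<Suc n}"
  using assms
proof (induction rule: inc_induct)
  case base
  show ?case unfolding cp_last_id by (rule permutes_id)
next
  case (step k)
  show ?case unfolding cp_Suc[OF step(2)] using step by (intro permutes_compose adj_permutes) auto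
qed

section \<open>The symmetric group acting on tensor powers\<close>

context ACU_tensor_cat
begin

lemma tens_Obj [simp]: "(\<And>k. k < n \<Longrightarrow> Xs k \<in> Obj C) \<Longrightarrow> tens C n Xs \<in> Obj C"
  by (induction n) auto

lemma swap_simps [simp]:
  assumes "X \<in> Obj C"
  shows "swap C X n k \<in> Arr C" "Dom C (swap C X n k) = tpow C n X" "Cod C (swap C X n k) = tpow C n X"
proof -
  have "swap C X n k \<in> Arr C \<and> Dom C (swap C X n k) = tpow C n X \<and> Cod C (swap C X n k) = tpow C n X"
    using assms by (induction n) auto
  then show "swap C X n k \<in> Arr C" "Dom C (swap C X n k) = tpow C n X" "Cod C (swap C X n k) = tpow C n X" by auto
qed

declare swap.simps(2) [simp del]

lemma swap_Suc: "Suc k < n \<Longrightarrow> swap C X (Suc n) k = swap C X n k \<otimes>\<^sub>a Id C X"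
  by (simp add: swap.simps(2))

lemma ap_swap_last:
  assumes "objs (lv a)" "ob a = tpow C k X" "X \<in> Obj C" "pos j (lv a @ [X, X]) s"
  shows "ap j (Tn (Tn a (Lf X)) (Lf X), Tn (Tn a (Lf X)) (Lf X), swap C X (Suc (Suc k)) k) s
    = ap (j + length (lv a)) (Sw X X) s"
proof -
  obtain P R where s: "vs s" "fst s = P @ (lv a @ [X, X]) @ R" "length P = j" using assms(4) by (rule posE)
  let ?t = "ap (j + length (lv a)) (Sw X X) s"
  have t: "vs ?t" "fst ?t = P @ (lv a @ [X, X]) @ R" using s assms by simp_all
  have "ap j (Tn a (Tn (Lf X) (Lf X)), Tn a (Tn (Lf X) (Lf X)), Id C (tpow C k X) \<otimes>\<^sub>a Sym C X X) s = ?t"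
    using assms s t ap_Tar[of a a "Id C (tpow C k X)" "Tn (Lf X) (Lf X)" "Tn (Lf X) (Lf X)" "Sym C X X" s j] by simp
  then show ?thesis
    using assms s t by (simp add: swap.simps(2) ap_Comp[of _ "Tn a (Tn (Lf X) (Lf X))"])
qed

lemma swap_square:
  "X \<in> Obj C \<Longrightarrow> Suc k < n \<Longrightarrow> swap C X n k \<cdot> swap C X n k = Id C (tpow C n X)"
proof (induction n)
  case (Suc n)
  show ?case
  proof (cases "Suc k = n")
    case True
    let ?t = "Tn (Tn (Lf (tpow C k X)) (Lf X)) (Lf X)"
    have "swap C X (Suc (Suc k)) k \<cdot> swap C X (Suc (Suc k)) k = Id C (tpow C (Suc (Suc k)) X)"
      using Suc.prems
      by (intro faithful[of ?t ?t]) (simp_all add: ap_Comp[of ?t ?t] ap_swap_last pos_def Sw_Sw)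
    then show ?thesis using True by simp
  next
    case False
    then show ?thesis using Suc by (simp add: swap_Suc Tar_Comp_Arr)
  qed
qed simp

text \<open>Generators that avoid the last factor are tensored with an identity, so the induction
  handles them. In the remaining case all factors that are not moved are drawn as a single strand,
  and the relation is \<open>yang_baxter\<close>; \<open>swap_square\<close> and
  \<open>swap_far\<close> follow the same pattern.\<close>

lemma swap_braid:
  "X \<in> Obj C \<Longrightarrow> Suc (Suc k) < n \<Longrightarrow>
     swap C X n k \<cdot> swap C X n (Suc k) \<cdot> swap C X n k = swap C X n (Suc k) \<cdot> swap C X n k \<cdot> swap C X n (Suc k)"
proof (induction n)
  case (Suc n)
  show ?case
  proof (cases "Suc (Suc k) = n")
    case True
    let ?a = "Tn (Lf (tpow C k X)) (Lf X)"
    let ?t = "Tn (Tn ?a (Lf X)) (Lf X)" and ?n = "Suc (Suc (Suc k))"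
    have 1: "ap 0 (?t, ?t, swap C X ?n (Suc k)) s = ap (Suc (Suc 0)) (Sw X X) s"
      if "vs s" "fst s = [tpow C k X, X, X, X]" for s
      using that Suc.prems ap_swap_last[of ?a "Suc k" X 0 s] by (simp add: pos_def)
    have 2: "ap 0 (?t, ?t, swap C X ?n k) s = ap (Suc 0) (Sw X X) s"
      if "vs s" "fst s = [tpow C k X, X, X, X]" for s
      using that Suc.prems ap_swap_last[of "Lf (tpow C k X)" k X 0 s] by (simp add: pos_def swap_Suc ap_Tar)
    have "swap C X ?n k \<cdot> swap C X ?n (Suc k) \<cdot> swap C X ?n k = swap C X ?n (Suc k) \<cdot> swap C X ?n k \<cdot> swap C X ?n (Suc k)"
      using Suc.prems by (intro faithful[of ?t ?t]) (simp_all add: ap_Comp[of ?t ?t] 1 2 pos_def yang_baxter)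
    then show ?thesis using True by simp
  next
    case False
    then show ?thesis using Suc by (simp add: swap_Suc Tar_Comp_Arr)
  qed
qed simp

lemma swap_far:
  "X \<in> Obj C \<Longrightarrow> Suc j < k \<Longrightarrow> Suc k < n \<Longrightarrow> swap C X n j \<cdot> swap C X n k = swap C X n k \<cdot> swap C X n j"
proof (induction n)
  case (Suc n)
  show ?case
  proof (cases "Suc k = n")
    case True
    let ?t = "Tn (Tn (Lf (tpow C k X)) (Lf X)) (Lf X)" and ?n = "Suc (Suc k)"
    let ?b = "b11 (tpow C k X) (tpow C k X) (swap C X k j)"
    have 1: "ap 0 (?t, ?t, swap C X ?n j) s = ap 0 ?b s"
      if "vs s" "fst s = [tpow C k X, X, X]" for s
      using that Suc.prems by (simp add: swap_Suc ap_Tar)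
    have "ap 0 ?b (ap (Suc 0) (Sw X X) (start [tpow C k X, X, X])) = ap (Suc 0) (Sw X X) (ap 0 ?b (start [tpow C k X, X, X]))"
      using Suc.prems by (subst comm) simp_all
    then have "swap C X ?n j \<cdot> swap C X ?n k = swap C X ?n k \<cdot> swap C X ?n j"
      using Suc.prems by (intro faithful[of ?t ?t]) (simp_all add: ap_Comp[of ?t ?t] 1 ap_swap_last pos_def)
    then show ?thesis using True by simp
  next
    case False
    then show ?thesis using Suc by (simp add: swap_Suc Tar_Comp_Arr)
  qed
qed simp

lemma coxeter_swap:
  assumes "X \<in> Obj C"
  shows "coxeter (Hom C (tpow C (Suc n) X) (tpow C (Suc n) X)) (\<cdot>) (Id C (tpow C (Suc n) X)) (swap C X (Suc n)) n"
proof
  have simp: "tpow C (Suc n) X \<in> Obj C" using assms by simp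
  note [simp del] = tens.simps
  show "\<And>a b c. a \<in> Hom C (tpow C (Suc n) X) (tpow C (Suc n) X) \<Longrightarrow> b \<in> Hom C (tpow C (Suc n) X) (tpow C (Suc n) X) \<Longrightarrow>
       c \<in> Hom C (tpow C (Suc n) X) (tpow C (Suc n) X) \<Longrightarrow> (a \<cdot> b) \<cdot> c = a \<cdot> (b \<cdot> c)"
    using simp by (simp add: in_Hom_iff)
  show "\<And>i j. Suc i < j \<Longrightarrow> j < n \<Longrightarrow> swap C X (Suc n) i \<cdot> swap C X (Suc n) j = swap C X (Suc n) j \<cdot> swap C X (Suc n) i"
    using assms by (intro swap_far) simp_all
qed (use assms in \<open>simp_all add: in_Hom_iff swap_square swap_braid\<close>)

declare id_apply [simp del] comp_apply [simp del]

lemma perm_acts_Hom: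
  assumes "perm_acts C X n \<sigma> f" "X \<in> Obj C"
  shows "f \<in> Hom C (tpow C n X) (tpow C n X)" "\<sigma> permutes {..<n}"
proof -
  have "f \<in> Hom C (tpow C n X) (tpow C n X) \<and> \<sigma> permutes {..<n}"
    using assms(1)
  proof (induction rule: perm_acts.induct)
    case 1
    show ?case using assms(2) by (intro conjI permutes_id) (simp add: in_Hom_iff)
  next
    case (2 \<sigma> f k)
    then show ?case using assms(2) by (intro conjI permutes_compose adj_permutes) (simp_all add: in_Hom_iff)
  qed
  then show "f \<in> Hom C (tpow C n X) (tpow C n X)" "\<sigma> permutes {..<n}" by auto
qed

lemma perm_acts_lift:
  assumes "perm_acts C X n \<sigma> f" "X \<in> Obj C"
  shows "perm_acts C X (Suc n) \<sigma> (f \<otimes>\<^sub>a Id C X)"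
  using assms(1)
proof (induction rule: perm_acts.induct)
  case 1
  then show ?case using perm_acts.intros(1)[where X = X and n = "Suc n"] assms(2) by (simp del: id_apply)
next
  case (2 \<sigma> f k)
  have "f \<in> Hom C (tpow C n X) (tpow C n X)" using perm_acts_Hom 2 assms(2) by blast
  then have "(swap C X n k \<cdot> f) \<otimes>\<^sub>a Id C X = swap C X (Suc n) k \<cdot> (f \<otimes>\<^sub>a Id C X)"
    using 2 assms(2) by (simp add: swap_Suc whisk_right in_Hom_iff)
  then show ?case using perm_acts.intros(2)[OF 2(3), of k] 2(2) by simp
qed

text \<open>Induction over words in the generators. Multiplying a normal form by a further generator
  obeys the same Coxeter relations for permutations and for morphisms, so both keep normal forms
  with the same cycle and with corresponding remaining factors.\<close>

lemma perm_acts_cases: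
  assumes X: "X \<in> Obj C" and "perm_acts C X (Suc n) \<sigma> f"
  shows "\<exists>k \<sigma>' f'. k \<le> n \<and> perm_acts C X n \<sigma>' f' \<and> \<sigma> = cp n k \<circ> \<sigma>' \<and>
     f = coxeter.cyc (\<cdot>) (Id C (tpow C (Suc n) X)) (swap C X (Suc n)) n k \<cdot> (f' \<otimes>\<^sub>a Id C X)"
  using assms(2)
proof (induction rule: perm_acts.induct)
  interpret E: coxeter "Hom C (tpow C (Suc n) X) (tpow C (Suc n) X)" "(\<cdot>)" "Id C (tpow C (Suc n) X)" "swap C X (Suc n)" n
    using X by (rule coxeter_swap)
  note [simp del] = tens.simps(2)
  have T: "tpow C n X \<otimes>\<^sub>o X = tpow C (Suc n) X" by (simp add: tens.simps(2))
  have cl: "E.cyc k \<in> Arr C" "Dom C (E.cyc k) = tpow C (Suc n) X" "Cod C (E.cyc k) = tpow C (Suc n) X" if "k \<le> n" for k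
    using E.cyc_closed[OF that] by (simp_all add: in_Hom_iff)
  {
    case 1
    have "perm_acts C X n id (Id C (tpow C n X))" by (rule perm_acts.intros)
    moreover have "Id C (tpow C (Suc n) X) = E.cyc n \<cdot> (Id C (tpow C n X) \<otimes>\<^sub>a Id C X)" using X by (simp add: T)
    ultimately show ?case by (intro exI[of _ n] exI[of _ id] exI[of _ "Id C (tpow C n X)"]) auto
  next
    case (2 \<sigma> f j)
    then obtain k \<sigma>' f' where k: "k \<le> n" "perm_acts C X n \<sigma>' f'" "\<sigma> = cp n k \<circ> \<sigma>'" "f = E.cyc k \<cdot> (f' \<otimes>\<^sub>a Id C X)" by auto
    have f': "f' \<in> Arr C" "Dom C f' = tpow C n X" "Cod C f' = tpow C n X"
      using perm_acts_Hom[OF k(2) X] by (simp_all add: in_Hom_iff)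
    have j: "j < n" using 2 by simp
    have eq: "swap C X (Suc n) j \<cdot> f = (swap C X (Suc n) j \<cdot> E.cyc k) \<cdot> (f' \<otimes>\<^sub>a Id C X)"
      using k f' X cl by (simp add: T)
    have eq': "adj j \<circ> \<sigma> = (adj j \<circ> cp n k) \<circ> \<sigma>'" using k by (simp add: comp_assoc)
    \<comment> \<open>In the first two cases the cycle is lengthened or shortened by one letter. In
      the other two the generator passes through the cycle and is taken over by the factor on
      \<open>n\<close> strands, with index \<open>j\<close> or \<open>j - 1\<close>.\<close>
    consider "Suc j = k" | "j = k" | "Suc j < k" | "k < j" by linarith
    then show ?case
    proof cases
      case 1
      then have "swap C X (Suc n) j \<cdot> E.cyc k = E.cyc j" "adj j \<circ> cp n k = cp n j"
        using j E.cyc_Suc[of j] cp_Suc[of j n] by auto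
      then show ?thesis using eq eq' k j by (metis less_imp_le)
    next
      case 2
      then have "swap C X (Suc n) j \<cdot> E.cyc k = E.cyc (Suc j)" "adj j \<circ> cp n k = cp n (Suc j)"
        using j E.s_cyc[of j] cp_adj[of j n] by auto
      then show ?thesis using eq eq' k j by (metis Suc_leI)
    next
      case 3
      have "swap C X (Suc n) j \<cdot> E.cyc k = E.cyc k \<cdot> swap C X (Suc n) j" "adj j \<circ> cp n k = cp n k \<circ> adj j"
        using 3 k E.s_cyc_below[of j k] cp_adj_below[of j k n] by auto
      moreover have "swap C X (Suc n) j \<cdot> (f' \<otimes>\<^sub>a Id C X) = (swap C X n j \<cdot> f') \<otimes>\<^sub>a Id C X"
        using 3 k f' X by (simp add: swap_Suc whisk_right)
      ultimately have "swap C X (Suc n) j \<cdot> f = E.cyc k \<cdot> ((swap C X n j \<cdot> f') \<otimes>\<^sub>a Id C X)"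
        "adj j \<circ> \<sigma> = cp n k \<circ> (adj j \<circ> \<sigma>')"
        using eq eq' cl[OF k(1)] f' X by (simp_all add: T comp_assoc)
      moreover have "perm_acts C X n (adj j \<circ> \<sigma>') (swap C X n j \<cdot> f')" using 3 k by (intro perm_acts.intros) auto
      ultimately show ?thesis using k by blast
    next
      case 4
      then obtain i where i: "j = Suc i" "k \<le> i" by (cases j) auto
      have "swap C X (Suc n) j \<cdot> E.cyc k = E.cyc k \<cdot> swap C X (Suc n) i" "adj j \<circ> cp n k = cp n k \<circ> adj i"
        using i j k E.s_cyc_above[of k i] cp_adj_above[of k i n] by auto
      moreover have "swap C X (Suc n) i \<cdot> (f' \<otimes>\<^sub>a Id C X) = (swap C X n i \<cdot> f') \<otimes>\<^sub>a Id C X"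
        using i j k f' X by (simp add: swap_Suc whisk_right)
      ultimately have "swap C X (Suc n) j \<cdot> f = E.cyc k \<cdot> ((swap C X n i \<cdot> f') \<otimes>\<^sub>a Id C X)"
        "adj j \<circ> \<sigma> = cp n k \<circ> (adj i \<circ> \<sigma>')"
        using eq eq' cl[OF k(1)] f' X by (simp_all add: T comp_assoc)
      moreover have "perm_acts C X n (adj i \<circ> \<sigma>') (swap C X n i \<cdot> f')" using i j k by (intro perm_acts.intros) auto
      ultimately show ?thesis using k by blast
    qed
  }
qed

lemma perm_acts_0: "perm_acts C X 0 \<sigma> f \<Longrightarrow> \<sigma> = id \<and> f = Id C \<bbbI>"
  by (induction rule: perm_acts.induct) auto

text \<open>Two normal forms of the same permutation have the same cycle, because
  \<open>cp_last\<close> gives its start as the image of \<open>n\<close>; cancelling the cycle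
  leaves two words on \<open>n\<close> strands for the induction.\<close>

lemma perm_acts_unique:
  assumes X: "X \<in> Obj C"
  shows "perm_acts C X n \<sigma> f \<Longrightarrow> perm_acts C X n \<sigma> g \<Longrightarrow> f = g"
proof (induction n arbitrary: \<sigma> f g)
  case 0
  then show ?case using perm_acts_0 by metis
next
  case (Suc n)
  let ?c = "coxeter.cyc (\<cdot>) (Id C (tpow C (Suc n) X)) (swap C X (Suc n)) n"
  obtain k \<sigma>' f' where k: "k \<le> n" "perm_acts C X n \<sigma>' f'" "\<sigma> = cp n k \<circ> \<sigma>'" "f = ?c k \<cdot> (f' \<otimes>\<^sub>a Id C X)"
    using perm_acts_cases[OF X Suc.prems(1)] by blast
  obtain l \<tau> g' where l: "l \<le> n" "perm_acts C X n \<tau> g'" "\<sigma> = cp n l \<circ> \<tau>" "g = ?c l \<cdot> (g' \<otimes>\<^sub>a Id C X)"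
    using perm_acts_cases[OF X Suc.prems(2)] by blast
  have fx: "\<sigma>' n = n" "\<tau> n = n" using perm_acts_Hom(2)[OF k(2) X] perm_acts_Hom(2)[OF l(2) X] by (auto simp: permutes_def)
  have "\<sigma> n = k" unfolding k(3) using k(1) fx by (simp add: cp_last comp_apply)
  moreover have "\<sigma> n = l" unfolding l(3) using l(1) fx by (simp add: cp_last comp_apply)
  ultimately have kl: "k = l" by simp
  have "Hilbert_Choice.inv (cp n k) \<circ> (cp n k \<circ> \<sigma>') = Hilbert_Choice.inv (cp n k) \<circ> (cp n k \<circ> \<tau>)" using k(3) l(3) kl by simp
  then have "\<sigma>' = \<tau>" using permutes_inv_o(2)[OF cp_permutes[OF k(1)]] by (simp flip: comp_assoc)
  then show ?case using Suc.IH k l kl by blast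
qed

lemma perm_acts_cyc:
  assumes "k \<le> n" "perm_acts C X (Suc n) \<sigma> f"
  shows "\<exists>g. perm_acts C X (Suc n) (cp n k \<circ> \<sigma>) g"
  using assms(1)
proof (induction rule: inc_induct)
  case base
  then show ?case using assms(2) by auto
next
  case (step k)
  then obtain g where "perm_acts C X (Suc n) (cp n (Suc k) \<circ> \<sigma>) g" by auto
  from perm_acts.intros(2)[OF this, of k] show ?case using step by (auto simp: cp_Suc comp_assoc)
qed

lemma perm_acts_exists:
  assumes X: "X \<in> Obj C"
  shows "\<sigma> permutes {..<n} \<Longrightarrow> \<exists>f. perm_acts C X n \<sigma> f"
proof (induction n arbitrary: \<sigma>)
  case 0
  then have "\<sigma> = id" by simp
  then show ?case using perm_acts.intros(1)[of C X 0] by metis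
next
  case (Suc n)
  let ?k = "\<sigma> n" let ?\<tau> = "Hilbert_Choice.inv (cp n ?k) \<circ> \<sigma>"
  have k: "?k \<le> n" using Suc.prems permutes_in_image[OF Suc.prems, of n] by simp
  note cp = cp_permutes[OF k]
  have t: "?\<tau> permutes {..<Suc n}" by (intro permutes_compose permutes_inv cp Suc.prems)
  have "Hilbert_Choice.inv (cp n ?k) ?k = n" unfolding permutes_inv_eq[OF cp] by (rule cp_last[OF k])
  then have tn: "?\<tau> n = n" by (simp only: comp_apply)
  have "?\<tau> permutes {..<n}"
  proof (rule permutes_superset[OF t])
    fix x assume "x \<in> {..<Suc n} - {..<n}"
    then have "x = n" by auto
    then show "?\<tau> x = x" using tn by simp
  qed
  then obtain f where "perm_acts C X n ?\<tau> f" using Suc.IH by blast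
  then have "perm_acts C X (Suc n) ?\<tau> (f \<otimes>\<^sub>a Id C X)" using X by (rule perm_acts_lift)
  from perm_acts_cyc[OF k this] obtain g where "perm_acts C X (Suc n) (cp n ?k \<circ> ?\<tau>) g" by blast
  moreover have "cp n ?k \<circ> ?\<tau> = \<sigma>" using permutes_inv_o(1)[OF cp] by (simp flip: comp_assoc)
  ultimately show ?case by auto
qed

lemma perm_mor_eqI: "X \<in> Obj C \<Longrightarrow> perm_acts C X n \<sigma> f \<Longrightarrow> perm_mor C X n \<sigma> = f"
  unfolding perm_mor_def using perm_acts_unique by blast

lemma perm_mor_acts: "X \<in> Obj C \<Longrightarrow> \<sigma> permutes {..<n} \<Longrightarrow> perm_acts C X n \<sigma> (perm_mor C X n \<sigma>)"
  using perm_acts_exists perm_mor_eqI by metis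

lemma perm_mor_simps [simp]:
  assumes "X \<in> Obj C" "\<sigma> permutes {..<n}"
  shows "perm_mor C X n \<sigma> \<in> Arr C" "Dom C (perm_mor C X n \<sigma>) = tpow C n X" "Cod C (perm_mor C X n \<sigma>) = tpow C n X"
  using perm_acts_Hom(1)[OF perm_mor_acts[OF assms] assms(1)] by (simp_all add: in_Hom_iff)

lemma perm_mor_id [simp]: "X \<in> Obj C \<Longrightarrow> perm_mor C X n id = Id C (tpow C n X)"
  by (intro perm_mor_eqI perm_acts.intros)

lemma perm_mor_adj_comp:
  assumes "X \<in> Obj C" "\<sigma> permutes {..<n}" "Suc k < n"
  shows "perm_mor C X n (adj k \<circ> \<sigma>) = swap C X n k \<cdot> perm_mor C X n \<sigma>"
  using assms by (intro perm_mor_eqI perm_acts.intros perm_mor_acts)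

lemma perm_mor_adj: "X \<in> Obj C \<Longrightarrow> Suc k < n \<Longrightarrow> perm_mor C X n (adj k) = swap C X n k"
  using perm_mor_adj_comp[of X id n k, OF _ permutes_id] by simp

lemma perm_mor_lift:
  "X \<in> Obj C \<Longrightarrow> \<sigma> permutes {..<n} \<Longrightarrow> perm_mor C X (Suc n) \<sigma> = perm_mor C X n \<sigma> \<otimes>\<^sub>a Id C X"
  by (intro perm_mor_eqI perm_acts_lift perm_mor_acts)

lemma perm_mor_comp:
  assumes X: "X \<in> Obj C" and \<sigma>: "\<sigma> permutes {..<n}" and \<tau>: "\<tau> permutes {..<n}"
  shows "perm_mor C X n (\<sigma> \<circ> \<tau>) = perm_mor C X n \<sigma> \<cdot> perm_mor C X n \<tau>"
proof -
  have "perm_acts C X n \<sigma> f \<Longrightarrow> perm_mor C X n (\<sigma> \<circ> \<tau>) = f \<cdot> perm_mor C X n \<tau>" for f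
  proof (induction rule: perm_acts.induct)
    case 1
    then show ?case using X \<tau> by simp
  next
    case (2 \<sigma> f k)
    have "\<sigma> permutes {..<n}" "f \<in> Hom C (tpow C n X) (tpow C n X)" using perm_acts_Hom[OF 2(1) X] by auto
    then show ?case
      using 2 X \<tau> perm_mor_adj_comp[of X "\<sigma> \<circ> \<tau>" n k] permutes_compose[OF \<tau>] by (simp add: comp_assoc in_Hom_iff)
  qed
  from this[OF perm_mor_acts[OF X \<sigma>]] show ?thesis .
qed

text \<open>Induction along a word in adjacent transpositions, so that statements on all
  permutations need only be checked for multiplication by a generator.\<close>

lemma perm_mor_induct [consumes 2, case_names id adj]:
  assumes X: "X \<in> Obj C" and "\<sigma> permutes {..<n}"
    and "P id (Id C (tpow C n X))"
    and "\<And>\<sigma> k. \<sigma> permutes {..<n} \<Longrightarrow> Suc k < n \<Longrightarrow> P \<sigma> (perm_mor C X n \<sigma>) \<Longrightarrow>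
      P (adj k \<circ> \<sigma>) (swap C X n k \<cdot> perm_mor C X n \<sigma>)"
  shows "P \<sigma> (perm_mor C X n \<sigma>)"
proof -
  have "perm_acts C X n \<sigma> f \<Longrightarrow> P \<sigma> f" for f
  proof (induction rule: perm_acts.induct)
    case (2 \<sigma> f k)
    have "perm_mor C X n \<sigma> = f" using X 2(1) by (rule perm_mor_eqI)
    then show ?case using assms(4)[of \<sigma> k] 2 perm_acts_Hom(2)[OF 2(1) X] by auto
  qed (use assms(3) in auto)
  from this[OF perm_mor_acts[OF assms(1,2)]] show ?thesis .
qed

declare id_apply [simp] comp_apply [simp]

end

section \<open>Antisymmetrizers\<close>

context rat_linear_additive_cat
begin

abbreviation hsum :: "'a \<Rightarrow> 'a \<Rightarrow> ('i \<Rightarrow> 'b) \<Rightarrow> 'i set \<Rightarrow> 'b" where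
  "hsum X Y f S \<equiv> finsum (hom_module C X Y) f S"

lemma hsum_closed:
  assumes "X \<in> Obj C" "Y \<in> Obj C" "\<And>i. i \<in> S \<Longrightarrow> f i \<in> Hom C X Y"
  shows "hsum X Y f S \<in> Hom C X Y"
proof -
  interpret M: abelian_group "hom_module C X Y" using assms by (intro hom_abelian_group)
  show ?thesis using M.finsum_closed[of f S] assms by auto
qed

lemma hsum_cong:
  assumes "X \<in> Obj C" "Y \<in> Obj C" "S = T" "\<And>i. i \<in> T \<Longrightarrow> g i \<in> Hom C X Y" "\<And>i. i \<in> T \<Longrightarrow> f i = g i"
  shows "hsum X Y f S = hsum X Y g T"
proof -
  interpret M: abelian_group "hom_module C X Y" using assms by (intro hom_abelian_group)
  show ?thesis using assms by (intro M.finsum_cong') auto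
qed

lemma hsum_insert:
  assumes "X \<in> Obj C" "Y \<in> Obj C" "finite S" "a \<notin> S" "\<And>i. i \<in> S \<Longrightarrow> f i \<in> Hom C X Y" "f a \<in> Hom C X Y"
  shows "hsum X Y f (insert a S) = Add C (f a) (hsum X Y f S)"
proof -
  interpret M: abelian_group "hom_module C X Y" using assms by (intro hom_abelian_group)
  show ?thesis using M.finsum_insert[of S a f] assms by auto
qed

lemma hsum_Un:
  assumes "X \<in> Obj C" "Y \<in> Obj C" "finite S" "finite T" "S \<inter> T = {}" "\<And>i. i \<in> S \<union> T \<Longrightarrow> f i \<in> Hom C X Y"
  shows "hsum X Y f (S \<union> T) = Add C (hsum X Y f S) (hsum X Y f T)"
proof -
  interpret M: abelian_group "hom_module C X Y" using assms by (intro hom_abelian_group)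
  show ?thesis using M.finsum_Un_disjoint[of S T f] assms by auto
qed

lemma hsum_reindex:
  assumes "X \<in> Obj C" "Y \<in> Obj C" "inj_on h S" "\<And>i. i \<in> h ` S \<Longrightarrow> f i \<in> Hom C X Y"
  shows "hsum X Y f (h ` S) = hsum X Y (\<lambda>i. f (h i)) S"
proof -
  interpret M: abelian_group "hom_module C X Y" using assms by (intro hom_abelian_group)
  show ?thesis using assms by (intro M.finsum_reindex) auto
qed

text \<open>Formulated for any additive map, as it is applied to compositions on either side, to
  scalar multiplication and to partial traces.\<close>

lemma hsum_map:
  assumes o: "X \<in> Obj C" "Y \<in> Obj C" "X' \<in> Obj C" "Y' \<in> Obj C" and "finite S"
    and f: "\<And>i. i \<in> S \<Longrightarrow> f i \<in> Hom C X Y"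
    and \<phi>: "\<And>a. a \<in> Hom C X Y \<Longrightarrow> \<phi> a \<in> Hom C X' Y'"
      "\<And>a b. a \<in> Hom C X Y \<Longrightarrow> b \<in> Hom C X Y \<Longrightarrow> \<phi> (Add C a b) = Add C (\<phi> a) (\<phi> b)"
  shows "\<phi> (hsum X Y f S) = hsum X' Y' (\<lambda>i. \<phi> (f i)) S"
proof -
  interpret M: abelian_group "hom_module C X Y" using o by (intro hom_abelian_group)
  interpret N: abelian_group "hom_module C X' Y'" using o by (intro hom_abelian_group)
  show ?thesis
    using \<open>finite S\<close> f
  proof (induction S)
    case empty
    have z: "Zer C X Y \<in> Hom C X Y" using M.zero_closed by simp
    \<comment> \<open>The image of zero is its own double, hence zero.\<close>
    then have "\<phi> (Zer C X Y) = Add C (\<phi> (Zer C X Y)) (\<phi> (Zer C X Y))"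
      using M.l_zero[of "Zer C X Y"] \<phi>(2)[OF z z] by simp
    then have "\<phi> (Zer C X Y) = Zer C X' Y'"
      using N.add.l_cancel_one'[of "\<phi> (Zer C X Y)" "\<phi> (Zer C X Y)"] \<phi>(1)[OF z] by simp
    then show ?case by simp
  next
    case (insert a S)
    have "hsum X Y f S \<in> Hom C X Y" using insert o by (intro hsum_closed) auto
    then show ?case using insert o \<phi> by (simp add: hsum_insert)
  qed
qed

lemma hsum_const:
  assumes "finite S" "a \<in> Hom C X Y" "S \<noteq> {}"
  shows "hsum X Y (\<lambda>_. a) S = Scl C (of_nat (card S)) a"
proof -
  have o: "X \<in> Obj C" "Y \<in> Obj C" "a \<in> Arr C" using assms by (auto simp: in_Hom_iff)
  interpret M: abelian_group "hom_module C X Y" using o by (intro hom_abelian_group)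
  show ?thesis using assms(1,3)
  proof (induction S rule: finite_ne_induct)
    case (singleton x)
    then show ?case using hsum_insert[of X Y "{}" x "\<lambda>_. a"] o assms M.r_zero[of a] by simp
  next
    case (insert x S)
    then show ?case using hsum_insert[of X Y S x "\<lambda>_. a"] o assms Scl_add[of a 1 "of_nat (card S)"] by simp
  qed
qed

lemma Scl_hsum:
  assumes "X \<in> Obj C" "Y \<in> Obj C" "finite S" "\<And>i. i \<in> S \<Longrightarrow> f i \<in> Hom C X Y"
  shows "Scl C q (hsum X Y f S) = hsum X Y (\<lambda>i. Scl C q (f i)) S"
  using assms by (intro hsum_map) (auto simp: in_Hom_iff)

end

context ACU_tensor_cat
begin

abbreviation perms :: "nat \<Rightarrow> (nat \<Rightarrow> nat) set" where
  "perms n \<equiv> {\<sigma>. \<sigma> permutes {..<n}}"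

abbreviation sgnr :: "(nat \<Rightarrow> nat) \<Rightarrow> rat" where
  "sgnr \<sigma> \<equiv> of_int (sign \<sigma>)"

lemma finite_perms [simp]: "finite (perms n)"
  by (simp add: finite_permutations)

lemma card_perms [simp]: "card (perms n) = fact n"
  by (subst card_permutations) simp_all

lemma perms_nonempty [simp]: "perms n \<noteq> {}"
  using permutes_id by blast

lemma sgnr_sq [simp]: "sgnr \<sigma> * sgnr \<sigma> = 1"
  by (simp add: sign_def)

lemma sgnr_comp: "\<sigma> permutes {..<n} \<Longrightarrow> \<tau> permutes {..<n} \<Longrightarrow> sgnr (\<sigma> \<circ> \<tau>) = sgnr \<sigma> * sgnr \<tau>"
  using sign_compose[of \<sigma> \<tau>] permutation_permutes by fastforce

lemma sgnr_adj: "sgnr (adj k) = - 1"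
  by (simp add: sign_swap_id)

lemma antisym_terms:
  assumes "X \<in> Obj C" "\<sigma> \<in> perms n"
  shows "Scl C (sgnr \<sigma>) (perm_mor C X n \<sigma>) \<in> Hom C (tpow C n X) (tpow C n X)"
  using assms by (simp add: in_Hom_iff)

lemma antisym_simps [simp]:
  assumes "X \<in> Obj C"
  shows "antisym C n X \<in> Arr C" "Dom C (antisym C n X) = tpow C n X" "Cod C (antisym C n X) = tpow C n X"
  using hsum_closed[of "tpow C n X" "tpow C n X" "perms n" "\<lambda>\<sigma>. Scl C (sgnr \<sigma>) (perm_mor C X n \<sigma>)"] assms antisym_terms[OF assms]
  unfolding antisym_def by (simp_all add: in_Hom_iff)

text \<open>The sign in the antisymmetrizer cancels the sign in the hypothesis, so all n! summands
  become \<open>B\<close>, and the normalization divides by their number.\<close>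

lemma antisym_absorb:
  assumes X: "X \<in> Obj C" and o: "P \<in> Obj C" "Q \<in> Obj C"
    and \<phi>: "\<And>a. a \<in> Hom C (tpow C n X) (tpow C n X) \<Longrightarrow> \<phi> a \<in> Hom C P Q"
      "\<And>a b. a \<in> Hom C (tpow C n X) (tpow C n X) \<Longrightarrow> b \<in> Hom C (tpow C n X) (tpow C n X) \<Longrightarrow> \<phi> (Add C a b) = Add C (\<phi> a) (\<phi> b)"
      "\<And>a q. a \<in> Hom C (tpow C n X) (tpow C n X) \<Longrightarrow> \<phi> (Scl C q a) = Scl C q (\<phi> a)"
    and s: "\<And>\<sigma>. \<sigma> permutes {..<n} \<Longrightarrow> \<phi> (perm_mor C X n \<sigma>) = Scl C (sgnr \<sigma>) B" and B: "B \<in> Hom C P Q"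
  shows "\<phi> (antisym C n X) = B"
proof -
  have pm: "perm_mor C X n \<sigma> \<in> Hom C (tpow C n X) (tpow C n X)" if "\<sigma> \<in> perms n" for \<sigma>
    using that X by (simp add: in_Hom_iff)
  have "\<phi> (antisym C n X) = Scl C (1 / fact n) (\<phi> (hsum (tpow C n X) (tpow C n X) (\<lambda>\<sigma>. Scl C (sgnr \<sigma>) (perm_mor C X n \<sigma>)) (perms n)))"
    unfolding antisym_def using X antisym_terms[OF X] by (intro \<phi>(3) hsum_closed) auto
  also have "\<phi> (hsum (tpow C n X) (tpow C n X) (\<lambda>\<sigma>. Scl C (sgnr \<sigma>) (perm_mor C X n \<sigma>)) (perms n))
      = hsum P Q (\<lambda>\<sigma>. \<phi> (Scl C (sgnr \<sigma>) (perm_mor C X n \<sigma>))) (perms n)"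
    using X o antisym_terms[OF X] \<phi>(1,2) by (intro hsum_map) auto
  also have "\<dots> = hsum P Q (\<lambda>_. B) (perms n)"
  proof (rule hsum_cong[OF o refl])
    fix \<sigma> assume \<sigma>: "\<sigma> \<in> perms n"
    then show "\<phi> (Scl C (sgnr \<sigma>) (perm_mor C X n \<sigma>)) = B"
      using \<phi>(3)[OF pm[OF \<sigma>]] s[of \<sigma>] B by (simp add: in_Hom_iff)
  qed (use B in auto)
  also have "\<dots> = Scl C (fact n) B"
    using hsum_const[OF finite_perms B perms_nonempty, of n] by simp
  finally show ?thesis using B by (simp add: in_Hom_iff)
qed

text \<open>Multiplication by an adjacent transposition permutes the summands and reverses every
  sign.\<close>

lemma swap_antisym:
  assumes X: "X \<in> Obj C" and k: "Suc k < n"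
  shows "swap C X n k \<cdot> antisym C n X = Scl C (- 1) (antisym C n X)"
    "antisym C n X \<cdot> swap C X n k = Scl C (- 1) (antisym C n X)"
proof -
  let ?T = "tpow C n X" let ?f = "\<lambda>\<sigma>. Scl C (sgnr \<sigma>) (perm_mor C X n \<sigma>)"
  have T: "?T \<in> Obj C" using X by simp
  have ad: "adj k permutes {..<n}" using k by (rule adj_permutes)
  have S: "hsum ?T ?T ?f (perms n) \<in> Hom C ?T ?T" using T antisym_terms[OF X] by (intro hsum_closed) auto
  \<comment> \<open>Composition with \<open>adj k\<close> on either side is an involution of the
    symmetric group, so it only reorders the sum.\<close>
  have *: "hsum ?T ?T (\<lambda>\<sigma>. ?f (h \<sigma>)) (perms n) = hsum ?T ?T ?f (perms n)"
    if h: "h = (\<lambda>\<sigma>. adj k \<circ> \<sigma>) \<or> h = (\<lambda>\<sigma>. \<sigma> \<circ> adj k)" for h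
  proof -
    have inv: "h (h \<sigma>) = \<sigma>" for \<sigma> using h by (auto simp: fun_eq_iff)
    have cl: "h \<sigma> \<in> perms n" if "\<sigma> \<in> perms n" for \<sigma>
      using that h ad permutes_compose by blast
    have "h ` perms n = perms n" using inv cl by (metis (no_types, lifting) image_eqI subsetI subset_antisym image_subsetI)
    moreover have "inj_on h (perms n)" using inv by (metis inj_onI)
    ultimately show ?thesis using hsum_reindex[of ?T ?T h "perms n" ?f] T antisym_terms[OF X] by simp
  qed
  have "swap C X n k \<cdot> hsum ?T ?T ?f (perms n) = hsum ?T ?T (\<lambda>\<sigma>. swap C X n k \<cdot> ?f \<sigma>) (perms n)"
    using X T antisym_terms[OF X]
    by (intro hsum_map) (auto simp: in_Hom_iff intro!: Comp_Add)
  also have "\<dots> = hsum ?T ?T (\<lambda>\<sigma>. Scl C (- 1) (?f (adj k \<circ> \<sigma>))) (perms n)"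
  proof (rule hsum_cong[OF T T refl])
    fix \<sigma> assume \<sigma>: "\<sigma> \<in> perms n"
    then show "swap C X n k \<cdot> ?f \<sigma> = Scl C (- 1) (?f (adj k \<circ> \<sigma>))"
      using X k ad by (simp add: perm_mor_adj_comp sgnr_comp sgnr_adj sign_swap_id del: comp_apply)
  next
    fix \<sigma> assume \<sigma>: "\<sigma> \<in> perms n"
    then show "Scl C (- 1) (?f (adj k \<circ> \<sigma>)) \<in> Hom C ?T ?T"
      using X ad antisym_terms[OF X, of "adj k \<circ> \<sigma>" n] permutes_compose[OF _ ad] by (simp add: in_Hom_iff)
  qed
  also have "\<dots> = Scl C (- 1) (hsum ?T ?T (\<lambda>\<sigma>. ?f (adj k \<circ> \<sigma>)) (perms n))"
    using T antisym_terms[OF X] permutes_compose[OF _ ad] by (intro Scl_hsum[symmetric]) auto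
  finally have 1: "swap C X n k \<cdot> hsum ?T ?T ?f (perms n) = Scl C (- 1) (hsum ?T ?T ?f (perms n))"
    using * by auto
  then show "swap C X n k \<cdot> antisym C n X = Scl C (- 1) (antisym C n X)"
    unfolding antisym_def using X S by (simp add: in_Hom_iff)
  have "hsum ?T ?T ?f (perms n) \<cdot> swap C X n k = hsum ?T ?T (\<lambda>\<sigma>. ?f \<sigma> \<cdot> swap C X n k) (perms n)"
    using X T antisym_terms[OF X]
    by (intro hsum_map[where \<phi> = "\<lambda>a. a \<cdot> swap C X n k"]) (auto simp: in_Hom_iff intro!: Add_Comp)
  also have "\<dots> = hsum ?T ?T (\<lambda>\<sigma>. Scl C (- 1) (?f (\<sigma> \<circ> adj k))) (perms n)"
  proof (rule hsum_cong[OF T T refl])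
    fix \<sigma> assume \<sigma>: "\<sigma> \<in> perms n"
    then show "?f \<sigma> \<cdot> swap C X n k = Scl C (- 1) (?f (\<sigma> \<circ> adj k))"
      using X k ad by (simp add: perm_mor_comp perm_mor_adj sgnr_comp sgnr_adj sign_swap_id del: comp_apply)
  next
    fix \<sigma> assume \<sigma>: "\<sigma> \<in> perms n"
    then show "Scl C (- 1) (?f (\<sigma> \<circ> adj k)) \<in> Hom C ?T ?T"
      using X ad antisym_terms[OF X, of "\<sigma> \<circ> adj k" n] permutes_compose[OF ad] by (simp add: in_Hom_iff)
  qed
  also have "\<dots> = Scl C (- 1) (hsum ?T ?T (\<lambda>\<sigma>. ?f (\<sigma> \<circ> adj k)) (perms n))"
    using T antisym_terms[OF X] permutes_compose[OF ad] by (intro Scl_hsum[symmetric]) auto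
  finally have 2: "hsum ?T ?T ?f (perms n) \<cdot> swap C X n k = Scl C (- 1) (hsum ?T ?T ?f (perms n))"
    using * by auto
  then show "antisym C n X \<cdot> swap C X n k = Scl C (- 1) (antisym C n X)"
    unfolding antisym_def using X S by (simp add: in_Hom_iff)
qed

lemma perm_mor_antisymmetric:
  assumes X: "X \<in> Obj C" and \<sigma>: "\<sigma> permutes {..<n}" and b: "b \<in> Arr C" "Cod C b = tpow C n X"
    and s: "\<And>k. Suc k < n \<Longrightarrow> swap C X n k \<cdot> b = Scl C (- 1) b"
  shows "perm_mor C X n \<sigma> \<cdot> b = Scl C (sgnr \<sigma>) b"
  using X \<sigma>
proof (induction rule: perm_mor_induct)
  case id
  then show ?case using b by (simp add: sign_id)
next
  case (adj \<sigma> k)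
  have "sgnr (adj k \<circ> \<sigma>) = - sgnr \<sigma>"
    using adj sgnr_comp[OF adj_permutes adj(1)] sgnr_adj by simp
  then show ?case using adj X b s by (simp add: comp_def)
qed

text \<open>The form used for absorbing antisymmetrizers: it suffices that \<open>\<phi>\<close>
  changes sign when an adjacent transposition is composed on the left. The sign of a general
  permutation then accumulates along a word.\<close>

lemma antisym_absorb_swap:
  assumes X: "X \<in> Obj C" and o: "P \<in> Obj C" "Q \<in> Obj C"
    and \<phi>: "\<And>a. a \<in> Hom C (tpow C n X) (tpow C n X) \<Longrightarrow> \<phi> a \<in> Hom C P Q"
      "\<And>a b. a \<in> Hom C (tpow C n X) (tpow C n X) \<Longrightarrow> b \<in> Hom C (tpow C n X) (tpow C n X) \<Longrightarrow> \<phi> (Add C a b) = Add C (\<phi> a) (\<phi> b)"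
      "\<And>a q. a \<in> Hom C (tpow C n X) (tpow C n X) \<Longrightarrow> \<phi> (Scl C q a) = Scl C q (\<phi> a)"
    and s: "\<And>a k. a \<in> Hom C (tpow C n X) (tpow C n X) \<Longrightarrow> Suc k < n \<Longrightarrow> \<phi> (swap C X n k \<cdot> a) = Scl C (- 1) (\<phi> a)"
  shows "\<phi> (antisym C n X) = \<phi> (Id C (tpow C n X))"
proof (rule antisym_absorb[OF X o \<phi>])
  have I: "Id C (tpow C n X) \<in> Hom C (tpow C n X) (tpow C n X)" using X by (simp add: in_Hom_iff)
  then show B: "\<phi> (Id C (tpow C n X)) \<in> Hom C P Q" by (rule \<phi>(1))
  fix \<sigma> assume "\<sigma> permutes {..<n}"
  with X show "\<phi> (perm_mor C X n \<sigma>) = Scl C (sgnr \<sigma>) (\<phi> (Id C (tpow C n X)))"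
  proof (induction rule: perm_mor_induct)
    case id
    then show ?case using B by (simp add: sign_id in_Hom_iff)
  next
    case (adj \<sigma> k)
    have "sgnr (adj k \<circ> \<sigma>) = - sgnr \<sigma>"
      using adj sgnr_comp[OF adj_permutes adj(1)] sgnr_adj by simp
    then show ?case using adj X s[of "perm_mor C X n \<sigma>" k] B by (simp add: in_Hom_iff comp_def)
  qed
qed auto

lemma antisym_comp_antisymmetric:
  assumes X: "X \<in> Obj C" and b: "b \<in> Arr C" "Cod C b = tpow C n X"
    and s: "\<And>k. Suc k < n \<Longrightarrow> swap C X n k \<cdot> b = Scl C (- 1) b"
  shows "antisym C n X \<cdot> b = b"
  using X b perm_mor_antisymmetric[OF X _ b s]
  by (intro antisym_absorb[where \<phi> = "\<lambda>a. a \<cdot> b" and P = "Dom C b" and Q = "tpow C n X"])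
     (auto simp: in_Hom_iff intro!: Add_Comp)

lemma antisym_idem: "X \<in> Obj C \<Longrightarrow> antisym C n X \<cdot> antisym C n X = antisym C n X"
  by (rule antisym_comp_antisymmetric) (simp_all add: swap_antisym)

end

section \<open>Exterior powers as direct factors\<close>

context rigid_pseudo_abelian_tensor_cat
begin

text \<open>The choice in \<open>wedge_splitting\<close> is legitimate because the antisymmetrizer
  is idempotent and idempotents split.\<close>

lemma wedge_facts:
  assumes "X \<in> Obj C"
  shows "wedge C i X \<in> Obj C \<and> winj C i X \<in> Hom C (wedge C i X) (tpow C i X) \<and> wprj C i X \<in> Hom C (tpow C i X) (wedge C i X) \<and>
     wprj C i X \<cdot> winj C i X = Id C (wedge C i X) \<and> winj C i X \<cdot> wprj C i X = antisym C i X"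
proof -
  have "antisym C i X \<in> Hom C (tpow C i X) (tpow C i X)" using assms by (simp add: in_Hom_iff)
  from idempotents_split[OF this antisym_idem[OF assms]]
  have "\<exists>x. case x of (W, s, p) \<Rightarrow> W \<in> Obj C \<and> s \<in> Hom C W (tpow C i X) \<and>
     p \<in> Hom C (tpow C i X) W \<and> p \<cdot> s = Id C W \<and> s \<cdot> p = antisym C i X" by auto
  then have "case wedge_splitting C i X of (W, s, p) \<Rightarrow> W \<in> Obj C \<and> s \<in> Hom C W (tpow C i X) \<and>
     p \<in> Hom C (tpow C i X) W \<and> p \<cdot> s = Id C W \<and> s \<cdot> p = antisym C i X"
    unfolding wedge_splitting_def by (rule someI_ex)
  then show ?thesis by (auto simp: wedge_def winj_def wprj_def split: prod.splits)
qed

lemma wedge_simps [simp]: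
  assumes "X \<in> Obj C"
  shows "wedge C i X \<in> Obj C"
    "winj C i X \<in> Arr C" "Dom C (winj C i X) = wedge C i X" "Cod C (winj C i X) = tpow C i X"
    "wprj C i X \<in> Arr C" "Dom C (wprj C i X) = tpow C i X" "Cod C (wprj C i X) = wedge C i X"
    "wprj C i X \<cdot> winj C i X = Id C (wedge C i X)"
  using wedge_facts[OF assms, of i] by (simp_all add: in_Hom_iff)

lemma winj_wprj: "X \<in> Obj C \<Longrightarrow> winj C i X \<cdot> wprj C i X = antisym C i X"
  using wedge_facts by simp

lemma antisym_winj: "X \<in> Obj C \<Longrightarrow> antisym C i X \<cdot> winj C i X = winj C i X"
  by (simp flip: winj_wprj)

lemma wprj_antisym:
  assumes X: "X \<in> Obj C"
  shows "wprj C i X \<cdot> antisym C i X = wprj C i X"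
proof -
  have "wprj C i X \<cdot> antisym C i X = (wprj C i X \<cdot> winj C i X) \<cdot> wprj C i X"
    unfolding winj_wprj[OF X, symmetric] by (rule Comp_assoc_Arr[symmetric]) (use X in simp_all)
  then show ?thesis using X by simp
qed

end

section \<open>Duality of tensor powers\<close>

text \<open>Positions of factors; the simplifier computes with successors only.\<close>

abbreviation (input) p1 :: nat where "p1 \<equiv> Suc 0"
abbreviation (input) p2 :: nat where "p2 \<equiv> Suc p1"
abbreviation (input) p3 :: nat where "p3 \<equiv> Suc p2"
abbreviation (input) p4 :: nat where "p4 \<equiv> Suc p3"

context ACU_tensor_cat
begin

lemma ap_Sym_treeL:
  assumes "vs s" "fst s = P @ (lv t @ [X]) @ R" "length P = k"
  shows "ap k (Tn t (Lf X), Tn (Lf X) t, Sym C (ob t) X) s = mvL X k (lv t) s"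
proof -
  have o: "X \<in> Obj C" "objs (lv t)" using assms by (auto simp: vs_def)
  let ?t = "mvL X k (lv t) s"
  note t = mvL_wf[OF assms]
  have "ap k (Tn t (Lf X), Tn (Lf X) t, Sym C (ob t) X) (ap k (Tn (Lf X) t, Tn t (Lf X), Sym C X (ob t)) ?t)
      = ap k (Tn (Lf X) t, Tn (Lf X) t, Sym C (ob t) X \<cdot> Sym C X (ob t)) ?t"
    using o t assms by (subst ap_Comp) simp_all
  also have "\<dots> = ?t"
    using o t assms by (intro ap_Id') (simp_all add: Sym_Sym)
  finally show ?thesis
    using ap_Sym_tree[OF t(1,2) assms(3)] t(3) by simp
qed

text \<open>The twist crosses the block X, Y with the block X', Y' in four crossings. One of them
  meets its inverse inside \<open>ev1324\<close>, and two of the others provide the twists of the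
  two pairings.\<close>

lemma twist_ev1324:
  assumes o: "X \<in> Obj C" "Y \<in> Obj C" "X' \<in> Obj C" "Y' \<in> Obj C"
    and e: "e \<in> Hom C (X' \<otimes>\<^sub>o X) \<bbbI>" and f: "f \<in> Hom C (Y' \<otimes>\<^sub>o Y) \<bbbI>"
  shows "twist C (X' \<otimes>\<^sub>o Y') (X \<otimes>\<^sub>o Y) (ev1324 C X' Y' X Y e f) = ev1324 C X Y X' Y' (twist C X' X e) (twist C Y' Y f)"
proof (rule faithful[of "Tn (Tn (Lf X) (Lf Y)) (Tn (Lf X') (Lf Y'))" Ut])
  note ef = e[unfolded in_Hom_iff] f[unfolded in_Hom_iff]
  note H = ev1324_Hom[OF o(3,4,1,2) e f, unfolded in_Hom_iff] ev1324_Hom[OF o twist_Hom[OF o(3,1) e] twist_Hom[OF o(4,2) f], unfolded in_Hom_iff]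
  let ?s = "start [X, Y, X', Y']"
  let ?P = "X \<otimes>\<^sub>o Y"
  let ?t = "Tn (Lf X) (Lf Y)"
  have s1: "ap 0 (Tn ?t (Lf X'), Tn (Lf X') ?t, Sym C ?P X') ?s = ap 0 (Sw X X') (ap p1 (Sw Y X') ?s)"
    using ap_Sym_treeL[of ?s "[]" ?t X' "[Y']" 0] o by simp
  have s2: "ap p1 (Tn ?t (Lf Y'), Tn (Lf Y') ?t, Sym C ?P Y') s = ap p1 (Sw X Y') (ap p2 (Sw Y Y') s)"
    if "vs s" "fst s = [X', X, Y, Y']" for s
    using ap_Sym_treeL[of s "[X']" ?t Y' "[]" p1] o that by simp
  have "ap 0 (Tn ?t (Tn (Lf X') (Lf Y')), Tn (Tn (Lf X') (Lf Y')) ?t, Sym C ?P (X' \<otimes>\<^sub>o Y')) ?s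
     = ap p1 (Sw X Y') (ap p2 (Sw Y Y') (ap 0 (Sw X X') (ap p1 (Sw Y X') ?s)))"
    using o s1 s2 by (simp add: Sym_Tn ap_Comp[of _ "Tn (Lf X') (Tn (Lf Y') ?t)"] ap_Comp[of _ "Tn (Lf X') (Tn ?t (Lf Y'))"]
        ap_Comp[of _ "Tn (Tn (Lf X') ?t) (Lf Y')"] ap_Comp[of _ "Tn (Tn ?t (Lf X')) (Lf Y')"] ap_Tar)
  then have "ap 0 (Tn ?t (Tn (Lf X') (Lf Y')), Ut, twist C (X' \<otimes>\<^sub>o Y') ?P (ev1324 C X' Y' X Y e f)) ?s
     = ap 0 (b20 X' X e) (ap p2 (b20 Y' Y f) (ap p1 (Sw Y' X)
        (ap p1 (Sw X Y') (ap p2 (Sw Y Y') (ap 0 (Sw X X') (ap p1 (Sw Y X') ?s))))))"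
    using o H ef unfolding twist_def by (simp add: ap_Comp[of _ "Tn (Tn (Lf X') (Lf Y')) ?t"] ap_ev1324 pos_def e f)
  also have "\<dots> = ap 0 (b20 X' X e) (ap p2 (b20 Y' Y f) (ap p2 (Sw Y Y') (ap 0 (Sw X X') (ap p1 (Sw Y X') ?s))))"
    using o by (simp add: Sw_Sw pos_def)
  also have "\<dots> = ap 0 (b20 X' X e) (ap 0 (Sw X X') (ap p2 (b20 Y' Y f) (ap p2 (Sw Y Y') (ap p1 (Sw Y X') ?s))))"
    using o ef by (simp add: comm[of "Sw X X'" "b20 Y' Y f" _ 0 p2]
        comm[of "Sw X X'" "Sw Y Y'" _ 0 p2])
  also have "\<dots> = ap 0 (Tn ?t (Tn (Lf X') (Lf Y')), Ut, ev1324 C X Y X' Y' (twist C X' X e) (twist C Y' Y f)) ?s"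
    using o ef by (simp add: ap_ev1324 ap_twist twist_Hom pos_def e f)
  finally show "ap 0 (Tn ?t (Tn (Lf X') (Lf Y')), Ut, twist C (X' \<otimes>\<^sub>o Y') ?P (ev1324 C X' Y' X Y e f)) (start (lv (Tn ?t (Tn (Lf X') (Lf Y')))))
     = ap 0 (Tn ?t (Tn (Lf X') (Lf Y')), Ut, ev1324 C X Y X' Y' (twist C X' X e) (twist C Y' Y f)) (start (lv (Tn ?t (Tn (Lf X') (Lf Y')))))"
    by simp
  show "wb (Tn ?t (Tn (Lf X') (Lf Y')), Ut, twist C (X' \<otimes>\<^sub>o Y') ?P (ev1324 C X' Y' X Y e f))"
    using o H by (simp add: twist_def)
  show "wb (Tn ?t (Tn (Lf X') (Lf Y')), Ut, ev1324 C X Y X' Y' (twist C X' X e) (twist C Y' Y f))"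
    using o H by simp
qed

definition tensor_coev :: "'a \<Rightarrow> 'a \<Rightarrow> 'a \<Rightarrow> 'a \<Rightarrow> 'b \<Rightarrow> 'b \<Rightarrow> 'b" where
  "tensor_coev X X' Y Y' c d = interchange C X X' Y Y' \<cdot> (c \<otimes>\<^sub>a d) \<cdot> Inv C (Lun C \<bbbI>)"

lemma ap_tensor_coev:
  assumes "vs s" "k \<le> length (fst s)" "X \<in> Obj C" "Y \<in> Obj C" "X' \<in> Obj C" "Y' \<in> Obj C"
    "c \<in> Hom C \<bbbI> (X \<otimes>\<^sub>o X')" "d \<in> Hom C \<bbbI> (Y \<otimes>\<^sub>o Y')"
  shows "ap k (Ut, Tn (Tn (Lf X) (Lf Y)) (Tn (Lf X') (Lf Y')), tensor_coev X X' Y Y' c d) s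
    = ap (Suc k) (Sw X' Y) (ap k (b02 X X' c) (ap k (b02 Y Y' d) s))"
  using assms interchange_Hom[of X X' Y Y'] unfolding tensor_coev_def
  by (simp add: in_Hom_iff ap_Comp[of _ "Tn (Tn (Lf X) (Lf X')) (Tn (Lf Y) (Lf Y'))"] ap_Comp[of _ "Tn Ut Ut"] ap_Tar ap_interchange pos_def)

lemma tensor_coev_Hom:
  assumes "X \<in> Obj C" "Y \<in> Obj C" "X' \<in> Obj C" "Y' \<in> Obj C"
    "c \<in> Hom C \<bbbI> (X \<otimes>\<^sub>o X')" "d \<in> Hom C \<bbbI> (Y \<otimes>\<^sub>o Y')"
  shows "tensor_coev X X' Y Y' c d \<in> Hom C \<bbbI> ((X \<otimes>\<^sub>o Y) \<otimes>\<^sub>o (X' \<otimes>\<^sub>o Y'))"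
  using assms interchange_Hom[of X X' Y Y'] unfolding tensor_coev_def by (simp add: in_Hom_iff)

text \<open>Allows the zigzags of compound objects to be checked strand by strand. The zigzag
  composites \<open>z\<close> and \<open>z'\<close> are ordinary morphisms: drawn along the leaves
  of \<open>t\<close> and \<open>t'\<close> they are shown to be identities, drawn along single
  strands they give \<open>perf\<close>.\<close>

lemma perfI_tree:
  assumes o: "objs (lv t)" "objs (lv t')" and e: "e \<in> Hom C (ob t' \<otimes>\<^sub>o ob t) \<bbbI>" and c: "c \<in> Hom C \<bbbI> (ob t \<otimes>\<^sub>o ob t')"
    and 1: "ap (length (lv t)) (Tn t' t, Ut, e) (ap 0 (Ut, Tn t t', c) (start (lv t))) = start (lv t)"
    and 2: "ap 0 (Tn t' t, Ut, e) (ap (length (lv t')) (Ut, Tn t t', c) (start (lv t'))) = start (lv t')"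
  shows "perf (ob t) (ob t') e c"
proof -
  let ?X = "ob t" and ?X' = "ob t'"
  note ec = e[unfolded in_Hom_iff] c[unfolded in_Hom_iff]
  define z where "z = Run C ?X \<cdot> ((Id C ?X \<otimes>\<^sub>a e) \<cdot> (Asc C ?X ?X' ?X \<cdot> ((c \<otimes>\<^sub>a Id C ?X) \<cdot> Inv C (Lun C ?X))))"
  define z' where "z' = Lun C ?X' \<cdot> ((e \<otimes>\<^sub>a Id C ?X') \<cdot> (Inv C (Asc C ?X' ?X ?X') \<cdot> ((Id C ?X' \<otimes>\<^sub>a c) \<cdot> Inv C (Run C ?X'))))"
  have H: "z \<in> Arr C" "Dom C z = ?X" "Cod C z = ?X" "z' \<in> Arr C" "Dom C z' = ?X'" "Cod C z' = ?X'"
    using o ec by (simp_all add: z_def z'_def)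
  have z: "ap 0 (a, a, z) (start (lv a)) = ap (length (lv a)) (Tn a' a, Ut, e) (ap 0 (Ut, Tn a a', c) (start (lv a)))"
    if a: "ob a = ?X" "ob a' = ?X'" "objs (lv a)" "objs (lv a')" for a a'
  proof -
    let ?s = "ap 0 (Ut, Tn a a', c) (start (lv a))"
    have s: "vs ?s" "fst ?s = lv a @ lv a' @ lv a" using a ec by simp_all
    have v: "vs (ap (length (lv a)) (Tn a' a, Ut, e) ?s)" "fst (ap (length (lv a)) (Tn a' a, Ut, e) ?s) = lv a"
      using a ec s by simp_all
    have 1: "ap 0 (Tn Ut a, Tn (Tn a a') a, c \<otimes>\<^sub>a Id C (ob a)) (start (lv a)) = ?s"
      using a ec o by (subst ap_Tar) simp_all
    have 2: "ap 0 (Tn (Tn a a') a, Tn a (Tn a' a), Asc C (ob a) (ob a') (ob a)) ?s = ?s"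
      using a s by (intro ap_Asc(1)) simp_all
    have 3: "ap 0 (Tn a (Tn a' a), Tn a Ut, Id C (ob a) \<otimes>\<^sub>a e) ?s = ap (length (lv a)) (Tn a' a, Ut, e) ?s"
      using a ec o s v by (subst ap_Tar) simp_all
    show ?thesis
      unfolding z_def a(1,2)[symmetric] using a ec s v 1 2 3 o
      by (simp add: ap_Comp[of _ "Tn a Ut"] ap_Comp[of _ "Tn a (Tn a' a)"] ap_Comp[of _ "Tn (Tn a a') a"] ap_Comp[of _ "Tn Ut a"])
  qed
  have z': "ap 0 (a', a', z') (start (lv a')) = ap 0 (Tn a' a, Ut, e) (ap (length (lv a')) (Ut, Tn a a', c) (start (lv a')))"
    if a: "ob a = ?X" "ob a' = ?X'" "objs (lv a)" "objs (lv a')" for a a'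
  proof -
    let ?s = "ap (length (lv a')) (Ut, Tn a a', c) (start (lv a'))"
    have s: "vs ?s" "fst ?s = lv a' @ lv a @ lv a'" using a ec by simp_all
    have v: "vs (ap 0 (Tn a' a, Ut, e) ?s)" "fst (ap 0 (Tn a' a, Ut, e) ?s) = lv a'"
      using a ec s by simp_all
    have 1: "ap 0 (Tn a' Ut, Tn a' (Tn a a'), Id C (ob a') \<otimes>\<^sub>a c) (start (lv a')) = ?s"
      using a ec o s by (subst ap_Tar) simp_all
    have 2: "ap 0 (Tn a' (Tn a a'), Tn (Tn a' a) a', Inv C (Asc C (ob a') (ob a) (ob a'))) ?s = ?s"
      using a s by (intro ap_Asc(2)) simp_all
    have 3: "ap 0 (Tn (Tn a' a) a', Tn Ut a', e \<otimes>\<^sub>a Id C (ob a')) ?s = ap 0 (Tn a' a, Ut, e) ?s"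
      using a ec o s v by (subst ap_Tar) simp_all
    show ?thesis
      unfolding z'_def a(1,2)[symmetric] using a ec s v 1 2 3 o
      by (simp add: ap_Comp[of _ "Tn Ut a'"] ap_Comp[of _ "Tn (Tn a' a) a'"] ap_Comp[of _ "Tn a' (Tn a a')"] ap_Comp[of _ "Tn a' Ut"])
  qed
  have "z = Id C ?X"
    using z[of t t'] o 1 H by (intro faithful[of t t]) simp_all
  moreover have "z' = Id C ?X'"
    using z'[of t t'] o 2 H by (intro faithful[of t' t']) simp_all
  ultimately show ?thesis
    using z[of "Lf ?X" "Lf ?X'"] z'[of "Lf ?X" "Lf ?X'"] o e c by (simp add: perf_def)
qed

text \<open>Sliding the evaluations and Casimir elements across the strands of the other pair
  removes the crossings that the interchange of middle legs creates, and one zigzag for each pair is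
  left.\<close>

lemma perf_tensor:
  assumes p: "perf X X' e c" and q: "perf Y Y' f d"
  shows "perf (X \<otimes>\<^sub>o Y) (X' \<otimes>\<^sub>o Y') (ev1324 C X' Y' X Y e f) (tensor_coev X X' Y Y' c d)"
proof -
  note p' = perfD[OF p] note q' = perfD[OF q]
  note o = p'(1,2) q'(1,2) p'(3,4)[unfolded in_Hom_iff] q'(3,4)[unfolded in_Hom_iff]
  let ?t = "Tn (Lf X) (Lf Y)" and ?t' = "Tn (Lf X') (Lf Y')"
  let ?e = "b20 X' X e" and ?c = "b02 X X' c" and ?f = "b20 Y' Y f" and ?d = "b02 Y Y' d"
  have E: "ev1324 C X' Y' X Y e f \<in> Hom C (ob ?t' \<otimes>\<^sub>o ob ?t) \<bbbI>"
    using ev1324_Hom[OF p'(2) q'(2) p'(1) q'(1) p'(3) q'(3)] by simp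
  have D: "tensor_coev X X' Y Y' c d \<in> Hom C \<bbbI> (ob ?t \<otimes>\<^sub>o ob ?t')"
    using tensor_coev_Hom[OF p'(1) q'(1) p'(2) q'(2) p'(4) q'(4)] by simp
  let ?s = "start [X, Y]"
  have "ap p2 (Tn ?t' ?t, Ut, ev1324 C X' Y' X Y e f) (ap 0 (Ut, Tn ?t ?t', tensor_coev X X' Y Y' c d) ?s)
     = ap p2 ?e (ap p4 ?f (ap p3 (Sw Y' X) (ap p1 (Sw X' Y) (ap 0 ?c (ap 0 ?d ?s)))))"
    using o p'(3,4) q'(3,4) by (simp add: ap_tensor_coev ap_ev1324 pos_def)
  also have "ap 0 ?c (ap 0 ?d ?s) = ap p2 ?d (ap 0 ?c ?s)"
    using o by (simp add: comm[of ?c ?d _ 0 0])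
  also have "ap p2 ?d (ap 0 ?c ?s) = ap p3 (Sw X Y') (ap p2 (Sw X Y) (ap p3 ?d (ap 0 ?c ?s)))"
    using o q'(4) by (simp add: slideR_02 pos_def)
  also have "ap p3 (Sw Y' X) (ap p1 (Sw X' Y) (ap p3 (Sw X Y') (ap p2 (Sw X Y) (ap p3 ?d (ap 0 ?c ?s)))))
     = ap p1 (Sw X' Y) (ap p2 (Sw X Y) (ap p3 ?d (ap 0 ?c ?s)))"
    using o by (simp add: comm[of "Sw X' Y" "Sw X Y'" _ p1 p3] Sw_Sw pos_def)
  also have "ap p4 ?f (ap p1 (Sw X' Y) (ap p2 (Sw X Y) (ap p3 ?d (ap 0 ?c ?s))))
     = ap p1 (Sw X' Y) (ap p2 (Sw X Y) (ap p4 ?f (ap p3 ?d (ap 0 ?c ?s))))"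
    using o by (simp add: comm[of "Sw X' Y" ?f _ p1 p4]
       comm[of "Sw X Y" ?f _ p2 p4])
  also have "ap p4 ?f (ap p3 ?d (ap 0 ?c ?s)) = ap 0 ?c ?s"
    using o q by (simp add: zigzag1 pos_def)
  also have "ap p2 ?e (ap p1 (Sw X' Y) (ap p2 (Sw X Y) (ap 0 ?c ?s))) = ap p1 ?e (ap 0 ?c ?s)"
    using o p'(3) by (simp add: slideL_20 pos_def)
  also have "\<dots> = ?s"
    using o p by (simp add: zigzag1 pos_def)
  finally have 1: "ap p2 (Tn ?t' ?t, Ut, ev1324 C X' Y' X Y e f) (ap 0 (Ut, Tn ?t ?t', tensor_coev X X' Y Y' c d) ?s) = ?s" .
  let ?r = "start [X', Y']"
  have "ap 0 (Tn ?t' ?t, Ut, ev1324 C X' Y' X Y e f) (ap p2 (Ut, Tn ?t ?t', tensor_coev X X' Y Y' c d) ?r)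
     = ap 0 ?e (ap p2 ?f (ap p1 (Sw Y' X) (ap p3 (Sw X' Y) (ap p2 ?c (ap p2 ?d ?r)))))"
    using o p'(3,4) q'(3,4) by (simp add: ap_tensor_coev ap_ev1324 pos_def)
  also have "ap p2 ?c (ap p2 ?d ?r) = ap p4 ?d (ap p2 ?c ?r)"
    using o by (simp add: comm[of ?c ?d _ p2 p2])
  also have "ap p1 (Sw Y' X) (ap p3 (Sw X' Y) (ap p4 ?d (ap p2 ?c ?r)))
     = ap p3 (Sw X' Y) (ap p4 ?d (ap p2 (Sw X' Y') (ap p2 (Sw Y' X') (ap p1 (Sw Y' X) (ap p2 ?c ?r)))))"
    using o by (simp add: comm[of "Sw Y' X" "Sw X' Y" _ p1 p3]
       comm[of "Sw Y' X" ?d _ p1 p4] Sw_Sw pos_def)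
  also have "ap p2 (Sw Y' X') (ap p1 (Sw Y' X) (ap p2 ?c ?r)) = ap p1 ?c ?r"
    using o p'(4) by (simp add: slideR_02 pos_def)
  also have "ap 0 ?e (ap p2 ?f (ap p3 (Sw X' Y) (ap p4 ?d (ap p2 (Sw X' Y') (ap p1 ?c ?r)))))
     = ap 0 ?f (ap p1 (Sw X' Y) (ap p2 ?d (ap 0 (Sw X' Y') (ap 0 ?e (ap p1 ?c ?r)))))"
    using o by (simp add: comm[of ?e ?f _ 0 p2]
       comm[of ?e "Sw X' Y" _ 0 p3]
       comm[of ?e ?d _ 0 p4] comm[of ?e "Sw X' Y'" _ 0 p2])
  also have "ap 0 ?e (ap p1 ?c ?r) = ?r"
    using o p by (simp add: zigzag2 pos_def)
  also have "ap p2 ?d (ap 0 (Sw X' Y') ?r) = ap 0 (Sw X' Y') (ap p2 ?d ?r)"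
    using o by (simp add: comm[of "Sw X' Y'" ?d _ 0 p2])
  also have "ap 0 ?f (ap p1 (Sw X' Y) (ap 0 (Sw X' Y') (ap p2 ?d ?r))) = ap p1 ?f (ap p2 ?d ?r)"
    using o q'(3) by (simp add: slideR_20 pos_def)
  also have "\<dots> = ?r"
    using o q by (simp add: zigzag2 pos_def)
  finally have 2: "ap 0 (Tn ?t' ?t, Ut, ev1324 C X' Y' X Y e f) (ap p2 (Ut, Tn ?t ?t', tensor_coev X X' Y Y' c d) ?r) = ?r" .
  show ?thesis
    using perfI_tree[of ?t ?t', OF _ _ E D] o 1 2 by simp
qed

lemma perf_Unit: "perf \<bbbI> \<bbbI> (Lun C \<bbbI>) (Inv C (Lun C \<bbbI>))"
  using perfI_tree[of Ut Ut "Lun C \<bbbI>" "Inv C (Lun C \<bbbI>)"] by (simp add: in_Hom_iff)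

text \<open>The hypothesis \<open>adj\<close> says that the two idempotents are transposes of each
  other. An idempotent arising on one leg of the pairing can thus be moved to the other leg, where
  the section or the retraction absorbs it, and the zigzag of the ambient pair applies.\<close>

lemma perf_retract:
  assumes p: "perf X X' e c"
    and s: "s \<in> Hom C W X" "q \<in> Hom C X W" "q \<cdot> s = Id C W"
    and s': "s' \<in> Hom C W' X'" "q' \<in> Hom C X' W'" "q' \<cdot> s' = Id C W'"
    and adj: "e \<cdot> ((s' \<cdot> q') \<otimes>\<^sub>a Id C X) = e \<cdot> (Id C X' \<otimes>\<^sub>a (s \<cdot> q))"
  shows "perf W W' (e \<cdot> (s' \<otimes>\<^sub>a s)) ((q \<otimes>\<^sub>a q') \<cdot> c)"
proof -
  note p' = perfD[OF p]
  note o = p'(1,2) p'(3,4)[unfolded in_Hom_iff] s(1,2)[unfolded in_Hom_iff] s'(1,2)[unfolded in_Hom_iff]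
  have W: "W \<in> Obj C" "W' \<in> Obj C" using o by auto
  let ?e = "b20 X' X e" and ?c = "b02 X X' c"
  let ?s = "b11 W X s" and ?q = "b11 X W q" and ?s' = "b11 W' X' s'" and ?q' = "b11 X' W' q'"
  have E: "ap k (b20 W' W (e \<cdot> (s' \<otimes>\<^sub>a s))) u = ap k ?e (ap k ?s' (ap (Suc k) ?s u))"
    if "pos k [W', W] u" for k u
    using that o W by (simp add: ap_Comp[of _ "Tn (Lf X') (Lf X)"] ap_Tar pos_def)
  have D: "ap k (b02 W W' ((q \<otimes>\<^sub>a q') \<cdot> c)) u = ap k ?q (ap (Suc k) ?q' (ap k ?c u))"
    if "vs u" "k \<le> length (fst u)" for k u
    using that o W by (simp add: ap_Comp[of _ "Tn (Lf X) (Lf X')"] ap_Tar pos_def)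
  have qs: "ap k ?q (ap k ?s u) = u" if "pos k [W] u" for k u
    using that o W s(3) ap_Comp[of "Lf W" "Lf X" s "Lf W" q u k] by (simp add: pos_def)
  have qs': "ap k ?q' (ap k ?s' u) = u" if "pos k [W'] u" for k u
    using that o W s'(3) ap_Comp[of "Lf W'" "Lf X'" s' "Lf W'" q' u k] by (simp add: pos_def)
  have adj': "ap k ?e (ap k ?s' (ap k ?q' u)) = ap k ?e (ap (Suc k) ?s (ap (Suc k) ?q u))" if u: "pos k [X', X] u" for k u
  proof -
    let ?x = "start [X', X]"
    have "ap 0 (b20 X' X (e \<cdot> ((s' \<cdot> q') \<otimes>\<^sub>a Id C X))) ?x = ap 0 ?e (ap 0 ?s' (ap 0 ?q' ?x))"
      using o W by (simp add: ap_Comp[of _ "Tn (Lf X') (Lf X)"] ap_Tar ap_Comp[of _ "Lf W'"])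
    moreover have "ap 0 (b20 X' X (e \<cdot> (Id C X' \<otimes>\<^sub>a (s \<cdot> q)))) ?x = ap 0 ?e (ap p1 ?s (ap p1 ?q ?x))"
      using o W by (simp add: ap_Comp[of _ "Tn (Lf X') (Lf X)"] ap_Tar ap_Comp[of _ "Lf W"])
    ultimately show ?thesis
      using pos_transfer[OF u, of "[(0, ?q'), (0, ?s'), (0, ?e)]" "[(p1, ?q), (p1, ?s), (0, ?e)]"] adj o W by simp
  qed
  let ?u = "start [W]"
  have "ap p1 (b20 W' W (e \<cdot> (s' \<otimes>\<^sub>a s))) (ap 0 (b02 W W' ((q \<otimes>\<^sub>a q') \<cdot> c)) ?u)
     = ap p1 ?e (ap p1 ?s' (ap p2 ?s (ap 0 ?q (ap p1 ?q' (ap 0 ?c ?u)))))"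
    using o W by (simp add: E D pos_def)
  also have "\<dots> = ap 0 ?q (ap p1 ?e (ap p1 ?s' (ap p1 ?q' (ap p2 ?s (ap 0 ?c ?u)))))"
    using o W by (simp add: comm[of ?q ?e _ 0 p1]
       comm[of ?q ?s' _ 0 p1] comm[of ?q ?s _ 0 p2]
       comm[of ?q' ?s _ p1 p2])
  also have "\<dots> = ap 0 ?q (ap p1 ?e (ap p2 ?s (ap 0 ?c ?u)))"
    using o W by (simp add: adj' qs pos_def)
  also have "\<dots> = ap 0 ?q (ap p1 ?e (ap 0 ?c (ap 0 ?s ?u)))"
    using o W by (simp add: comm[of ?c ?s _ 0 0])
  also have "\<dots> = ?u"
    using o W p by (simp add: zigzag1 qs pos_def)
  finally have 1: "ap p1 (b20 W' W (e \<cdot> (s' \<otimes>\<^sub>a s))) (ap 0 (b02 W W' ((q \<otimes>\<^sub>a q') \<cdot> c)) ?u) = ?u" .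
  let ?v = "start [W']"
  have "ap 0 (b20 W' W (e \<cdot> (s' \<otimes>\<^sub>a s))) (ap p1 (b02 W W' ((q \<otimes>\<^sub>a q') \<cdot> c)) ?v)
     = ap 0 ?e (ap 0 ?s' (ap p1 ?s (ap p1 ?q (ap p2 ?q' (ap p1 ?c ?v)))))"
    using o W by (simp add: E D pos_def)
  also have "\<dots> = ap 0 ?q' (ap 0 ?e (ap p1 ?s (ap p1 ?q (ap 0 ?s' (ap p1 ?c ?v)))))"
    using o W by (simp add: comm[of ?s' ?s _ 0 p1] comm[of ?s' ?q _ 0 p1]
       comm[of ?s' ?q' _ 0 p2] comm[of ?q ?q' _ p1 p2]
       comm[of ?s ?q' _ p1 p2] comm[of ?e ?q' _ 0 p2])
  also have "\<dots> = ap 0 ?q' (ap 0 ?e (ap 0 ?s' (ap p1 ?c ?v)))"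
    using o W by (simp add: adj'[symmetric] qs' pos_def)
  also have "\<dots> = ap 0 ?q' (ap 0 ?e (ap p1 ?c (ap 0 ?s' ?v)))"
    using o W by (simp add: comm[of ?s' ?c _ 0 p1])
  also have "\<dots> = ?v"
    using o W p by (simp add: zigzag2 qs' pos_def)
  finally have 2: "ap 0 (b20 W' W (e \<cdot> (s' \<otimes>\<^sub>a s))) (ap p1 (b02 W W' ((q \<otimes>\<^sub>a q') \<cdot> c)) ?v) = ?v" .
  show ?thesis
    using o W 1 2 by (simp add: perf_def in_Hom_iff)
qed

lemma Add_distrib:
  assumes "f \<in> Arr C" "f' \<in> Arr C" "g \<in> Arr C" "Dom C f = Dom C f'" "Cod C f = Cod C f'"
  shows "Cod C f = Dom C g \<Longrightarrow> g \<cdot> Add C f f' = Add C (g \<cdot> f) (g \<cdot> f')"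
    "Cod C g = Dom C f \<Longrightarrow> Add C f f' \<cdot> g = Add C (f \<cdot> g) (f' \<cdot> g)"
    "Add C f f' \<otimes>\<^sub>a g = Add C (f \<otimes>\<^sub>a g) (f' \<otimes>\<^sub>a g)"
    "g \<otimes>\<^sub>a Add C f f' = Add C (g \<otimes>\<^sub>a f) (g \<otimes>\<^sub>a f')"
  using Comp_Add[of f "Dom C f" "Cod C f" f' g "Cod C g"] Add_Comp[of g "Dom C g" "Dom C f" f "Cod C f" f']
    Tar_Add_left[of f "Dom C f" "Cod C f" f' g "Dom C g" "Cod C g"] Tar_Add_right[of g "Dom C g" "Cod C g" f "Dom C f" "Cod C f" f'] assms
  by (simp_all add: in_Hom_iff)

section \<open>Concatenation of tensor powers and the antisymmetrizers\<close>

lemma tpow_add_props: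
  assumes "X \<in> Obj C"
  shows "is_iso C (tpow_add C X i j) \<and> Dom C (tpow_add C X i j) = tpow C i X \<otimes>\<^sub>o tpow C j X \<and> Cod C (tpow_add C X i j) = tpow C (i + j) X"
proof (induction j)
  case (Suc j)
  then have "tpow_add C X i j \<in> Arr C" using is_iso_Arr by blast
  moreover have "is_iso C (Inv C (Asc C (tpow C i X) (tpow C j X) X))"
    using assms by (intro is_isoI[of _ "Asc C (tpow C i X) (tpow C j X) X"]) (simp_all add: in_Hom_iff)
  ultimately show ?case using Suc assms by (auto intro!: Comp_iso Tar_iso)
qed (use assms in simp)

lemma tpow_add_simps [simp]:
  assumes "X \<in> Obj C"
  shows "is_iso C (tpow_add C X i j)" "tpow_add C X i j \<in> Arr C" "Dom C (tpow_add C X i j) = tpow C i X \<otimes>\<^sub>o tpow C j X"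
    "Cod C (tpow_add C X i j) = tpow C (i + j) X"
  using tpow_add_props[OF assms, of i j] is_iso_Arr by auto

abbreviation ad :: "'a \<Rightarrow> nat \<Rightarrow> nat \<Rightarrow> ('a, 'b) box" where
  "ad X i j \<equiv> b21 (tpow C i X) (tpow C j X) (tpow C (i + j) X) (tpow_add C X i j)"

declare tpow_add.simps(2) [simp del]

lemma ap_tpow_add_Suc_tree:
  assumes "pos k (lv a @ [tpow C j X, X]) s" "X \<in> Obj C" "ob a = tpow C i X"
  shows "ap k (Tn a (Tn (Lf (tpow C j X)) (Lf X)), Tn (Lf (tpow C (i + j) X)) (Lf X), tpow_add C X i (Suc j)) s
    = ap k (Tn a (Lf (tpow C j X)), Lf (tpow C (i + j) X), tpow_add C X i j) s"
proof -
  let ?S = "start (lv a @ [tpow C j X, X])"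
  have o: "objs (lv a)" using pos_objs[OF assms(1)] by simp
  have S: "vs ?S" using o assms by simp
  let ?t = "Tn (Tn a (Lf (tpow C j X))) (Lf X)"
  let ?u = "ap 0 (Tn a (Lf (tpow C j X)), Lf (tpow C (i + j) X), tpow_add C X i j) ?S"
  have 1: "ap 0 (Tn a (Tn (Lf (tpow C j X)) (Lf X)), ?t, Inv C (Asc C (tpow C i X) (tpow C j X) X)) ?S = ?S"
    using assms o by (intro ap_Asc(2)) simp_all
  have 2: "ap 0 (?t, Tn (Lf (tpow C (i + j) X)) (Lf X), tpow_add C X i j \<otimes>\<^sub>a Id C X) ?S = ?u"
    using assms o by (subst ap_Tar) simp_all
  have "ap 0 (Tn a (Tn (Lf (tpow C j X)) (Lf X)), Tn (Lf (tpow C (i + j) X)) (Lf X), tpow_add C X i (Suc j)) ?S = ?u"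
    unfolding tpow_add.simps(2) using assms o S 1 2 by (subst ap_Comp[of _ ?t]) simp_all
  then show ?thesis
    using pos_transfer[OF assms(1), of "[(0, (Tn a (Tn (Lf (tpow C j X)) (Lf X)), Tn (Lf (tpow C (i + j) X)) (Lf X), tpow_add C X i (Suc j)))]"
      "[(0, (Tn a (Lf (tpow C j X)), Lf (tpow C (i + j) X), tpow_add C X i j))]"] assms(2,3) o by simp
qed

lemma ap_tpow_add_Suc:
  assumes "pos k [tpow C i X, tpow C j X, X] s" "X \<in> Obj C"
  shows "ap k (Tn (Lf (tpow C i X)) (Tn (Lf (tpow C j X)) (Lf X)), Tn (Lf (tpow C (i + j) X)) (Lf X), tpow_add C X i (Suc j)) s
    = ap k (ad X i j) s"
  using ap_tpow_add_Suc_tree[of k "Lf (tpow C i X)"] assms by simp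

lemma tpow_add_0_left: "X \<in> Obj C \<Longrightarrow> tpow_add C X 0 j = Lun C (tpow C j X)"
proof (induction j)
  case 0
  then show ?case by (simp add: Lun_eq_Run_Unit)
next
  case (Suc j)
  then show ?case using Lun_Asc[of "tpow C j X" X] by (simp add: tpow_add.simps(2) flip: Lun_Asc)
qed

lemma tpow_add_swap_left:
  assumes X: "X \<in> Obj C" and k: "Suc k < i"
  shows "tpow_add C X i j \<cdot> (swap C X i k \<otimes>\<^sub>a Id C (tpow C j X)) = swap C X (i + j) k \<cdot> tpow_add C X i j"
proof (induction j)
  case 0
  then show ?case using X Run_nat[of "swap C X i k"] by simp
next
  case (Suc j)
  let ?T = "tpow C i X" and ?U = "tpow C j X" and ?t = "Tn (Lf (tpow C i X)) (Tn (Lf (tpow C j X)) (Lf X))"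
  let ?t' = "Tn (Lf (tpow C (i + j) X)) (Lf X)"
  let ?s = "b11 ?T ?T (swap C X i k)" and ?s' = "b11 (tpow C (i + j) X) (tpow C (i + j) X) (swap C X (i + j) k)"
  have eq: "ap 0 (ad X i j) (ap 0 ?s (start [?T, ?U, X])) = ap 0 ?s' (ap 0 (ad X i j) (start [?T, ?U, X]))"
  proof -
    have "ap 0 (b21 ?T ?U (tpow C (i + j) X) (tpow_add C X i j \<cdot> (swap C X i k \<otimes>\<^sub>a Id C ?U))) (start [?T, ?U, X])
       = ap 0 (ad X i j) (ap 0 ?s (start [?T, ?U, X]))"
      using X by (simp add: ap_Comp[of _ "Tn (Lf ?T) (Lf ?U)"] ap_Tar)
    moreover have "ap 0 (b21 ?T ?U (tpow C (i + j) X) (swap C X (i + j) k \<cdot> tpow_add C X i j)) (start [?T, ?U, X])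
       = ap 0 ?s' (ap 0 (ad X i j) (start [?T, ?U, X]))"
      using X by (simp add: ap_Comp[of _ "Lf (tpow C (i + j) X)"])
    ultimately show ?thesis using Suc by simp
  qed
  show ?case
  proof (rule faithful[of ?t ?t'])
    have "ap 0 (?t, ?t', tpow_add C X i (Suc j) \<cdot> (swap C X i k \<otimes>\<^sub>a Id C (tpow C (Suc j) X))) (start (lv ?t))
      = ap 0 (ad X i j) (ap 0 ?s (start [?T, ?U, X]))"
      using X by (simp add: ap_Comp[of _ ?t] ap_Tar ap_tpow_add_Suc pos_def)
    also have "\<dots> = ap 0 (?t, ?t', swap C X (i + Suc j) k \<cdot> tpow_add C X i (Suc j)) (start (lv ?t))"
      unfolding eq using X k by (simp add: ap_Comp[of _ ?t'] ap_Tar swap_Suc ap_tpow_add_Suc pos_def)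
    finally show "ap 0 (?t, ?t', tpow_add C X i (Suc j) \<cdot> (swap C X i k \<otimes>\<^sub>a Id C (tpow C (Suc j) X))) (start (lv ?t))
      = ap 0 (?t, ?t', swap C X (i + Suc j) k \<cdot> tpow_add C X i (Suc j)) (start (lv ?t))" .
  qed (use X in simp_all)
qed

text \<open>By induction unless the generator moves the last two factors. Then both sides are one
  crossing, and splitting off these two factors shows that it ends up at position
  \<open>i + k\<close>.\<close>

lemma tpow_add_swap_right:
  assumes X: "X \<in> Obj C" and k: "Suc k < j"
  shows "tpow_add C X i j \<cdot> (Id C (tpow C i X) \<otimes>\<^sub>a swap C X j k) = swap C X (i + j) (i + k) \<cdot> tpow_add C X i j"
  using k
proof (induction j)
  case (Suc j)
  let ?T = "tpow C i X" and ?U = "tpow C j X"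
  show ?case
  proof (cases "Suc k = j")
    case False
    let ?t = "Tn (Lf ?T) (Tn (Lf ?U) (Lf X))"
    let ?t' = "Tn (Lf (tpow C (i + j) X)) (Lf X)"
    let ?s = "b11 ?U ?U (swap C X j k)" and ?s' = "b11 (tpow C (i + j) X) (tpow C (i + j) X) (swap C X (i + j) (i + k))"
    have k: "Suc k < j" using False Suc by simp
    have eq: "ap 0 (ad X i j) (ap p1 ?s (start [?T, ?U, X])) = ap 0 ?s' (ap 0 (ad X i j) (start [?T, ?U, X]))"
    proof -
      have "ap 0 (b21 ?T ?U (tpow C (i + j) X) (tpow_add C X i j \<cdot> (Id C ?T \<otimes>\<^sub>a swap C X j k))) (start [?T, ?U, X])
         = ap 0 (ad X i j) (ap p1 ?s (start [?T, ?U, X]))"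
        using X by (simp add: ap_Comp[of _ "Tn (Lf ?T) (Lf ?U)"] ap_Tar)
      moreover have "ap 0 (b21 ?T ?U (tpow C (i + j) X) (swap C X (i + j) (i + k) \<cdot> tpow_add C X i j)) (start [?T, ?U, X])
         = ap 0 ?s' (ap 0 (ad X i j) (start [?T, ?U, X]))"
        using X by (simp add: ap_Comp[of _ "Lf (tpow C (i + j) X)"])
      ultimately show ?thesis using Suc.IH[OF k] by simp
    qed
    show ?thesis
    proof (rule faithful[of ?t ?t'])
      have "ap 0 (?t, ?t', tpow_add C X i (Suc j) \<cdot> (Id C ?T \<otimes>\<^sub>a swap C X (Suc j) k)) (start (lv ?t))
        = ap 0 (ad X i j) (ap p1 ?s (start [?T, ?U, X]))"
        using X k by (simp add: ap_Comp[of _ ?t] ap_Tar ap_tpow_add_Suc swap_Suc pos_def)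
      also have "\<dots> = ap 0 (?t, ?t', swap C X (i + Suc j) (i + k) \<cdot> tpow_add C X i (Suc j)) (start (lv ?t))"
        unfolding eq using X k by (simp add: ap_Comp[of _ ?t'] ap_Tar swap_Suc ap_tpow_add_Suc pos_def)
      finally show "ap 0 (?t, ?t', tpow_add C X i (Suc j) \<cdot> (Id C ?T \<otimes>\<^sub>a swap C X (Suc j) k)) (start (lv ?t))
        = ap 0 (?t, ?t', swap C X (i + Suc j) (i + k) \<cdot> tpow_add C X i (Suc j)) (start (lv ?t))" .
    qed (use X in simp_all)
  next
    case True
    let ?U = "tpow C k X"
    let ?q = "Tn (Tn (Lf ?U) (Lf X)) (Lf X)"
    let ?t = "Tn (Lf ?T) ?q"
    let ?t' = "Tn (Tn (Lf (tpow C (i + k) X)) (Lf X)) (Lf X)"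
    have add: "ap 0 (?t, ?t', tpow_add C X i (Suc (Suc k))) s = ap 0 (ad X i k) s" if "vs s" "fst s = [?T, ?U, X, X]" for s
      using that X unfolding tpow_add.simps(2)[of C X i "Suc k"]
      by (simp add: ap_Comp[of _ "Tn (Tn (Lf ?T) (Tn (Lf ?U) (Lf X))) (Lf X)"] ap_Tar ap_tpow_add_Suc pos_def)
    have "tpow_add C X i (Suc (Suc k)) \<cdot> (Id C ?T \<otimes>\<^sub>a swap C X (Suc (Suc k)) k) = swap C X (i + Suc (Suc k)) (i + k) \<cdot> tpow_add C X i (Suc (Suc k))"
    proof (rule faithful[of ?t ?t'])
      have "ap 0 (?t, ?t', tpow_add C X i (Suc (Suc k)) \<cdot> (Id C ?T \<otimes>\<^sub>a swap C X (Suc (Suc k)) k)) (start (lv ?t))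
        = ap 0 (ad X i k) (ap p2 (Sw X X) (start [?T, ?U, X, X]))"
        using X by (simp add: ap_Comp[of _ ?t] ap_Tar add ap_swap_last pos_def)
      also have "\<dots> = ap p1 (Sw X X) (ap 0 (ad X i k) (start [?T, ?U, X, X]))"
        using X by (simp add: comm[of "ad X i k" "Sw X X" _ 0 p2])
      also have "\<dots> = ap 0 (?t, ?t', swap C X (i + Suc (Suc k)) (i + k) \<cdot> tpow_add C X i (Suc (Suc k))) (start (lv ?t))"
        using X by (simp add: ap_Comp[of _ ?t'] add ap_swap_last pos_def)
      finally show "ap 0 (?t, ?t', tpow_add C X i (Suc (Suc k)) \<cdot> (Id C ?T \<otimes>\<^sub>a swap C X (Suc (Suc k)) k)) (start (lv ?t))
        = ap 0 (?t, ?t', swap C X (i + Suc (Suc k)) (i + k) \<cdot> tpow_add C X i (Suc (Suc k))) (start (lv ?t))" .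
    qed (use X in simp_all)
    then show ?thesis using True by simp
  qed
qed simp

text \<open>Transpositions within a block are transpositions of the whole product, so the outer
  antisymmetrizer already turns them into signs; antisymmetrizing a block beforehand changes
  nothing.\<close>

lemma antisym_tpow_add:
  assumes X: "X \<in> Obj C"
  shows "antisym C (i + j) X \<cdot> (tpow_add C X i j \<cdot> (antisym C i X \<otimes>\<^sub>a Id C (tpow C j X))) = antisym C (i + j) X \<cdot> tpow_add C X i j"
    "antisym C (i + j) X \<cdot> (tpow_add C X i j \<cdot> (Id C (tpow C i X) \<otimes>\<^sub>a antisym C j X)) = antisym C (i + j) X \<cdot> tpow_add C X i j"
proof -
  let ?A = "antisym C (i + j) X" and ?a = "tpow_add C X i j" and ?T = "tpow C i X" and ?U = "tpow C j X"
  have sl: "?A \<cdot> (swap C X (i + j) k \<cdot> (?a \<cdot> u)) = Scl C (- 1) (?A \<cdot> (?a \<cdot> u))"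
    if "Suc k < i + j" "u \<in> Arr C" "Cod C u = ?T \<otimes>\<^sub>o ?U" for k u
  proof -
    have "?A \<cdot> (swap C X (i + j) k \<cdot> (?a \<cdot> u)) = (?A \<cdot> swap C X (i + j) k) \<cdot> (?a \<cdot> u)"
      using X that by simp
    then show ?thesis using X that by (simp add: swap_antisym)
  qed
  have "?A \<cdot> (?a \<cdot> (antisym C i X \<otimes>\<^sub>a Id C ?U)) = ?A \<cdot> (?a \<cdot> (Id C ?T \<otimes>\<^sub>a Id C ?U))"
  proof (rule antisym_absorb_swap[where P = "?T \<otimes>\<^sub>o ?U" and Q = "tpow C (i + j) X" and \<phi> = "\<lambda>b. ?A \<cdot> (?a \<cdot> (b \<otimes>\<^sub>a Id C ?U))"])
    fix b c assume b: "b \<in> Hom C ?T ?T" and c: "c \<in> Hom C ?T ?T"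
    from b c show "?A \<cdot> (?a \<cdot> (Add C b c \<otimes>\<^sub>a Id C ?U)) = Add C (?A \<cdot> (?a \<cdot> (b \<otimes>\<^sub>a Id C ?U))) (?A \<cdot> (?a \<cdot> (c \<otimes>\<^sub>a Id C ?U)))"
      using X by (simp add: in_Hom_iff Add_distrib)
  next
    fix b k assume b: "b \<in> Hom C ?T ?T" and k: "Suc k < i"
    have "?a \<cdot> ((swap C X i k \<cdot> b) \<otimes>\<^sub>a Id C ?U) = (?a \<cdot> (swap C X i k \<otimes>\<^sub>a Id C ?U)) \<cdot> (b \<otimes>\<^sub>a Id C ?U)"
      using b X by (simp add: in_Hom_iff whisk_right)
    also have "\<dots> = swap C X (i + j) k \<cdot> (?a \<cdot> (b \<otimes>\<^sub>a Id C ?U))"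
      using b X k by (simp add: in_Hom_iff tpow_add_swap_left)
    finally show "?A \<cdot> (?a \<cdot> ((swap C X i k \<cdot> b) \<otimes>\<^sub>a Id C ?U)) = Scl C (- 1) (?A \<cdot> (?a \<cdot> (b \<otimes>\<^sub>a Id C ?U)))"
      using b X k sl[of k "b \<otimes>\<^sub>a Id C ?U"] by (simp add: in_Hom_iff)
  qed (use X in \<open>auto simp: in_Hom_iff\<close>)
  then show "?A \<cdot> (?a \<cdot> (antisym C i X \<otimes>\<^sub>a Id C ?U)) = ?A \<cdot> ?a" using X by simp
  have "?A \<cdot> (?a \<cdot> (Id C ?T \<otimes>\<^sub>a antisym C j X)) = ?A \<cdot> (?a \<cdot> (Id C ?T \<otimes>\<^sub>a Id C ?U))"
  proof (rule antisym_absorb_swap[where P = "?T \<otimes>\<^sub>o ?U" and Q = "tpow C (i + j) X" and \<phi> = "\<lambda>b. ?A \<cdot> (?a \<cdot> (Id C ?T \<otimes>\<^sub>a b))"])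
    fix b c assume b: "b \<in> Hom C ?U ?U" and c: "c \<in> Hom C ?U ?U"
    from b c show "?A \<cdot> (?a \<cdot> (Id C ?T \<otimes>\<^sub>a Add C b c)) = Add C (?A \<cdot> (?a \<cdot> (Id C ?T \<otimes>\<^sub>a b))) (?A \<cdot> (?a \<cdot> (Id C ?T \<otimes>\<^sub>a c)))"
      using X b c by (simp add: in_Hom_iff Add_distrib)
  next
    fix b k assume b: "b \<in> Hom C ?U ?U" and k: "Suc k < j"
    have "?a \<cdot> (Id C ?T \<otimes>\<^sub>a (swap C X j k \<cdot> b)) = (?a \<cdot> (Id C ?T \<otimes>\<^sub>a swap C X j k)) \<cdot> (Id C ?T \<otimes>\<^sub>a b)"
      using b X by (simp add: in_Hom_iff whisk_left)
    also have "\<dots> = swap C X (i + j) (i + k) \<cdot> (?a \<cdot> (Id C ?T \<otimes>\<^sub>a b))"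
      using b X k by (simp add: in_Hom_iff tpow_add_swap_right)
    finally show "?A \<cdot> (?a \<cdot> (Id C ?T \<otimes>\<^sub>a (swap C X j k \<cdot> b))) = Scl C (- 1) (?A \<cdot> (?a \<cdot> (Id C ?T \<otimes>\<^sub>a b)))"
      using b X k sl[of "i + k" "Id C ?T \<otimes>\<^sub>a b"] by (simp add: in_Hom_iff)
  qed (use X in \<open>auto simp: in_Hom_iff\<close>)
  then show "?A \<cdot> (?a \<cdot> (Id C ?T \<otimes>\<^sub>a antisym C j X)) = ?A \<cdot> ?a" using X by simp
qed

lemma antisym_Suc_absorb:
  assumes X: "X \<in> Obj C"
  shows "antisym C (Suc n) X \<cdot> (antisym C n X \<otimes>\<^sub>a Id C X) = antisym C (Suc n) X"
proof -
  let ?A = "antisym C (Suc n) X" and ?T = "tpow C n X"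
  have "?A \<cdot> (antisym C n X \<otimes>\<^sub>a Id C X) = ?A \<cdot> (Id C ?T \<otimes>\<^sub>a Id C X)"
  proof (rule antisym_absorb_swap[where P = "?T \<otimes>\<^sub>o X" and Q = "?T \<otimes>\<^sub>o X" and \<phi> = "\<lambda>b. ?A \<cdot> (b \<otimes>\<^sub>a Id C X)"])
    fix b c assume b: "b \<in> Hom C ?T ?T" and c: "c \<in> Hom C ?T ?T"
    from b c show "?A \<cdot> (Add C b c \<otimes>\<^sub>a Id C X) = Add C (?A \<cdot> (b \<otimes>\<^sub>a Id C X)) (?A \<cdot> (c \<otimes>\<^sub>a Id C X))"
      using X by (simp add: in_Hom_iff Add_distrib)
  next
    fix b k assume b: "b \<in> Hom C ?T ?T" and k: "Suc k < n"
    have "?A \<cdot> ((swap C X n k \<cdot> b) \<otimes>\<^sub>a Id C X) = (?A \<cdot> swap C X (Suc n) k) \<cdot> (b \<otimes>\<^sub>a Id C X)"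
      using b X k by (simp add: in_Hom_iff whisk_right swap_Suc)
    then show "?A \<cdot> ((swap C X n k \<cdot> b) \<otimes>\<^sub>a Id C X) = Scl C (- 1) (?A \<cdot> (b \<otimes>\<^sub>a Id C X))"
      using b X k by (simp add: in_Hom_iff swap_antisym)
  qed (use X in \<open>auto simp: in_Hom_iff\<close>)
  then show ?thesis using X by simp
qed

lemma ap_ev1324_tree:
  assumes "pos k (lv a @ lv b @ lv c @ lv d) s" "e \<in> Hom C (ob a \<otimes>\<^sub>o ob c) \<bbbI>" "e' \<in> Hom C (ob b \<otimes>\<^sub>o ob d) \<bbbI>"
  shows "ap k (Tn (Tn a b) (Tn c d), Ut, ev1324 C (ob a) (ob b) (ob c) (ob d) e e') s
     = ap k (Tn a c, Ut, e) (ap (k + length (lv a) + length (lv c)) (Tn b d, Ut, e')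
         (ap (k + length (lv a)) (Tn b c, Tn c b, Sym C (ob b) (ob c)) s))"
proof -
  obtain P R where s: "vs s" "fst s = P @ (lv a @ lv b @ lv c @ lv d) @ R" "length P = k" using assms(1) by (rule posE)
  have o: "objs (lv a)" "objs (lv b)" "objs (lv c)" "objs (lv d)" using pos_objs[OF assms(1)] by auto
  let ?t = "ap (k + length (lv a)) (Tn b c, Tn c b, Sym C (ob b) (ob c)) s"
  have t: "vs ?t" "fst ?t = P @ lv a @ lv c @ lv b @ lv d @ R" using s o by simp_all
  let ?u = "ap k (Tn a c, Ut, e) (ap (k + length (lv a) + length (lv c)) (Tn b d, Ut, e') ?t)"
  have u: "vs ?u" using t s o assms(2,3) by (simp add: in_Hom_iff)
  have 1: "ap k (Tn (Tn a c) (Tn b d), Tn Ut Ut, e \<otimes>\<^sub>a e') ?t = ?u"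
    using t s o assms(2,3) by (subst ap_Tar) (simp_all add: in_Hom_iff add.assoc)
  have 2: "ap k (Tn Ut Ut, Ut, Lun C \<bbbI>) ?u = ?u"
    using u s t by (intro ap_Lun(1)) simp_all
  have "interchange C (ob a) (ob b) (ob c) (ob d) \<in> Hom C ((ob a \<otimes>\<^sub>o ob b) \<otimes>\<^sub>o (ob c \<otimes>\<^sub>o ob d)) ((ob a \<otimes>\<^sub>o ob c) \<otimes>\<^sub>o (ob b \<otimes>\<^sub>o ob d))"
    using o by (intro interchange_Hom) simp_all
  then show ?thesis
    unfolding ev1324_def using s o assms(2,3) t 1 2 ap_interchange_gen[OF assms(1)]
    by (simp add: ap_Comp[of _ "Tn Ut Ut"] ap_Comp[of _ "Tn (Tn a c) (Tn b d)"] in_Hom_iff)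
qed

text \<open>Under an antisymmetrizer, moving the last factor to the left of a block of
  \<open>i\<close> factors costs i signs. Each induction step passes one factor; the smaller
  antisymmetrizer required by the induction hypothesis is inserted and removed by
  \<open>antisym_Suc_absorb\<close>.\<close>

lemma wmove_last:
  assumes X: "X \<in> Obj C"
  shows "antisym C (Suc (j + i)) X \<cdot> (tpow_add C X j i \<otimes>\<^sub>a Id C X) = Scl C ((- 1) ^ i) (antisym C (Suc (j + i)) X \<cdot>
    (tpow_add C X (Suc j) i \<cdot> (Inv C (Asc C (tpow C j X) X (tpow C i X)) \<cdot>
     ((Id C (tpow C j X) \<otimes>\<^sub>a Sym C (tpow C i X) X) \<cdot> Asc C (tpow C j X) (tpow C i X) X))))"
proof (induction i)
  case 0
  let ?T = "tpow C j X"
  let ?t = "Tn (Tn (Lf ?T) Ut) (Lf X)" and ?t' = "Tn (Lf ?T) (Lf X)"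
  have 1: "ap p1 (Tn Ut (Lf X), Tn (Lf X) Ut, Sym C \<bbbI> X) s = s" if "vs s" "fst s = [?T, X]" for s
    using that X ap_Sym_treeL[of s "[?T]" Ut X "[]" p1] by simp
  have "tpow_add C X j 0 \<otimes>\<^sub>a Id C X = tpow_add C X (Suc j) 0 \<cdot> (Inv C (Asc C ?T X \<bbbI>) \<cdot>
     ((Id C ?T \<otimes>\<^sub>a Sym C \<bbbI> X) \<cdot> Asc C ?T \<bbbI> X))"
    using X by (intro faithful[of ?t ?t']) (simp_all add: ap_Tar 1 ap_Comp[of _ "Tn (Tn (Lf ?T) (Lf X)) Ut"]
      ap_Comp[of _ "Tn (Lf ?T) (Tn Ut (Lf X))"] ap_Comp[of _ "Tn (Lf ?T) (Tn (Lf X) Ut)"])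
  then show ?case using X by simp
next
  case (Suc i)
  let ?Tj = "tpow C j X" and ?Ti = "tpow C i X" and ?n = "j + i"
  let ?Tn = "tpow C (j + i) X"
  let ?t = "Tn (Tn (Lf ?Tj) (Tn (Lf ?Ti) (Lf X))) (Lf X)" and ?o = "Lf (tpow C (Suc (Suc ?n)) X)"
  let ?q = "Tn (Tn (Lf ?Tn) (Lf X)) (Lf X)" and ?q' = "Tn (Lf (tpow C (Suc ?n) X)) (Lf X)"
  let ?A = "antisym C (Suc (Suc ?n)) X" and ?A' = "antisym C (Suc ?n) X"
  let ?p = "(Tn (Lf ?Tn) (Lf X), Lf (tpow C (Suc ?n) X), ?A')"
  let ?m = "(Tn (Tn (Lf ?Tj) (Lf X)) (Lf ?Ti), Lf (tpow C (Suc ?n) X), tpow_add C X (Suc j) i)"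
  note [simp del] = tens.simps(2)
  have T [simp]: "tpow C n X \<otimes>\<^sub>o X = tpow C (Suc n) X" for n by (simp add: tens.simps(2))
  \<comment> \<open>One crossing of the two last factors costs one sign.\<close>
  have A: "ap 0 (?q, ?o, ?A) u = sscl (- 1) (ap 0 (?q, ?o, ?A) (ap p1 (Sw X X) u))" if "vs u" "fst u = [?Tn, X, X]" for u
  proof -
    have "?A = Scl C (- 1) (?A \<cdot> swap C X (Suc (Suc ?n)) ?n)"
      using X by (simp add: swap_antisym)
    then have "ap 0 (?q, ?o, ?A) u = ap 0 (?q, ?o, Scl C (- 1) (?A \<cdot> swap C X (Suc (Suc ?n)) ?n)) u" by simp
    also have "\<dots> = sscl (- 1) (ap 0 (?q, ?o, ?A) (ap p1 (Sw X X) u))"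
      using X that ap_swap_last[of "Lf ?Tn" ?n X 0 u] by (simp add: ap_Scl ap_Comp[of _ ?q] pos_def)
    finally show ?thesis .
  qed
  have abs: "ap 0 (?q', ?o, ?A) u = ap 0 (?q', ?o, ?A) (ap 0 (b11 (tpow C (Suc ?n) X) (tpow C (Suc ?n) X) ?A') u)"
    if "vs u" "fst u = [tpow C (Suc ?n) X, X]" for u
  proof -
    have "ap 0 (?q', ?o, ?A \<cdot> (?A' \<otimes>\<^sub>a Id C X)) u = ap 0 (?q', ?o, ?A) (ap 0 (b11 (tpow C (Suc ?n) X) (tpow C (Suc ?n) X) ?A') u)"
      using X that by (simp add: ap_Comp[of _ ?q'] ap_Tar)
    then show ?thesis using X by (simp add: antisym_Suc_absorb)
  qed
  have abs': "ap 0 (?q, ?o, ?A) u = ap 0 (?q', ?o, ?A) (ap 0 ?p u)"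
    if "vs u" "fst u = [?Tn, X, X]" for u
  proof -
    have "ap 0 (?q, ?o, ?A \<cdot> (?A' \<otimes>\<^sub>a Id C X)) u = ap 0 (?q', ?o, ?A) (ap 0 ?p u)"
      using X that by (simp add: ap_Comp[of _ ?q'] ap_Tar)
    then show ?thesis using X by (simp add: antisym_Suc_absorb)
  qed
  have IH: "ap 0 ?p (ap 0 (ad X j i) u) = sscl ((- 1) ^ i) (ap 0 (b11 (tpow C (Suc ?n) X) (tpow C (Suc ?n) X) ?A') (ap 0 ?m (ap p1 (Sw ?Ti X) u)))"
    if u: "vs u" "fst u = [?Tj, ?Ti, X, X]" for u
  proof -
    let ?r = "Tn (Tn (Lf ?Tj) (Lf ?Ti)) (Lf X)" and ?e = "Lf (tpow C (Suc ?n) X)"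
    let ?S = "Inv C (Asc C ?Tj X ?Ti) \<cdot> ((Id C ?Tj \<otimes>\<^sub>a Sym C ?Ti X) \<cdot> Asc C ?Tj ?Ti X)"
    have "ap 0 ?p (ap 0 (ad X j i) u) = ap 0 (?r, ?e, ?A' \<cdot> (tpow_add C X j i \<otimes>\<^sub>a Id C X)) u"
      using X u by (simp add: ap_Comp[of _ "Tn (Lf ?Tn) (Lf X)"] ap_Tar)
    also have "\<dots> = ap 0 (?r, ?e, Scl C ((- 1) ^ i) (?A' \<cdot> (tpow_add C X (Suc j) i \<cdot> ?S))) u"
      by (simp add: Suc)
    also have "\<dots> = sscl ((- 1) ^ i) (ap 0 (b11 (tpow C (Suc ?n) X) (tpow C (Suc ?n) X) ?A') (ap 0 ?m (ap p1 (Sw ?Ti X) u)))"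
      using X u by (simp add: ap_Scl ap_Comp[of _ ?e] ap_Comp[of _ "Tn (Tn (Lf ?Tj) (Lf X)) (Lf ?Ti)"]
        ap_Comp[of _ "Tn (Lf ?Tj) (Tn (Lf X) (Lf ?Ti))"] ap_Comp[of _ "Tn (Lf ?Tj) (Tn (Lf ?Ti) (Lf X))"] ap_Tar)
    finally show ?thesis .
  qed
  show ?case
  proof (rule faithful[of ?t ?o])
    let ?s = "start [?Tj, ?Ti, X, X]"
    let ?S = "Inv C (Asc C ?Tj X (tpow C (Suc i) X)) \<cdot> ((Id C ?Tj \<otimes>\<^sub>a Sym C (tpow C (Suc i) X) X) \<cdot> Asc C ?Tj (tpow C (Suc i) X) X)"
    have "ap 0 (?t, ?o, antisym C (Suc (j + Suc i)) X \<cdot> (tpow_add C X j (Suc i) \<otimes>\<^sub>a Id C X)) ?s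
       = ap 0 (?q, ?o, ?A) (ap 0 (ad X j i) ?s)"
      using X by (simp add: ap_Comp[of _ ?q] ap_Tar ap_tpow_add_Suc pos_def)
    also have "\<dots> = sscl (- 1) (ap 0 (?q, ?o, ?A) (ap 0 (ad X j i) (ap p2 (Sw X X) ?s)))"
      using X by (subst A) (simp_all add: comm[of "ad X j i" "Sw X X" _ 0 p2])
    also have "\<dots> = sscl (- 1) (sscl ((- 1) ^ i) (ap 0 (?q', ?o, ?A) (ap 0 ?m (ap p1 (Sw ?Ti X) (ap p2 (Sw X X) ?s)))))"
      using X by (simp add: abs' IH ap_sscl abs[symmetric])
    finally have 1: "ap 0 (?t, ?o, antisym C (Suc (j + Suc i)) X \<cdot> (tpow_add C X j (Suc i) \<otimes>\<^sub>a Id C X)) ?s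
       = sscl ((- 1) ^ Suc i) (ap 0 (?q', ?o, ?A) (ap 0 ?m (ap p1 (Sw ?Ti X) (ap p2 (Sw X X) ?s))))"
      using X by simp
    let ?l = "Tn (Lf ?Ti) (Lf X)"
    have "ap p1 (Tn ?l (Lf X), Tn (Lf X) ?l, Sym C (tpow C (Suc i) X) X) ?s = ap p1 (Sw ?Ti X) (ap p2 (Sw X X) ?s)"
      using ap_Sym_treeL[of ?s "[?Tj]" ?l X "[]" p1] X by simp
    then have "ap 0 (?t, Tn (Tn (Lf ?Tj) (Lf X)) ?l, ?S) ?s = ap p1 (Sw ?Ti X) (ap p2 (Sw X X) ?s)"
      using X by (simp add: ap_Comp[of _ "Tn (Lf ?Tj) (Tn (Lf X) ?l)"] ap_Comp[of _ "Tn (Lf ?Tj) (Tn ?l (Lf X))"] ap_Tar)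
    then have "ap 0 (?t, ?o, ?A \<cdot> (tpow_add C X (Suc j) (Suc i) \<cdot> ?S)) ?s
       = ap 0 (?q', ?o, ?A) (ap 0 ?m (ap p1 (Sw ?Ti X) (ap p2 (Sw X X) ?s)))"
      using X ap_tpow_add_Suc_tree[of 0 "Tn (Lf ?Tj) (Lf X)" i X "ap p1 (Sw ?Ti X) (ap p2 (Sw X X) ?s)" "Suc j"]
      by (simp add: ap_Comp[of _ ?q'] ap_Comp[of _ "Tn (Tn (Lf ?Tj) (Lf X)) ?l"] pos_def)
    then show "ap 0 (?t, ?o, antisym C (Suc (j + Suc i)) X \<cdot> (tpow_add C X j (Suc i) \<otimes>\<^sub>a Id C X)) (start (lv ?t))
       = ap 0 (?t, ?o, Scl C ((- 1) ^ Suc i) (antisym C (Suc (j + Suc i)) X \<cdot> (tpow_add C X (Suc j) (Suc i) \<cdot> ?S))) (start (lv ?t))"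
      using X 1 by (simp add: ap_Scl)
  qed (use X in simp_all)
qed

text \<open>Graded commutativity before projecting to exterior powers. The induction adds one factor
  to the second block; moving it past the first block by \<open>wmove_last\<close> raises the
  exponent from \<open>i * j\<close> to \<open>i * j + i\<close>.\<close>

lemma antisym_tpow_add_commute:
  assumes X: "X \<in> Obj C"
  shows "antisym C (i + j) X \<cdot> tpow_add C X i j = Scl C ((- 1) ^ (i * j)) (antisym C (i + j) X \<cdot> (tpow_add C X j i \<cdot> Sym C (tpow C i X) (tpow C j X)))"
proof (induction j)
  case 0
  show ?case using X Lun_Sym[of "tpow C i X"] by (simp add: tpow_add_0_left)
next
  case (Suc j)
  let ?Tj = "tpow C j X" and ?Ti = "tpow C i X" and ?n = "i + j"
  let ?Tn = "tpow C (i + j) X"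
  let ?t = "Tn (Lf ?Ti) (Tn (Lf ?Tj) (Lf X))" and ?o = "Lf (tpow C (Suc ?n) X)"
  let ?q = "Tn (Lf ?Tn) (Lf X)"
  let ?A = "antisym C (Suc ?n) X" and ?A' = "antisym C ?n X"
  let ?m = "(Tn (Tn (Lf ?Tj) (Lf X)) (Lf ?Ti), ?o, tpow_add C X (Suc j) i)"
  note [simp del] = tens.simps(2)
  have T [simp]: "tpow C n X \<otimes>\<^sub>o X = tpow C (Suc n) X" for n by (simp add: tens.simps(2))
  have c: "j + i = i + j" by simp
  have ad: "ad X j i = b21 ?Tj ?Ti ?Tn (tpow_add C X j i)" by (simp only: c)
  have abs: "ap 0 (?q, ?o, ?A) (ap 0 (b11 ?Tn ?Tn ?A') u) = ap 0 (?q, ?o, ?A) u" if "vs u" "fst u = [?Tn, X]" for u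
  proof -
    have "ap 0 (?q, ?o, ?A \<cdot> (?A' \<otimes>\<^sub>a Id C X)) u = ap 0 (?q, ?o, ?A) (ap 0 (b11 ?Tn ?Tn ?A') u)"
      using X that by (simp add: ap_Comp[of _ ?q] ap_Tar)
    then show ?thesis using X by (simp add: antisym_Suc_absorb)
  qed
  have addc: "Cod C (tpow_add C X j i) = ?Tn" using X by (simp add: add.commute)
  have IH: "ap 0 (b11 ?Tn ?Tn ?A') (ap 0 (ad X i j) u) = sscl ((- 1) ^ (i * j)) (ap 0 (b11 ?Tn ?Tn ?A') (ap 0 (b21 ?Tj ?Ti ?Tn (tpow_add C X j i)) (ap 0 (Sw ?Ti ?Tj) u)))"
    if u: "vs u" "fst u = [?Ti, ?Tj, X]" for u
  proof -
    have "ap 0 (b11 ?Tn ?Tn ?A') (ap 0 (ad X i j) u) = ap 0 (b21 ?Ti ?Tj ?Tn (?A' \<cdot> tpow_add C X i j)) u"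
      using X u by (simp add: ap_Comp[of _ "Lf ?Tn"])
    also have "\<dots> = sscl ((- 1) ^ (i * j)) (ap 0 (b11 ?Tn ?Tn ?A') (ap 0 (b21 ?Tj ?Ti ?Tn (tpow_add C X j i)) (ap 0 (Sw ?Ti ?Tj) u)))"
      unfolding Suc using X u addc by (simp add: ap_Scl ap_Comp[of _ "Lf ?Tn"] ap_Comp[of _ "Tn (Lf ?Tj) (Lf ?Ti)"])
    finally show ?thesis .
  qed
  have M: "ap 0 (?q, ?o, ?A) (ap 0 (b21 ?Tj ?Ti ?Tn (tpow_add C X j i)) u) = sscl ((- 1) ^ i) (ap 0 (b11 (tpow C (Suc ?n) X) (tpow C (Suc ?n) X) ?A) (ap 0 ?m (ap p1 (Sw ?Ti X) u)))"
    if u: "vs u" "fst u = [?Tj, ?Ti, X]" for u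
  proof -
    let ?r = "Tn (Tn (Lf ?Tj) (Lf ?Ti)) (Lf X)"
    let ?S = "Inv C (Asc C ?Tj X ?Ti) \<cdot> ((Id C ?Tj \<otimes>\<^sub>a Sym C ?Ti X) \<cdot> Asc C ?Tj ?Ti X)"
    have S: "tpow_add C X (Suc j) i \<in> Hom C (tpow C (Suc j) X \<otimes>\<^sub>o ?Ti) (tpow C (Suc ?n) X)"
      using X by (simp add: in_Hom_iff add.commute)
    have "ap 0 (?q, ?o, ?A) (ap 0 (b21 ?Tj ?Ti ?Tn (tpow_add C X j i)) u) = ap 0 (?r, ?o, ?A \<cdot> (tpow_add C X j i \<otimes>\<^sub>a Id C X)) u"
      using X u addc by (simp add: ap_Comp[of _ ?q] ap_Tar)
    also have "\<dots> = ap 0 (?r, ?o, Scl C ((- 1) ^ i) (?A \<cdot> (tpow_add C X (Suc j) i \<cdot> ?S))) u"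
      using wmove_last[OF X, of j i] unfolding c by simp
    also have "\<dots> = sscl ((- 1) ^ i) (ap 0 (b11 (tpow C (Suc ?n) X) (tpow C (Suc ?n) X) ?A) (ap 0 ?m (ap p1 (Sw ?Ti X) u)))"
      using X u S by (simp add: in_Hom_iff ap_Scl ap_Comp[of _ ?o] ap_Comp[of _ "Tn (Tn (Lf ?Tj) (Lf X)) (Lf ?Ti)"]
        ap_Comp[of _ "Tn (Lf ?Tj) (Tn (Lf X) (Lf ?Ti))"] ap_Comp[of _ "Tn (Lf ?Tj) (Tn (Lf ?Ti) (Lf X))"] ap_Tar)
    finally show ?thesis .
  qed
  let ?s = "start [?Ti, ?Tj, X]"
  have S: "tpow_add C X (Suc j) i \<in> Hom C (tpow C (Suc j) X \<otimes>\<^sub>o ?Ti) (tpow C (Suc ?n) X)"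
    using X by (simp add: in_Hom_iff add.commute)
  have "ap 0 (?t, ?o, ?A \<cdot> tpow_add C X i (Suc j)) ?s = ap 0 (?q, ?o, ?A) (ap 0 (b11 ?Tn ?Tn ?A') (ap 0 (ad X i j) ?s))"
    using X by (simp add: ap_Comp[of _ ?q] ap_tpow_add_Suc abs pos_def)
  also have "\<dots> = sscl ((- 1) ^ (i * j)) (ap 0 (?q, ?o, ?A) (ap 0 (b21 ?Tj ?Ti ?Tn (tpow_add C X j i)) (ap 0 (Sw ?Ti ?Tj) ?s)))"
    using X addc by (simp add: IH ap_sscl abs)
  also have "\<dots> = sscl ((- 1) ^ (i * j)) (sscl ((- 1) ^ i) (ap 0 (b11 (tpow C (Suc ?n) X) (tpow C (Suc ?n) X) ?A) (ap 0 ?m (ap p1 (Sw ?Ti X) (ap 0 (Sw ?Ti ?Tj) ?s)))))"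
    using X by (simp add: M)
  also have "\<dots> = ap 0 (?t, ?o, Scl C ((- 1) ^ (i * Suc j)) (?A \<cdot> (tpow_add C X (Suc j) i \<cdot> Sym C ?Ti (tpow C (Suc j) X)))) ?s"
    using X S ap_Sym_tree[of ?s "[]" ?Ti "Tn (Lf ?Tj) (Lf X)" "[]" 0]
    by (simp add: in_Hom_iff ap_Scl ap_Comp[of _ ?o] ap_Comp[of _ "Tn (Tn (Lf ?Tj) (Lf X)) (Lf ?Ti)"] power_add mult.commute)
  finally show ?case
    using X S by (intro faithful[of ?t ?o]) (simp_all add: in_Hom_iff)
qed

end

section \<open>Pairings of tensor powers\<close>

context rigid_pseudo_abelian_tensor_cat
begin

lemma ev_pow_Hom:
  assumes "X \<in> Obj C"
  shows "ev_pow C n X \<in> Hom C (tpow C n (dual C X) \<otimes>\<^sub>o tpow C n X) \<bbbI>"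
proof (induction n)
  case (Suc n)
  have "ev C X \<in> Hom C (dual C X \<otimes>\<^sub>o X) \<bbbI>" using assms by (simp add: in_Hom_iff)
  then show ?case using Suc assms ev1324_Hom by simp
qed (simp add: in_Hom_iff)

lemma ev_pow_simps [simp]:
  assumes "X \<in> Obj C"
  shows "ev_pow C n X \<in> Arr C" "Dom C (ev_pow C n X) = tpow C n (dual C X) \<otimes>\<^sub>o tpow C n X" "Cod C (ev_pow C n X) = \<bbbI>"
  using ev_pow_Hom[OF assms, of n] by (simp_all add: in_Hom_iff)

lemma ev_Hom: "X \<in> Obj C \<Longrightarrow> ev C X \<in> Hom C (dual C X \<otimes>\<^sub>o X) \<bbbI>"
  by (simp add: in_Hom_iff)

declare ev_pow.simps(2) [simp del]

abbreviation evb :: "'a \<Rightarrow> ('a, 'b) box" where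
  "evb X \<equiv> b20 (dual C X) X (ev C X)"

abbreviation evp :: "nat \<Rightarrow> 'a \<Rightarrow> ('a, 'b) box" where
  "evp n X \<equiv> b20 (tpow C n (dual C X)) (tpow C n X) (ev_pow C n X)"

lemma ap_ev_pow_Suc:
  assumes "pos k [tpow C n (dual C X), dual C X, tpow C n X, X] s" "X \<in> Obj C"
  shows "ap k (Tn (Tn (Lf (tpow C n (dual C X))) (Lf (dual C X))) (Tn (Lf (tpow C n X)) (Lf X)), Ut, ev_pow C (Suc n) X) s
    = ap k (evp n X) (ap (Suc (Suc k)) (evb X) (ap (Suc k) (Sw (dual C X) (tpow C n X)) s))"
  unfolding ev_pow.simps(2) using assms ev_pow_Hom[OF assms(2)] ev_Hom[OF assms(2)] by (intro ap_ev1324)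

text \<open>Both sides pair the same factors. In the induction step the evaluation of the newly
  added pair is slid out of the concatenations, after which the induction hypothesis applies to the
  rest.\<close>

lemma ev_pow_add:
  assumes X: "X \<in> Obj C"
  shows "ev_pow C (i + j) X \<cdot> (tpow_add C (dual C X) i j \<otimes>\<^sub>a tpow_add C X i j)
    = ev1324 C (tpow C i (dual C X)) (tpow C j (dual C X)) (tpow C i X) (tpow C j X) (ev_pow C i X) (ev_pow C j X)"
proof (induction j)
  case 0
  let ?Y = "dual C X" and ?T = "tpow C i X" and ?T' = "tpow C i (dual C X)"
  let ?t = "Tn (Tn (Lf ?T') Ut) (Tn (Lf ?T) Ut)" and ?s = "start [?T', ?T]"
  have "ap p1 (Tn Ut (Lf ?T), Tn (Lf ?T) Ut, Sym C \<bbbI> ?T) ?s = ?s"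
    using X ap_Sym_treeL[of ?s "[?T']" Ut ?T "[]" p1] by simp
  moreover have "Lun C \<bbbI> \<in> Hom C (\<bbbI> \<otimes>\<^sub>o \<bbbI>) \<bbbI>" by (simp add: in_Hom_iff)
  ultimately have "ap 0 (?t, Ut, ev1324 C ?T' \<bbbI> ?T \<bbbI> (ev_pow C i X) (Lun C \<bbbI>)) ?s = ap 0 (evp i X) ?s"
    using X ap_ev1324_tree[of 0 "Lf ?T'" Ut "Lf ?T" Ut ?s "ev_pow C i X" "Lun C \<bbbI>"] ev_pow_Hom[OF X, of i] by (simp add: pos_def)
  moreover have "ap 0 (?t, Ut, ev_pow C i X \<cdot> (Run C ?T' \<otimes>\<^sub>a Run C ?T)) ?s = ap 0 (evp i X) ?s"
    using X by (simp add: ap_Comp[of _ "Tn (Lf ?T') (Lf ?T)"] ap_Tar)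
  moreover have "ev1324 C ?T' \<bbbI> ?T \<bbbI> (ev_pow C i X) (Lun C \<bbbI>) \<in> Hom C ((?T' \<otimes>\<^sub>o \<bbbI>) \<otimes>\<^sub>o (?T \<otimes>\<^sub>o \<bbbI>)) \<bbbI>"
    using X ev_pow_Hom[OF X, of i] by (intro ev1324_Hom) (simp_all add: in_Hom_iff)
  ultimately show ?case using X by (intro faithful[of ?t Ut]) (simp_all add: in_Hom_iff)
next
  case (Suc j)
  let ?Y = "dual C X"
  let ?Ti = "tpow C i X" and ?Ti' = "tpow C i ?Y" and ?Tj = "tpow C j X" and ?Tj' = "tpow C j ?Y"
  let ?Tn = "tpow C (i + j) X" and ?Tn' = "tpow C (i + j) ?Y"
  let ?b = "Tn (Lf ?Tj') (Lf ?Y)" and ?d = "Tn (Lf ?Tj) (Lf X)"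
  let ?t = "Tn (Tn (Lf ?Ti') ?b) (Tn (Lf ?Ti) ?d)"
  let ?u = "Tn (Tn (Lf ?Tn') (Lf ?Y)) (Tn (Lf ?Tn) (Lf X))"
  let ?s = "start [?Ti', ?Tj', ?Y, ?Ti, ?Tj, X]"
  note EH = ev_pow_Hom[OF X]
  have IH: "ap 0 (evp (i + j) X) (ap 0 (ad ?Y i j) (ap p2 (ad X i j) u))
     = ap 0 (evp i X) (ap p2 (evp j X) (ap p1 (Sw ?Tj' ?Ti) u))" if u: "vs u" "fst u = [?Ti', ?Tj', ?Ti, ?Tj]" for u
  proof -
    let ?v = "Tn (Tn (Lf ?Ti') (Lf ?Tj')) (Tn (Lf ?Ti) (Lf ?Tj))"
    have "ap 0 (evp (i + j) X) (ap 0 (ad ?Y i j) (ap p2 (ad X i j) u))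
       = ap 0 (?v, Ut, ev_pow C (i + j) X \<cdot> (tpow_add C ?Y i j \<otimes>\<^sub>a tpow_add C X i j)) u"
      using u X by (simp add: ap_Comp[of _ "Tn (Lf ?Tn') (Lf ?Tn)"] ap_Tar)
    then show ?thesis unfolding Suc using u X EH by (simp add: ap_ev1324 pos_def)
  qed
  have "ap 0 (?t, Ut, ev_pow C (i + Suc j) X \<cdot> (tpow_add C ?Y i (Suc j) \<otimes>\<^sub>a tpow_add C X i (Suc j))) ?s
     = ap 0 (evp (i + j) X) (ap p2 (evb X) (ap p1 (Sw ?Y ?Tn) (ap 0 (ad ?Y i j) (ap p3 (ad X i j) ?s))))"
    using X by (simp add: ap_Comp[of _ ?u] ap_Tar ap_tpow_add_Suc ap_ev_pow_Suc pos_def)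
  also have "ap p1 (Sw ?Y ?Tn) (ap 0 (ad ?Y i j) (ap p3 (ad X i j) ?s)) = ap 0 (ad ?Y i j) (ap p2 (Sw ?Y ?Tn) (ap p3 (ad X i j) ?s))"
    using X by (simp add: comm[of "ad ?Y i j" "Sw ?Y ?Tn" _ 0 p2])
  also have "ap p2 (Sw ?Y ?Tn) (ap p3 (ad X i j) ?s) = ap p2 (ad X i j) (ap p3 (Sw ?Y ?Tj) (ap p2 (Sw ?Y ?Ti) ?s))"
    using X by (subst slideR_21) (simp_all add: pos_def in_Hom_iff)
  also have "ap p2 (evb X) (ap 0 (ad ?Y i j) (ap p2 (ad X i j) (ap p3 (Sw ?Y ?Tj) (ap p2 (Sw ?Y ?Ti) ?s))))
     = ap 0 (ad ?Y i j) (ap p2 (ad X i j) (ap p4 (evb X) (ap p3 (Sw ?Y ?Tj) (ap p2 (Sw ?Y ?Ti) ?s))))"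
    using X by (simp add: comm[of "ad ?Y i j" "evb X" _ 0 p3]
      comm[of "ad X i j" "evb X" _ p2 p4])
  also have "ap 0 (evp (i + j) X) \<dots> = ap 0 (evp i X) (ap p2 (evp j X) (ap p1 (Sw ?Tj' ?Ti) (ap p4 (evb X) (ap p3 (Sw ?Y ?Tj) (ap p2 (Sw ?Y ?Ti) ?s)))))"
    using X by (intro IH) simp_all
  also have "\<dots> = ap 0 (evp i X) (ap p2 (evp j X) (ap p4 (evb X) (ap p3 (Sw ?Y ?Tj) (ap p1 (Sw ?Tj' ?Ti) (ap p2 (Sw ?Y ?Ti) ?s)))))"
    using X by (simp add: comm[of "Sw ?Tj' ?Ti" "evb X" _ p1 p4]
       comm[of "Sw ?Tj' ?Ti" "Sw ?Y ?Tj" _ p1 p3])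
  also have "\<dots> = ap 0 (?t, Ut, ev1324 C ?Ti' (tpow C (Suc j) ?Y) ?Ti (tpow C (Suc j) X) (ev_pow C i X) (ev_pow C (Suc j) X)) ?s"
  proof -
    have "ap p1 (Tn ?b (Lf ?Ti), Tn (Lf ?Ti) ?b, Sym C (ob ?b) ?Ti) ?s = ap p1 (Sw ?Tj' ?Ti) (ap p2 (Sw ?Y ?Ti) ?s)"
      using X ap_Sym_treeL[of ?s "[?Ti']" ?b ?Ti "[?Tj, X]" p1] by simp
    then show ?thesis
      using X ap_ev1324_tree[of 0 "Lf ?Ti'" ?b "Lf ?Ti" ?d ?s "ev_pow C i X" "ev_pow C (Suc j) X"] EH[of i] EH[of "Suc j"]
      by (simp add: pos_def ap_ev_pow_Suc)
  qed
  finally have "ap 0 (?t, Ut, ev_pow C (i + Suc j) X \<cdot> (tpow_add C ?Y i (Suc j) \<otimes>\<^sub>a tpow_add C X i (Suc j))) (start (lv ?t))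
    = ap 0 (?t, Ut, ev1324 C ?Ti' (tpow C (Suc j) ?Y) ?Ti (tpow C (Suc j) X) (ev_pow C i X) (ev_pow C (Suc j) X)) (start (lv ?t))" by simp
  moreover have "ev1324 C ?Ti' (tpow C (Suc j) ?Y) ?Ti (tpow C (Suc j) X) (ev_pow C i X) (ev_pow C (Suc j) X)
      \<in> Hom C ((?Ti' \<otimes>\<^sub>o tpow C (Suc j) ?Y) \<otimes>\<^sub>o (?Ti \<otimes>\<^sub>o tpow C (Suc j) X)) \<bbbI>"
    using X EH[of i] EH[of "Suc j"] by (intro ev1324_Hom) simp_all
  ultimately show ?case using X by (intro faithful[of ?t Ut]) (simp_all add: in_Hom_iff)
qed

text \<open>Since corresponding factors are paired, a transposition on one side may be moved to the
  other. Only the last generator is a genuine case: its crossing is pulled through the two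
  evaluations.\<close>

lemma ev_pow_swap:
  assumes X: "X \<in> Obj C"
  shows "Suc k < n \<Longrightarrow> ev_pow C n X \<cdot> (swap C (dual C X) n k \<otimes>\<^sub>a Id C (tpow C n X)) = ev_pow C n X \<cdot> (Id C (tpow C n (dual C X)) \<otimes>\<^sub>a swap C X n k)"
proof (induction n)
  case (Suc n)
  let ?Y = "dual C X"
  show ?case
  proof (cases "Suc k = n")
    case False
    then have k: "Suc k < n" using Suc by simp
    let ?T = "tpow C n X" and ?T' = "tpow C n ?Y"
    let ?t = "Tn (Tn (Lf ?T') (Lf ?Y)) (Tn (Lf ?T) (Lf X))" and ?s = "start [?T', ?Y, ?T, X]"
    let ?w = "b11 ?T ?T (swap C X n k)" and ?w' = "b11 ?T' ?T' (swap C ?Y n k)"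
    have IH: "ap 0 (evp n X) (ap 0 ?w' u) = ap 0 (evp n X) (ap p1 ?w u)" if u: "vs u" "fst u = [?T', ?T]" for u
    proof -
      have "ap 0 (evp n X) (ap 0 ?w' u) = ap 0 (Tn (Lf ?T') (Lf ?T), Ut, ev_pow C n X \<cdot> (swap C ?Y n k \<otimes>\<^sub>a Id C ?T)) u"
        using X u by (simp add: ap_Comp[of _ "Tn (Lf ?T') (Lf ?T)"] ap_Tar)
      then show ?thesis
        unfolding Suc.IH[OF k] using X u by (simp add: ap_Comp[of _ "Tn (Lf ?T') (Lf ?T)"] ap_Tar)
    qed
    have "ap 0 (?t, Ut, ev_pow C (Suc n) X \<cdot> (swap C ?Y (Suc n) k \<otimes>\<^sub>a Id C (tpow C (Suc n) X))) ?s
       = ap 0 (evp n X) (ap p2 (evb X) (ap p1 (Sw ?Y ?T) (ap 0 ?w' ?s)))"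
      using X k by (simp add: ap_Comp[of _ ?t] ap_Tar swap_Suc ap_ev_pow_Suc pos_def)
    also have "\<dots> = ap 0 (evp n X) (ap 0 ?w' (ap p2 (evb X) (ap p1 (Sw ?Y ?T) ?s)))"
      using X by (simp add: comm[of ?w' "evb X" _ 0 p2] comm[of ?w' "Sw ?Y ?T" _ 0 p1])
    also have "\<dots> = ap 0 (evp n X) (ap p1 ?w (ap p2 (evb X) (ap p1 (Sw ?Y ?T) ?s)))"
      using X by (intro IH) simp_all
    also have "\<dots> = ap 0 (evp n X) (ap p2 (evb X) (ap p1 ?w (ap p1 (Sw ?Y ?T) ?s)))"
      using X by (simp add: comm[of ?w "evb X" _ p1 p2])
    also have "ap p1 ?w (ap p1 (Sw ?Y ?T) ?s) = ap p1 (Sw ?Y ?T) (ap p2 ?w ?s)"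
      using X by (subst slideR_11) (simp_all add: pos_def in_Hom_iff)
    also have "ap 0 (evp n X) (ap p2 (evb X) (ap p1 (Sw ?Y ?T) (ap p2 ?w ?s)))
       = ap 0 (?t, Ut, ev_pow C (Suc n) X \<cdot> (Id C (tpow C (Suc n) ?Y) \<otimes>\<^sub>a swap C X (Suc n) k)) ?s"
      using X k by (simp add: ap_Comp[of _ ?t] ap_Tar swap_Suc ap_ev_pow_Suc pos_def)
    finally show ?thesis
      using X by (intro faithful[of ?t Ut]) simp_all
  next
    case True
    let ?T = "tpow C k X" and ?T' = "tpow C k ?Y" and ?n = "Suc (Suc k)"
    let ?a = "Tn (Tn (Lf ?T) (Lf X)) (Lf X)" and ?a' = "Tn (Tn (Lf ?T') (Lf ?Y)) (Lf ?Y)"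
    let ?e = "evb X" and ?s = "start [?T', ?Y, ?Y, ?T, X, X]"
    note EH = ev_pow_Hom[OF X]
    \<comment> \<open>A drawing with the last two pairs separated and their evaluations adjacent.
      Sliding off one evaluation consumes the crossing of the two dual strands, and sliding it back
      on from the other side creates a crossing of the two strands X.\<close>
    have E: "ap 0 (Tn ?a' ?a, Ut, ev_pow C ?n X) u
       = ap 0 (evp k X) (ap p2 ?e (ap p4 ?e (ap p3 (Sw ?Y X) (ap p1 (Sw ?Y ?T) (ap p2 (Sw ?Y ?T) u)))))"
      if u: "vs u" "fst u = [?T', ?Y, ?Y, ?T, X, X]" for u
    proof -
      let ?c = "Tn (Lf ?T) (Lf X)"
      have "ap p2 (Tn (Lf ?Y) ?c, Tn ?c (Lf ?Y), Sym C ?Y (ob ?c)) u = ap p3 (Sw ?Y X) (ap p2 (Sw ?Y ?T) u)"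
        using X u ap_Sym_tree[of u "[?T', ?Y]" ?Y ?c "[X]" p2] by simp
      then have "ap 0 (Tn ?a' ?a, Ut, ev_pow C ?n X) u
        = ap 0 (evp k X) (ap p2 ?e (ap p1 (Sw ?Y ?T) (ap p4 ?e (ap p3 (Sw ?Y X) (ap p2 (Sw ?Y ?T) u)))))"
        unfolding ev_pow.simps(2)[of C "Suc k"]
        using X u EH[of "Suc k"] ev_Hom[OF X] ap_ev1324_tree[of 0 "Tn (Lf ?T') (Lf ?Y)" "Lf ?Y" ?c "Lf X" u "ev_pow C (Suc k) X" "ev C X"]
        by (simp add: pos_def ap_ev_pow_Suc)
      then show ?thesis
        using X u by (simp add: comm[of "Sw ?Y ?T" ?e _ p1 p4]
          comm[of "Sw ?Y ?T" "Sw ?Y X" _ p1 p3])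
    qed
    have "ap 0 (Tn ?a' ?a, Ut, ev_pow C ?n X \<cdot> (swap C ?Y ?n k \<otimes>\<^sub>a Id C (tpow C ?n X))) ?s
       = ap 0 (Tn ?a' ?a, Ut, ev_pow C ?n X) (ap p1 (Sw ?Y ?Y) ?s)"
      using X by (simp add: ap_Comp[of _ "Tn ?a' ?a"] ap_Tar ap_swap_last pos_def)
    also have "\<dots> = ap 0 (evp k X) (ap p2 ?e (ap p4 ?e (ap p3 (Sw ?Y X) (ap p1 (Sw ?Y ?T) (ap p2 (Sw ?Y ?T) (ap p1 (Sw ?Y ?Y) ?s))))))"
      using X by (intro E) simp_all
    also have "ap p1 (Sw ?Y ?T) (ap p2 (Sw ?Y ?T) (ap p1 (Sw ?Y ?Y) ?s)) = ap p2 (Sw ?Y ?Y) (ap p1 (Sw ?Y ?T) (ap p2 (Sw ?Y ?T) ?s))"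
      using X by (subst yang_baxter) (simp_all add: pos_def)
    also have "ap p2 ?e (ap p4 ?e (ap p3 (Sw ?Y X) (ap p2 (Sw ?Y ?Y) (ap p1 (Sw ?Y ?T) (ap p2 (Sw ?Y ?T) ?s)))))
      = ap p2 ?e (ap p2 ?e (ap p3 (Sw ?Y X) (ap p2 (Sw ?Y ?Y) (ap p1 (Sw ?Y ?T) (ap p2 (Sw ?Y ?T) ?s)))))"
      using X by (simp add: comm[of ?e ?e _ p2 p4])
    also have "ap p2 ?e (ap p3 (Sw ?Y X) (ap p2 (Sw ?Y ?Y) (ap p1 (Sw ?Y ?T) (ap p2 (Sw ?Y ?T) ?s)))) = ap p3 ?e (ap p1 (Sw ?Y ?T) (ap p2 (Sw ?Y ?T) ?s))"
      using X ev_Hom[OF X] by (subst slideR_20) (simp_all add: pos_def)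
    also have "\<dots> = ap p4 ?e (ap p3 (Sw ?Y X) (ap p4 (Sw X X) (ap p1 (Sw ?Y ?T) (ap p2 (Sw ?Y ?T) ?s))))"
      using X ev_Hom[OF X] by (subst slideL_20) (simp_all add: pos_def)
    also have "ap p4 (Sw X X) (ap p1 (Sw ?Y ?T) (ap p2 (Sw ?Y ?T) ?s)) = ap p1 (Sw ?Y ?T) (ap p2 (Sw ?Y ?T) (ap p4 (Sw X X) ?s))"
      using X by (simp add: comm[where f = "Sw ?Y ?T" and g = "Sw X X" and l = p4])
    also have "ap 0 (evp k X) (ap p2 ?e (ap p4 ?e (ap p3 (Sw ?Y X) (ap p1 (Sw ?Y ?T) (ap p2 (Sw ?Y ?T) (ap p4 (Sw X X) ?s))))))
      = ap 0 (Tn ?a' ?a, Ut, ev_pow C ?n X) (ap p4 (Sw X X) ?s)"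
      using X by (intro E[symmetric]) simp_all
    also have "\<dots> = ap 0 (Tn ?a' ?a, Ut, ev_pow C ?n X \<cdot> (Id C (tpow C ?n ?Y) \<otimes>\<^sub>a swap C X ?n k)) ?s"
      using X by (simp add: ap_Comp[of _ "Tn ?a' ?a"] ap_Tar ap_swap_last pos_def)
    finally have "ev_pow C ?n X \<cdot> (swap C ?Y ?n k \<otimes>\<^sub>a Id C (tpow C ?n X)) = ev_pow C ?n X \<cdot> (Id C (tpow C ?n ?Y) \<otimes>\<^sub>a swap C X ?n k)"
      using X by (intro faithful[of "Tn ?a' ?a" Ut]) simp_all
    then show ?thesis using True by simp
  qed
qed simp

text \<open>Both sides equal \<open>ev \<circ> (A \<otimes> A)\<close>.\<close>

lemma ev_pow_antisym:
  assumes X: "X \<in> Obj C"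
  shows "ev_pow C n X \<cdot> (antisym C n (dual C X) \<otimes>\<^sub>a Id C (tpow C n X)) = ev_pow C n X \<cdot> (Id C (tpow C n (dual C X)) \<otimes>\<^sub>a antisym C n X)"
proof -
  let ?Y = "dual C X" and ?e = "ev_pow C n X"
  let ?T = "tpow C n X" and ?T' = "tpow C n (dual C X)"
  have Y: "?Y \<in> Obj C" using X by simp
  have "?e \<cdot> (antisym C n ?Y \<otimes>\<^sub>a antisym C n X) = ?e \<cdot> (antisym C n ?Y \<otimes>\<^sub>a Id C ?T)"
  proof (rule antisym_absorb_swap[OF X, where P = "?T' \<otimes>\<^sub>o ?T" and Q = \<bbbI> and \<phi> = "\<lambda>b. ?e \<cdot> (antisym C n ?Y \<otimes>\<^sub>a b)"])
    fix b k assume b: "b \<in> Hom C ?T ?T" and k: "Suc k < n"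
    have "?e \<cdot> (antisym C n ?Y \<otimes>\<^sub>a (swap C X n k \<cdot> b)) = (?e \<cdot> (Id C ?T' \<otimes>\<^sub>a swap C X n k)) \<cdot> (antisym C n ?Y \<otimes>\<^sub>a b)"
      using b X by (simp add: in_Hom_iff Tar_Comp_Arr)
    also have "\<dots> = ?e \<cdot> ((swap C ?Y n k \<cdot> antisym C n ?Y) \<otimes>\<^sub>a b)"
      unfolding ev_pow_swap[OF X k, symmetric] using b X by (simp add: in_Hom_iff Tar_Comp_Arr)
    finally show "?e \<cdot> (antisym C n ?Y \<otimes>\<^sub>a (swap C X n k \<cdot> b)) = Scl C (- 1) (?e \<cdot> (antisym C n ?Y \<otimes>\<^sub>a b))"
      using b X k by (simp add: in_Hom_iff swap_antisym)
  qed (use X in \<open>auto simp: in_Hom_iff Add_distrib\<close>)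
  moreover have "?e \<cdot> (antisym C n ?Y \<otimes>\<^sub>a antisym C n X) = ?e \<cdot> (Id C ?T' \<otimes>\<^sub>a antisym C n X)"
  proof (rule antisym_absorb_swap[OF Y, where P = "?T' \<otimes>\<^sub>o ?T" and Q = \<bbbI> and \<phi> = "\<lambda>b. ?e \<cdot> (b \<otimes>\<^sub>a antisym C n X)"])
    fix b k assume b: "b \<in> Hom C ?T' ?T'" and k: "Suc k < n"
    have "?e \<cdot> ((swap C ?Y n k \<cdot> b) \<otimes>\<^sub>a antisym C n X) = (?e \<cdot> (swap C ?Y n k \<otimes>\<^sub>a Id C ?T)) \<cdot> (b \<otimes>\<^sub>a antisym C n X)"
      using b X by (simp add: in_Hom_iff Tar_Comp_Arr)
    also have "\<dots> = ?e \<cdot> (b \<otimes>\<^sub>a (swap C X n k \<cdot> antisym C n X))"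
      unfolding ev_pow_swap[OF X k] using b X by (simp add: in_Hom_iff Tar_Comp_Arr)
    finally show "?e \<cdot> ((swap C ?Y n k \<cdot> b) \<otimes>\<^sub>a antisym C n X) = Scl C (- 1) (?e \<cdot> (b \<otimes>\<^sub>a antisym C n X))"
      using b X k by (simp add: in_Hom_iff swap_antisym)
  qed (use X in \<open>auto simp: in_Hom_iff Add_distrib\<close>)
  ultimately show ?thesis by simp
qed

primrec coev_pow :: "nat \<Rightarrow> 'a \<Rightarrow> 'b \<Rightarrow> 'b" where
  "coev_pow 0 X c = Inv C (Lun C \<bbbI>)"
| "coev_pow (Suc n) X c = tensor_coev (tpow C n X) (tpow C n (dual C X)) X (dual C X) (coev_pow n X c) c"

lemma perf_ev_pow:
  assumes "perf X (dual C X) (ev C X) c"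
  shows "perf (tpow C n X) (tpow C n (dual C X)) (ev_pow C n X) (coev_pow n X c)"
proof (induction n)
  case 0
  then show ?case by (simp add: perf_Unit)
next
  case (Suc n)
  then show ?case using perf_tensor[OF Suc assms] by (simp add: ev_pow.simps(2))
qed

text \<open>The properties shared by \<open>ev_pow\<close> and by its twist. Working with them
  treats contractions by elements of the exterior powers of V and of its dual at once, hence both
  kinds of Poincare morphisms.\<close>

definition pairing :: "'a \<Rightarrow> 'a \<Rightarrow> (nat \<Rightarrow> 'b) \<Rightarrow> bool" where
  "pairing Y X \<epsilon> \<longleftrightarrow> Y \<in> Obj C \<and> X \<in> Obj C \<and> (\<forall>n. \<epsilon> n \<in> Hom C (tpow C n Y \<otimes>\<^sub>o tpow C n X) \<bbbI>) \<and>
     (\<forall>i j. \<epsilon> (i + j) \<cdot> (tpow_add C Y i j \<otimes>\<^sub>a tpow_add C X i j)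
        = ev1324 C (tpow C i Y) (tpow C j Y) (tpow C i X) (tpow C j X) (\<epsilon> i) (\<epsilon> j)) \<and>
     (\<forall>n. \<epsilon> n \<cdot> (antisym C n Y \<otimes>\<^sub>a Id C (tpow C n X)) = \<epsilon> n \<cdot> (Id C (tpow C n Y) \<otimes>\<^sub>a antisym C n X))"

lemma pairingD:
  assumes "pairing Y X \<epsilon>"
  shows "Y \<in> Obj C" "X \<in> Obj C" "\<epsilon> n \<in> Hom C (tpow C n Y \<otimes>\<^sub>o tpow C n X) \<bbbI>"
    "\<epsilon> (i + j) \<cdot> (tpow_add C Y i j \<otimes>\<^sub>a tpow_add C X i j)
        = ev1324 C (tpow C i Y) (tpow C j Y) (tpow C i X) (tpow C j X) (\<epsilon> i) (\<epsilon> j)"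
    "\<epsilon> n \<cdot> (antisym C n Y \<otimes>\<^sub>a Id C (tpow C n X)) = \<epsilon> n \<cdot> (Id C (tpow C n Y) \<otimes>\<^sub>a antisym C n X)"
  using assms unfolding pairing_def by blast+

lemma pairing_ev_pow:
  assumes X: "X \<in> Obj C"
  shows "pairing (dual C X) X (\<lambda>n. ev_pow C n X)"
  using X ev_pow_Hom[OF X] ev_pow_add[OF X] ev_pow_antisym[OF X] unfolding pairing_def by fastforce

lemma pairing_twist:
  assumes "pairing Y X \<epsilon>"
  shows "pairing X Y (\<lambda>n. twist C (tpow C n Y) (tpow C n X) (\<epsilon> n))"
  unfolding pairing_def
proof (intro conjI allI)
  have o: "Y \<in> Obj C" "X \<in> Obj C" and \<epsilon>: "\<epsilon> n \<in> Hom C (tpow C n Y \<otimes>\<^sub>o tpow C n X) \<bbbI>" for n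
    using pairingD(1-3)[OF assms] by auto
  have \<epsilon>' [simp]: "\<epsilon> n \<in> Arr C" "Dom C (\<epsilon> n) = tpow C n Y \<otimes>\<^sub>o tpow C n X" "Cod C (\<epsilon> n) = \<bbbI>" for n
    using \<epsilon>[of n] by (simp_all add: in_Hom_iff)
  show "X \<in> Obj C" "Y \<in> Obj C" using o by auto
  fix n
  show "twist C (tpow C n Y) (tpow C n X) (\<epsilon> n) \<in> Hom C (tpow C n X \<otimes>\<^sub>o tpow C n Y) \<bbbI>"
    using o \<epsilon> by (intro twist_Hom) simp_all
  show "twist C (tpow C n Y) (tpow C n X) (\<epsilon> n) \<cdot> (antisym C n X \<otimes>\<^sub>a Id C (tpow C n Y))
      = twist C (tpow C n Y) (tpow C n X) (\<epsilon> n) \<cdot> (Id C (tpow C n X) \<otimes>\<^sub>a antisym C n Y)"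
  proof -
    let ?T = "tpow C n X" and ?U = "tpow C n Y"
    have "(\<epsilon> n \<cdot> Sym C ?T ?U) \<cdot> (antisym C n X \<otimes>\<^sub>a Id C ?U) = (\<epsilon> n \<cdot> (Id C ?U \<otimes>\<^sub>a antisym C n X)) \<cdot> Sym C ?T ?U"
      using o Sym_nat[of "antisym C n X" "Id C ?U"] by simp
    also have "\<epsilon> n \<cdot> (Id C ?U \<otimes>\<^sub>a antisym C n X) = \<epsilon> n \<cdot> (antisym C n Y \<otimes>\<^sub>a Id C ?T)"
      using pairingD(5)[OF assms] by simp
    also have "(\<epsilon> n \<cdot> (antisym C n Y \<otimes>\<^sub>a Id C ?T)) \<cdot> Sym C ?T ?U = (\<epsilon> n \<cdot> Sym C ?T ?U) \<cdot> (Id C ?T \<otimes>\<^sub>a antisym C n Y)"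
      using o Sym_nat[of "Id C ?T" "antisym C n Y"] by simp
    finally show ?thesis by (simp add: twist_def)
  qed
  fix i j
  let ?a = "tpow_add C Y i j" and ?b = "tpow_add C X i j"
  let ?P = "tpow C i X \<otimes>\<^sub>o tpow C j X" and ?Q = "tpow C i Y \<otimes>\<^sub>o tpow C j Y"
  let ?T = "tpow C (i + j) X" and ?U = "tpow C (i + j) Y"
  have "(\<epsilon> (i + j) \<cdot> Sym C ?T ?U) \<cdot> (?b \<otimes>\<^sub>a ?a) = (\<epsilon> (i + j) \<cdot> (?a \<otimes>\<^sub>a ?b)) \<cdot> Sym C ?P ?Q"
    using o Sym_nat[of ?b ?a] by simp
  also have "\<epsilon> (i + j) \<cdot> (?a \<otimes>\<^sub>a ?b) = ev1324 C (tpow C i Y) (tpow C j Y) (tpow C i X) (tpow C j X) (\<epsilon> i) (\<epsilon> j)"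
    by (rule pairingD(4)[OF assms])
  also have "\<dots> \<cdot> Sym C ?P ?Q = ev1324 C (tpow C i X) (tpow C j X) (tpow C i Y) (tpow C j Y)
     (twist C (tpow C i Y) (tpow C i X) (\<epsilon> i)) (twist C (tpow C j Y) (tpow C j X) (\<epsilon> j))"
    using o \<epsilon> twist_ev1324[of "tpow C i X" "tpow C j X" "tpow C i Y" "tpow C j Y" "\<epsilon> i" "\<epsilon> j"] by (simp add: twist_def)
  finally show "twist C ?U ?T (\<epsilon> (i + j)) \<cdot> (?b \<otimes>\<^sub>a ?a) = ev1324 C (tpow C i X) (tpow C j X) (tpow C i Y) (tpow C j Y)
     (twist C (tpow C i Y) (tpow C i X) (\<epsilon> i)) (twist C (tpow C j Y) (tpow C j X) (\<epsilon> j))"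
    by (simp add: twist_def)
qed

definition alt :: "'a \<Rightarrow> 'a \<Rightarrow> (nat \<Rightarrow> 'b) \<Rightarrow> nat \<Rightarrow> 'b" where
  "alt Y X \<epsilon> n = \<epsilon> n \<cdot> (winj C n Y \<otimes>\<^sub>a winj C n X)"

lemma alt_Hom:
  assumes "pairing Y X \<epsilon>"
  shows "alt Y X \<epsilon> n \<in> Hom C (wedge C n Y \<otimes>\<^sub>o wedge C n X) \<bbbI>"
  using pairingD(1,2)[OF assms] pairingD(3)[OF assms, of n] by (simp add: alt_def in_Hom_iff)

end

section \<open>The alternating algebra\<close>

context rigid_pseudo_abelian_tensor_cat
begin

text \<open>\<open>comm\<close> read from right to left, with the position of \<open>g\<close> fixed
  by an equation free of subtraction, so that the simplifier can check it.\<close>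

lemma comm_rev:
  assumes "wb f" "wb g" "vs s" "fits k f (fst s)" "fits l g (fst s)" "k + length (ins f) \<le> l" "l' + length (ins f) = l + length (outs f)"
  shows "ap l' g (ap k f s) = ap k f (ap l g s)"
proof -
  have "l' = l + length (outs f) - length (ins f)" using assms(7) by simp
  then show ?thesis using comm[OF assms(1-6)] by simp
qed

abbreviation wi :: "nat \<Rightarrow> 'a \<Rightarrow> ('a, 'b) box" where
  "wi n X \<equiv> b11 (wedge C n X) (tpow C n X) (winj C n X)"

abbreviation wp :: "nat \<Rightarrow> 'a \<Rightarrow> ('a, 'b) box" where
  "wp n X \<equiv> b11 (tpow C n X) (wedge C n X) (wprj C n X)"

abbreviation as :: "nat \<Rightarrow> 'a \<Rightarrow> ('a, 'b) box" where
  "as n X \<equiv> b11 (tpow C n X) (tpow C n X) (antisym C n X)"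

abbreviation ia :: "'a \<Rightarrow> nat \<Rightarrow> nat \<Rightarrow> ('a, 'b) box" where
  "ia X i j \<equiv> b12 (tpow C (i + j) X) (tpow C i X) (tpow C j X) (Inv C (tpow_add C X i j))"

abbreviation wm :: "'a \<Rightarrow> nat \<Rightarrow> nat \<Rightarrow> ('a, 'b) box" where
  "wm X i j \<equiv> b21 (wedge C i X) (wedge C j X) (wedge C (i + j) X) (wmult C X i j)"

lemma wmult_simps [simp]:
  assumes "X \<in> Obj C"
  shows "wmult C X i j \<in> Arr C" "Dom C (wmult C X i j) = wedge C i X \<otimes>\<^sub>o wedge C j X" "Cod C (wmult C X i j) = wedge C (i + j) X"
  using assms by (simp_all add: wmult_def)

lemma ap_wi_wp: "X \<in> Obj C \<Longrightarrow> pos k [tpow C n X] s \<Longrightarrow> ap k (wi n X) (ap k (wp n X) s) = ap k (as n X) s"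
  using ap_Comp[of "Lf (tpow C n X)" "Lf (wedge C n X)" "wprj C n X" "Lf (tpow C n X)" "winj C n X" s k]
  by (simp add: winj_wprj pos_def)

lemma ap_as_wi: "X \<in> Obj C \<Longrightarrow> pos k [wedge C n X] s \<Longrightarrow> ap k (as n X) (ap k (wi n X) s) = ap k (wi n X) s"
  using ap_Comp[of "Lf (wedge C n X)" "Lf (tpow C n X)" "winj C n X" "Lf (tpow C n X)" "antisym C n X" s k]
  by (simp add: antisym_winj pos_def)

lemma ap_ad_ia: "X \<in> Obj C \<Longrightarrow> pos k [tpow C (i + j) X] s \<Longrightarrow> ap k (ad X i j) (ap k (ia X i j) s) = s"
  using ap_Comp[of "Lf (tpow C (i + j) X)" "Tn (Lf (tpow C i X)) (Lf (tpow C j X))" "Inv C (tpow_add C X i j)" "Lf (tpow C (i + j) X)" "tpow_add C X i j" s k]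
  by (simp add: pos_def)

lemma ap_wmult:
  assumes "X \<in> Obj C" "pos k [wedge C i X, wedge C j X] s"
  shows "ap k (wm X i j) s = ap k (wp (i + j) X) (ap k (ad X i j) (ap k (wi i X) (ap (Suc k) (wi j X) s)))"
  using assms unfolding wmult_def
  by (simp add: ap_Comp[of _ "Lf (tpow C (i + j) X)"] ap_Comp[of _ "Tn (Lf (tpow C i X)) (Lf (tpow C j X))"] ap_Tar pos_def)

text \<open>The projection absorbs an antisymmetrizer, which makes the tensor-power version
  \<open>antisym_tpow_add_commute\<close> applicable between the projection and the
  injections.\<close>

lemma wmult_commute:
  assumes X: "X \<in> Obj C"
  shows "wmult C X i j = Scl C ((- 1) ^ (i * j)) (wmult C X j i \<cdot> Sym C (wedge C i X) (wedge C j X))"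
proof -
  let ?p = "wprj C (i + j) X" and ?s = "winj C i X \<otimes>\<^sub>a winj C j X" and ?A = "antisym C (i + j) X"
  let ?S = "Sym C (tpow C i X) (tpow C j X)"
  have a: "tpow_add C X j i \<in> Arr C" "Dom C (tpow_add C X j i) = tpow C j X \<otimes>\<^sub>o tpow C i X" "Cod C (tpow_add C X j i) = tpow C (i + j) X"
    using X by (simp_all add: add.commute)
  have "wmult C X i j = (?p \<cdot> ?A) \<cdot> (tpow_add C X i j \<cdot> ?s)"
    using X by (simp add: wmult_def wprj_antisym del: Comp_assoc_Arr)
  also have "\<dots> = ?p \<cdot> ((?A \<cdot> tpow_add C X i j) \<cdot> ?s)"
    using X by simp
  also have "\<dots> = Scl C ((- 1) ^ (i * j)) (?p \<cdot> (?A \<cdot> (tpow_add C X j i \<cdot> (?S \<cdot> ?s))))"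
    unfolding antisym_tpow_add_commute[OF X] using X a by simp
  also have "?S \<cdot> ?s = (winj C j X \<otimes>\<^sub>a winj C i X) \<cdot> Sym C (wedge C i X) (wedge C j X)"
    using X Sym_nat[of "winj C i X" "winj C j X"] by simp
  also have "?p \<cdot> (?A \<cdot> (tpow_add C X j i \<cdot> ((winj C j X \<otimes>\<^sub>a winj C i X) \<cdot> Sym C (wedge C i X) (wedge C j X))))
    = (?p \<cdot> ?A) \<cdot> (tpow_add C X j i \<cdot> ((winj C j X \<otimes>\<^sub>a winj C i X) \<cdot> Sym C (wedge C i X) (wedge C j X)))"
    using X a by simp
  also have "\<dots> = wmult C X j i \<cdot> Sym C (wedge C i X) (wedge C j X)"
    using X a by (simp add: wmult_def wprj_antisym add.commute)
  finally show ?thesis .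
qed

lemma wcontract_Hom:
  assumes "Y \<in> Obj C" "X \<in> Obj C" "e \<in> Hom C (tpow C i Y \<otimes>\<^sub>o tpow C i X) \<bbbI>"
  shows "wcontract C Y X e i (i + j) \<in> Hom C (wedge C i Y \<otimes>\<^sub>o wedge C (i + j) X) (wedge C j X)"
  using assms contract_left_Hom[of "tpow C i Y" "tpow C i X" "tpow C j X" e] by (simp add: wcontract_def in_Hom_iff)

lemma ap_wcontract:
  assumes "Y \<in> Obj C" "X \<in> Obj C" "e \<in> Hom C (tpow C i Y \<otimes>\<^sub>o tpow C i X) \<bbbI>" "pos k [wedge C i Y, wedge C (i + j) X] s"
  shows "ap k (b21 (wedge C i Y) (wedge C (i + j) X) (wedge C j X) (wcontract C Y X e i (i + j))) s
    = ap k (wp j X) (ap k (b20 (tpow C i Y) (tpow C i X) e) (ap (Suc k) (ia X i j) (ap k (wi i Y) (ap (Suc k) (wi (i + j) X) s))))"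
proof -
  let ?s = "start [wedge C i Y, wedge C (i + j) X]"
  have "ap 0 (b21 (wedge C i Y) (wedge C (i + j) X) (wedge C j X) (wcontract C Y X e i (i + j))) ?s
    = ap 0 (wp j X) (ap 0 (b20 (tpow C i Y) (tpow C i X) e) (ap 0 (wi i Y) (ap p1 (ia X i j) (ap p1 (wi (i + j) X) ?s))))"
    unfolding wcontract_def using assms(1-3) contract_left_Hom[of "tpow C i Y" "tpow C i X" "tpow C j X" e]
    by (simp add: in_Hom_iff ap_Comp[of _ "Lf (tpow C j X)"] ap_Comp[of _ "Tn (Lf (tpow C i Y)) (Tn (Lf (tpow C i X)) (Lf (tpow C j X)))"]
      ap_Tar ap_Comp[of _ "Lf (tpow C (i + j) X)"] ap_contract_left pos_def)
  also have "\<dots> = ap 0 (wp j X) (ap 0 (b20 (tpow C i Y) (tpow C i X) e) (ap p1 (ia X i j) (ap 0 (wi i Y) (ap p1 (wi (i + j) X) ?s))))"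
    using assms(1-3) by (simp add: in_Hom_iff comm[of "wi i Y" "ia X i j" _ 0 p1])
  finally show ?thesis
    using pos_transfer[OF assms(4), of "[(0, b21 (wedge C i Y) (wedge C (i + j) X) (wedge C j X) (wcontract C Y X e i (i + j)))]"
      "[(p1, wi (i + j) X), (0, wi i Y), (p1, ia X i j), (0, b20 (tpow C i Y) (tpow C i X) e), (0, wp j X)]"]
      assms(1-3) wcontract_Hom[OF assms(1-3), of j] by (simp add: in_Hom_iff)
qed

abbreviation altb :: "'a \<Rightarrow> 'a \<Rightarrow> (nat \<Rightarrow> 'b) \<Rightarrow> nat \<Rightarrow> ('a, 'b) box" where
  "altb Y X \<epsilon> n \<equiv> b20 (wedge C n Y) (wedge C n X) (alt Y X \<epsilon> n)"

lemma ap_alt: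
  assumes "pairing Y X \<epsilon>" "pos k [wedge C n Y, wedge C n X] s"
  shows "ap k (altb Y X \<epsilon> n) s = ap k (b20 (tpow C n Y) (tpow C n X) (\<epsilon> n)) (ap k (wi n Y) (ap (Suc k) (wi n X) s))"
  using assms(2) pairingD(1,2)[OF assms(1)] pairingD(3)[OF assms(1), of n] unfolding alt_def
  by (simp add: in_Hom_iff ap_Comp[of _ "Tn (Lf (tpow C n Y)) (Lf (tpow C n X))"] ap_Tar pos_def)

lemma pairing_antisym_ap:
  assumes "pairing Y X \<epsilon>" "pos k [tpow C n Y, tpow C n X] s"
  shows "ap k (b20 (tpow C n Y) (tpow C n X) (\<epsilon> n)) (ap k (as n Y) s) = ap k (b20 (tpow C n Y) (tpow C n X) (\<epsilon> n)) (ap (Suc k) (as n X) s)"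
proof -
  let ?e = "b20 (tpow C n Y) (tpow C n X) (\<epsilon> n)" and ?u = "start [tpow C n Y, tpow C n X]" and ?t = "Tn (Lf (tpow C n Y)) (Lf (tpow C n X))"
  have o: "Y \<in> Obj C" "X \<in> Obj C" "\<epsilon> n \<in> Arr C" "Dom C (\<epsilon> n) = tpow C n Y \<otimes>\<^sub>o tpow C n X" "Cod C (\<epsilon> n) = \<bbbI>"
    and h: "\<epsilon> n \<cdot> (antisym C n Y \<otimes>\<^sub>a Id C (tpow C n X)) = \<epsilon> n \<cdot> (Id C (tpow C n Y) \<otimes>\<^sub>a antisym C n X)"
    using pairingD(1,2)[OF assms(1)] pairingD(3,5)[OF assms(1), of n] by (auto simp: in_Hom_iff)
  have "ap 0 (?t, Ut, \<epsilon> n \<cdot> (antisym C n Y \<otimes>\<^sub>a Id C (tpow C n X))) ?u = ap 0 ?e (ap 0 (as n Y) ?u)"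
    using o by (simp add: ap_Comp[of _ ?t] ap_Tar)
  moreover have "ap 0 (?t, Ut, \<epsilon> n \<cdot> (Id C (tpow C n Y) \<otimes>\<^sub>a antisym C n X)) ?u = ap 0 ?e (ap p1 (as n X) ?u)"
    using o by (simp add: ap_Comp[of _ ?t] ap_Tar)
  ultimately show ?thesis
    using pos_transfer[OF assms(2), of "[(0, as n Y), (0, ?e)]" "[(p1, as n X), (0, ?e)]"] o h by simp
qed

lemma pairing_add_ap:
  assumes "pairing Y X \<epsilon>" "pos k [tpow C i Y, tpow C j Y, tpow C i X, tpow C j X] s"
  shows "ap k (b20 (tpow C (i + j) Y) (tpow C (i + j) X) (\<epsilon> (i + j))) (ap k (ad Y i j) (ap (Suc (Suc k)) (ad X i j) s))
    = ap k (b20 (tpow C i Y) (tpow C i X) (\<epsilon> i)) (ap (Suc (Suc k)) (b20 (tpow C j Y) (tpow C j X) (\<epsilon> j)) (ap (Suc k) (Sw (tpow C j Y) (tpow C i X)) s))"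
proof -
  let ?E = "\<lambda>n. b20 (tpow C n Y) (tpow C n X) (\<epsilon> n)" and ?u = "start [tpow C i Y, tpow C j Y, tpow C i X, tpow C j X]"
  let ?t = "Tn (Tn (Lf (tpow C i Y)) (Lf (tpow C j Y))) (Tn (Lf (tpow C i X)) (Lf (tpow C j X)))"
  have o: "Y \<in> Obj C" "X \<in> Obj C" and e: "\<And>n. \<epsilon> n \<in> Hom C (tpow C n Y \<otimes>\<^sub>o tpow C n X) \<bbbI>"
    and h: "\<epsilon> (i + j) \<cdot> (tpow_add C Y i j \<otimes>\<^sub>a tpow_add C X i j)
        = ev1324 C (tpow C i Y) (tpow C j Y) (tpow C i X) (tpow C j X) (\<epsilon> i) (\<epsilon> j)"
    using pairingD(1-4)[OF assms(1)] by auto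
  have e': "\<epsilon> n \<in> Arr C" "Dom C (\<epsilon> n) = tpow C n Y \<otimes>\<^sub>o tpow C n X" "Cod C (\<epsilon> n) = \<bbbI>" for n using e[of n] by (auto simp: in_Hom_iff)
  have "ap 0 (?t, Ut, \<epsilon> (i + j) \<cdot> (tpow_add C Y i j \<otimes>\<^sub>a tpow_add C X i j)) ?u = ap 0 (?E (i + j)) (ap 0 (ad Y i j) (ap p2 (ad X i j) ?u))"
    using o e' by (simp add: ap_Comp[of _ "Tn (Lf (tpow C (i + j) Y)) (Lf (tpow C (i + j) X))"] ap_Tar)
  moreover have "ap 0 (?t, Ut, ev1324 C (tpow C i Y) (tpow C j Y) (tpow C i X) (tpow C j X) (\<epsilon> i) (\<epsilon> j)) ?u
      = ap 0 (?E i) (ap p2 (?E j) (ap p1 (Sw (tpow C j Y) (tpow C i X)) ?u))"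
    using o e by (simp add: ap_ev1324 pos_def)
  ultimately show ?thesis
    using pos_transfer[OF assms(2), of "[(p2, ad X i j), (0, ad Y i j), (0, ?E (i + j))]"
      "[(p1, Sw (tpow C j Y) (tpow C i X)), (p2, ?E j), (0, ?E i)]"] o e' h by simp
qed

text \<open>Contraction by an element of degree i is transposed to left exterior multiplication by
  it. The first i factors are contracted, so the element of degree i must come first in the product;
  this accounts for the crossing. All antisymmetrizers are absorbed, and the rest is the splitting
  of the pairing on i + j factors.\<close>

lemma wcontract_adjoint:
  assumes P: "pairing Y X \<epsilon>"
  shows "ap 0 (altb Y X \<epsilon> j) (ap p1 (b21 (wedge C i Y) (wedge C (i + j) X) (wedge C j X) (wcontract C Y X (\<epsilon> i) i (i + j)))
      (start [wedge C j Y, wedge C i Y, wedge C (i + j) X]))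
    = ap 0 (altb Y X \<epsilon> (i + j)) (ap 0 (wm Y i j) (ap 0 (Sw (wedge C j Y) (wedge C i Y)) (start [wedge C j Y, wedge C i Y, wedge C (i + j) X])))"
proof -
  let ?g = "i + j" and ?s = "start [wedge C j Y, wedge C i Y, wedge C (i + j) X]"
  let ?E = "\<lambda>n. b20 (tpow C n Y) (tpow C n X) (\<epsilon> n)"
  have o: "Y \<in> Obj C" "X \<in> Obj C" and e: "\<And>n. \<epsilon> n \<in> Hom C (tpow C n Y \<otimes>\<^sub>o tpow C n X) \<bbbI>"
    using pairingD(1-3)[OF P] by auto
  have e': "\<epsilon> n \<in> Arr C" "Dom C (\<epsilon> n) = tpow C n Y \<otimes>\<^sub>o tpow C n X" "Cod C (\<epsilon> n) = \<bbbI>" for n using e[of n] by (auto simp: in_Hom_iff)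
  let ?Tj = "tpow C j Y" and ?Ti = "tpow C i Y"
  let ?r = "ap p2 (ia X i j) (ap p2 (wi ?g X) ?s)"
  have "ap 0 (altb Y X \<epsilon> j) (ap p1 (b21 (wedge C i Y) (wedge C ?g X) (wedge C j X) (wcontract C Y X (\<epsilon> i) i ?g)) ?s)
    = ap 0 (?E j) (ap 0 (wi j Y) (ap p1 (wi j X) (ap p1 (wp j X) (ap p1 (?E i) (ap p2 (ia X i j) (ap p1 (wi i Y) (ap p2 (wi ?g X) ?s)))))))"
    using o e e' P by (simp add: ap_wcontract ap_alt pos_def)
  \<comment> \<open>Projection and injection leave an antisymmetrizer on the side of X; in the next
    step it is moved across the pairing to the side of Y, where the injection absorbs it.\<close>
  also have "\<dots> = ap 0 (?E j) (ap p1 (as j X) (ap 0 (wi j Y) (ap p1 (?E i) (ap p2 (ia X i j) (ap p1 (wi i Y) (ap p2 (wi ?g X) ?s))))))"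
    using o e' by (simp add: ap_wi_wp pos_def comm[of "wi j Y" "as j X" _ 0 p1])
  also have "\<dots> = ap 0 (?E j) (ap 0 (wi j Y) (ap p1 (?E i) (ap p2 (ia X i j) (ap p1 (wi i Y) (ap p2 (wi ?g X) ?s)))))"
    using o e' P by (simp add: pairing_antisym_ap[symmetric] ap_as_wi pos_def)
  also have "\<dots> = ap 0 (?E j) (ap p1 (?E i) (ap 0 (wi j Y) (ap p1 (wi i Y) ?r)))"
    using o e' by (simp add: comm[of "wi j Y" "?E i" _ 0 p1] comm[of "wi i Y" "ia X i j" _ p1 p2])
  finally have L: "ap 0 (altb Y X \<epsilon> j) (ap p1 (b21 (wedge C i Y) (wedge C ?g X) (wedge C j X) (wcontract C Y X (\<epsilon> i) i ?g)) ?s)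
    = ap 0 (?E j) (ap p1 (?E i) (ap 0 (wi j Y) (ap p1 (wi i Y) ?r)))" .
  let ?w = "ap 0 (Sw (wedge C j Y) (wedge C i Y)) ?s"
  let ?w' = "ap 0 (Sw (wedge C j Y) (wedge C i Y)) ?r"
  have "ap 0 (altb Y X \<epsilon> ?g) (ap 0 (wm Y i j) ?w)
    = ap 0 (?E ?g) (ap 0 (wi ?g Y) (ap p1 (wi ?g X) (ap 0 (wp ?g Y) (ap 0 (ad Y i j) (ap 0 (wi i Y) (ap p1 (wi j Y) ?w))))))"
    using o e' P by (simp add: ap_wmult ap_alt pos_def)
  also have "\<dots> = ap 0 (?E ?g) (ap 0 (as ?g Y) (ap p1 (wi ?g X) (ap 0 (ad Y i j) (ap 0 (wi i Y) (ap p1 (wi j Y) ?w)))))"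
    using o e' by (simp add: ap_wi_wp pos_def comm_rev[of "wp ?g Y" "wi ?g X" _ 0 p1 p1])
  also have "\<dots> = ap 0 (?E ?g) (ap p1 (wi ?g X) (ap 0 (ad Y i j) (ap 0 (wi i Y) (ap p1 (wi j Y) ?w))))"
    using o e' P by (simp add: pairing_antisym_ap ap_as_wi pos_def)
  also have "\<dots> = ap 0 (?E ?g) (ap 0 (ad Y i j) (ap 0 (wi i Y) (ap p1 (wi j Y) (ap 0 (Sw (wedge C j Y) (wedge C i Y)) (ap p2 (wi ?g X) ?s)))))"
    using o e' by (simp add: comm_rev[of "ad Y i j" "wi ?g X" _ 0 p2 p1]
       comm_rev[of "wi i Y" "wi ?g X" _ 0 p2 p2] comm_rev[of "wi j Y" "wi ?g X" _ p1 p2 p2]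
       comm_rev[of "Sw (wedge C j Y) (wedge C i Y)" "wi ?g X" _ 0 p2 p2])
  \<comment> \<open>The element of degree g is written as the concatenation of its own splitting
    \<open>?r\<close>, so that both arguments of the pairing are concatenations.\<close>
  also have "ap p2 (wi ?g X) ?s = ap p2 (ad X i j) ?r"
    using o by (simp add: ap_ad_ia pos_def)
  also have "ap 0 (Sw (wedge C j Y) (wedge C i Y)) (ap p2 (ad X i j) ?r) = ap p2 (ad X i j) ?w'"
    using o by (simp add: comm[of "Sw (wedge C j Y) (wedge C i Y)" "ad X i j" _ 0 p2])
  also have "ap 0 (wi i Y) (ap p1 (wi j Y) (ap p2 (ad X i j) ?w')) = ap p2 (ad X i j) (ap 0 (wi i Y) (ap p1 (wi j Y) ?w'))"
    using o by (simp add: comm[of "wi i Y" "ad X i j" _ 0 p2] comm[of "wi j Y" "ad X i j" _ p1 p2])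
  also have "ap 0 (?E ?g) (ap 0 (ad Y i j) (ap p2 (ad X i j) (ap 0 (wi i Y) (ap p1 (wi j Y) ?w'))))
     = ap 0 (?E i) (ap p2 (?E j) (ap p1 (Sw (tpow C j Y) (tpow C i X)) (ap 0 (wi i Y) (ap p1 (wi j Y) ?w'))))"
    using o P by (intro pairing_add_ap) (simp_all add: pos_def)
  also have "ap p1 (wi j Y) ?w' = ap 0 (Sw ?Tj (wedge C i Y)) (ap 0 (wi j Y) ?r)"
    using o by (subst slideL_11) (simp_all add: pos_def in_Hom_iff)
  also have "ap 0 (wi i Y) (ap 0 (Sw ?Tj (wedge C i Y)) (ap 0 (wi j Y) ?r)) = ap 0 (Sw ?Tj ?Ti) (ap p1 (wi i Y) (ap 0 (wi j Y) ?r))"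
    using o by (subst slideR_11) (simp_all add: pos_def in_Hom_iff)
  also have "ap p1 (wi i Y) (ap 0 (wi j Y) ?r) = ap 0 (wi j Y) (ap p1 (wi i Y) ?r)"
    using o by (simp add: comm[of "wi j Y" "wi i Y" _ 0 p1])
  also have "ap 0 (?E i) (ap p2 (?E j) (ap p1 (Sw ?Tj (tpow C i X)) (ap 0 (Sw ?Tj ?Ti) (ap 0 (wi j Y) (ap p1 (wi i Y) ?r)))))
    = ap 0 (?E j) (ap 0 (?E i) (ap p1 (Sw ?Tj (tpow C i X)) (ap 0 (Sw ?Tj ?Ti) (ap 0 (wi j Y) (ap p1 (wi i Y) ?r)))))"
    using o e' by (simp add: comm[of "?E i" "?E j" _ 0 p2])
  also have "ap 0 (?E i) (ap p1 (Sw ?Tj (tpow C i X)) (ap 0 (Sw ?Tj ?Ti) (ap 0 (wi j Y) (ap p1 (wi i Y) ?r)))) = ap p1 (?E i) (ap 0 (wi j Y) (ap p1 (wi i Y) ?r))"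
    using o e by (intro slideR_20) (simp_all add: pos_def)
  finally show ?thesis using L by simp
qed

end

section \<open>Traces of antisymmetrizers\<close>

context rigid_pseudo_abelian_tensor_cat
begin

lemma Scl_0: "f \<in> Arr C \<Longrightarrow> Scl C 0 f = Zer C (Dom C f) (Cod C f)"
proof -
  assume f: "f \<in> Arr C"
  interpret M: Module.module rat_ring "hom_module C (Dom C f) (Cod C f)"
    using f by (intro hom_module) auto
  show ?thesis using M.smult_l_null[of f] f by (simp add: in_Hom_iff)
qed

text \<open>The empty sum is included because for n = 0 there is no permutation in the symmetric
  group on n + 1 strands that moves the last strand.\<close>

lemma hsum_const':
  assumes "finite S" "a \<in> Hom C X Y"
  shows "hsum X Y (\<lambda>_. a) S = Scl C (of_nat (card S)) a"
proof (cases "S = {}")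
  case True
  interpret M: abelian_group "hom_module C X Y" using assms(2) by (intro hom_abelian_group) (auto simp: in_Hom_iff)
  show ?thesis using True assms(2) Scl_0[of a] by (simp add: in_Hom_iff)
qed (use hsum_const assms in blast)

lemma act_Add:
  assumes "r \<in> Hom C \<bbbI> \<bbbI>" "s \<in> Hom C \<bbbI> \<bbbI>" "f \<in> Arr C"
  shows "act C (Add C r s) f = Add C (act C r f) (act C s f)"
  using assms unfolding act_def by (simp add: in_Hom_iff Add_distrib)

lemma act_Scl:
  assumes "r \<in> Hom C \<bbbI> \<bbbI>" "f \<in> Arr C"
  shows "act C (Scl C q r) f = Scl C q (act C r f)" "act C r (Scl C q f) = Scl C q (act C r f)"
  using assms unfolding act_def by (simp_all add: in_Hom_iff)

lemma act_Id: "f \<in> Arr C \<Longrightarrow> act C (Id C \<bbbI>) f = f"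
proof -
  assume f: "f \<in> Arr C"
  have "Lun C (Cod C f) \<cdot> ((Id C \<bbbI> \<otimes>\<^sub>a f) \<cdot> Inv C (Lun C (Dom C f))) = (f \<cdot> Lun C (Dom C f)) \<cdot> Inv C (Lun C (Dom C f))"
    using f by (simp flip: Lun_nat)
  then show ?thesis unfolding act_def using f by simp
qed

lemma shift_Hom: "r \<in> Hom C \<bbbI> \<bbbI> \<Longrightarrow> shift C r q \<in> Hom C \<bbbI> \<bbbI>"
  by (simp add: shift_def in_Hom_iff)

lemma act_shift:
  assumes "r \<in> Hom C \<bbbI> \<bbbI>" "f \<in> Arr C"
  shows "act C (shift C r q) f = Add C (act C r f) (Scl C q f)"
  using assms act_Add[of r "Scl C q (Id C \<bbbI>)" f] act_Scl(1)[of "Id C \<bbbI>" f q] act_Id[of f]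
  by (simp add: shift_def in_Hom_iff)

abbreviation ep :: "nat \<Rightarrow> 'a \<Rightarrow> ('a, 'b) box" where
  "ep n X \<equiv> b20 (tpow C n X) (tpow C n (dual C X)) (ev_pow_tw C n X)"

lemma ev_pow_tw_Hom: "X \<in> Obj C \<Longrightarrow> ev_pow_tw C n X \<in> Hom C (tpow C n X \<otimes>\<^sub>o tpow C n (dual C X)) \<bbbI>"
  unfolding ev_pow_tw_def using ev_pow_Hom by (intro twist_Hom) simp_all

lemma ap_contract_right_tree:
  assumes "vs s" "fst s = lv a @ lv b @ lv d @ xs" "e \<in> Hom C (ob b \<otimes>\<^sub>o ob d) \<bbbI>"
  shows "ap 0 (Tn (Tn a b) d, a, contract_right C (ob a) (ob b) (ob d) e) s = ap (length (lv a)) (Tn b d, Ut, e) s"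
proof -
  have o: "objs (lv a)" "objs (lv b)" "objs (lv d)" "objs xs" using assms by (auto simp: vs_def)
  note e = assms(3)[unfolded in_Hom_iff]
  let ?w = "ap (length (lv a)) (Tn b d, Ut, e) s"
  have w: "vs ?w" "fst ?w = lv a @ xs" using assms o e by simp_all
  have 1: "ap 0 (Tn (Tn a b) d, Tn a (Tn b d), Asc C (ob a) (ob b) (ob d)) s = s"
    using assms o by (intro ap_Asc(1)) simp_all
  have 2: "ap 0 (Tn a (Tn b d), Tn a Ut, Id C (ob a) \<otimes>\<^sub>a e) s = ?w"
    using assms o e w by (subst ap_Tar) simp_all
  have 3: "ap 0 (Tn a Ut, a, Run C (ob a)) ?w = ?w"
    using w o by (intro ap_Run(1)) simp_all
  show ?thesis
    unfolding contract_right_def using assms(1,2) o e 1 2 3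
    by (simp add: ap_Comp[of _ "Tn a Ut"] ap_Comp[of _ "Tn a (Tn b d)"])
qed

text \<open>The partial trace over the last factor of an endomorphism of \<open>T \<otimes> X\<close>.\<close>

definition ptr :: "'a \<Rightarrow> 'b \<Rightarrow> 'a \<Rightarrow> 'b \<Rightarrow> 'b" where
  "ptr X c T f = contract_right C T X (dual C X) (twist C (dual C X) X (ev C X)) \<cdot>
     ((f \<otimes>\<^sub>a Id C (dual C X)) \<cdot> (Inv C (Asc C T X (dual C X)) \<cdot> ((Id C T \<otimes>\<^sub>a c) \<cdot> Inv C (Run C T))))"

abbreviation evt :: "'a \<Rightarrow> ('a, 'b) box" where
  "evt X \<equiv> b20 X (dual C X) (twist C (dual C X) X (ev C X))"

lemma evt_Hom: "X \<in> Obj C \<Longrightarrow> twist C (dual C X) X (ev C X) \<in> Hom C (X \<otimes>\<^sub>o dual C X) \<bbbI>"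
  by (intro twist_Hom ev_Hom) simp_all

context
  fixes X :: 'a and c :: 'b
  assumes X: "X \<in> Obj C" and p: "perf X (dual C X) (ev C X) c"
begin

lemma c_simps [simp]: "c \<in> Arr C" "Dom C c = \<bbbI>" "Cod C c = X \<otimes>\<^sub>o dual C X"
  using perfD(4)[OF p] by (simp_all add: in_Hom_iff)

lemma evt_simps [simp]:
  "twist C (dual C X) X (ev C X) \<in> Arr C" "Dom C (twist C (dual C X) X (ev C X)) = X \<otimes>\<^sub>o dual C X"
  "Cod C (twist C (dual C X) X (ev C X)) = \<bbbI>"
  using evt_Hom[OF X] by (simp_all add: in_Hom_iff)

lemma ptr_Hom:
  assumes "T \<in> Obj C" "f \<in> Hom C (T \<otimes>\<^sub>o X) (T \<otimes>\<^sub>o X)"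
  shows "ptr X c T f \<in> Hom C T T"
  using assms X contract_right_Hom[OF assms(1) X _ evt_Hom[OF X]] by (simp add: ptr_def in_Hom_iff)

lemma ap_ptr:
  assumes "vs s" "fst s = lv a @ xs" "f \<in> Hom C (ob a \<otimes>\<^sub>o X) (ob a \<otimes>\<^sub>o X)"
  shows "ap 0 (a, a, ptr X c (ob a) f) s = ap (length (lv a)) (evt X) (ap 0 (Tn a (Lf X), Tn a (Lf X), f) (ap (length (lv a)) (b02 X (dual C X) c) s))"
proof -
  let ?D = "dual C X" and ?S = "start (lv a)"
  have o: "objs (lv a)" using assms by (auto simp: vs_def)
  note f = assms(3)[unfolded in_Hom_iff]
  let ?u = "ap (length (lv a)) (b02 X ?D c) ?S" and ?F = "(Tn a (Lf X), Tn a (Lf X), f)"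
  let ?v = "ap 0 ?F ?u" let ?w = "ap (length (lv a)) (evt X) ?v"
  have u: "vs ?u" "fst ?u = lv a @ [X, ?D]" using o X by simp_all
  have v: "vs ?v" "fst ?v = lv a @ [X, ?D]" using u f o X by simp_all
  have w: "vs ?w" "fst ?w = lv a" using v o X by simp_all
  have 1: "ap 0 (Tn a Ut, Tn a (Tn (Lf X) (Lf ?D)), Id C (ob a) \<otimes>\<^sub>a c) ?S = ?u"
    using o X u by (subst ap_Tar) simp_all
  have 2: "ap 0 (Tn a (Tn (Lf X) (Lf ?D)), Tn (Tn a (Lf X)) (Lf ?D), Inv C (Asc C (ob a) X ?D)) ?u = ?u"
    using o X u by (intro ap_Asc(2)) simp_all
  have 3: "ap 0 (Tn (Tn a (Lf X)) (Lf ?D), Tn (Tn a (Lf X)) (Lf ?D), f \<otimes>\<^sub>a Id C ?D) ?u = ?v"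
    using o X u f by (subst ap_Tar) simp_all
  have 4: "ap 0 (Tn (Tn a (Lf X)) (Lf ?D), a, contract_right C (ob a) X ?D (twist C ?D X (ev C X))) ?v = ?w"
    using ap_contract_right_tree[of ?v a "Lf X" "Lf ?D" "[]"] v evt_Hom[OF X] by simp
  have 5: "ap 0 (a, Tn a Ut, Inv C (Run C (ob a))) ?S = ?S"
    using o by (intro ap_Run(2)) simp_all
  have cr: "contract_right C (ob a) X ?D (twist C ?D X (ev C X)) \<in> Hom C ((ob a \<otimes>\<^sub>o X) \<otimes>\<^sub>o ?D) (ob a)"
    using o X evt_Hom[OF X] by (intro contract_right_Hom) simp_all
  have "ap 0 (a, a, ptr X c (ob a) f) ?S = ap 0 (Tn (Tn a (Lf X)) (Lf ?D), a, contract_right C (ob a) X ?D (twist C ?D X (ev C X)))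
     (ap 0 (Tn (Tn a (Lf X)) (Lf ?D), Tn (Tn a (Lf X)) (Lf ?D), f \<otimes>\<^sub>a Id C ?D)
     (ap 0 (Tn a (Tn (Lf X) (Lf ?D)), Tn (Tn a (Lf X)) (Lf ?D), Inv C (Asc C (ob a) X ?D))
     (ap 0 (Tn a Ut, Tn a (Tn (Lf X) (Lf ?D)), Id C (ob a) \<otimes>\<^sub>a c) (ap 0 (a, Tn a Ut, Inv C (Run C (ob a))) ?S))))"
    unfolding ptr_def using o X f cr
    by (simp add: in_Hom_iff ap_Comp[of _ "Tn (Tn a (Lf X)) (Lf ?D)"] ap_Comp[of _ "Tn a (Tn (Lf X) (Lf ?D))"] ap_Comp[of _ "Tn a Ut"] del: ap_Run ap_Asc)
  also have "\<dots> = ?w" unfolding 5 1 2 3 4 by (rule refl)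
  finally have "ap 0 (a, a, ptr X c (ob a) f) ?S = ?w" .
  moreover have "pos 0 (lv a) s" using assms by (simp add: pos_def)
  ultimately show ?thesis
    using pos_transfer[of 0 "lv a" s "[(0, (a, a, ptr X c (ob a) f))]" "[(length (lv a), b02 X ?D c), (0, ?F), (length (lv a), evt X)]"]
      o f X ptr_Hom[of "ob a" f] assms(3) by (simp add: in_Hom_iff)
qed

lemma ptr_Add:
  assumes "T \<in> Obj C" "f \<in> Hom C (T \<otimes>\<^sub>o X) (T \<otimes>\<^sub>o X)" "g \<in> Hom C (T \<otimes>\<^sub>o X) (T \<otimes>\<^sub>o X)"
  shows "ptr X c T (Add C f g) = Add C (ptr X c T f) (ptr X c T g)"
  using assms X contract_right_Hom[OF assms(1) X _ evt_Hom[OF X]] unfolding ptr_def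
  by (simp add: in_Hom_iff Add_distrib)

lemma ptr_Scl:
  assumes "T \<in> Obj C" "f \<in> Hom C (T \<otimes>\<^sub>o X) (T \<otimes>\<^sub>o X)"
  shows "ptr X c T (Scl C q f) = Scl C q (ptr X c T f)"
  using assms X contract_right_Hom[OF assms(1) X _ evt_Hom[OF X]] unfolding ptr_def
  by (simp add: in_Hom_iff)

lemma ptr_Id:
  assumes "T \<in> Obj C"
  shows "ptr X c T (Id C (T \<otimes>\<^sub>o X)) = act C (twist C (dual C X) X (ev C X) \<cdot> c) (Id C T)"
proof (rule faithful[of "Lf T" "Lf T"])
  let ?r = "twist C (dual C X) X (ev C X) \<cdot> c"
  have r: "?r \<in> Hom C \<bbbI> \<bbbI>" using X by (simp add: in_Hom_iff)
  have "ap 0 (b11 T T (ptr X c T (Id C (T \<otimes>\<^sub>o X)))) (start [T]) = ap p1 (evt X) (ap p1 (b02 X (dual C X) c) (start [T]))"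
    using assms X ap_ptr[of "start [T]" "Lf T" "[]" "Id C (T \<otimes>\<^sub>o X)"] by (simp add: in_Hom_iff)
  also have "\<dots> = ap p1 (Ut, Ut, ?r) (start [T])"
    using assms X by (simp add: ap_Comp[of _ "Tn (Lf X) (Lf (dual C X))"])
  also have "\<dots> = ap 0 (Ut, Ut, ?r) (start [T])"
    using assms r by (intro b00_move) simp_all
  also have "\<dots> = ap 0 (b11 T T (act C ?r (Id C T))) (start [T])"
    using assms r by (simp add: ap_act)
  finally show "ap 0 (b11 T T (ptr X c T (Id C (T \<otimes>\<^sub>o X)))) (start (lv (Lf T))) = ap 0 (b11 T T (act C ?r (Id C T))) (start (lv (Lf T)))"
    by simp
qed (use assms X ptr_Hom[of T "Id C (T \<otimes>\<^sub>o X)"] in \<open>simp_all add: in_Hom_iff\<close>)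

text \<open>Boxes that do not touch the closed strand can be slid out of the partial trace on either
  side.\<close>

lemma ptr_bimodule:
  assumes T: "T \<in> Obj C" and f: "f \<in> Hom C (T \<otimes>\<^sub>o X) (T \<otimes>\<^sub>o X)" and a: "a \<in> Hom C T T" and b: "b \<in> Hom C T T"
  shows "ptr X c T ((a \<otimes>\<^sub>a Id C X) \<cdot> (f \<cdot> (b \<otimes>\<^sub>a Id C X))) = a \<cdot> (ptr X c T f \<cdot> b)"
proof (rule faithful[of "Lf T" "Lf T"])
  note h = f[unfolded in_Hom_iff] a[unfolded in_Hom_iff] b[unfolded in_Hom_iff]
  let ?t = "Tn (Lf T) (Lf X)" and ?s = "start [T]" and ?c = "b02 X (dual C X) c"
  let ?G = "(a \<otimes>\<^sub>a Id C X) \<cdot> (f \<cdot> (b \<otimes>\<^sub>a Id C X))"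
  have "ap 0 (b11 T T (ptr X c T ?G)) ?s = ap p1 (evt X) (ap 0 (?t, ?t, ?G) (ap p1 ?c ?s))"
    using T X h ap_ptr[of ?s "Lf T" "[]" ?G] by (simp add: in_Hom_iff)
  also have "\<dots> = ap p1 (evt X) (ap 0 (b11 T T a) (ap 0 (?t, ?t, f) (ap 0 (b11 T T b) (ap p1 ?c ?s))))"
    using T X h by (simp add: ap_Comp[of _ ?t] ap_Tar)
  also have "\<dots> = ap 0 (b11 T T a) (ap p1 (evt X) (ap 0 (?t, ?t, f) (ap p1 ?c (ap 0 (b11 T T b) ?s))))"
    using T X h by (simp add: comm[of "b11 T T a" "evt X" _ 0 p1] comm[of "b11 T T b" ?c _ 0 p1])
  also have "\<dots> = ap 0 (b11 T T (a \<cdot> (ptr X c T f \<cdot> b))) ?s"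
    using T X h f ap_ptr[of "ap 0 (b11 T T b) ?s" "Lf T" "[]" f] ptr_Hom[OF T f] by (simp add: in_Hom_iff ap_Comp[of _ "Lf T"])
  finally show "ap 0 (b11 T T (ptr X c T ?G)) (start (lv (Lf T))) = ap 0 (b11 T T (a \<cdot> (ptr X c T f \<cdot> b))) (start (lv (Lf T)))" by simp
qed (use assms X ptr_Hom[OF T f] ptr_Hom[OF T, of "(a \<otimes>\<^sub>a Id C X) \<cdot> (f \<cdot> (b \<otimes>\<^sub>a Id C X))"] in \<open>simp_all add: in_Hom_iff\<close>)

text \<open>Sliding the Casimir element across the strand undoes the crossing; the zigzag identity
  then straightens the curl.\<close>

lemma ptr_swap: "ptr X c (tpow C (Suc k) X) (swap C X (Suc (Suc k)) k) = Id C (tpow C (Suc k) X)"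
proof (rule faithful[of "Tn (Lf (tpow C k X)) (Lf X)" "Tn (Lf (tpow C k X)) (Lf X)"])
  let ?T = "tpow C k X" and ?D = "dual C X" and ?S = "swap C X (Suc (Suc k)) k"
  let ?a = "Tn (Lf ?T) (Lf X)" and ?s = "start [?T, X]"
  let ?c = "b02 X ?D c" and ?e = "evb X"
  have e: "ap p2 (Sw X ?D) (ap p1 (Sw X X) (ap p2 ?c ?s)) = ap p1 ?c ?s"
    using X perfD(4)[OF p] by (subst slideR_02) (simp_all add: pos_def)
  have "ap 0 (?a, ?a, ptr X c (ob ?a) ?S) ?s = ap p2 (evt X) (ap 0 (Tn ?a (Lf X), Tn ?a (Lf X), ?S) (ap p2 ?c ?s))"
    using X ap_ptr[of ?s ?a "[]" ?S] by (simp add: in_Hom_iff)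
  also have "\<dots> = ap p2 ?e (ap p2 (Sw X ?D) (ap p1 (Sw X X) (ap p2 ?c ?s)))"
    using X ev_Hom[OF X] by (simp add: ap_swap_last ap_twist pos_def)
  also have "\<dots> = ?s"
    unfolding e using X by (simp add: zigzag1[OF p] pos_def)
  finally show "ap 0 (?a, ?a, ptr X c (tpow C (Suc k) X) ?S) (start (lv ?a)) = ap 0 (?a, ?a, Id C (tpow C (Suc k) X)) (start (lv ?a))"
    using X by simp
qed (use X ptr_Hom[of "tpow C (Suc k) X" "swap C X (Suc (Suc k)) k"] in \<open>simp_all add: in_Hom_iff\<close>)

lemma perm_mor_antisym:
  assumes "\<sigma> permutes {..<n}"
  shows "perm_mor C X n \<sigma> \<cdot> antisym C n X = Scl C (sgnr \<sigma>) (antisym C n X)"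
  using X assms by (intro perm_mor_antisymmetric) (simp_all add: swap_antisym)

text \<open>If \<open>\<sigma>\<close> fixes the last strand, the closed strand is a loop with value
  the rank. Otherwise \<open>\<sigma>\<close> factors through one crossing at the last strand, whose
  partial trace is the identity. The factors on n strands become signs on the antisymmetrizer, and
  the crossing contributes the additional -1.\<close>

lemma ptr_perm:
  assumes \<sigma>: "\<sigma> permutes {..<Suc n}"
  shows "ptr X c (tpow C n X) (perm_mor C X (Suc n) \<sigma> \<cdot> (antisym C n X \<otimes>\<^sub>a Id C X))
     = Scl C (sgnr \<sigma>) (if \<sigma> permutes {..<n} then act C (twist C (dual C X) X (ev C X) \<cdot> c) (antisym C n X) else Scl C (- 1) (antisym C n X))"
proof -
  let ?T = "tpow C n X" and ?A = "antisym C n X" and ?r = "twist C (dual C X) X (ev C X) \<cdot> c"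
  have T: "?T \<in> Obj C" and r: "?r \<in> Hom C \<bbbI> \<bbbI>" using X by (simp_all add: in_Hom_iff)
  note r' = r[unfolded in_Hom_iff]
  have actr: "act C ?r (Id C ?T) \<cdot> ?A = act C ?r ?A"
  proof (rule faithful[of "Lf ?T" "Lf ?T"])
    show "ap 0 (b11 ?T ?T (act C ?r (Id C ?T) \<cdot> ?A)) (start (lv (Lf ?T))) = ap 0 (b11 ?T ?T (act C ?r ?A)) (start (lv (Lf ?T)))"
      using X r by (simp add: ap_Comp[of _ "Lf ?T"] ap_act)
  qed (use X r' in simp_all)
  show ?thesis
  proof (cases "\<sigma> permutes {..<n}")
    case True
    let ?P = "perm_mor C X n \<sigma>"
    have 1: "perm_mor C X (Suc n) \<sigma> \<cdot> (?A \<otimes>\<^sub>a Id C X) = Scl C (sgnr \<sigma>) (?A \<otimes>\<^sub>a Id C X)"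
      using X True by (simp add: perm_mor_lift Tar_Comp_Arr perm_mor_antisym)
    have "?A \<otimes>\<^sub>a Id C X = (Id C ?T \<otimes>\<^sub>a Id C X) \<cdot> (Id C (?T \<otimes>\<^sub>o X) \<cdot> (?A \<otimes>\<^sub>a Id C X))"
      using X by simp
    then have 2: "ptr X c ?T (?A \<otimes>\<^sub>a Id C X) = act C ?r ?A"
      using X actr r' ptr_Id[OF T] ptr_bimodule[of ?T "Id C (?T \<otimes>\<^sub>o X)" "Id C ?T" ?A] by (simp add: in_Hom_iff)
    show ?thesis unfolding 1 using True X 2 by (subst ptr_Scl) (simp_all add: in_Hom_iff)
  next
    case False
    define b where "b = \<sigma> n"
    have bn: "b \<noteq> n"
    proof
      assume "b = n"
      then have "\<sigma> permutes {..<n}"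
        using \<sigma> by (intro permutes_superset[OF \<sigma>]) (auto simp: b_def less_Suc_eq)
      then show False using False by simp
    qed
    have "b < Suc n" using permutes_in_image[OF \<sigma>, of n] by (simp add: b_def)
    then have b: "b < n" using bn by simp
    then obtain m where m: "n = Suc m" by (cases n) auto
    \<comment> \<open>With n = m + 1, \<open>\<rho>\<close> sends b, the image of n under
      \<open>\<sigma>\<close>, to m, and \<open>adj m\<close> sends m back to n. So
      \<open>\<beta>\<close> fixes n, and \<open>\<sigma>\<close> is
      \<open>\<rho> \<circ> adj m \<circ> \<beta>\<close>, with \<open>\<rho>\<close> and
      \<open>\<beta>\<close> moving only the first n strands.\<close>
    define \<rho> where "\<rho> = Transposition.transpose b m"
    define \<beta> where "\<beta> = adj m \<circ> (\<rho> \<circ> \<sigma>)"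
    have \<rho>: "\<rho> permutes {..<n}" unfolding \<rho>_def using b m by (intro permutes_swap_id) auto
    then have \<rho>': "\<rho> permutes {..<Suc n}" by (rule permutes_subset) auto
    have ad: "adj m permutes {..<Suc n}" using m by (intro adj_permutes) simp
    have \<beta>': "\<beta> permutes {..<Suc n}" unfolding \<beta>_def by (intro permutes_compose ad \<rho>' \<sigma>)
    have "\<beta> n = adj m (\<rho> b)" by (simp only: \<beta>_def comp_apply b_def)
    then have \<beta>n: "\<beta> n = n" by (simp add: \<rho>_def m)
    have \<beta>: "\<beta> permutes {..<n}"
      using \<beta>' by (rule permutes_superset) (use \<beta>n in \<open>auto simp: less_Suc_eq\<close>)
    have dec: "\<sigma> = \<rho> \<circ> (adj m \<circ> \<beta>)" by (simp add: \<beta>_def \<rho>_def fun_eq_iff)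
    have sg: "sgnr \<sigma> = - (sgnr \<rho> * sgnr \<beta>)"
      using sgnr_comp[OF \<rho>' permutes_compose[OF \<beta>' ad]] sgnr_comp[OF ad \<beta>'] sgnr_adj[of m] by (simp add: dec)
    let ?P = "perm_mor C X n \<rho>" and ?B = "perm_mor C X n \<beta>" and ?S = "swap C X (Suc n) m"
    have "perm_mor C X (Suc n) \<sigma> = (?P \<otimes>\<^sub>a Id C X) \<cdot> (?S \<cdot> (?B \<otimes>\<^sub>a Id C X))"
      unfolding dec using X \<rho> \<beta> \<rho>' \<beta>' ad m permutes_compose[OF \<beta>' ad]
      by (simp add: perm_mor_comp perm_mor_lift perm_mor_adj del: tens.simps)
    then have "perm_mor C X (Suc n) \<sigma> \<cdot> (?A \<otimes>\<^sub>a Id C X) = (?P \<otimes>\<^sub>a Id C X) \<cdot> (?S \<cdot> ((?B \<cdot> ?A) \<otimes>\<^sub>a Id C X))"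
      using X \<rho> \<beta> by (simp add: whisk_right)
    then have 1: "perm_mor C X (Suc n) \<sigma> \<cdot> (?A \<otimes>\<^sub>a Id C X) = Scl C (sgnr \<beta>) ((?P \<otimes>\<^sub>a Id C X) \<cdot> (?S \<cdot> (?A \<otimes>\<^sub>a Id C X)))"
      using X \<rho> \<beta> by (simp add: perm_mor_antisym)
    have "ptr X c ?T ?S = Id C ?T"
      unfolding m by (rule ptr_swap)
    then have 2: "ptr X c ?T ((?P \<otimes>\<^sub>a Id C X) \<cdot> (?S \<cdot> (?A \<otimes>\<^sub>a Id C X))) = Scl C (sgnr \<rho>) ?A"
      using X \<rho> ptr_bimodule[of ?T ?S ?P ?A] by (simp add: in_Hom_iff perm_mor_antisym)
    show ?thesis unfolding 1 using False X sg 2 \<rho> by (subst ptr_Scl) (simp_all add: in_Hom_iff mult.commute)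
  qed
qed

text \<open>The n! permutations that fix the last strand contribute r each, the other n * n!
  contribute -1 each, all as multiples of the smaller antisymmetrizer; dividing by (n + 1)! gives (r
  - n)/(n + 1).\<close>

theorem ptr_antisym:
  "ptr X c (tpow C n X) (antisym C (Suc n) X)
     = Scl C (1 / of_nat (Suc n)) (act C (shift C (twist C (dual C X) X (ev C X) \<cdot> c) (- of_nat n)) (antisym C n X))"
proof -
  let ?T = "tpow C n X" and ?A = "antisym C n X" and ?r = "twist C (dual C X) X (ev C X) \<cdot> c"
  let ?U = "tpow C (Suc n) X"
  have T: "?T \<in> Obj C" "?U \<in> Obj C" and r: "?r \<in> Hom C \<bbbI> \<bbbI>" using X by (simp_all add: in_Hom_iff)
  note r' = r[unfolded in_Hom_iff]
  let ?R = "act C ?r ?A" and ?N = "Scl C (- 1) ?A"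
  have RN: "?R \<in> Hom C ?T ?T" "?N \<in> Hom C ?T ?T" using X r' by (simp_all add: in_Hom_iff)
  let ?f = "\<lambda>\<sigma>. Scl C (sgnr \<sigma>) (perm_mor C X (Suc n) \<sigma>)"
  \<comment> \<open>The smaller antisymmetrizer is inserted in front, which
    \<open>antisym_Suc_absorb\<close> permits. Only then is the partial trace of a single
    permutation a multiple of a fixed morphism.\<close>
  let ?\<phi> = "\<lambda>b. ptr X c ?T (b \<cdot> (?A \<otimes>\<^sub>a Id C X))"
  have \<phi>H: "?\<phi> b \<in> Hom C ?T ?T" if "b \<in> Hom C ?U ?U" for b
    using that X T by (intro ptr_Hom) (simp_all add: in_Hom_iff)
  have \<phi>S: "?\<phi> (Scl C q b) = Scl C q (?\<phi> b)" if "b \<in> Hom C ?U ?U" for q b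
    using that X T ptr_Scl[of ?T "b \<cdot> (?A \<otimes>\<^sub>a Id C X)"] by (simp add: in_Hom_iff)
  have fH: "?f \<sigma> \<in> Hom C ?U ?U" if "\<sigma> \<in> perms (Suc n)" for \<sigma>
    using antisym_terms[OF X that] by simp
  have sub: "perms n \<subseteq> perms (Suc n)" using permutes_subset by (metis (mono_tags, lifting) Collect_mono lessThan_subset_iff le_add2 plus_1_eq_Suc)
  let ?R2 = "perms (Suc n) - perms n"
  have part: "perms (Suc n) = perms n \<union> ?R2" using sub by auto
  have cardR: "of_nat (card ?R2) = (of_nat n * fact n :: rat)"
    using sub by (subst card_Diff_subset) (simp_all add: algebra_simps of_nat_diff)
  have val: "?\<phi> (?f \<sigma>) = (if \<sigma> \<in> perms n then ?R else ?N)" if "\<sigma> \<in> perms (Suc n)" for \<sigma>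
    using \<phi>S[of "perm_mor C X (Suc n) \<sigma>" "sgnr \<sigma>"] that X r' ptr_perm[of \<sigma> n] by (simp add: in_Hom_iff mult.assoc[symmetric])
  have "ptr X c ?T (antisym C (Suc n) X) = ?\<phi> (antisym C (Suc n) X)"
    using X by (simp add: antisym_Suc_absorb)
  also have "\<dots> = Scl C (1 / fact (Suc n)) (?\<phi> (hsum ?U ?U ?f (perms (Suc n))))"
    unfolding antisym_def[of C "Suc n"] using fH T by (intro \<phi>S hsum_closed) auto
  also have "?\<phi> (hsum ?U ?U ?f (perms (Suc n))) = hsum ?T ?T (\<lambda>\<sigma>. ?\<phi> (?f \<sigma>)) (perms (Suc n))"
  proof (rule hsum_map[where \<phi> = ?\<phi>])
    fix a b assume "a \<in> Hom C ?U ?U" "b \<in> Hom C ?U ?U"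
    then show "?\<phi> (Add C a b) = Add C (?\<phi> a) (?\<phi> b)"
      using X T ptr_Add[of ?T "a \<cdot> (?A \<otimes>\<^sub>a Id C X)" "b \<cdot> (?A \<otimes>\<^sub>a Id C X)"] by (simp add: in_Hom_iff Add_distrib)
  qed (use T fH \<phi>H in auto)
  also have "\<dots> = hsum ?T ?T (\<lambda>\<sigma>. if \<sigma> \<in> perms n then ?R else ?N) (perms n \<union> ?R2)"
    using val RN T part by (intro hsum_cong) auto
  also have "\<dots> = Add C (hsum ?T ?T (\<lambda>\<sigma>. if \<sigma> \<in> perms n then ?R else ?N) (perms n)) (hsum ?T ?T (\<lambda>\<sigma>. if \<sigma> \<in> perms n then ?R else ?N) ?R2)"
    using T RN by (intro hsum_Un) auto
  also have "hsum ?T ?T (\<lambda>\<sigma>. if \<sigma> \<in> perms n then ?R else ?N) (perms n) = hsum ?T ?T (\<lambda>_. ?R) (perms n)"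
    using T RN by (intro hsum_cong) auto
  also have "\<dots> = Scl C (fact n) ?R" using hsum_const'[OF finite_perms RN(1), of n] by simp
  also have "hsum ?T ?T (\<lambda>\<sigma>. if \<sigma> \<in> perms n then ?R else ?N) ?R2 = hsum ?T ?T (\<lambda>_. ?N) ?R2"
    using T RN by (intro hsum_cong) auto
  also have "\<dots> = Scl C (of_nat n * fact n) ?N"
    using hsum_const'[OF _ RN(2), of ?R2] cardR by simp
  finally have "ptr X c ?T (antisym C (Suc n) X) = Scl C (1 / fact (Suc n)) (Add C (Scl C (fact n) ?R) (Scl C (of_nat n * fact n) ?N))" .
  also have "\<dots> = Scl C (1 / of_nat (Suc n)) (Add C ?R (Scl C (- of_nat n) ?A))"
  proof -
    have q: "fact n / fact (Suc n) = (1 / of_nat (Suc n) :: rat)"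
      unfolding fact_Suc by (metis fact_nonzero mult.commute mult.left_neutral mult_divide_mult_cancel_right times_divide_eq_right)
    then have q': "of_nat n * fact n / fact (Suc n) = (of_nat n / of_nat (Suc n) :: rat)"
      by (metis times_divide_eq_right mult.right_neutral)
    show ?thesis using X r' by (simp add: q q' del: fact_Suc of_nat_Suc mult_minus1_right)
  qed
  also have "\<dots> = Scl C (1 / of_nat (Suc n)) (act C (shift C ?r (- of_nat n)) ?A)"
    using X act_shift[OF r, of ?A "- of_nat n"] by simp
  finally show ?thesis .
qed

end

section \<open>Closing several strands of an antisymmetrizer\<close>

abbreviation ea :: "nat \<Rightarrow> 'a \<Rightarrow> ('a, 'b) box" where
  "ea n X \<equiv> b20 (wedge C n (dual C X)) (wedge C n X) (ev_alt C n X)"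

lemma ev_alt_eq_alt: "ev_alt C n X = alt (dual C X) X (\<lambda>n. ev_pow C n X) n"
  by (simp add: ev_alt_def alt_def)

lemma ev_alt_Hom: "X \<in> Obj C \<Longrightarrow> ev_alt C n X \<in> Hom C (wedge C n (dual C X) \<otimes>\<^sub>o wedge C n X) \<bbbI>"
  unfolding ev_alt_eq_alt by (rule alt_Hom[OF pairing_ev_pow])

lemma ev_alt_simps [simp]:
  assumes "X \<in> Obj C"
  shows "ev_alt C n X \<in> Arr C" "Dom C (ev_alt C n X) = wedge C n (dual C X) \<otimes>\<^sub>o wedge C n X" "Cod C (ev_alt C n X) = \<bbbI>"
  using ev_alt_Hom[OF assms, of n] by (simp_all add: in_Hom_iff)

text \<open>
  Each closed strand of the antisymmetrizer on \<open>n + 1\<close> strands contributes the factor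
  \<open>(r - n)/(n + 1)\<close>; the product for \<open>n = i, \<dots>, i + j - 1\<close> is \<open>binom(r - i, j)/binom(i + j, j)\<close>.
\<close>

primrec sc :: "'b \<Rightarrow> nat \<Rightarrow> nat \<Rightarrow> 'b" where
  "sc r i 0 = Id C \<bbbI>"
| "sc r i (Suc j) = Scl C (1 / of_nat (Suc (i + j))) (sc r i j \<cdot> shift C r (- of_nat (i + j)))"

lemma sc_Hom: "r \<in> Hom C \<bbbI> \<bbbI> \<Longrightarrow> sc r i j \<in> Hom C \<bbbI> \<bbbI>"
proof (induction j)
  case (Suc j)
  then show ?case using shift_Hom[of r "- of_nat (i + j)"] by (simp add: in_Hom_iff)
qed (simp add: in_Hom_iff)

lemma shift_shift:
  assumes r: "r \<in> Hom C \<bbbI> \<bbbI>"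
  shows "shift C (shift C r p) q = shift C r (p + q)"
proof -
  interpret M: Module.module rat_ring "hom_module C \<bbbI> \<bbbI>" by (intro hom_module) auto
  have "Add C (Add C r (Scl C p (Id C \<bbbI>))) (Scl C q (Id C \<bbbI>)) = Add C r (Add C (Scl C p (Id C \<bbbI>)) (Scl C q (Id C \<bbbI>)))"
    using r M.a_assoc[of r "Scl C p (Id C \<bbbI>)" "Scl C q (Id C \<bbbI>)"] by (simp add: in_Hom_iff)
  then show ?thesis by (simp add: shift_def Scl_add)
qed

text \<open>The product of (r - n)/(n + 1) over n from i to i + j - 1 is i!/(i + j)! times the
  falling factorial of r - i of length j. The coefficient equals 1/j! divided by the binomial
  coefficient of i + j over j.\<close>

lemma sc_eq_ebinom:
  assumes r: "r \<in> Hom C \<bbbI> \<bbbI>"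
  shows "sc r i j = Scl C (inverse (of_nat ((i + j) choose j))) (ebinom C (shift C r (- of_nat i)) j)"
proof -
  let ?x = "shift C r (- of_nat i)"
  have F: "falling C ?x j \<in> Hom C \<bbbI> \<bbbI>" for j
  proof (induction j)
    case (Suc j)
    then show ?case using shift_Hom[OF shift_Hom[OF r], of "- of_nat i" "- of_nat j"] by (simp add: in_Hom_iff)
  qed (simp add: in_Hom_iff)
  have "sc r i j = Scl C (fact i / fact (i + j)) (falling C ?x j)"
  proof (induction j)
    case (Suc j)
    have s: "shift C ?x (- of_nat j) = shift C r (- of_nat (i + j))"
      by (simp add: shift_shift[OF r])
    have q: "1 / of_nat (Suc (i + j)) * (fact i / fact (i + j)) = (fact i / fact (i + Suc j) :: rat)"
      by simp
    have "sc r i (Suc j) = Scl C (1 / of_nat (Suc (i + j)) * (fact i / fact (i + j))) (falling C ?x j \<cdot> shift C r (- of_nat (i + j)))"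
      using Suc F[of j] shift_Hom[OF r, of "- of_nat (i + j)"] by (simp add: in_Hom_iff del: of_nat_Suc of_nat_add)
    then show ?case unfolding q by (simp add: s)
  qed simp
  moreover have "inverse (of_nat ((i + j) choose j)) * (1 / fact j) = (fact i / fact (i + j) :: rat)"
    using binomial_fact[of j "i + j", where ?'a = rat] by simp
  ultimately show ?thesis using F[of j] by (simp add: ebinom_def in_Hom_iff)
qed

context
  fixes X :: 'a and c :: 'b
  assumes X: "X \<in> Obj C" and p: "perf X (dual C X) (ev C X) c"
begin

lemma c_simps' [simp]: "c \<in> Arr C" "Dom C c = \<bbbI>" "Cod C c = X \<otimes>\<^sub>o dual C X"
  using perfD(4)[OF p] by (simp_all add: in_Hom_iff)

abbreviation rk :: 'b where "rk \<equiv> twist C (dual C X) X (ev C X) \<cdot> c"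

lemma rk_Hom: "rk \<in> Hom C \<bbbI> \<bbbI>"
  using evt_Hom[OF X] by (simp add: in_Hom_iff)

lemma coev_pow_simps [simp]:
  "coev_pow n X c \<in> Arr C" "Dom C (coev_pow n X c) = \<bbbI>" "Cod C (coev_pow n X c) = tpow C n X \<otimes>\<^sub>o tpow C n (dual C X)"
  using perfD(4)[OF perf_ev_pow[OF p, of n]] by (simp_all add: in_Hom_iff)

lemma tw_simps [simp]:
  "ev_pow_tw C n X \<in> Arr C" "Dom C (ev_pow_tw C n X) = tpow C n X \<otimes>\<^sub>o tpow C n (dual C X)" "Cod C (ev_pow_tw C n X) = \<bbbI>"
  using ev_pow_tw_Hom[OF X, of n] by (simp_all add: in_Hom_iff)

text \<open>The antisymmetrizer on \<open>i + j\<close> factors with the last \<open>j\<close> of them traced out.\<close>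

definition PT :: "nat \<Rightarrow> nat \<Rightarrow> 'b" where
  "PT i j = contract_right C (tpow C i X) (tpow C j X) (tpow C j (dual C X)) (ev_pow_tw C j X) \<cdot>
     (((Inv C (tpow_add C X i j) \<cdot> (antisym C (i + j) X \<cdot> tpow_add C X i j)) \<otimes>\<^sub>a Id C (tpow C j (dual C X))) \<cdot>
      (Inv C (Asc C (tpow C i X) (tpow C j X) (tpow C j (dual C X))) \<cdot> ((Id C (tpow C i X) \<otimes>\<^sub>a coev_pow j X c) \<cdot> Inv C (Run C (tpow C i X)))))"

lemma PT_Hom: "PT i j \<in> Hom C (tpow C i X) (tpow C i X)"
proof -
  have "contract_right C (tpow C i X) (tpow C j X) (tpow C j (dual C X)) (ev_pow_tw C j X)
      \<in> Hom C ((tpow C i X \<otimes>\<^sub>o tpow C j X) \<otimes>\<^sub>o tpow C j (dual C X)) (tpow C i X)"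
    using X ev_pow_tw_Hom[OF X] by (intro contract_right_Hom) simp_all
  then show ?thesis using X by (simp add: PT_def in_Hom_iff)
qed

text \<open>The bracketings \<open>b\<close>, \<open>d\<close> and \<open>m\<close> are free, so
  that in an induction the last factor can be drawn as a strand of its own.\<close>

lemma ap_PT:
  assumes b: "objs (lv b)" "ob b = tpow C j X" and d: "objs (lv d)" "ob d = tpow C j (dual C X)"
    and m: "objs (lv m)" "ob m = tpow C (i + j) X"
  shows "ap 0 (b11 (tpow C i X) (tpow C i X) (PT i j)) (start [tpow C i X]) =
    ap p1 (Tn b d, Ut, ev_pow_tw C j X) (ap 0 (m, Tn (Lf (tpow C i X)) b, Inv C (tpow_add C X i j))
      (ap 0 (m, m, antisym C (i + j) X) (ap 0 (Tn (Lf (tpow C i X)) b, m, tpow_add C X i j)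
       (ap p1 (Ut, Tn b d, coev_pow j X c) (start [tpow C i X])))))"
proof -
  let ?T = "tpow C i X" and ?b = "tpow C j X" and ?d = "tpow C j (dual C X)" and ?n = "tpow C (i + j) X"
  let ?a = "Lf ?T" and ?ad = "tpow_add C X i j" and ?A = "antisym C (i + j) X"
  let ?s = "start [?T]"
  let ?F = "Inv C ?ad \<cdot> (?A \<cdot> ?ad)"
  have F: "?F \<in> Arr C" "Dom C ?F = ?T \<otimes>\<^sub>o ?b" "Cod C ?F = ?T \<otimes>\<^sub>o ?b" using X by simp_all
  let ?CR = "contract_right C ?T ?b ?d (ev_pow_tw C j X)"
  have CR: "?CR \<in> Hom C ((?T \<otimes>\<^sub>o ?b) \<otimes>\<^sub>o ?d) ?T"
    using X ev_pow_tw_Hom[OF X] by (intro contract_right_Hom) simp_all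
  let ?u = "ap p1 (Ut, Tn b d, coev_pow j X c) ?s"
  have u: "vs ?u" "fst ?u = ?T # lv b @ lv d" using X b d by simp_all
  let ?u1 = "ap 0 (Tn ?a b, m, ?ad) ?u"
  have u1: "vs ?u1" "fst ?u1 = lv m @ lv d" using u X b d m by simp_all
  let ?u2 = "ap 0 (m, m, ?A) ?u1"
  have u2: "vs ?u2" "fst ?u2 = lv m @ lv d" using u1 X b d m by simp_all
  let ?v = "ap 0 (m, Tn ?a b, Inv C ?ad) ?u2"
  have v: "vs ?v" "fst ?v = ?T # lv b @ lv d" using u2 X b d m by simp_all
  have 0: "ap 0 (?a, Tn ?a Ut, Inv C (Run C ?T)) ?s = ?s" using X by simp
  have 1: "ap 0 (Tn ?a Ut, Tn ?a (Tn b d), Id C ?T \<otimes>\<^sub>a coev_pow j X c) ?s = ?u"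
    using X b d u by (subst ap_Tar) simp_all
  have 2: "ap 0 (Tn ?a (Tn b d), Tn (Tn ?a b) d, Inv C (Asc C ?T ?b ?d)) ?u = ?u"
    using X b d u by (intro ap_Asc(2)) simp_all
  have "ap 0 (Tn (Tn ?a b) d, Tn (Tn ?a b) d, ?F \<otimes>\<^sub>a Id C ?d) ?u = ap 0 (Tn ?a b, Tn ?a b, ?F) ?u"
    using X b d u F by (subst ap_Tar) simp_all
  also have "\<dots> = ap 0 (m, Tn ?a b, Inv C ?ad) (ap 0 (Tn ?a b, m, ?A \<cdot> ?ad) ?u)"
    using X b d u m by (intro ap_Comp) simp_all
  also have "ap 0 (Tn ?a b, m, ?A \<cdot> ?ad) ?u = ?u2"
    using X b d u m by (intro ap_Comp) simp_all
  finally have 3: "ap 0 (Tn (Tn ?a b) d, Tn (Tn ?a b) d, ?F \<otimes>\<^sub>a Id C ?d) ?u = ?v" .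
  have 4: "ap 0 (Tn (Tn ?a b) d, ?a, ?CR) ?v = ap p1 (Tn b d, Ut, ev_pow_tw C j X) ?v"
    using ap_contract_right_tree[of ?v ?a b d "[]" "ev_pow_tw C j X"] v b d ev_pow_tw_Hom[OF X] by simp
  have "ap 0 (?a, ?a, PT i j) ?s = ap 0 (Tn (Tn ?a b) d, ?a, ?CR) (ap 0 (Tn (Tn ?a b) d, Tn (Tn ?a b) d, ?F \<otimes>\<^sub>a Id C ?d)
     (ap 0 (Tn ?a (Tn b d), Tn (Tn ?a b) d, Inv C (Asc C ?T ?b ?d)) (ap 0 (Tn ?a Ut, Tn ?a (Tn b d), Id C ?T \<otimes>\<^sub>a coev_pow j X c)
     (ap 0 (?a, Tn ?a Ut, Inv C (Run C ?T)) ?s))))"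
  proof -
    define G where "G = ?F"
    have G: "G \<in> Arr C" "Dom C G = ?T \<otimes>\<^sub>o ?b" "Cod C G = ?T \<otimes>\<^sub>o ?b" using F by (simp_all add: G_def)
    show ?thesis unfolding PT_def G_def[symmetric] using X b d G CR
      by (simp add: in_Hom_iff ap_Comp[of _ "Tn (Tn ?a b) d"] ap_Comp[of _ "Tn ?a (Tn b d)"] ap_Comp[of _ "Tn ?a Ut"] del: ap_Run ap_Asc)
  qed
  also have "\<dots> = ap p1 (Tn b d, Ut, ev_pow_tw C j X) ?v" unfolding 0 1 2 3 4 by (rule refl)
  finally show ?thesis .
qed

text \<open>The loop of the last factor is drawn innermost. Closing it is the one-strand partial
  trace of the antisymmetrizer on i + j + 1 factors; it produces a scalar and the antisymmetrizer on
  i + j factors, to which the induction hypothesis applies.\<close>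

lemma PT_eq: "PT i j = act C (sc rk i j) (antisym C i X)"
proof (induction j)
  case 0
  have tw: "ev_pow_tw C 0 X = Run C \<bbbI>" by (simp add: ev_pow_tw_def twist_def Lun_Sym)
  have "PT i 0 = antisym C i X"
    using ap_PT[of Ut 0 Ut "Lf (tpow C i X)" i] X PT_Hom[of i 0]
    by (intro faithful[of "Lf (tpow C i X)" "Lf (tpow C i X)"]) (simp_all add: tw in_Hom_iff)
  then show ?case using X by (simp add: act_Id)
next
  case (Suc j)
  let ?D = "dual C X" and ?n = "i + j"
  let ?Ti = "tpow C i X" and ?Tj = "tpow C j X" and ?Tj' = "tpow C j ?D" and ?Tn = "tpow C ?n X"
  let ?b = "Tn (Lf ?Tj) (Lf X)" and ?d = "Tn (Lf ?Tj') (Lf ?D)" and ?m = "Tn (Lf ?Tn) (Lf X)"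
  let ?s = "start [?Ti]" and ?A = "antisym C (Suc ?n) X"
  let ?c = "b02 X ?D c" and ?cj = "b02 ?Tj ?Tj' (coev_pow j X c)"
  let ?sh = "shift C rk (- of_nat ?n)" and ?q = "1 / of_nat (Suc ?n) :: rat"
  have sh: "?sh \<in> Hom C \<bbbI> \<bbbI>" by (rule shift_Hom[OF rk_Hom])
  have scH: "sc rk i j \<in> Hom C \<bbbI> \<bbbI>" by (rule sc_Hom[OF rk_Hom])
  note h = sh[unfolded in_Hom_iff] scH[unfolded in_Hom_iff]
  have et: "twist C ?D X (ev C X) \<in> Arr C" "Dom C (twist C ?D X (ev C X)) = X \<otimes>\<^sub>o ?D" "Cod C (twist C ?D X (ev C X)) = \<bbbI>"
    using evt_Hom[OF X] by (simp_all add: in_Hom_iff)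
  have tw: "ev_pow_tw C (Suc j) X = ev1324 C ?Tj X ?Tj' ?D (ev_pow_tw C j X) (twist C ?D X (ev C X))"
    unfolding ev_pow_tw_def ev_pow.simps(2) using X twist_ev1324[OF _ X _ _ ev_pow_Hom[OF X, of j] ev_Hom[OF X]] by simp
  have ia: "ap 0 (?m, Tn (Lf ?Ti) ?b, Inv C (tpow_add C X i (Suc j))) u = ap 0 (ia X i j) u"
    if u: "vs u" "fst u = ?Tn # X # xs" for u xs
  proof -
    let ?v = "ap 0 (ia X i j) u"
    have v: "vs ?v" "fst ?v = ?Ti # ?Tj # X # xs" using u X by simp_all
    have "ap 0 (Tn (Lf ?Ti) ?b, Tn (Lf ?Ti) ?b, Inv C (tpow_add C X i (Suc j)) \<cdot> tpow_add C X i (Suc j)) ?v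
       = ap 0 (?m, Tn (Lf ?Ti) ?b, Inv C (tpow_add C X i (Suc j))) (ap 0 (Tn (Lf ?Ti) ?b, ?m, tpow_add C X i (Suc j)) ?v)"
      using v X by (intro ap_Comp) (simp_all add: vs_def)
    moreover have "ap 0 (Tn (Lf ?Ti) ?b, ?m, tpow_add C X i (Suc j)) ?v = u"
      using v u X by (simp add: ap_tpow_add_Suc ap_ad_ia pos_def)
    ultimately show ?thesis using v X by simp
  qed
  let ?u = "ap p1 ?cj ?s"
  have u: "vs ?u" "fst ?u = [?Ti, ?Tj, ?Tj']" using X by simp_all
  \<comment> \<open>The Casimir element of the new factor is moved inside the one of the first j
    factors; the crossing left over is undone later by the matching crossing in the pairing.\<close>
  have sl: "ap p2 (Sw ?Tj' X) (ap p3 ?c ?u) = ap p3 (Sw ?D ?Tj') (ap p2 ?c ?u)"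
  proof -
    have "ap p2 ?c ?u = ap p3 (Sw ?Tj' ?D) (ap p2 (Sw ?Tj' X) (ap p3 ?c ?u))"
      using X u perfD(4)[OF p] by (subst slideR_02) (simp_all add: pos_def)
    then show ?thesis using X u by (simp add: Sw_Sw pos_def)
  qed
  have coev: "ap p1 (Ut, Tn ?b ?d, coev_pow (Suc j) X c) ?s = ap p3 (Sw ?D ?Tj') (ap p2 ?c ?u)"
  proof -
    have "ap p1 (Ut, Tn ?b ?d, coev_pow (Suc j) X c) ?s = ap p2 (Sw ?Tj' X) (ap p1 ?cj (ap p1 ?c ?s))"
      using X perfD(4)[OF p] perfD(4)[OF perf_ev_pow[OF p, of j]] by (simp add: ap_tensor_coev)
    also have "ap p1 ?cj (ap p1 ?c ?s) = ap p3 ?c ?u"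
      using X by (simp add: comm[of ?cj ?c _ p1 p1])
    finally show ?thesis using sl by simp
  qed
  let ?S = "Sw ?D ?Tj'"
  have "ap 0 (b11 ?Ti ?Ti (PT i (Suc j))) ?s = ap p1 (Tn ?b ?d, Ut, ev_pow_tw C (Suc j) X) (ap 0 (?m, Tn (Lf ?Ti) ?b, Inv C (tpow_add C X i (Suc j)))
      (ap 0 (?m, ?m, ?A) (ap 0 (Tn (Lf ?Ti) ?b, ?m, tpow_add C X i (Suc j)) (ap p3 ?S (ap p2 ?c ?u)))))"
    using ap_PT[of ?b "Suc j" ?d ?m i] X coev by simp
  also have "\<dots> = ap p1 (Tn ?b ?d, Ut, ev_pow_tw C (Suc j) X) (ap 0 (ia X i j) (ap 0 (?m, ?m, ?A) (ap 0 (ad X i j) (ap p3 ?S (ap p2 ?c ?u)))))"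
    using X u by (simp add: ia ap_tpow_add_Suc pos_def)
  also have "\<dots> = ap p1 (ep j X) (ap p3 (evt X) (ap p2 (Sw X ?Tj') (ap 0 (ia X i j) (ap 0 (?m, ?m, ?A) (ap 0 (ad X i j) (ap p3 ?S (ap p2 ?c ?u)))))))"
    unfolding tw using X u evt_Hom[OF X] ev_pow_tw_Hom[OF X, of j] by (simp add: ap_ev1324 pos_def)
  also have "ap 0 (ia X i j) (ap 0 (?m, ?m, ?A) (ap 0 (ad X i j) (ap p3 ?S (ap p2 ?c ?u))))
     = ap p3 ?S (ap 0 (ia X i j) (ap 0 (?m, ?m, ?A) (ap 0 (ad X i j) (ap p2 ?c ?u))))"
    using X u by (simp add: comm[of "ad X i j" ?S _ 0 p3] comm[of "(?m, ?m, ?A)" ?S _ 0 p2]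
       comm[of "ia X i j" ?S _ 0 p2])
  also have "ap p3 (evt X) (ap p2 (Sw X ?Tj') (ap p3 ?S (ap 0 (ia X i j) (ap 0 (?m, ?m, ?A) (ap 0 (ad X i j) (ap p2 ?c ?u))))))
     = ap p2 (evt X) (ap 0 (ia X i j) (ap 0 (?m, ?m, ?A) (ap 0 (ad X i j) (ap p2 ?c ?u))))"
    using X u evt_Hom[OF X] by (subst slideL_20) (simp_all add: pos_def)
  also have "\<dots> = ap 0 (ia X i j) (ap p1 (evt X) (ap 0 (?m, ?m, ?A) (ap p1 ?c (ap 0 (ad X i j) ?u))))"
    using X u et by (simp add: comm[of "ad X i j" ?c _ 0 p2]
      comm[of "ia X i j" "evt X" _ 0 p1])
  also have "ap p1 (evt X) (ap 0 (?m, ?m, ?A) (ap p1 ?c (ap 0 (ad X i j) ?u))) = ap 0 (b11 ?Tn ?Tn (ptr X c ?Tn ?A)) (ap 0 (ad X i j) ?u)"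
    using X u ap_ptr[OF X p, of "ap 0 (ad X i j) ?u" "Lf ?Tn" "[?Tj']" ?A] by (simp add: in_Hom_iff)
  also have "\<dots> = sscl ?q (ap 0 (Ut, Ut, ?sh) (ap 0 (as ?n X) (ap 0 (ad X i j) ?u)))"
    unfolding ptr_antisym[OF X p] using X u sh h by (simp add: ap_Scl ap_act del: of_nat_add of_nat_Suc)
  also have "ap p1 (ep j X) (ap 0 (ia X i j) (sscl ?q (ap 0 (Ut, Ut, ?sh) (ap 0 (as ?n X) (ap 0 (ad X i j) ?u)))))
     = sscl ?q (ap 0 (Ut, Ut, ?sh) (ap p1 (ep j X) (ap 0 (ia X i j) (ap 0 (as ?n X) (ap 0 (ad X i j) ?u)))))"
    using X u sh h by (simp add: ap_sscl b00_comm del: of_nat_add of_nat_Suc)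
  also have "ap p1 (ep j X) (ap 0 (ia X i j) (ap 0 (as ?n X) (ap 0 (ad X i j) ?u))) = ap 0 (b11 ?Ti ?Ti (PT i j)) ?s"
    using ap_PT[of "Lf ?Tj" j "Lf ?Tj'" "Lf ?Tn" i] X by simp
  also have "\<dots> = ap 0 (Ut, Ut, sc rk i j) (ap 0 (as i X) ?s)"
    unfolding Suc using X scH h by (simp add: ap_act)
  also have "ap 0 (Ut, Ut, ?sh) (ap 0 (Ut, Ut, sc rk i j) (ap 0 (as i X) ?s)) = ap 0 (Ut, Ut, sc rk i j) (ap 0 (Ut, Ut, ?sh) (ap 0 (as i X) ?s))"
    using X scH h sh by (intro b00_comm) (simp_all del: of_nat_add of_nat_Suc)
  also have "sscl ?q \<dots> = ap 0 (b11 ?Ti ?Ti (act C (sc rk i (Suc j)) (antisym C i X))) ?s"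
  proof -
    have "sc rk i (Suc j) \<in> Hom C \<bbbI> \<bbbI>" by (rule sc_Hom[OF rk_Hom])
    then have "ap 0 (b11 ?Ti ?Ti (act C (sc rk i (Suc j)) (antisym C i X))) ?s = ap 0 (Ut, Ut, sc rk i (Suc j)) (ap 0 (as i X) ?s)"
      using X by (intro ap_act) simp_all
    also have "\<dots> = sscl ?q (ap 0 (Ut, Ut, sc rk i j) (ap 0 (Ut, Ut, ?sh) (ap 0 (as i X) ?s)))"
      using X h by (simp add: ap_Scl ap_Comp[of Ut Ut] del: of_nat_add of_nat_Suc)
    finally show ?thesis by simp
  qed
  finally show ?case
    using X PT_Hom[of i "Suc j"] sc_Hom[OF rk_Hom, of i "Suc j"] by (intro faithful[of "Lf ?Ti" "Lf ?Ti"]) (simp_all add: in_Hom_iff)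
qed

end

end

section \<open>Casimir elements and traces of exterior powers\<close>

context ACU_tensor_cat
begin

text \<open>Endomorphisms transposed with respect to the pairing are transposed with respect to the
  Casimir element. A second Casimir element and an evaluation are inserted by a zigzag, and
  \<open>adj\<close> is used at that evaluation.\<close>

lemma coev_transpose:
  assumes p: "perf X X' e c" and a: "a \<in> Hom C X X" "a' \<in> Hom C X' X'"
    and adj: "e \<cdot> (a' \<otimes>\<^sub>a Id C X) = e \<cdot> (Id C X' \<otimes>\<^sub>a a)"
  shows "(a \<otimes>\<^sub>a Id C X') \<cdot> c = (Id C X \<otimes>\<^sub>a a') \<cdot> c"
proof (rule faithful[of Ut "Tn (Lf X) (Lf X')"])
  note o = perfD(1,2)[OF p] perfD(3,4)[OF p, unfolded in_Hom_iff] a[unfolded in_Hom_iff]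
  let ?t = "Tn (Lf X) (Lf X')" and ?e = "b20 X' X e" and ?c = "b02 X X' c" and ?s = "start []"
  let ?a = "b11 X X a" and ?a' = "b11 X' X' a'"
  have adj': "ap p1 ?e (ap p1 ?a' u) = ap p1 ?e (ap p2 ?a u)" if u: "vs u" "fst u = [X, X', X, X']" for u
  proof -
    let ?x = "start [X', X]" and ?r = "Tn (Lf X') (Lf X)"
    have "ap 0 (?r, Ut, e \<cdot> (a' \<otimes>\<^sub>a Id C X)) ?x = ap 0 ?e (ap 0 ?a' ?x)"
      "ap 0 (?r, Ut, e \<cdot> (Id C X' \<otimes>\<^sub>a a)) ?x = ap 0 ?e (ap p1 ?a ?x)"
      using o by (simp_all add: ap_Comp[of _ ?r] ap_Tar)
    then show ?thesis
      using pos_transfer[of p1 "[X', X]" u "[(0, ?a'), (0, ?e)]" "[(p1, ?a), (0, ?e)]"] adj u o by (simp add: pos_def)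
  qed
  have "ap 0 (Ut, ?t, (Id C X \<otimes>\<^sub>a a') \<cdot> c) ?s = ap p1 ?a' (ap 0 ?c ?s)"
    using o by (simp add: ap_Comp[of _ ?t] ap_Tar)
  also have "\<dots> = ap p1 ?e (ap p2 ?c (ap p1 ?a' (ap 0 ?c ?s)))"
    using o p by (simp add: zigzag2 pos_def)
  also have "\<dots> = ap p1 ?e (ap p1 ?a' (ap p2 ?c (ap 0 ?c ?s)))"
    using o by (simp add: comm[of ?a' ?c _ p1 p2])
  also have "\<dots> = ap p1 ?e (ap p2 ?a (ap p2 ?c (ap 0 ?c ?s)))"
    using o by (intro adj') simp_all
  also have "ap p2 ?c (ap 0 ?c ?s) = ap 0 ?c (ap 0 ?c ?s)"
    using o by (simp add: comm[of ?c ?c _ 0 0])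
  also have "ap p2 ?a (ap 0 ?c (ap 0 ?c ?s)) = ap 0 ?c (ap 0 ?a (ap 0 ?c ?s))"
    using o by (simp add: comm[of ?c ?a _ 0 0])
  also have "ap p1 ?e (ap 0 ?c (ap 0 ?a (ap 0 ?c ?s))) = ap 0 ?a (ap 0 ?c ?s)"
    using o p by (simp add: zigzag1 pos_def)
  also have "\<dots> = ap 0 (Ut, ?t, (a \<otimes>\<^sub>a Id C X') \<cdot> c) ?s"
    using o by (simp add: ap_Comp[of _ ?t] ap_Tar)
  finally show "ap 0 (Ut, ?t, (a \<otimes>\<^sub>a Id C X') \<cdot> c) (start (lv Ut)) = ap 0 (Ut, ?t, (Id C X \<otimes>\<^sub>a a') \<cdot> c) (start (lv Ut))" by simp
qed (use perfD[OF p] a in \<open>simp_all add: in_Hom_iff\<close>)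

end

context rigid_pseudo_abelian_tensor_cat
begin

context
  fixes X :: 'a and c :: 'b
  assumes X: "X \<in> Obj C" and p: "perf X (dual C X) (ev C X) c"
begin

lemmas cp_simps [simp] = coev_pow_simps[OF X p] tw_simps[OF X p] c_simps'[OF X p]

definition cw :: "nat \<Rightarrow> 'b" where
  "cw n = (wprj C n X \<otimes>\<^sub>a wprj C n (dual C X)) \<cdot> coev_pow n X c"

text \<open>The exterior power is a retract of the tensor power on either side, and
  \<open>ev_pow_antisym\<close> says that the two antisymmetrizers are transposes.\<close>

lemma perf_ev_alt: "perf (wedge C n X) (wedge C n (dual C X)) (ev_alt C n X) (cw n)"
  unfolding ev_alt_def cw_def
  using X perf_ev_pow[OF p, of n] ev_pow_antisym[OF X, of n]
  by (intro perf_retract) (simp_all add: in_Hom_iff winj_wprj)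

lemma cw_simps [simp]:
  "cw n \<in> Arr C" "Dom C (cw n) = \<bbbI>" "Cod C (cw n) = wedge C n X \<otimes>\<^sub>o wedge C n (dual C X)"
  using X by (simp_all add: cw_def)

abbreviation cb :: "nat \<Rightarrow> ('a, 'b) box" where
  "cb n \<equiv> b02 (tpow C n X) (tpow C n (dual C X)) (coev_pow n X c)"

lemma ap_cw:
  assumes "vs s" "k \<le> length (fst s)"
  shows "ap k (b02 (wedge C n X) (wedge C n (dual C X)) (cw n)) s = ap k (wp n X) (ap (Suc k) (wp n (dual C X)) (ap k (cb n) s))"
  using assms X unfolding cw_def by (simp add: ap_Comp[of _ "Tn (Lf (tpow C n X)) (Lf (tpow C n (dual C X)))"] ap_Tar)

lemma antisym_coev_pow:
  assumes "vs s" "k \<le> length (fst s)"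
  shows "ap (Suc k) (as n (dual C X)) (ap k (cb n) s) = ap k (as n X) (ap k (cb n) s)"
proof -
  let ?t = "Tn (Lf (tpow C n X)) (Lf (tpow C n (dual C X)))"
  have "(antisym C n X \<otimes>\<^sub>a Id C (tpow C n (dual C X))) \<cdot> coev_pow n X c = (Id C (tpow C n X) \<otimes>\<^sub>a antisym C n (dual C X)) \<cdot> coev_pow n X c"
    using X by (intro coev_transpose[OF perf_ev_pow[OF p, of n]] ev_pow_antisym) (simp_all add: in_Hom_iff)
  then have "ap k (Ut, ?t, (antisym C n X \<otimes>\<^sub>a Id C (tpow C n (dual C X))) \<cdot> coev_pow n X c) s
     = ap k (Ut, ?t, (Id C (tpow C n X) \<otimes>\<^sub>a antisym C n (dual C X)) \<cdot> coev_pow n X c) s" by simp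
  then show ?thesis using assms X by (simp add: ap_Comp[of _ ?t] ap_Tar)
qed

text \<open>The pairing on i + j factors splits. Its part on the last j factors meets the two legs
  of the Casimir element and closes j strands of the antisymmetrizer, while the two block crossings
  between degrees i and j cancel.\<close>

lemma trace_tensor:
  "ap 0 (evp (i + j) X) (ap 0 (ad (dual C X) i j) (ap p1 (Sw (tpow C (i + j) X) (tpow C j (dual C X)))
     (ap p1 (as (i + j) X) (ap p1 (ad X i j) (ap p2 (cb j) (start [tpow C i (dual C X), tpow C i X]))))))
   = ap 0 (evp i X) (ap p1 (b11 (tpow C i X) (tpow C i X) (PT X c i j)) (start [tpow C i (dual C X), tpow C i X]))"
proof -
  let ?D = "dual C X" let ?Ti = "tpow C i X" and ?Ti' = "tpow C i ?D" and ?Tj = "tpow C j X" and ?Tj' = "tpow C j ?D"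
  let ?Tn = "tpow C (i + j) X"
  let ?s = "start [?Ti', ?Ti]"
  let ?w = "ap p1 (as (i + j) X) (ap p1 (ad X i j) (ap p2 (cb j) ?s))"
  let ?z = "ap p1 (ia X i j) ?w"
  have w: "vs ?w" "fst ?w = [?Ti', ?Tn, ?Tj']" using X by simp_all
  have z: "vs ?z" "fst ?z = [?Ti', ?Ti, ?Tj, ?Tj']" using X w by simp_all
  have "?w = ap p1 (ad X i j) ?z" using X w by (simp add: ap_ad_ia pos_def)
  then have "ap p1 (Sw ?Tn ?Tj') ?w = ap p1 (Sw ?Tn ?Tj') (ap p1 (ad X i j) ?z)" by simp
  also have "\<dots> = ap p2 (ad X i j) (ap p1 (Sw ?Ti ?Tj') (ap p2 (Sw ?Tj ?Tj') ?z))"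
    using X z by (subst slideL_21) (simp_all add: pos_def in_Hom_iff)
  finally have 1: "ap p1 (Sw ?Tn ?Tj') ?w = ap p2 (ad X i j) (ap p1 (Sw ?Ti ?Tj') (ap p2 (Sw ?Tj ?Tj') ?z))" .
  have 2: "ap 0 (evp (i + j) X) (ap 0 (ad ?D i j) (ap p2 (ad X i j) (ap p1 (Sw ?Ti ?Tj') (ap p2 (Sw ?Tj ?Tj') ?z))))
     = ap 0 (evp i X) (ap p2 (evp j X) (ap p1 (Sw ?Tj' ?Ti) (ap p1 (Sw ?Ti ?Tj') (ap p2 (Sw ?Tj ?Tj') ?z))))"
    using X z pairing_ev_pow[OF X] by (subst pairing_add_ap[where \<epsilon> = "\<lambda>n. ev_pow C n X"]) (simp_all add: pos_def)
  also have "\<dots> = ap 0 (evp i X) (ap p2 (ep j X) ?z)"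
    using X z ev_pow_Hom[OF X, of j] by (simp add: Sw_Sw ev_pow_tw_def ap_twist pos_def)
  also have "ap p2 (ep j X) ?z = ap p1 (b11 ?Ti ?Ti (PT X c i j)) ?s"
  proof -
    have e: "ap 0 (b11 ?Ti ?Ti (PT X c i j)) (start [?Ti])
       = ap p1 (ep j X) (ap 0 (ia X i j) (ap 0 (as (i + j) X) (ap 0 (ad X i j) (ap p1 (cb j) (start [?Ti])))))"
      using ap_PT[OF X p, of "Lf ?Tj" j "Lf ?Tj'" "Lf ?Tn" i] X by simp
    have "run (sh p1 [(0, b11 ?Ti ?Ti (PT X c i j))]) ?s
       = run (sh p1 [(p1, cb j), (0, ad X i j), (0, as (i + j) X), (0, ia X i j), (p1, ep j X)]) ?s"
      using X PT_Hom[OF X p, of i j] e by (intro pos_transfer[where xs = "[?Ti]"]) (simp_all add: pos_def in_Hom_iff)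
    then show ?thesis by simp
  qed
  finally show ?thesis unfolding 1 by simp
qed

lemma antisym_ad:
  assumes "vs u" "pos k [tpow C i X, tpow C j X] u"
  shows "ap k (as (i + j) X) (ap k (ad X i j) (ap (Suc k) (as j X) u)) = ap k (as (i + j) X) (ap k (ad X i j) u)"
proof -
  let ?t = "Tn (Lf (tpow C i X)) (Lf (tpow C j X))" and ?o = "Lf (tpow C (i + j) X)" let ?u = "start [tpow C i X, tpow C j X]"
  have "ap 0 (?t, ?o, antisym C (i + j) X \<cdot> (tpow_add C X i j \<cdot> (Id C (tpow C i X) \<otimes>\<^sub>a antisym C j X))) ?u
     = ap 0 (as (i + j) X) (ap 0 (ad X i j) (ap p1 (as j X) ?u))"
    using X by (simp add: ap_Comp[of _ ?o] ap_Comp[of _ ?t] ap_Tar)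
  moreover have "ap 0 (?t, ?o, antisym C (i + j) X \<cdot> tpow_add C X i j) ?u = ap 0 (as (i + j) X) (ap 0 (ad X i j) ?u)"
    using X by (simp add: ap_Comp[of _ ?o])
  ultimately show ?thesis
    using pos_transfer[OF assms(2), of "[(p1, as j X), (0, ad X i j), (0, as (i + j) X)]" "[(0, ad X i j), (0, as (i + j) X)]"] X
      antisym_tpow_add(2)[OF X, of i j] by simp
qed

text \<open>From here on only isotopies of diagrams, zigzag identities and graded commutativity are needed.\<close>

theorem trace_wedge:
  "ap 0 (ea (i + j) X) (ap 0 (wm (dual C X) i j) (ap p1 (Sw (wedge C (i + j) X) (wedge C j (dual C X)))
     (ap p1 (wm X i j) (ap p2 (b02 (wedge C j X) (wedge C j (dual C X)) (cw j)) (start [wedge C i (dual C X), wedge C i X])))))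
   = ap 0 (Ut, Ut, sc (rk X c) i j) (ap 0 (ea i X) (start [wedge C i (dual C X), wedge C i X]))"
proof -
  let ?D = "dual C X" and ?g = "i + j"
  let ?A' = "wedge C i ?D" and ?A = "wedge C i X" and ?B' = "wedge C j ?D" and ?W = "wedge C ?g X"
  let ?Tg = "tpow C ?g X" and ?Tj' = "tpow C j ?D"
  let ?s = "start [?A', ?A]"
  let ?x = "ap p2 (cb j) ?s"
  have D: "?D \<in> Obj C" using X by simp
  have x: "vs ?x" "fst ?x = [?A', ?A, tpow C j X, ?Tj']" using X by simp_all
  note P = pairing_ev_pow[OF X]
  let ?m = "ap p1 (wp ?g X) (ap p1 (ad X i j) (ap p1 (wi i X) (ap p2 (wi j X) (ap p2 (wp j X) (ap p3 (wp j ?D) ?x)))))"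
  let ?n = "ap p1 (Sw ?W ?B') ?m"
  let ?y = "ap p1 (ad X i j) (ap p1 (wi i X) (ap p2 (as j X) (ap p3 (wp j ?D) ?x)))"
  have m: "vs ?m" "fst ?m = [?A', ?W, ?B']" using X by simp_all
  have n: "vs ?n" "fst ?n = [?A', ?B', ?W]" using X m by simp_all
  have "ap 0 (ea ?g X) (ap 0 (wm ?D i j) ?n) = ap 0 (evp ?g X) (ap 0 (wi ?g ?D) (ap p1 (wi ?g X) (ap 0 (wp ?g ?D) (ap 0 (ad ?D i j) (ap 0 (wi i ?D) (ap p1 (wi j ?D) ?n))))))"
    unfolding ev_alt_eq_alt using X n by (simp add: ap_wmult ap_alt[OF P] pos_def)
  also have "\<dots> = ap 0 (evp ?g X) (ap 0 (as ?g ?D) (ap p1 (wi ?g X) (ap 0 (ad ?D i j) (ap 0 (wi i ?D) (ap p1 (wi j ?D) ?n)))))"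
    using X n by (simp add: ap_wi_wp pos_def comm_rev[of "wp ?g ?D" "wi ?g X" _ 0 p1 p1])
  also have "\<dots> = ap 0 (evp ?g X) (ap p1 (wi ?g X) (ap 0 (ad ?D i j) (ap 0 (wi i ?D) (ap p1 (wi j ?D) ?n))))"
    using X n by (simp add: pairing_antisym_ap[OF P] ap_as_wi pos_def)
  also have "\<dots> = ap 0 (evp ?g X) (ap 0 (ad ?D i j) (ap 0 (wi i ?D) (ap p1 (wi j ?D) (ap p2 (wi ?g X) ?n))))"
    using X n by (simp add: comm_rev[of "ad ?D i j" "wi ?g X" _ 0 p2 p1]
      comm_rev[of "wi i ?D" "wi ?g X" _ 0 p2 p2]
      comm_rev[of "wi j ?D" "wi ?g X" _ p1 p2 p2])
  also have "ap p2 (wi ?g X) ?n = ap p1 (Sw ?Tg ?B') (ap p1 (wi ?g X) ?m)"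
    using X m by (subst slideL_11) (simp_all add: pos_def in_Hom_iff)
  also have "ap p1 (wi ?g X) ?m = ap p1 (as ?g X) ?y"
    using X by (simp add: ap_wi_wp pos_def)
  also have "ap p1 (wi j ?D) (ap p1 (Sw ?Tg ?B') (ap p1 (as ?g X) ?y)) = ap p1 (Sw ?Tg ?Tj') (ap p2 (wi j ?D) (ap p1 (as ?g X) ?y))"
    using X by (subst slideR_11) (simp_all add: pos_def in_Hom_iff)
  also have "ap p2 (wi j ?D) (ap p1 (as ?g X) ?y) = ap p1 (as ?g X) (ap p1 (ad X i j) (ap p1 (wi i X) (ap p2 (as j X) (ap p3 (as j ?D) ?x))))"
    using X by (simp add: ap_wi_wp pos_def comm_rev[of "as ?g X" "wi j ?D" _ p1 p2 p2]
      comm_rev[of "ad X i j" "wi j ?D" _ p1 p3 p2]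
      comm_rev[of "wi i X" "wi j ?D" _ p1 p3 p3]
      comm_rev[of "as j X" "wi j ?D" _ p2 p3 p3])
  \<comment> \<open>The antisymmetrizer on the dual leg of the Casimir element moves to the other
    leg, merges with the one already there by idempotency, and is then absorbed by the
    antisymmetrizer on i + j factors.\<close>
  also have "ap p3 (as j ?D) ?x = ap p2 (as j X) ?x"
    using X by (simp add: antisym_coev_pow)
  also have "ap p2 (as j X) (ap p2 (as j X) ?x) = ap p2 (as j X) ?x"
    using X x ap_Comp[of "Lf (tpow C j X)" "Lf (tpow C j X)" "antisym C j X" "Lf (tpow C j X)" "antisym C j X" ?x p2]
    by (simp add: antisym_idem)
  also have "ap p1 (wi i X) (ap p2 (as j X) ?x) = ap p2 (as j X) (ap p1 (wi i X) ?x)"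
    using X by (simp add: comm[of "wi i X" "as j X" _ p1 p2])
  also have "ap p1 (as ?g X) (ap p1 (ad X i j) (ap p2 (as j X) (ap p1 (wi i X) ?x))) = ap p1 (as ?g X) (ap p1 (ad X i j) (ap p1 (wi i X) ?x))"
    using X by (intro antisym_ad) (simp_all add: pos_def)
  also have "ap 0 (wi i ?D) (ap p1 (Sw ?Tg ?Tj') (ap p1 (as ?g X) (ap p1 (ad X i j) (ap p1 (wi i X) ?x))))
     = ap p1 (Sw ?Tg ?Tj') (ap p1 (as ?g X) (ap p1 (ad X i j) (ap p2 (cb j) (ap 0 (wi i ?D) (ap p1 (wi i X) ?s)))))"
    using X by (simp add: comm[of "wi i ?D" "Sw ?Tg ?Tj'" _ 0 p1] comm[of "wi i ?D" "as ?g X" _ 0 p1]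
       comm[of "wi i ?D" "ad X i j" _ 0 p1] comm[of "wi i ?D" "wi i X" _ 0 p1]
       comm[of "wi i ?D" "cb j" _ 0 p2] comm[of "wi i X" "cb j" _ p1 p2])
  also have "ap 0 (evp ?g X) (ap 0 (ad ?D i j) (ap p1 (Sw ?Tg ?Tj') (ap p1 (as ?g X) (ap p1 (ad X i j) (ap p2 (cb j) (ap 0 (wi i ?D) (ap p1 (wi i X) ?s)))))))
     = ap 0 (evp i X) (ap p1 (b11 (tpow C i X) (tpow C i X) (PT X c i j)) (ap 0 (wi i ?D) (ap p1 (wi i X) ?s)))"
    using pos_transfer[of 0 "[tpow C i ?D, tpow C i X]" "ap 0 (wi i ?D) (ap p1 (wi i X) ?s)"
       "[(p2, cb j), (p1, ad X i j), (p1, as ?g X), (p1, Sw ?Tg ?Tj'), (0, ad ?D i j), (0, evp ?g X)]"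
       "[(p1, b11 (tpow C i X) (tpow C i X) (PT X c i j)), (0, evp i X)]"] trace_tensor X PT_Hom[OF X p, of i j]
    by (simp add: pos_def in_Hom_iff)
  also have "\<dots> = ap 0 (evp i X) (ap 0 (Ut, Ut, sc (rk X c) i j) (ap p1 (as i X) (ap 0 (wi i ?D) (ap p1 (wi i X) ?s))))"
    unfolding PT_eq[OF X p] using X sc_Hom[OF rk_Hom[OF X p]] by (subst ap_act) simp_all
  also have "\<dots> = ap 0 (Ut, Ut, sc (rk X c) i j) (ap 0 (evp i X) (ap p1 (as i X) (ap 0 (wi i ?D) (ap p1 (wi i X) ?s))))"
    using X sc_Hom[OF rk_Hom[OF X p]] by (intro b00_comm) simp_all
  also have "ap p1 (as i X) (ap 0 (wi i ?D) (ap p1 (wi i X) ?s)) = ap 0 (wi i ?D) (ap p1 (wi i X) ?s)"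
    using X by (simp add: ap_as_wi pos_def comm_rev[of "wi i ?D" "as i X" _ 0 p1 p1])
  also have "ap 0 (evp i X) (ap 0 (wi i ?D) (ap p1 (wi i X) ?s)) = ap 0 (ea i X) ?s"
    unfolding ev_alt_eq_alt using X by (simp add: ap_alt[OF P] pos_def)
  finally show ?thesis using X by (simp add: ap_cw ap_wmult pos_def)
qed

end

end

section \<open>Poincare morphisms\<close>

context ACU_tensor_cat
begin

text \<open>The inverse creates a Casimir element of W and evaluates its first leg. The two zigzags
  show that the composites are identities, the one on \<open>Ihom C W B\<close> after testing it by
  evaluation.\<close>

lemma alpha:
  assumes p: "perf W U e c" and B: "B \<in> Obj C"
  shows "alpha C W U e B \<in> Hom C (B \<otimes>\<^sub>o U) (Ihom C W B)"
    and "Evl C W B \<cdot> (alpha C W U e B \<otimes>\<^sub>a Id C W) = contract_right C B U W e"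
    and "is_iso C (alpha C W U e B)"
proof -
  note o = perfD(1,2)[OF p] B perfD(3,4)[OF p, unfolded in_Hom_iff]
  let ?H = "Ihom C W B" and ?a = "alpha C W U e B" and ?e = "b20 U W e" and ?c = "b02 W U c"
  let ?E = "b21 (Ihom C W B) W B (Evl C W B)" and ?ab = "b21 B U (Ihom C W B) (alpha C W U e B)"
  have cr: "contract_right C B U W e \<in> Hom C ((B \<otimes>\<^sub>o U) \<otimes>\<^sub>o W) B"
    using o perfD(3)[OF p] by (intro contract_right_Hom) simp_all
  show a: "?a \<in> Hom C (B \<otimes>\<^sub>o U) ?H" and aE: "Evl C W B \<cdot> (?a \<otimes>\<^sub>a Id C W) = contract_right C B U W e"
    unfolding alpha_def using o cr by (simp_all add: Ihom_adjunct)
  note a' = a[unfolded in_Hom_iff]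
  let ?p = "(Evl C W B \<otimes>\<^sub>a Id C U) \<cdot> (Inv C (Asc C ?H W U) \<cdot> ((Id C ?H \<otimes>\<^sub>a c) \<cdot> Inv C (Run C ?H)))"
  let ?pb = "b12 (Ihom C W B) B U ?p"
  have p': "?p \<in> Arr C" "Dom C ?p = ?H" "Cod C ?p = B \<otimes>\<^sub>o U" using o by simp_all
  have ap_p: "ap 0 ?pb s = ap 0 ?E (ap p1 ?c s)" if s: "vs s" "fst s = ?H # xs" for s xs
  proof -
    let ?h = "Lf ?H" and ?w = "Lf W" and ?u = "Lf U" and ?b = "Lf B"
    let ?x = "ap p1 ?c s"
    have x: "vs ?x" "fst ?x = ?H # W # U # xs" using o s by simp_all
    have 1: "ap 0 (Tn ?h Ut, Tn ?h (Tn ?w ?u), Id C ?H \<otimes>\<^sub>a c) s = ?x"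
      using o s x by (subst ap_Tar) simp_all
    have 2: "ap 0 (Tn ?h (Tn ?w ?u), Tn (Tn ?h ?w) ?u, Inv C (Asc C ?H W U)) ?x = ?x"
      using o x by (intro ap_Asc(2)) simp_all
    have 3: "ap 0 (?h, Tn ?h Ut, Inv C (Run C ?H)) s = s" using o s by simp
    have 4: "ap 0 (Tn (Tn ?h ?w) ?u, Tn ?b ?u, Evl C W B \<otimes>\<^sub>a Id C U) ?x = ap 0 ?E ?x"
      using o x by (subst ap_Tar) simp_all
    show ?thesis
      using o s x by (simp add: ap_Comp[of _ "Tn (Tn ?h ?w) ?u"] ap_Comp[of _ "Tn ?h (Tn ?w ?u)"] ap_Comp[of _ "Tn ?h Ut"] 1 2 3 4 del: ap_Run ap_Asc)
  qed
  have ap_a: "ap 0 ?E (ap 0 ?ab s) = ap p1 ?e s" if s: "vs s" "fst s = B # U # W # xs" for s xs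
  proof -
    have "ap 0 (Tn (Tn (Lf B) (Lf U)) (Lf W), Lf B, Evl C W B \<cdot> (?a \<otimes>\<^sub>a Id C W)) s = ap 0 ?E (ap 0 ?ab s)"
      using o a' s by (simp add: ap_Comp[of _ "Tn (Lf ?H) (Lf W)"] ap_Tar)
    moreover have "ap 0 (Tn (Tn (Lf B) (Lf U)) (Lf W), Lf B, contract_right C B U W e) s = ap p1 ?e s"
      using o s perfD(3)[OF p] by (intro ap_contract_right) (simp_all add: pos_def)
    ultimately show ?thesis using aE by simp
  qed
  have 1: "?p \<cdot> ?a = Id C (B \<otimes>\<^sub>o U)"
  proof (rule faithful[of "Tn (Lf B) (Lf U)" "Tn (Lf B) (Lf U)"])
    let ?s = "start [B, U]" and ?t = "Tn (Lf B) (Lf U)"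
    have "ap 0 (?t, ?t, ?p \<cdot> ?a) ?s = ap 0 ?pb (ap 0 ?ab ?s)"
      using o a' p' by (intro ap_Comp) simp_all
    also have "\<dots> = ap 0 ?E (ap p1 ?c (ap 0 ?ab ?s))"
      using o a' by (intro ap_p[of _ "[]"]) simp_all
    also have "ap p1 ?c (ap 0 ?ab ?s) = ap 0 ?ab (ap p2 ?c ?s)"
      using o a' by (simp add: comm[of ?ab ?c _ 0 p2])
    also have "ap 0 ?E (ap 0 ?ab (ap p2 ?c ?s)) = ap p1 ?e (ap p2 ?c ?s)"
      using o by (intro ap_a[of _ "[U]"]) simp_all
    also have "\<dots> = ?s" using o p by (intro zigzag2) (simp_all add: pos_def)
    finally show "ap 0 (?t, ?t, ?p \<cdot> ?a) (start (lv ?t)) = ap 0 (?t, ?t, Id C (B \<otimes>\<^sub>o U)) (start (lv ?t))" using o by simp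
  qed (use o a' in simp_all)
  have 2: "?a \<cdot> ?p = Id C ?H"
  proof (rule Evl_cancel[of W B])
    let ?s = "start [?H, W]" and ?t = "Tn (Lf ?H) (Lf W)"
    show "Evl C W B \<cdot> ((?a \<cdot> ?p) \<otimes>\<^sub>a Id C W) = Evl C W B \<cdot> (Id C ?H \<otimes>\<^sub>a Id C W)"
    proof (rule faithful[of ?t "Lf B"])
      have "ap 0 (?t, Lf B, Evl C W B \<cdot> ((?a \<cdot> ?p) \<otimes>\<^sub>a Id C W)) ?s = ap 0 ?E (ap 0 (b11 ?H ?H (?a \<cdot> ?p)) ?s)"
        using o a' p' by (simp add: ap_Comp[of _ ?t] ap_Tar)
      also have "ap 0 (b11 ?H ?H (?a \<cdot> ?p)) ?s = ap 0 ?ab (ap 0 ?pb ?s)"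
        using o a' p' by (intro ap_Comp) simp_all
      also have "ap 0 ?E (ap 0 ?ab (ap 0 ?pb ?s)) = ap p1 ?e (ap 0 ?pb ?s)"
        using o p' by (intro ap_a[of _ "[]"]) simp_all
      also have "ap 0 ?pb ?s = ap 0 ?E (ap p1 ?c ?s)"
        using o by (intro ap_p[of _ "[W]"]) simp_all
      also have "ap p1 ?e (ap 0 ?E (ap p1 ?c ?s)) = ap 0 ?E (ap p2 ?e (ap p1 ?c ?s))"
        using o by (simp add: comm[of ?E ?e _ 0 p2])
      also have "ap p2 ?e (ap p1 ?c ?s) = ?s" using o p by (intro zigzag1) (simp_all add: pos_def)
      finally show "ap 0 (?t, Lf B, Evl C W B \<cdot> ((?a \<cdot> ?p) \<otimes>\<^sub>a Id C W)) (start (lv ?t)) = ap 0 (?t, Lf B, Evl C W B \<cdot> (Id C ?H \<otimes>\<^sub>a Id C W)) (start (lv ?t))"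
        using o by (simp add: ap_Comp[of _ ?t] ap_Tar)
    qed (use o a' p' in simp_all)
  qed (use o a' p' in \<open>simp_all add: in_Hom_iff\<close>)
  show "is_iso C ?a" using a' p' 1 2 by (intro is_isoI[of ?a ?p]) (simp_all add: in_Hom_iff)
qed

text \<open>The Poincare morphism of \<open>K : A \<otimes> W \<rightarrow> B\<close> in terms of a transpose \<open>M\<close> of \<open>K\<close>.\<close>

lemma alpha_adjunct:
  fixes D
  assumes p: "perf W U e c" and q: "perf B Bs f d" and A: "A \<in> Obj C"
    and K: "K \<in> Hom C (A \<otimes>\<^sub>o W) B" and M: "M \<in> Hom C (A \<otimes>\<^sub>o Bs) U"
    and adj: "ap 0 (b20 Bs B f) (ap p1 (b21 A W B K) (start [Bs, A, W]))
            = ap 0 (b20 U W e) (ap 0 (b21 A Bs U M) (ap 0 (Sw Bs A) (start [Bs, A, W])))"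
  defines "D \<equiv> Inv C (alpha C W U e B) \<cdot> adjunct C (Ihom C W B) W (Evl C W B) A K"
  shows "D \<in> Hom C A (B \<otimes>\<^sub>o U)"
    and "pos k [A] s \<Longrightarrow> ap k (b12 A B U D) s = ap (Suc k) (b21 A Bs U M) (ap (Suc k) (Sw Bs A) (ap k (b02 B Bs d) s))"
proof -
  note o = perfD(1,2)[OF p] perfD(1,2)[OF q] A perfD(3,4)[OF p, unfolded in_Hom_iff] perfD(3,4)[OF q, unfolded in_Hom_iff]
    K[unfolded in_Hom_iff] M[unfolded in_Hom_iff]
  note al = alpha[OF p perfD(1)[OF q]]
  note al' = al(1)[unfolded in_Hom_iff] al(3)
  let ?j = "adjunct C (Ihom C W B) W (Evl C W B) A K" and ?a = "alpha C W U e B"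
  have j: "?j \<in> Hom C A (Ihom C W B)" "Evl C W B \<cdot> (?j \<otimes>\<^sub>a Id C W) = K"
    using o K by (simp_all add: Ihom_adjunct)
  note j' = j(1)[unfolded in_Hom_iff]
  show D: "D \<in> Hom C A (B \<otimes>\<^sub>o U)" using al' j' by (simp add: D_def in_Hom_iff)
  note D' = D[unfolded in_Hom_iff]
  let ?D = "b12 A B U D" and ?e = "b20 U W e" and ?c = "b02 W U c" and ?f = "b20 Bs B f" and ?d = "b02 B Bs d"
    and ?K = "b21 A W B K" and ?M = "b21 A Bs U M"
  have "K = Evl C W B \<cdot> ((?a \<cdot> D) \<otimes>\<^sub>a Id C W)" using al' j' j(2) by (simp add: D_def)
  also have "\<dots> = (Evl C W B \<cdot> (?a \<otimes>\<^sub>a Id C W)) \<cdot> (D \<otimes>\<^sub>a Id C W)"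
    using o al' D' Tar_Comp_Arr[of D ?a "Id C W" "Id C W"] by simp
  finally have KD: "K = contract_right C B U W e \<cdot> (D \<otimes>\<^sub>a Id C W)" unfolding al(2) .
  have cr: "contract_right C B U W e \<in> Hom C ((B \<otimes>\<^sub>o U) \<otimes>\<^sub>o W) B"
    using o perfD(3)[OF p] by (intro contract_right_Hom) simp_all
  have apK: "ap 0 ?K t = ap p1 ?e (ap 0 ?D t)" if t: "vs t" "fst t = A # W # xs" for t xs
  proof -
    let ?t = "Tn (Tn (Lf B) (Lf U)) (Lf W)"
    have "ap 0 ?K t = ap 0 (?t, Lf B, contract_right C B U W e) (ap 0 ?D t)"
      unfolding KD using o D' t cr[unfolded in_Hom_iff] by (simp add: ap_Comp[of _ ?t] ap_Tar)
    also have "\<dots> = ap p1 ?e (ap 0 ?D t)"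
      using o D' t perfD(3)[OF p] by (intro ap_contract_right) (simp_all add: pos_def)
    finally show ?thesis .
  qed
  let ?s = "start [A]"
  let ?w = "ap p1 ?c ?s"
  have w: "vs ?w" "fst ?w = [A, W, U]" using o by simp_all
  let ?v = "ap 0 ?d ?s"
  have v: "vs ?v" "fst ?v = [B, Bs, A]" using o by simp_all
  have adj': "ap p1 ?f (ap p2 ?K u) = ap p1 ?e (ap p1 ?M (ap p1 (Sw Bs A) u))"
    if u: "pos p1 [Bs, A, W] u" for u
    using pos_transfer[OF u, of "[(p1, ?K), (0, ?f)]" "[(0, Sw Bs A), (0, ?M), (0, ?e)]"] adj o by simp
  \<comment> \<open>A zigzag on the output U completes \<open>D\<close> to \<open>K\<close>. A
    second zigzag, on the output of \<open>K\<close>, brings in the pairing \<open>f\<close>, so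
    that \<open>adj\<close> can replace \<open>K\<close> by \<open>M\<close>. The first zigzag is
    then taken away again.\<close>
  have "ap 0 ?D ?s = ap p1 ?e (ap p2 ?c (ap 0 ?D ?s))"
    using o D' p by (subst zigzag2) (simp_all add: pos_def)
  also have "ap p2 ?c (ap 0 ?D ?s) = ap 0 ?D ?w"
    using o D' by (simp add: comm[of ?D ?c _ 0 p1])
  also have "ap p1 ?e (ap 0 ?D ?w) = ap 0 ?K ?w" using w by (intro apK[symmetric]) simp_all
  also have "\<dots> = ap p1 ?f (ap 0 ?d (ap 0 ?K ?w))"
    using o w q by (subst zigzag1) (simp_all add: pos_def)
  also have "ap 0 ?d (ap 0 ?K ?w) = ap p2 ?K (ap 0 ?d ?w)"
    using o w by (simp add: comm[of ?d ?K _ 0 0])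
  also have "ap 0 ?d ?w = ap p3 ?c ?v"
    using o by (simp add: comm[of ?d ?c _ 0 p1])
  also have "ap p1 ?f (ap p2 ?K (ap p3 ?c ?v)) = ap p1 ?e (ap p1 ?M (ap p1 (Sw Bs A) (ap p3 ?c ?v)))"
    using o v by (intro adj') (simp add: pos_def)
  also have "ap p1 (Sw Bs A) (ap p3 ?c ?v) = ap p3 ?c (ap p1 (Sw Bs A) ?v)"
    using o v by (simp add: comm[of "Sw Bs A" ?c _ p1 p3])
  also have "ap p1 ?M (ap p3 ?c (ap p1 (Sw Bs A) ?v)) = ap p2 ?c (ap p1 ?M (ap p1 (Sw Bs A) ?v))"
    using o v by (simp add: comm[of ?M ?c _ p1 p3])
  also have "ap p1 ?e (ap p2 ?c (ap p1 ?M (ap p1 (Sw Bs A) ?v))) = ap p1 ?M (ap p1 (Sw Bs A) ?v)"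
    using o v p by (intro zigzag2) (simp_all add: pos_def)
  finally have st: "ap 0 ?D ?s = ap p1 ?M (ap p1 (Sw Bs A) ?v)" .
  show "ap k ?D s = ap (Suc k) ?M (ap (Suc k) (Sw Bs A) (ap k ?d s))" if s: "pos k [A] s"
    using pos_transfer[OF s, of "[(0, ?D)]" "[(0, ?d), (p1, Sw Bs A), (p1, ?M)]"] st o D' by simp
qed

end

context rigid_pseudo_abelian_tensor_cat
begin

text \<open>\<open>ev_perf\<close> provides some Casimir element c. Its zigzag says that
  \<open>alpha\<close> maps c to the name of the identity, and \<open>coev\<close> is by definition
  the preimage of that name, so it is c.\<close>

lemma perf_coev:
  assumes X: "X \<in> Obj C"
  shows "perf X (dual C X) (ev C X) (coev C X)"
proof -
  obtain c where p: "perf X (dual C X) (ev C X) c" using ev_perf[OF X] by blast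
  let ?D = "dual C X" and ?a = "alpha C X (dual C X) (ev C X) X"
  note al = alpha[OF p X]
  note o = X al(1)[unfolded in_Hom_iff] al(3) perfD(4)[OF p, unfolded in_Hom_iff]
  have cr: "contract_right C X ?D X (ev C X) \<in> Hom C ((X \<otimes>\<^sub>o ?D) \<otimes>\<^sub>o X) X"
    using X ev_Hom[OF X] by (intro contract_right_Hom) simp_all
  have "adjunct C (Ihom C X X) X (Evl C X X) \<bbbI> (Lun C X) = ?a \<cdot> c"
  proof (rule Ihom_adjunct_eqI)
    have "Evl C X X \<cdot> ((?a \<cdot> c) \<otimes>\<^sub>a Id C X) = (Evl C X X \<cdot> (?a \<otimes>\<^sub>a Id C X)) \<cdot> (c \<otimes>\<^sub>a Id C X)"
      using o Tar_Comp_Arr[of c ?a "Id C X" "Id C X"] by simp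
    also have "\<dots> = contract_right C X ?D X (ev C X) \<cdot> (c \<otimes>\<^sub>a Id C X)" unfolding al(2) ..
    also have "\<dots> = Lun C X"
    proof (rule faithful[of "Tn Ut (Lf X)" "Lf X"])
      let ?t = "Tn (Tn (Lf X) (Lf ?D)) (Lf X)"
      have "ap 0 (Tn Ut (Lf X), Lf X, contract_right C X ?D X (ev C X) \<cdot> (c \<otimes>\<^sub>a Id C X)) (start [X])
         = ap 0 (?t, Lf X, contract_right C X ?D X (ev C X)) (ap 0 (b02 X ?D c) (start [X]))"
        using o cr[unfolded in_Hom_iff] by (simp add: ap_Comp[of _ ?t] ap_Tar)
      also have "\<dots> = ap p1 (b20 ?D X (ev C X)) (ap 0 (b02 X ?D c) (start [X]))"
        using o ev_Hom[OF X] by (intro ap_contract_right) (simp_all add: pos_def)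
      also have "\<dots> = start [X]" using p X by (intro zigzag1) (simp_all add: pos_def)
      finally show "ap 0 (Tn Ut (Lf X), Lf X, contract_right C X ?D X (ev C X) \<cdot> (c \<otimes>\<^sub>a Id C X)) (start (lv (Tn Ut (Lf X))))
         = ap 0 (Tn Ut (Lf X), Lf X, Lun C X) (start (lv (Tn Ut (Lf X))))" using X by simp
    qed (use o cr in \<open>simp_all add: in_Hom_iff\<close>)
    finally show "Evl C X X \<cdot> ((?a \<cdot> c) \<otimes>\<^sub>a Id C X) = Lun C X" .
  qed (use o in \<open>simp_all add: in_Hom_iff\<close>)
  then have "coev C X = c" unfolding coev_def using o by simp
  with p show ?thesis by simp
qed

end

section \<open>Bent multiplications\<close>

context ACU_tensor_cat
begin

text \<open>A strand next to a Casimir element may cross its near leg from one side or the other leg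
  from the other side; this is a slide with one crossing moved over to the other member.\<close>

lemma coev_Sw_left:
  assumes "pos k [X] s" "c \<in> Hom C \<bbbI> (A \<otimes>\<^sub>o B)" "A \<in> Obj C" "B \<in> Obj C" "l = Suc k"
  shows "ap l (Sw B X) (ap k (b02 A B c) s) = ap k (Sw X A) (ap l (b02 A B c) s)"
proof -
  let ?D = "b02 A B c" and ?s = "start [X]"
  have X: "X \<in> Obj C" using pos_objs[OF assms(1)] by simp
  note o = assms(3,4) assms(2)[unfolded in_Hom_iff] X
  have "ap 0 (Sw X A) (ap p1 ?D ?s) = ap 0 (Sw X A) (ap 0 (Sw A X) (ap p1 (Sw B X) (ap 0 ?D ?s)))"
    using o assms(2) by (subst slideL_02) (simp_all add: pos_def)
  also have "\<dots> = ap p1 (Sw B X) (ap 0 ?D ?s)" using o by (simp add: Sw_Sw pos_def)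
  finally show ?thesis
    using pos_transfer[OF assms(1), of "[(0, ?D), (p1, Sw B X)]" "[(p1, ?D), (0, Sw X A)]"] o assms(5) by simp
qed

context
  fixes A B Bs U d f D M
  assumes q: "perf B Bs f d" and A: "A \<in> Obj C" and U: "U \<in> Obj C" and M: "M \<in> Hom C (A \<otimes>\<^sub>o Bs) U"
    and D: "D \<in> Hom C A (B \<otimes>\<^sub>o U)"
    and ap_D: "\<And>k s. pos k [A] s \<Longrightarrow>
      ap k (b12 A B U D) s = ap (Suc k) (b21 A Bs U M) (ap (Suc k) (Sw Bs A) (ap k (b02 B Bs d) s))"
begin

text \<open>\<open>D\<close> is \<open>M\<close> with its second input bent to an output by the
  Casimir element. Contracting that output with a new input straightens the strand and gives
  \<open>M\<close> back; the crossings picked up on the way cancel after a Yang-Baxter move.\<close>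

lemma ev13_transpose: "ev13 C B U Bs (twist C Bs B f) \<cdot> (D \<otimes>\<^sub>a Id C Bs) = M"
proof -
  note o = perfD(1,2)[OF q] A U perfD(3,4)[OF q, unfolded in_Hom_iff] M[unfolded in_Hom_iff] D[unfolded in_Hom_iff]
  let ?f = "b20 Bs B f" and ?d = "b02 B Bs d" and ?M = "b21 A Bs U M" and ?D = "b12 A B U D"
  let ?s = "start [A, Bs]"
  have tw: "twist C Bs B f \<in> Hom C (B \<otimes>\<^sub>o Bs) \<bbbI>" using o perfD(3)[OF q] by (intro twist_Hom) simp_all
  have e13: "ev13 C B U Bs (twist C Bs B f) \<in> Hom C ((B \<otimes>\<^sub>o U) \<otimes>\<^sub>o Bs) U" using o tw by (intro ev13_Hom) simp_all
  note e13' = e13[unfolded in_Hom_iff]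
  let ?t = "Tn (Tn (Lf B) (Lf U)) (Lf Bs)"
  let ?v = "ap 0 ?d ?s"
  have v: "vs ?v" "fst ?v = [B, Bs, A, Bs]" using o by simp_all
  let ?x = "ap p1 (Sw Bs A) ?v"
  have x: "vs ?x" "fst ?x = [B, A, Bs, Bs]" using o v by simp_all
  let ?y = "ap p1 (Sw A Bs) (ap p2 (Sw Bs Bs) ?x)"
  have y: "vs ?y" "fst ?y = [B, Bs, A, Bs]" using o x by simp_all
  have "ap 0 (Tn (Lf A) (Lf Bs), Lf U, ev13 C B U Bs (twist C Bs B f) \<cdot> (D \<otimes>\<^sub>a Id C Bs)) ?s
     = ap 0 (?t, Lf U, ev13 C B U Bs (twist C Bs B f)) (ap 0 ?D ?s)"
    using o e13' by (simp add: ap_Comp[of _ ?t] ap_Tar)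
  also have "\<dots> = ap 0 (b20 B Bs (twist C Bs B f)) (ap p1 (Sw U Bs) (ap 0 ?D ?s))"
    using o tw by (intro ap_ev13) (simp_all add: pos_def)
  also have "ap 0 ?D ?s = ap p1 ?M ?x" using o by (simp add: ap_D pos_def)
  also have "ap p1 (Sw U Bs) (ap p1 ?M ?x) = ap p2 ?M ?y"
    using o x M by (subst slideL_21) (simp_all add: pos_def)
  also have "ap 0 (b20 B Bs (twist C Bs B f)) (ap p2 ?M ?y) = ap 0 ?f (ap 0 (Sw B Bs) (ap p2 ?M ?y))"
    using o y perfD(3)[OF q] by (intro ap_twist) (simp_all add: pos_def)
  also have "\<dots> = ap 0 ?M (ap 0 ?f (ap 0 (Sw B Bs) ?y))"
    using o y by (simp add: comm[of "Sw B Bs" ?M _ 0 p2] comm[of ?f ?M _ 0 p2])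
  also have "?x = ap 0 (Sw A B) (ap p1 ?d ?s)"
    using o perfD(4)[OF q] by (intro coev_Sw_left) (simp_all add: pos_def)
  also have "ap p2 (Sw Bs Bs) \<dots> = ap 0 (Sw A B) (ap p2 (Sw Bs Bs) (ap p1 ?d ?s))"
    using o by (simp add: comm[of "Sw A B" "Sw Bs Bs" _ 0 p2])
  also have "ap p2 (Sw Bs Bs) (ap p1 ?d ?s) = ap p1 (Sw Bs B) (ap p2 ?d ?s)"
    using o perfD(4)[OF q] by (intro coev_Sw_left) (simp_all add: pos_def)
  also have "ap 0 (Sw B Bs) (ap p1 (Sw A Bs) (ap 0 (Sw A B) (ap p1 (Sw Bs B) (ap p2 ?d ?s))))
     = ap p1 (Sw A B) (ap 0 (Sw A Bs) (ap p1 (Sw B Bs) (ap p1 (Sw Bs B) (ap p2 ?d ?s))))"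
    using o by (intro yang_baxter[symmetric]) (simp_all add: pos_def)
  also have "ap p1 (Sw B Bs) (ap p1 (Sw Bs B) (ap p2 ?d ?s)) = ap p2 ?d ?s"
    using o by (simp add: Sw_Sw pos_def)
  also have "ap 0 (Sw A Bs) (ap p2 ?d ?s) = ap p2 ?d (ap 0 (Sw A Bs) ?s)"
    using o by (simp add: comm[of "Sw A Bs" ?d _ 0 p2])
  also have "ap p1 (Sw A B) (ap p2 ?d (ap 0 (Sw A Bs) ?s)) = ap p2 (Sw Bs A) (ap p1 ?d (ap 0 (Sw A Bs) ?s))"
    using o perfD(4)[OF q] by (intro coev_Sw_left[symmetric]) (simp_all add: pos_def)
  also have "ap 0 ?f (ap p2 (Sw Bs A) (ap p1 ?d (ap 0 (Sw A Bs) ?s))) = ap 0 (Sw Bs A) (ap 0 ?f (ap p1 ?d (ap 0 (Sw A Bs) ?s)))"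
    using o by (simp add: comm[of ?f "Sw Bs A" _ 0 p2])
  also have "\<dots> = ?s" using o q by (simp add: zigzag2 Sw_Sw pos_def)
  finally show ?thesis
    using o e13' by (intro faithful[of "Tn (Lf A) (Lf Bs)" "Lf U"]) simp_all
qed

end

text \<open>Here the contracted strand arrives from the left, so after straightening its crossing
  with \<open>A\<close> remains in front of \<open>M\<close>. Comparison with
  \<open>ev13_transpose\<close> reduces (2) to graded commutativity.\<close>

lemma contract_left_transpose:
  assumes p: "perf B Bs f d" and A: "A \<in> Obj C" and U: "U \<in> Obj C" and M: "M \<in> Hom C (A \<otimes>\<^sub>o Bs) U"
    and D: "D \<in> Hom C A (B \<otimes>\<^sub>o U)"
    and ap_D: "\<And>k s. pos k [A] s \<Longrightarrow>
      ap k (b12 A B U D) s = ap (Suc k) (b21 A Bs U M) (ap (Suc k) (Sw Bs A) (ap k (b02 B Bs d) s))"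
  shows "contract_left C Bs B U f \<cdot> (Id C Bs \<otimes>\<^sub>a D) = M \<cdot> Sym C Bs A"
proof -
  note o = perfD(1,2)[OF p] A U perfD(3,4)[OF p, unfolded in_Hom_iff] M[unfolded in_Hom_iff] D[unfolded in_Hom_iff]
  let ?f = "b20 Bs B f" and ?d = "b02 B Bs d" and ?M = "b21 A Bs U M" and ?D = "b12 A B U D"
  let ?s = "start [Bs, A]" and ?t = "Tn (Lf Bs) (Tn (Lf B) (Lf U))" and ?i = "Tn (Lf Bs) (Lf A)"
  have cl: "contract_left C Bs B U f \<in> Hom C (Bs \<otimes>\<^sub>o (B \<otimes>\<^sub>o U)) U" using o perfD(3)[OF p] by (intro contract_left_Hom) simp_all
  note cl' = cl[unfolded in_Hom_iff]
  let ?v = "ap p1 ?d ?s"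
  have v: "vs ?v" "fst ?v = [Bs, B, Bs, A]" using o by simp_all
  have "ap 0 (?i, Lf U, contract_left C Bs B U f \<cdot> (Id C Bs \<otimes>\<^sub>a D)) ?s
     = ap 0 (?t, Lf U, contract_left C Bs B U f) (ap p1 ?D ?s)"
    using o cl' by (simp add: ap_Comp[of _ ?t] ap_Tar)
  also have "\<dots> = ap 0 ?f (ap p1 ?D ?s)"
    using o perfD(3)[OF p] by (intro ap_contract_left) (simp_all add: pos_def)
  also have "ap p1 ?D ?s = ap p2 ?M (ap p2 (Sw Bs A) ?v)" using o by (simp add: ap_D pos_def)
  also have "ap 0 ?f (ap p2 ?M (ap p2 (Sw Bs A) ?v)) = ap 0 ?M (ap 0 (Sw Bs A) (ap 0 ?f ?v))"
    using o v by (simp add: comm[of ?f ?M _ 0 p2] comm[of ?f "Sw Bs A" _ 0 p2])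
  also have "ap 0 ?f ?v = ?s" using o p by (intro zigzag2) (simp_all add: pos_def)
  also have "ap 0 ?M (ap 0 (Sw Bs A) ?s) = ap 0 (?i, Lf U, M \<cdot> Sym C Bs A) ?s"
    using o by (simp add: ap_Comp[of _ "Tn (Lf A) (Lf Bs)"])
  finally show ?thesis
    using o cl' by (intro faithful[of ?i "Lf U"]) simp_all
qed

section \<open>Consequences of a scalar identity for two traced multiplications\<close>

context
  fixes A A' B B' W W' :: 'a and m m' cB eB
  assumes A: "A \<in> Obj C" "A' \<in> Obj C" and W: "W \<in> Obj C" "W' \<in> Obj C"
    and m: "m \<in> Hom C (A \<otimes>\<^sub>o B) W" and m': "m' \<in> Hom C (A' \<otimes>\<^sub>o B') W'"
    and pB: "perf B B' eB cB"
begin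

lemmas cross_o = A W perfD(1,2)[OF pB] perfD(3,4)[OF pB, unfolded in_Hom_iff] m[unfolded in_Hom_iff] m'[unfolded in_Hom_iff]

text \<open>The product strand W is pulled across the box of \<open>m'\<close>, and A' across that
  of \<open>m\<close>. The leg of the Casimir element is thereby uncrossed, and the two bent
  multiplications appear in the shape to which \<open>key\<close> applies.\<close>

lemma cross:
  assumes s: "pos k [A, A'] s"
  shows "ap k (Sw W W') (ap k (b21 A B W m) (ap (Suc (Suc k)) (b21 A' B' W' m') (ap (Suc (Suc k)) (Sw B' A') (ap (Suc k) (b02 B B' cB) s))))
     = ap k (b21 A' B' W' m') (ap (Suc k) (Sw W B') (ap (Suc k) (b21 A B W m) (ap (Suc (Suc k)) (b02 B B' cB) (ap k (Sw A A') s))))"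
proof -
  note o = cross_o
  let ?m = "b21 A B W m" and ?m' = "b21 A' B' W' m'" and ?c = "b02 B B' cB" let ?s = "start [A, A']"
  let ?t = "ap p2 (Sw B' A') (ap p1 ?c ?s)"
  have t: "vs ?t" "fst ?t = [A, B, A', B']" using o by simp_all
  have "ap 0 (Sw W W') (ap 0 ?m (ap p2 ?m' ?t)) = ap 0 (Sw W W') (ap p1 ?m' (ap 0 ?m ?t))"
    using o t by (simp add: comm[of ?m ?m' _ 0 p2])
  also have "\<dots> = ap 0 ?m' (ap p1 (Sw W B') (ap 0 (Sw W A') (ap 0 ?m ?t)))"
    using o t m' by (intro slideR_21) (simp_all add: pos_def)
  also have "ap 0 (Sw W A') (ap 0 ?m ?t) = ap p1 ?m (ap 0 (Sw A A') (ap p1 (Sw B A') ?t))"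
    using o t m by (intro slideL_21) (simp_all add: pos_def)
  also have "ap p1 (Sw B A') ?t = ap p2 ?c ?s"
    using o perfD(4)[OF pB] by (intro slideL_02) (simp_all add: pos_def)
  also have "ap 0 (Sw A A') (ap p2 ?c ?s) = ap p2 ?c (ap 0 (Sw A A') ?s)"
    using o by (simp add: comm[of "Sw A A'" ?c _ 0 p2])
  finally show ?thesis
    using pos_transfer[OF s, of "[(p1, ?c), (p2, Sw B' A'), (p2, ?m'), (0, ?m), (0, Sw W W')]"
      "[(0, Sw A A'), (p2, ?c), (p1, ?m), (p1, Sw W B'), (0, ?m')]"] o by simp
qed

context
  fixes eA eW z
  assumes eA: "eA \<in> Hom C (A' \<otimes>\<^sub>o A) \<bbbI>" and eW: "eW \<in> Hom C (W' \<otimes>\<^sub>o W) \<bbbI>" and z: "z \<in> Hom C \<bbbI> \<bbbI>"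
    and key: "ap 0 (b20 W' W eW) (ap 0 (b21 A' B' W' m') (ap p1 (Sw W B') (ap p1 (b21 A B W m)
       (ap p2 (b02 B B' cB) (start [A', A]))))) = ap 0 (Ut, Ut, z) (ap 0 (b20 A' A eA) (start [A', A]))"
begin

lemmas key_o = cross_o eA[unfolded in_Hom_iff] eW[unfolded in_Hom_iff] z[unfolded in_Hom_iff]

text \<open>The hypothesis \<open>key\<close> is the shape of \<open>trace_wedge\<close>:
  \<open>m\<close> and \<open>m'\<close> are the exterior products for V and its dual, and
  \<open>z\<close> is the traced scalar. Inside a diagram the scalar is moved to position 0.\<close>

lemma key_pos:
  assumes s: "pos k [A', A] s"
  shows "ap k (b20 W' W eW) (ap k (b21 A' B' W' m') (ap (Suc k) (Sw W B') (ap (Suc k) (b21 A B W m)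
     (ap (Suc (Suc k)) (b02 B B' cB) s)))) = ap 0 (Ut, Ut, z) (ap k (b20 A' A eA) s)"
proof -
  have "ap k (b20 W' W eW) (ap k (b21 A' B' W' m') (ap (Suc k) (Sw W B') (ap (Suc k) (b21 A B W m)
     (ap (Suc (Suc k)) (b02 B B' cB) s)))) = ap k (Ut, Ut, z) (ap k (b20 A' A eA) s)"
    using pos_transfer[OF s, of "[(p2, b02 B B' cB), (p1, b21 A B W m), (p1, Sw W B'), (0, b21 A' B' W' m'), (0, b20 W' W eW)]"
      "[(0, b20 A' A eA), (0, (Ut, Ut, z))]"] key key_o by simp
  also have "\<dots> = ap 0 (Ut, Ut, z) (ap k (b20 A' A eA) s)"
    using s key_o z by (intro b00_move) (auto simp: pos_def)
  finally show ?thesis .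
qed

text \<open>The hypothesis is symmetric under exchanging the primed with the unprimed objects, with
  all pairings and the Casimir element twisted. The first half of (4) uses this exchanged
  form.\<close>

lemma key_twist:
  "ap 0 (b20 W W' (twist C W' W eW)) (ap 0 (b21 A B W m) (ap p1 (Sw W' B) (ap p1 (b21 A' B' W' m')
     (ap p2 (b02 B' B (Sym C B B' \<cdot> cB)) (start [A, A']))))) = ap 0 (Ut, Ut, z) (ap 0 (b20 A A' (twist C A' A eA)) (start [A, A']))"
proof -
  note o = key_o
  let ?m = "b21 A B W m" and ?m' = "b21 A' B' W' m'" and ?c = "b02 B B' cB" let ?s = "start [A, A']"
  let ?w = "ap p2 (b02 B' B (Sym C B B' \<cdot> cB)) ?s"
  define L where "L = ap 0 (b20 W W' (twist C W' W eW)) (ap 0 ?m (ap p1 (Sw W' B) (ap p1 ?m' ?w)))"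
  let ?v = "ap 0 ?m (ap p1 (Sw W' B) (ap p1 ?m' ?w))"
  have w: "vs ?w" "fst ?w = [A, A', B', B]" using o by simp_all
  have "L = ap 0 (b20 W' W eW) (ap 0 (Sw W W') ?v)"
    unfolding L_def using o w eW by (intro ap_twist) (simp_all add: pos_def)
  also have "ap p1 (Sw W' B) (ap p1 ?m' ?w) = ap p2 ?m' (ap p1 (Sw A' B) (ap p2 (Sw B' B) ?w))"
    using o w m' by (intro slideL_21) (simp_all add: pos_def)
  also have "?w = ap p2 (Sw B B') (ap p2 ?c ?s)"
    using o perfD(4)[OF pB] by (intro ap_Sym_02) (simp_all add: pos_def)
  also have "ap p2 (Sw B' B) \<dots> = ap p2 ?c ?s" using o by (simp add: Sw_Sw pos_def)
  also have "ap p1 (Sw A' B) (ap p2 ?c ?s) = ap p2 (Sw B' A') (ap p1 ?c ?s)"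
    using o perfD(4)[OF pB] by (intro coev_Sw_left[symmetric]) (simp_all add: pos_def)
  also have "ap 0 (Sw W W') (ap 0 ?m (ap p2 ?m' (ap p2 (Sw B' A') (ap p1 ?c ?s))))
     = ap 0 ?m' (ap p1 (Sw W B') (ap p1 ?m (ap p2 ?c (ap 0 (Sw A A') ?s))))"
    using o by (intro cross) (simp_all add: pos_def)
  also have "ap 0 (b20 W' W eW) \<dots> = ap 0 (Ut, Ut, z) (ap 0 (b20 A' A eA) (ap 0 (Sw A A') ?s))"
    using o by (intro key_pos) (simp_all add: pos_def)
  also have "ap 0 (b20 A' A eA) (ap 0 (Sw A A') ?s) = ap 0 (b20 A A' (twist C A' A eA)) ?s"
    using o eA by (intro ap_twist[symmetric]) (simp_all add: pos_def)
  finally show ?thesis unfolding L_def .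
qed

text \<open>For (1). Contracting the first factor of \<open>D\<close> restores the multiplication
  \<open>\<rho> \<cdot> m\<close> by \<open>ev13_transpose\<close>. The map \<open>\<rho>\<close>,
  later the reflexivity map, is consumed by \<open>h\<close>, and the scalar identity finishes the
  computation.\<close>

lemma ev1324_trace:
  assumes Y: "Y \<in> Obj C" and \<rho>: "\<rho> \<in> Hom C W Y" and h: "h \<in> Hom C (Y \<otimes>\<^sub>o W') \<bbbI>" "h \<cdot> (\<rho> \<otimes>\<^sub>a Id C W') = twist C W' W eW"
    and D: "D \<in> Hom C A (B' \<otimes>\<^sub>o Y)"
      "\<And>k s. pos k [A] s \<Longrightarrow> ap k (b12 A B' Y D) s = ap (Suc k) (b21 A B Y (\<rho> \<cdot> m)) (ap (Suc k) (Sw B A) (ap k (b02 B' B (Sym C B B' \<cdot> cB)) s))"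
    and E: "E \<in> Hom C A' (B \<otimes>\<^sub>o W')"
      "\<And>k s. pos k [A'] s \<Longrightarrow> ap k (b12 A' B W' E) s = ap (Suc k) (b21 A' B' W' m') (ap (Suc k) (Sw B' A') (ap k (b02 B B' cB) s))"
  shows "ev1324 C B' Y B W' eB h \<cdot> (D \<otimes>\<^sub>a E) = act C z (twist C A' A eA)"
proof -
  note o = key_o Y \<rho>[unfolded in_Hom_iff] h(1)[unfolded in_Hom_iff] D(1)[unfolded in_Hom_iff] E(1)[unfolded in_Hom_iff]
  let ?m = "b21 A B W m" and ?m' = "b21 A' B' W' m'" and ?c = "b02 B B' cB" and ?h = "b20 Y W' h" and ?r = "b11 W Y \<rho>"
  let ?D = "b12 A B' Y D" and ?E = "b12 A' B W' E" and ?eB = "b20 B' B eB"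
  let ?s = "start [A, A']"
  let ?t = "Tn (Tn (Lf B') (Lf Y)) (Tn (Lf B) (Lf W'))" and ?i = "Tn (Lf A) (Lf A')"
  have twA: "twist C A' A eA \<in> Hom C (A \<otimes>\<^sub>o A') \<bbbI>" using o eA by (intro twist_Hom) simp_all
  have aH: "act C z (twist C A' A eA) \<in> Hom C (A \<otimes>\<^sub>o A') \<bbbI>"
    using o twA[unfolded in_Hom_iff] by (simp add: act_def in_Hom_iff)
  have eH: "ev1324 C B' Y B W' eB h \<in> Hom C ((B' \<otimes>\<^sub>o Y) \<otimes>\<^sub>o (B \<otimes>\<^sub>o W')) \<bbbI>"
    using o h perfD(3)[OF pB] by (intro ev1324_Hom) simp_all
  note e' = eH[unfolded in_Hom_iff] aH[unfolded in_Hom_iff] twA[unfolded in_Hom_iff]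
  have rm: "\<rho> \<cdot> m \<in> Hom C (A \<otimes>\<^sub>o B) Y" using o by (simp add: in_Hom_iff)
  have pB': "perf B' B (twist C B' B eB) (Sym C B B' \<cdot> cB)" by (rule perf_twist[OF pB])
  have tt: "twist C B B' (twist C B' B eB) = eB" using o by (simp add: twist_def Sym_Sym)
  have F: "ev13 C B' Y B eB \<cdot> (D \<otimes>\<^sub>a Id C B) = \<rho> \<cdot> m"
    using ev13_transpose[OF pB' A(1) Y rm D] tt by simp
  have ev13: "ev13 C B' Y B eB \<in> Hom C ((B' \<otimes>\<^sub>o Y) \<otimes>\<^sub>o B) Y" using o perfD(3)[OF pB] by (intro ev13_Hom) simp_all
  have apF: "ap 0 ?eB (ap p1 (Sw Y B) (ap 0 ?D u)) = ap 0 ?r (ap 0 ?m u)" if u: "vs u" "fst u = A # B # xs" for u xs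
  proof -
    let ?x = "Tn (Tn (Lf B') (Lf Y)) (Lf B)"
    have "ap 0 (Tn (Lf A) (Lf B), Lf Y, ev13 C B' Y B eB \<cdot> (D \<otimes>\<^sub>a Id C B)) u = ap 0 (?x, Lf Y, ev13 C B' Y B eB) (ap 0 ?D u)"
      using o u ev13[unfolded in_Hom_iff] by (simp add: ap_Comp[of _ ?x] ap_Tar)
    also have "\<dots> = ap 0 ?eB (ap p1 (Sw Y B) (ap 0 ?D u))"
      using o u perfD(3)[OF pB] by (intro ap_ev13) (simp_all add: pos_def)
    finally show ?thesis unfolding F using o u by (simp add: ap_Comp[of _ "Lf W"])
  qed
  have aph: "ap 0 ?h (ap 0 ?r u) = ap 0 (b20 W' W eW) (ap 0 (Sw W W') u)" if u: "vs u" "fst u = W # W' # xs" for u xs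
  proof -
    have "ap 0 (Tn (Lf W) (Lf W'), Ut, h \<cdot> (\<rho> \<otimes>\<^sub>a Id C W')) u = ap 0 ?h (ap 0 ?r u)"
      using o u by (simp add: ap_Comp[of _ "Tn (Lf Y) (Lf W')"] ap_Tar)
    then show ?thesis unfolding h(2) using ap_twist[OF _ eW, of 0 u] u by (simp add: pos_def)
  qed
  let ?u = "ap p1 ?E ?s"
  have u: "vs ?u" "fst ?u = [A, B, W']" using o by simp_all
  have "ap 0 (?i, Ut, ev1324 C B' Y B W' eB h \<cdot> (D \<otimes>\<^sub>a E)) ?s = ap 0 (?t, Ut, ev1324 C B' Y B W' eB h) (ap 0 ?D ?u)"
    using o e' by (simp add: ap_Comp[of _ ?t] ap_Tar)
  also have "\<dots> = ap 0 ?eB (ap p2 ?h (ap p1 (Sw Y B) (ap 0 ?D ?u)))"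
    using o u h perfD(3)[OF pB] by (intro ap_ev1324) (simp_all add: pos_def)
  also have "\<dots> = ap 0 ?h (ap 0 ?eB (ap p1 (Sw Y B) (ap 0 ?D ?u)))"
    using o u by (simp add: comm[of ?eB ?h _ 0 p2])
  also have "ap 0 ?eB (ap p1 (Sw Y B) (ap 0 ?D ?u)) = ap 0 ?r (ap 0 ?m ?u)"
    using u by (intro apF[of _ "[W']"])
  also have "ap 0 ?h \<dots> = ap 0 (b20 W' W eW) (ap 0 (Sw W W') (ap 0 ?m ?u))"
    using o u by (intro aph[of _ "[]"]) simp_all
  also have "?u = ap p2 ?m' (ap p2 (Sw B' A') (ap p1 ?c ?s))" using o by (simp add: E pos_def)
  also have "ap 0 (Sw W W') (ap 0 ?m (ap p2 ?m' (ap p2 (Sw B' A') (ap p1 ?c ?s))))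
     = ap 0 ?m' (ap p1 (Sw W B') (ap p1 ?m (ap p2 ?c (ap 0 (Sw A A') ?s))))"
    using o by (intro cross) (simp_all add: pos_def)
  also have "ap 0 (b20 W' W eW) \<dots> = ap 0 (Ut, Ut, z) (ap 0 (b20 A' A eA) (ap 0 (Sw A A') ?s))"
    using o by (intro key_pos) (simp_all add: pos_def)
  also have "ap 0 (b20 A' A eA) (ap 0 (Sw A A') ?s) = ap 0 (b20 A A' (twist C A' A eA)) ?s"
    using o eA by (intro ap_twist[symmetric]) (simp_all add: pos_def)
  also have "ap 0 (Ut, Ut, z) \<dots> = ap 0 (?i, Ut, act C z (twist C A' A eA)) ?s"
    using o e' z by (intro ap_act[symmetric]) simp_all
  finally show ?thesis using o e' by (intro faithful[of ?i Ut]) simp_all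
qed

context
  fixes n n' :: 'b and cA and q :: rat
  assumes n: "n \<in> Hom C (B \<otimes>\<^sub>o A) W" "n' \<in> Hom C (B' \<otimes>\<^sub>o A') W'" and pA: "perf A A' eA cA"
    and mn: "m = Scl C q (n \<cdot> Sym C A B)" "m' = Scl C q (n' \<cdot> Sym C A' B')" and q: "q * q = 1"
begin

text \<open>\<open>n\<close> and \<open>n'\<close> are the multiplications in the opposite order.
  They enter because (3) and (4) combine a Poincare morphism in degree i with one in degree
  j.\<close>

lemma sign_flip: "n \<cdot> Sym C A B = Scl C q m" "n' \<cdot> Sym C A' B' = Scl C q m'" "m \<cdot> Sym C B A = Scl C q n"
proof -
  note o = cross_o n[unfolded in_Hom_iff]
  show "n \<cdot> Sym C A B = Scl C q m" "n' \<cdot> Sym C A' B' = Scl C q m'"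
    using o q by (simp_all add: mn)
  show "m \<cdot> Sym C B A = Scl C q n"
    using o q by (simp add: mn(1) Sym_Sym)
qed

lemma ap_sign_flip:
  "pos k [A, B] s \<Longrightarrow> ap k (b21 B A W n) (ap k (Sw A B) s) = sscl q (ap k (b21 A B W m) s)"
  "pos k [A', B'] s \<Longrightarrow> ap k (b21 B' A' W' n') (ap k (Sw A' B') s) = sscl q (ap k (b21 A' B' W' m') s)"
  "pos k [B, A] s \<Longrightarrow> ap k (b21 B A W n) s = sscl q (ap k (b21 A B W m) (ap k (Sw B A) s))"
proof -
  note o = cross_o n[unfolded in_Hom_iff]
  let ?AB = "Tn (Lf A) (Lf B)" and ?AB' = "Tn (Lf A') (Lf B')" and ?BA = "Tn (Lf B) (Lf A)" and ?BA' = "Tn (Lf B') (Lf A')"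
  show "ap k (b21 B A W n) (ap k (Sw A B) s) = sscl q (ap k (b21 A B W m) s)" if s: "pos k [A, B] s"
    using ap_Comp[of ?AB ?BA "Sym C A B" "Lf W" n s k] ap_Scl[of ?AB "Lf W" m s k q] s o sign_flip(1) by (simp add: pos_def)
  show "ap k (b21 B' A' W' n') (ap k (Sw A' B') s) = sscl q (ap k (b21 A' B' W' m') s)" if s: "pos k [A', B'] s"
    using ap_Comp[of ?AB' ?BA' "Sym C A' B'" "Lf W'" n' s k] ap_Scl[of ?AB' "Lf W'" m' s k q] s o sign_flip(2) by (simp add: pos_def)
  show "ap k (b21 B A W n) s = sscl q (ap k (b21 A B W m) (ap k (Sw B A) s))" if s: "pos k [B, A] s"
  proof -
    have "sscl q (ap k (b21 A B W m) (ap k (Sw B A) s)) = sscl q (sscl q (ap k (b21 B A W n) s))"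
      using ap_Comp[of ?BA ?AB "Sym C B A" "Lf W" m s k] ap_Scl[of ?BA "Lf W" n s k q] s o sign_flip(3) by (simp add: pos_def)
    then show ?thesis using s o q by (simp add: pos_def)
  qed
qed

text \<open>For the first half of (3). \<open>D\<close> comes from the product in the order of
  \<open>m\<close> and \<open>E\<close> from the opposite order \<open>n'\<close>, so one sign
  \<open>q\<close> survives. The A' leg of the Casimir element bending \<open>n'\<close> meets the
  traced diagram, and its zigzag leaves the identity of A.\<close>

lemma contract_right_trace:
  assumes Y: "Y \<in> Obj C" and \<rho>: "\<rho> \<in> Hom C W Y" and h: "h \<in> Hom C (Y \<otimes>\<^sub>o W') \<bbbI>" "h \<cdot> (\<rho> \<otimes>\<^sub>a Id C W') = twist C W' W eW"
    and D: "D \<in> Hom C A (B' \<otimes>\<^sub>o Y)"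
      "\<And>k s. pos k [A] s \<Longrightarrow> ap k (b12 A B' Y D) s = ap (Suc k) (b21 A B Y (\<rho> \<cdot> m)) (ap (Suc k) (Sw B A) (ap k (b02 B' B (Sym C B B' \<cdot> cB)) s))"
    and E: "E \<in> Hom C B' (A \<otimes>\<^sub>o W')"
      "\<And>k s. pos k [B'] s \<Longrightarrow> ap k (b12 B' A W' E) s = ap (Suc k) (b21 B' A' W' n') (ap (Suc k) (Sw A' B') (ap k (b02 A A' cA) s))"
  shows "contract_right C A W' Y (twist C Y W' h) \<cdot> ((E \<otimes>\<^sub>a Id C Y) \<cdot> D) = Scl C q (act C z (Id C A))"
proof -
  note o = key_o n[unfolded in_Hom_iff] perfD(4)[OF pA, unfolded in_Hom_iff] Y \<rho>[unfolded in_Hom_iff] h(1)[unfolded in_Hom_iff] D(1)[unfolded in_Hom_iff] E(1)[unfolded in_Hom_iff]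
  let ?m = "b21 A B W m" and ?m' = "b21 A' B' W' m'" and ?c = "b02 B B' cB" and ?r = "b11 W Y \<rho>" and ?n' = "b21 B' A' W' n'"
  let ?D = "b12 A B' Y D" and ?E = "b12 B' A W' E" and ?a = "b02 A A' cA" and ?ct = "b02 B' B (Sym C B B' \<cdot> cB)"
  let ?s = "start [A]" let ?t = "Tn (Tn (Lf A) (Lf W')) (Lf Y)" and ?x = "Tn (Lf B') (Lf Y)"
  have twh: "twist C Y W' h \<in> Hom C (W' \<otimes>\<^sub>o Y) \<bbbI>" using o h by (intro twist_Hom) simp_all
  have cr: "contract_right C A W' Y (twist C Y W' h) \<in> Hom C ((A \<otimes>\<^sub>o W') \<otimes>\<^sub>o Y) A"
    using o twh by (intro contract_right_Hom) simp_all
  have aH: "act C z (Id C A) \<in> Hom C A A" using o by (simp add: act_def in_Hom_iff)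
  note e' = twh[unfolded in_Hom_iff] cr[unfolded in_Hom_iff] aH[unfolded in_Hom_iff]
  have aph: "ap p1 (b20 W' Y (twist C Y W' h)) (ap p2 ?r u) = ap p1 (b20 W' W eW) u" if u: "pos p1 [W', W] u" for u
  proof -
    let ?u = "start [W', W]"
    have tE: "twist C Y W' h \<cdot> (Id C W' \<otimes>\<^sub>a \<rho>) = eW"
    proof -
      have "twist C Y W' h \<cdot> (Id C W' \<otimes>\<^sub>a \<rho>) = h \<cdot> ((\<rho> \<otimes>\<^sub>a Id C W') \<cdot> Sym C W' W)"
        using o Sym_natural[of "Id C W'" W' W' \<rho> W Y] by (simp add: twist_def in_Hom_iff)
      also have "\<dots> = (h \<cdot> (\<rho> \<otimes>\<^sub>a Id C W')) \<cdot> Sym C W' W" using o by simp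
      finally show ?thesis unfolding h(2) using o by (simp add: twist_def Sym_Sym)
    qed
    have "ap 0 (Tn (Lf W') (Lf W), Ut, twist C Y W' h \<cdot> (Id C W' \<otimes>\<^sub>a \<rho>)) ?u = ap 0 (b20 W' Y (twist C Y W' h)) (ap p1 ?r ?u)"
      using o e' by (simp add: ap_Comp[of _ "Tn (Lf W') (Lf Y)"] ap_Tar)
    then show ?thesis
      using pos_transfer[OF u, of "[(p1, ?r), (0, b20 W' Y (twist C Y W' h))]" "[(0, b20 W' W eW)]"] tE o e' by simp
  qed
  let ?w = "ap p1 (Sw B A) (ap 0 ?ct ?s)"
  have w: "vs ?w" "fst ?w = [B', A, B]" using o by simp_all
  let ?v = "ap 0 ?a ?w"
  have v: "vs ?v" "fst ?v = [A, A', B', A, B]" using o w by simp_all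
  have "ap 0 (b11 A A (contract_right C A W' Y (twist C Y W' h) \<cdot> ((E \<otimes>\<^sub>a Id C Y) \<cdot> D))) ?s
     = ap 0 (?t, Lf A, contract_right C A W' Y (twist C Y W' h)) (ap 0 ?E (ap 0 ?D ?s))"
    using o e' by (simp add: ap_Comp[of _ ?t] ap_Comp[of _ ?x] ap_Tar)
  also have "\<dots> = ap p1 (b20 W' Y (twist C Y W' h)) (ap 0 ?E (ap 0 ?D ?s))"
    using o twh by (intro ap_contract_right) (simp_all add: pos_def)
  also have "ap 0 ?D ?s = ap p1 ?r (ap p1 ?m ?w)" using o w by (simp add: D pos_def ap_Comp[of _ "Lf W"])
  also have "ap 0 ?E (ap p1 ?r (ap p1 ?m ?w)) = ap p2 ?r (ap 0 ?E (ap p1 ?m ?w))"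
    using o w by (simp add: comm[of ?E ?r _ 0 p1])
  also have "ap p1 (b20 W' Y (twist C Y W' h)) \<dots> = ap p1 (b20 W' W eW) (ap 0 ?E (ap p1 ?m ?w))"
    using o w by (intro aph) (simp add: pos_def)
  also have "ap 0 ?E (ap p1 ?m ?w) = ap p1 ?n' (ap p1 (Sw A' B') (ap 0 ?a (ap p1 ?m ?w)))"
    using o w by (simp add: E pos_def)
  also have "\<dots> = sscl q (ap p1 ?m' (ap 0 ?a (ap p1 ?m ?w)))"
    using o w by (intro ap_sign_flip) (simp add: pos_def)
  also have "ap 0 ?a (ap p1 ?m ?w) = ap p3 ?m ?v"
    using o w by (simp add: comm[of ?a ?m _ 0 p1])
  also have "?v = ap p3 (Sw B A) (ap p2 ?ct (ap 0 ?a ?s))"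
    using o by (simp add: comm[of ?a "Sw B A" _ 0 p1] comm[of ?a ?ct _ 0 0])
  also have "ap p3 (Sw B A) (ap p2 ?ct (ap 0 ?a ?s)) = ap p2 (Sw A B') (ap p3 ?ct (ap 0 ?a ?s))"
    using o by (intro coev_Sw_left) (simp_all add: pos_def in_Hom_iff)
  also have "ap p3 ?ct (ap 0 ?a ?s) = ap p3 (Sw B B') (ap p3 ?c (ap 0 ?a ?s))"
    using o perfD(4)[OF pB] by (intro ap_Sym_02) (simp_all add: pos_def)
  also have "ap p3 ?m (ap p2 (Sw A B') (ap p3 (Sw B B') (ap p3 ?c (ap 0 ?a ?s))))
     = ap p2 (Sw W B') (ap p2 ?m (ap p3 ?c (ap 0 ?a ?s)))"
    using o m by (intro slideL_21[symmetric]) (simp_all add: pos_def)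
  also have "ap p1 (b20 W' W eW) (sscl q (ap p1 ?m' \<dots>))
     = sscl q (ap p1 (b20 W' W eW) (ap p1 ?m' (ap p2 (Sw W B') (ap p2 ?m (ap p3 ?c (ap 0 ?a ?s))))))"
    using o by (intro ap_sscl) simp_all
  also have "ap p1 (b20 W' W eW) (ap p1 ?m' (ap p2 (Sw W B') (ap p2 ?m (ap p3 ?c (ap 0 ?a ?s)))))
     = ap 0 (Ut, Ut, z) (ap p1 (b20 A' A eA) (ap 0 ?a ?s))"
    using o by (intro key_pos) (simp_all add: pos_def)
  also have "ap p1 (b20 A' A eA) (ap 0 ?a ?s) = ?s"
    using o pA by (intro zigzag1) (simp_all add: pos_def)
  also have "ap 0 (Ut, Ut, z) ?s = ap 0 (b11 A A (act C z (Id C A))) ?s"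
    using o z by (subst ap_act) simp_all
  also have "sscl q \<dots> = ap 0 (b11 A A (Scl C q (act C z (Id C A)))) ?s"
    using o e' by (intro ap_Scl[symmetric]) simp_all
  finally show ?thesis using o e' by (intro faithful[of "Lf A" "Lf A"]) simp_all
qed

text \<open>The dual half of (3): now the bent product with \<open>\<rho>\<close> is in the opposite
  order and again contributes one \<open>q\<close>. The final zigzag is that of the twisted pairing,
  hence the identity of A'.\<close>

lemma contract_right_trace':
  assumes Y: "Y \<in> Obj C" and \<rho>: "\<rho> \<in> Hom C W Y" and h: "h \<in> Hom C (Y \<otimes>\<^sub>o W') \<bbbI>" "h \<cdot> (\<rho> \<otimes>\<^sub>a Id C W') = twist C W' W eW"
    and D: "D \<in> Hom C B (A' \<otimes>\<^sub>o Y)"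
      "\<And>k s. pos k [B] s \<Longrightarrow> ap k (b12 B A' Y D) s = ap (Suc k) (b21 B A Y (\<rho> \<cdot> n)) (ap (Suc k) (Sw A B) (ap k (b02 A' A (Sym C A A' \<cdot> cA)) s))"
    and E: "E \<in> Hom C A' (B \<otimes>\<^sub>o W')"
      "\<And>k s. pos k [A'] s \<Longrightarrow> ap k (b12 A' B W' E) s = ap (Suc k) (b21 A' B' W' m') (ap (Suc k) (Sw B' A') (ap k (b02 B B' cB) s))"
  shows "contract_right C A' Y W' h \<cdot> ((D \<otimes>\<^sub>a Id C W') \<cdot> E) = Scl C q (act C z (Id C A'))"
proof -
  note o = key_o n[unfolded in_Hom_iff] perfD(4)[OF pA, unfolded in_Hom_iff] Y \<rho>[unfolded in_Hom_iff] h(1)[unfolded in_Hom_iff] D(1)[unfolded in_Hom_iff] E(1)[unfolded in_Hom_iff]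
  let ?m = "b21 A B W m" and ?m' = "b21 A' B' W' m'" and ?c = "b02 B B' cB" and ?r = "b11 W Y \<rho>" and ?n = "b21 B A W n"
  let ?D = "b12 B A' Y D" and ?E = "b12 A' B W' E" and ?at = "b02 A' A (Sym C A A' \<cdot> cA)" and ?h = "b20 Y W' h"
  let ?s = "start [A']" let ?t = "Tn (Tn (Lf A') (Lf Y)) (Lf W')" and ?x = "Tn (Lf B) (Lf W')"
  have cr: "contract_right C A' Y W' h \<in> Hom C ((A' \<otimes>\<^sub>o Y) \<otimes>\<^sub>o W') A'"
    using o h by (intro contract_right_Hom) simp_all
  have aH: "act C z (Id C A') \<in> Hom C A' A'" using o by (simp add: act_def in_Hom_iff)
  note e' = cr[unfolded in_Hom_iff] aH[unfolded in_Hom_iff]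
  have aph: "ap p1 ?h (ap p1 ?r u) = ap p1 (b20 W' W eW) (ap p1 (Sw W W') u)" if u: "pos p1 [W, W'] u" for u
  proof -
    let ?u = "start [W, W']"
    have "ap 0 (Tn (Lf W) (Lf W'), Ut, h \<cdot> (\<rho> \<otimes>\<^sub>a Id C W')) ?u = ap 0 ?h (ap 0 ?r ?u)"
      using o by (simp add: ap_Comp[of _ "Tn (Lf Y) (Lf W')"] ap_Tar)
    moreover have "ap 0 (b20 W W' (twist C W' W eW)) ?u = ap 0 (b20 W' W eW) (ap 0 (Sw W W') ?u)"
      using o eW by (intro ap_twist) (simp_all add: pos_def)
    ultimately show ?thesis
      using pos_transfer[OF u, of "[(0, ?r), (0, ?h)]" "[(0, Sw W W'), (0, b20 W' W eW)]"] h(2) o by simp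
  qed
  let ?w = "ap 0 ?E ?s"
  have w: "vs ?w" "fst ?w = [B, W']" using o by simp_all
  let ?v = "ap 0 ?at ?s"
  have v: "vs ?v" "fst ?v = [A', A, A']" using o by simp_all
  have "ap 0 (b11 A' A' (contract_right C A' Y W' h \<cdot> ((D \<otimes>\<^sub>a Id C W') \<cdot> E))) ?s
     = ap 0 (?t, Lf A', contract_right C A' Y W' h) (ap 0 ?D ?w)"
    using o e' by (simp add: ap_Comp[of _ ?t] ap_Comp[of _ ?x] ap_Tar)
  also have "\<dots> = ap p1 ?h (ap 0 ?D ?w)"
    using o h by (intro ap_contract_right) (simp_all add: pos_def)
  also have "ap 0 ?D ?w = ap p1 ?r (ap p1 ?n (ap p1 (Sw A B) (ap 0 ?at ?w)))"
    using o w by (simp add: D pos_def ap_Comp[of _ "Lf W"])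
  also have "ap p1 ?n (ap p1 (Sw A B) (ap 0 ?at ?w)) = sscl q (ap p1 ?m (ap 0 ?at ?w))"
    using o w by (intro ap_sign_flip) (simp add: pos_def)
  also have "ap p1 ?h (ap p1 ?r (sscl q (ap p1 ?m (ap 0 ?at ?w)))) = sscl q (ap p1 ?h (ap p1 ?r (ap p1 ?m (ap 0 ?at ?w))))"
    using o w by (simp add: ap_sscl)
  also have "ap p1 ?h (ap p1 ?r (ap p1 ?m (ap 0 ?at ?w))) = ap p1 (b20 W' W eW) (ap p1 (Sw W W') (ap p1 ?m (ap 0 ?at ?w)))"
    using o w by (intro aph) (simp add: pos_def)
  also have "ap 0 ?at ?w = ap p2 ?E ?v"
    using o by (simp add: comm[of ?at ?E _ 0 0])
  also have "\<dots> = ap p3 ?m' (ap p3 (Sw B' A') (ap p2 ?c ?v))"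
    using o v by (simp add: E pos_def)
  also have "ap p1 (Sw W W') (ap p1 ?m (ap p3 ?m' (ap p3 (Sw B' A') (ap p2 ?c ?v))))
     = ap p1 ?m' (ap p2 (Sw W B') (ap p2 ?m (ap p3 ?c (ap p1 (Sw A A') ?v))))"
    using o v by (intro cross) (simp_all add: pos_def)
  also have "ap p1 (b20 W' W eW) \<dots> = ap 0 (Ut, Ut, z) (ap p1 (b20 A' A eA) (ap p1 (Sw A A') ?v))"
    using o v by (intro key_pos) (simp_all add: pos_def)
  also have "ap p1 (b20 A' A eA) (ap p1 (Sw A A') ?v) = ap p1 (b20 A A' (twist C A' A eA)) ?v"
    using o v eA by (intro ap_twist[symmetric]) (simp_all add: pos_def)
  also have "\<dots> = ?s"
    using o perf_twist[OF pA] by (intro zigzag1) (simp_all add: pos_def)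
  also have "ap 0 (Ut, Ut, z) ?s = ap 0 (b11 A' A' (act C z (Id C A'))) ?s"
    using o z by (subst ap_act) simp_all
  also have "sscl q \<dots> = ap 0 (b11 A' A' (Scl C q (act C z (Id C A')))) ?s"
    using o e' by (intro ap_Scl[symmetric]) simp_all
  finally show ?thesis using o e' by (intro faithful[of "Lf A'" "Lf A'"]) simp_all
qed

text \<open>For (4). The sign occurs twice, once from the multiplication \<open>n\<close> that joins
  the first factors and once from \<open>n'\<close> inside \<open>E\<close>, so it disappears. What
  stays unpaired is the product \<open>m'\<close> of the two arguments.\<close>

lemma mult13_trace:
  assumes Y: "Y \<in> Obj C" and \<rho>: "\<rho> \<in> Hom C W' Y" and h: "h \<in> Hom C (W \<otimes>\<^sub>o Y) \<bbbI>" "h \<cdot> (Id C W \<otimes>\<^sub>a \<rho>) = twist C W' W eW"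
    and D: "D \<in> Hom C A' (B \<otimes>\<^sub>o Y)"
      "\<And>k s. pos k [A'] s \<Longrightarrow> ap k (b12 A' B Y D) s = ap (Suc k) (b21 A' B' Y (\<rho> \<cdot> m')) (ap (Suc k) (Sw B' A') (ap k (b02 B B' cB) s))"
    and E: "E \<in> Hom C B' (A \<otimes>\<^sub>o Y)"
      "\<And>k s. pos k [B'] s \<Longrightarrow> ap k (b12 B' A Y E) s = ap (Suc k) (b21 B' A' Y (\<rho> \<cdot> n')) (ap (Suc k) (Sw A' B') (ap k (b02 A A' cA) s))"
  shows "(contract_left C W Y Y h \<cdot> (n \<otimes>\<^sub>a Id C (Y \<otimes>\<^sub>o Y)) \<cdot> interchange C B Y A Y) \<cdot> (D \<otimes>\<^sub>a E) = act C z (\<rho> \<cdot> m')"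
proof -
  note o = key_o n[unfolded in_Hom_iff] perfD(4)[OF pA, unfolded in_Hom_iff] Y \<rho>[unfolded in_Hom_iff] h(1)[unfolded in_Hom_iff] D(1)[unfolded in_Hom_iff] E(1)[unfolded in_Hom_iff]
  let ?m = "b21 A B W m" and ?m' = "b21 A' B' W' m'" and ?c = "b02 B B' cB" and ?r = "b11 W' Y \<rho>" and ?n = "b21 B A W n" and ?n' = "b21 B' A' W' n'"
  let ?D = "b12 A' B Y D" and ?E = "b12 B' A Y E" and ?a = "b02 A A' cA" and ?h = "b20 W Y h" and ?e = "b20 A' A eA"
  let ?t = "Tn (Tn (Lf B) (Lf Y)) (Tn (Lf A) (Lf Y))" and ?x = "Tn (Tn (Lf B) (Lf A)) (Tn (Lf Y) (Lf Y))" and ?y = "Tn (Lf W) (Tn (Lf Y) (Lf Y))"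
  let ?i = "Tn (Lf A') (Lf B')"
  have cl: "contract_left C W Y Y h \<in> Hom C (W \<otimes>\<^sub>o (Y \<otimes>\<^sub>o Y)) Y" using o h by (intro contract_left_Hom) simp_all
  have ic: "interchange C B Y A Y \<in> Hom C ((B \<otimes>\<^sub>o Y) \<otimes>\<^sub>o (A \<otimes>\<^sub>o Y)) ((B \<otimes>\<^sub>o A) \<otimes>\<^sub>o (Y \<otimes>\<^sub>o Y))" using o by (intro interchange_Hom) simp_all
  have aH: "act C z (\<rho> \<cdot> m') \<in> Hom C (A' \<otimes>\<^sub>o B') Y" using o by (simp add: act_def in_Hom_iff)
  note e' = cl[unfolded in_Hom_iff] ic[unfolded in_Hom_iff] aH[unfolded in_Hom_iff]
  have aph: "ap 0 ?h (ap p1 ?r u) = ap 0 (b20 W' W eW) (ap 0 (Sw W W') u)" if u: "vs u" "fst u = W # W' # xs" for u xs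
  proof -
    have "ap 0 (Tn (Lf W) (Lf W'), Ut, h \<cdot> (Id C W \<otimes>\<^sub>a \<rho>)) u = ap 0 ?h (ap p1 ?r u)"
      using o u by (simp add: ap_Comp[of _ "Tn (Lf W) (Lf Y)"] ap_Tar)
    then show ?thesis unfolding h(2) using ap_twist[OF _ eW, of 0 u] u by (simp add: pos_def)
  qed
  \<comment> \<open>\<open>E\<close> is opened only afterwards: this part, with a free strand A in
    its place, already is the pairing times the scalar. The Casimir element in \<open>E\<close> then
    straightens against that pairing.\<close>
  have st: "ap 0 ?h (ap 0 ?n (ap p1 (Sw Y A) (ap 0 ?D (start [A', A])))) = sscl q (ap 0 (Ut, Ut, z) (ap 0 ?e (start [A', A])))"
  proof -
    let ?s = "start [A', A]"
    let ?w = "ap p1 (Sw B' A') (ap 0 ?c ?s)"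
    have w: "vs ?w" "fst ?w = [B, A', B', A]" using o by simp_all
    let ?v = "ap p1 (Sw A' A) (ap p2 (Sw B' A) ?w)"
    have v: "vs ?v" "fst ?v = [B, A, A', B']" using o w by simp_all
    have "ap 0 ?D ?s = ap p1 ?r (ap p1 ?m' ?w)" using o w by (simp add: D pos_def ap_Comp[of _ "Lf W'"])
    then have "ap p1 (Sw Y A) (ap 0 ?D ?s) = ap p1 (Sw Y A) (ap p1 ?r (ap p1 ?m' ?w))" by simp
    also have "\<dots> = ap p2 ?r (ap p1 (Sw W' A) (ap p1 ?m' ?w))"
      using o w \<rho> by (intro slideL_11) (simp_all add: pos_def)
    also have "ap p1 (Sw W' A) (ap p1 ?m' ?w) = ap p2 ?m' ?v"
      using o w m' by (intro slideL_21) (simp_all add: pos_def)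
    finally have 1: "ap p1 (Sw Y A) (ap 0 ?D ?s) = ap p2 ?r (ap p2 ?m' ?v)" .
    have "?w = ap 0 (Sw A' B) (ap p1 ?c ?s)"
      using o perfD(4)[OF pB] by (intro coev_Sw_left) (simp_all add: pos_def)
    then have "?v = ap p1 (Sw A' A) (ap p2 (Sw B' A) (ap 0 (Sw A' B) (ap p1 ?c ?s)))" by simp
    also have "ap p2 (Sw B' A) (ap 0 (Sw A' B) (ap p1 ?c ?s)) = ap 0 (Sw A' B) (ap p2 (Sw B' A) (ap p1 ?c ?s))"
      using o by (simp add: comm[of "Sw A' B" "Sw B' A" _ 0 p2])
    also have "ap p2 (Sw B' A) (ap p1 ?c ?s) = ap p1 (Sw A B) (ap p2 ?c ?s)"
      using o perfD(4)[OF pB] by (intro coev_Sw_left) (simp_all add: pos_def)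
    also have "ap p1 (Sw A' A) (ap 0 (Sw A' B) (ap p1 (Sw A B) (ap p2 ?c ?s)))
       = ap 0 (Sw A B) (ap p1 (Sw A' B) (ap 0 (Sw A' A) (ap p2 ?c ?s)))"
      using o by (intro yang_baxter) (simp_all add: pos_def)
    also have "ap 0 (Sw A' A) (ap p2 ?c ?s) = ap p2 ?c (ap 0 (Sw A' A) ?s)"
      using o by (simp add: comm[of "Sw A' A" ?c _ 0 p2])
    also have "ap p1 (Sw A' B) (ap p2 ?c (ap 0 (Sw A' A) ?s)) = ap p2 (Sw B' A') (ap p1 ?c (ap 0 (Sw A' A) ?s))"
      using o perfD(4)[OF pB] by (intro coev_Sw_left[symmetric]) (simp_all add: pos_def)
    finally have 2: "?v = ap 0 (Sw A B) (ap p2 (Sw B' A') (ap p1 ?c (ap 0 (Sw A' A) ?s)))" .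
    let ?z = "ap p2 (Sw B' A') (ap p1 ?c (ap 0 (Sw A' A) ?s))"
    have z': "vs ?z" "fst ?z = [A, B, A', B']" using o by simp_all
    have "ap 0 ?h (ap 0 ?n (ap p2 ?r (ap p2 ?m' ?v))) = ap 0 ?h (ap p1 ?r (ap p1 ?m' (ap 0 ?n ?v)))"
      using o v by (simp add: comm[of ?n ?r _ 0 p2] comm[of ?n ?m' _ 0 p2])
    also have "ap 0 ?n ?v = sscl q (ap 0 ?m ?z)"
      unfolding 2 using o z' by (intro ap_sign_flip) (simp add: pos_def)
    also have "ap 0 ?h (ap p1 ?r (ap p1 ?m' (sscl q (ap 0 ?m ?z)))) = sscl q (ap 0 ?h (ap p1 ?r (ap p1 ?m' (ap 0 ?m ?z))))"
      using o z' by (simp add: ap_sscl)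
    also have "ap 0 ?h (ap p1 ?r (ap p1 ?m' (ap 0 ?m ?z))) = ap 0 (b20 W' W eW) (ap 0 (Sw W W') (ap p1 ?m' (ap 0 ?m ?z)))"
      using o z' by (intro aph[of _ "[]"]) simp_all
    also have "ap p1 ?m' (ap 0 ?m ?z) = ap 0 ?m (ap p2 ?m' ?z)"
      using o z' by (simp add: comm[of ?m ?m' _ 0 p2])
    also have "ap 0 (Sw W W') (ap 0 ?m (ap p2 ?m' ?z))
       = ap 0 ?m' (ap p1 (Sw W B') (ap p1 ?m (ap p2 ?c (ap 0 (Sw A A') (ap 0 (Sw A' A) ?s)))))"
      using o by (intro cross) (simp_all add: pos_def)
    also have "ap 0 (Sw A A') (ap 0 (Sw A' A) ?s) = ?s" using o by (simp add: Sw_Sw pos_def)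
    also have "ap 0 (b20 W' W eW) (ap 0 ?m' (ap p1 (Sw W B') (ap p1 ?m (ap p2 ?c ?s)))) = ap 0 (Ut, Ut, z) (ap 0 ?e ?s)"
      using o by (intro key_pos) (simp_all add: pos_def)
    finally show ?thesis unfolding 1 .
  qed
  have fold: "ap 0 ?h (ap 0 ?n (ap p1 (Sw Y A) (ap 0 ?D u))) = sscl q (ap 0 (Ut, Ut, z) (ap 0 ?e u))"
    if u: "pos 0 [A', A] u" for u
    using pos_transfer_sscl[OF u, of "[(0, ?D), (p1, Sw Y A), (0, ?n), (0, ?h)]" q "[(0, ?e), (0, (Ut, Ut, z))]"] st o by simp
  let ?s = "start [A', B']"
  let ?u = "ap p1 ?E ?s"
  have u: "vs ?u" "fst ?u = [A', A, Y]" using o by simp_all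
  let ?g = "ap p1 ?a ?s"
  have g: "vs ?g" "fst ?g = [A', A, A', B']" using o by simp_all
  have zs: "vs (ap 0 (Ut, Ut, z) ?s)" "fst (ap 0 (Ut, Ut, z) ?s) = [A', B']" using o by simp_all
  define F where "F = contract_left C W Y Y h \<cdot> (n \<otimes>\<^sub>a Id C (Y \<otimes>\<^sub>o Y)) \<cdot> interchange C B Y A Y"
  have F: "F \<in> Arr C" "Dom C F = (B \<otimes>\<^sub>o Y) \<otimes>\<^sub>o (A \<otimes>\<^sub>o Y)" "Cod C F = Y" using o e' by (simp_all add: F_def)
  have "ap 0 (?i, Lf Y, F \<cdot> (D \<otimes>\<^sub>a E)) ?s = ap 0 (?t, Lf Y, F) (ap 0 ?D ?u)"
    using o F by (simp add: ap_Comp[of _ ?t] ap_Tar)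
  also have "\<dots> = ap 0 (?y, Lf Y, contract_left C W Y Y h) (ap 0 (?x, ?y, n \<otimes>\<^sub>a Id C (Y \<otimes>\<^sub>o Y)) (ap 0 (?t, ?x, interchange C B Y A Y) (ap 0 ?D ?u)))"
    unfolding F_def using o u e' by (simp add: ap_Comp[of _ ?y] ap_Comp[of _ ?x])
  also have "ap 0 (?t, ?x, interchange C B Y A Y) (ap 0 ?D ?u) = ap p1 (Sw Y A) (ap 0 ?D ?u)"
    using o u by (subst ap_interchange) (simp_all add: pos_def)
  also have "ap 0 (?x, ?y, n \<otimes>\<^sub>a Id C (Y \<otimes>\<^sub>o Y)) \<dots> = ap 0 ?n (ap p1 (Sw Y A) (ap 0 ?D ?u))"
    using o u by (subst ap_Tar) simp_all
  also have "ap 0 (?y, Lf Y, contract_left C W Y Y h) \<dots> = ap 0 ?h (ap 0 ?n (ap p1 (Sw Y A) (ap 0 ?D ?u)))"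
    using o u h by (intro ap_contract_left) (simp_all add: pos_def)
  also have "\<dots> = sscl q (ap 0 (Ut, Ut, z) (ap 0 ?e ?u))" using o u by (intro fold) (simp add: pos_def)
  also have "?u = ap p2 ?r (ap p2 ?n' (ap p2 (Sw A' B') ?g))"
    using o g by (simp add: E pos_def ap_Comp[of _ "Lf W'"])
  also have "ap 0 ?e \<dots> = ap 0 ?r (ap 0 ?n' (ap 0 (Sw A' B') (ap 0 ?e ?g)))"
    using o g by (simp add: comm[of ?e ?r _ 0 p2] comm[of ?e ?n' _ 0 p2]
      comm[of ?e "Sw A' B'" _ 0 p2])
  also have "ap 0 ?e ?g = ?s" using o pA by (intro zigzag2) (simp_all add: pos_def)
  also have "ap 0 ?n' (ap 0 (Sw A' B') ?s) = sscl q (ap 0 ?m' ?s)"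
    using o by (intro ap_sign_flip) (simp add: pos_def)
  also have "sscl q (ap 0 (Ut, Ut, z) (ap 0 ?r (sscl q (ap 0 ?m' ?s)))) = ap 0 (Ut, Ut, z) (ap 0 ?r (ap 0 ?m' ?s))"
    using o q by (simp add: ap_sscl)
  also have "\<dots> = ap 0 (?i, Lf Y, act C z (\<rho> \<cdot> m')) ?s"
    using o z by (subst ap_act) (simp_all add: ap_Comp[of _ "Lf W'"])
  finally show ?thesis unfolding F_def[symmetric] using o e' F by (intro faithful[of ?i "Lf Y"]) simp_all
qed

end

end

end

text \<open>\<open>wrefl\<close> takes \<open>adjunct\<close> with respect to alternating pairings
  instead of \<open>Evl\<close>. For any perfect pairing the description in \<open>adjunct\<close>
  is met by exactly one morphism, obtained by creating a Casimir element and applying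
  \<open>f\<close>.\<close>

lemma perf_adjunct:
  assumes p: "perf X X' e c" and f: "f \<in> Hom C (Z \<otimes>\<^sub>o X) \<bbbI>" and Z: "Z \<in> Obj C"
  shows "adjunct C X' X e Z f \<in> Hom C Z X'" "e \<cdot> (adjunct C X' X e Z f \<otimes>\<^sub>a Id C X) = f"
proof -
  note o = perfD(1,2)[OF p] Z perfD(3,4)[OF p, unfolded in_Hom_iff] f[unfolded in_Hom_iff]
  let ?e = "b20 X' X e" and ?c = "b02 X X' c" and ?f = "b20 Z X f" and ?s = "start [Z]"
  define h where "h = Lun C X' \<cdot> ((f \<otimes>\<^sub>a Id C X') \<cdot> (Inv C (Asc C Z X X') \<cdot> ((Id C Z \<otimes>\<^sub>a c) \<cdot> Inv C (Run C Z))))"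
  let ?z = "Lf Z" and ?x = "Lf X" and ?y = "Lf X'"
  have h: "h \<in> Arr C" "Dom C h = Z" "Cod C h = X'" unfolding h_def using o by simp_all
  have h_eq: "ap 0 (b11 Z X' h) s = ap 0 ?f (ap p1 ?c s)" if s: "vs s" "fst s = Z # xs" for s xs
  proof -
    let ?w = "ap p1 ?c s"
    have w: "vs ?w" "fst ?w = Z # X # X' # xs" using o s by simp_all
    have 1: "ap 0 (Tn ?z Ut, Tn ?z (Tn ?x ?y), Id C Z \<otimes>\<^sub>a c) s = ?w"
      using o s w by (subst ap_Tar) simp_all
    have 2: "ap 0 (Tn ?z (Tn ?x ?y), Tn (Tn ?z ?x) ?y, Inv C (Asc C Z X X')) ?w = ?w"
      using o w by (intro ap_Asc(2)) simp_all
    have 3: "ap 0 (?z, Tn ?z Ut, Inv C (Run C Z)) s = s" using o s by simp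
    have 4: "ap 0 (Tn (Tn ?z ?x) ?y, Tn Ut ?y, f \<otimes>\<^sub>a Id C X') ?w = ap 0 ?f ?w"
      using o w by (subst ap_Tar) simp_all
    have 5: "ap 0 (Tn Ut ?y, ?y, Lun C X') (ap 0 ?f ?w) = ap 0 ?f ?w"
      using o w by simp
    show ?thesis
      unfolding h_def using o s w by (simp add: ap_Comp[of _ "Tn Ut ?y"] ap_Comp[of _ "Tn (Tn ?z ?x) ?y"] ap_Comp[of _ "Tn ?z (Tn ?x ?y)"]
        ap_Comp[of _ "Tn ?z Ut"] 1 2 3 4 5 del: ap_Run ap_Asc ap_Lun)
  qed
  have ex: "e \<cdot> (h \<otimes>\<^sub>a Id C X) = f"
  proof (rule faithful[of "Tn ?z ?x" Ut])
    let ?t = "start [Z, X]"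
    have "ap 0 (Tn ?z ?x, Ut, e \<cdot> (h \<otimes>\<^sub>a Id C X)) ?t = ap 0 ?e (ap 0 (b11 Z X' h) ?t)"
      using o h by (simp add: ap_Comp[of _ "Tn ?y ?x"] ap_Tar)
    also have "ap 0 (b11 Z X' h) ?t = ap 0 ?f (ap p1 ?c ?t)"
      using o by (intro h_eq) simp_all
    also have "ap 0 ?e (ap 0 ?f (ap p1 ?c ?t)) = ap 0 ?f (ap p2 ?e (ap p1 ?c ?t))"
      using o by (simp add: comm[of ?f ?e _ 0 p2])
    also have "ap p2 ?e (ap p1 ?c ?t) = ?t" using o p by (intro zigzag1) (simp_all add: pos_def)
    finally show "ap 0 (Tn ?z ?x, Ut, e \<cdot> (h \<otimes>\<^sub>a Id C X)) (start (lv (Tn ?z ?x))) = ap 0 (Tn ?z ?x, Ut, f) (start (lv (Tn ?z ?x)))" by simp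
  qed (use o h in simp_all)
  have uniq: "g = h" if g: "g \<in> Hom C Z X'" "e \<cdot> (g \<otimes>\<^sub>a Id C X) = f" for g
  proof (rule faithful[of ?z ?y])
    note g' = g(1)[unfolded in_Hom_iff]
    let ?g = "b11 Z X' g" and ?w = "ap p1 ?c ?s"
    have w: "vs ?w" "fst ?w = [Z, X, X']" using o by simp_all
    have "ap 0 ?g ?s = ap 0 ?e (ap p1 ?c (ap 0 ?g ?s))"
      using o g' p by (subst zigzag2) (simp_all add: pos_def)
    also have "ap p1 ?c (ap 0 ?g ?s) = ap 0 ?g ?w"
      using o g' by (simp add: comm[of ?g ?c _ 0 p1])
    also have "ap 0 ?e (ap 0 ?g ?w) = ap 0 (Tn ?z ?x, Ut, e \<cdot> (g \<otimes>\<^sub>a Id C X)) ?w"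
      using o g' w by (simp add: ap_Comp[of _ "Tn ?y ?x"] ap_Tar)
    also have "\<dots> = ap 0 (b11 Z X' h) ?s" unfolding g(2) using o by (intro h_eq[symmetric]) simp_all
    finally show "ap 0 ?g (start (lv ?z)) = ap 0 (b11 Z X' h) (start (lv ?z))" by simp
  qed (use o h g in \<open>simp_all add: in_Hom_iff\<close>)
  have "adjunct C X' X e Z f = h"
    unfolding adjunct_def
  proof (rule the_equality)
    show "h \<in> Hom C Z X' \<and> e \<cdot> (h \<otimes>\<^sub>a Id C X) = f" using h ex by (simp add: in_Hom_iff)
  qed (use uniq in blast)
  then show "adjunct C X' X e Z f \<in> Hom C Z X'" "e \<cdot> (adjunct C X' X e Z f \<otimes>\<^sub>a Id C X) = f"
    using h ex by (simp_all add: in_Hom_iff)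
qed

end

section \<open>Poincare morphisms as bent exterior products\<close>

context rigid_pseudo_abelian_tensor_cat
begin

lemma ev_alt_tw_eq_alt:
  assumes X: "X \<in> Obj C"
  shows "ev_alt_tw C n X = alt X (dual C X) (\<lambda>n. twist C (tpow C n (dual C X)) (tpow C n X) (ev_pow C n X)) n"
  using X Sym_nat[of "winj C n X" "winj C n (dual C X)"]
  by (simp add: ev_alt_tw_def ev_alt_def alt_def twist_def)

context
  fixes V :: 'a
  assumes V: "V \<in> Obj C"
begin

abbreviation wc :: "nat \<Rightarrow> 'b" where "wc n \<equiv> cw V (coev C V) n"

lemma perf_wc: "perf (wedge C n V) (wedge C n (dual C V)) (ev_alt C n V) (wc n)"
  by (rule perf_ev_alt[OF V perf_coev[OF V]])

lemma wrefl:
  "wrefl C g V \<in> Hom C (wedge C g V) (wedge C g (dual C (dual C V)))"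
  "ev_alt C g (dual C V) \<cdot> (wrefl C g V \<otimes>\<^sub>a Id C (wedge C g (dual C V))) = ev_alt_tw C g V"
proof -
  have D: "dual C V \<in> Obj C" using V by simp
  have t: "twist C (wedge C g (dual C V)) (wedge C g V) (ev_alt C g V) \<in> Hom C (wedge C g V \<otimes>\<^sub>o wedge C g (dual C V)) \<bbbI>"
    using V ev_alt_Hom[OF V] by (intro twist_Hom) simp_all
  show "wrefl C g V \<in> Hom C (wedge C g V) (wedge C g (dual C (dual C V)))"
    "ev_alt C g (dual C V) \<cdot> (wrefl C g V \<otimes>\<^sub>a Id C (wedge C g (dual C V))) = ev_alt_tw C g V"
    using V perf_adjunct[OF perf_ev_alt[OF D perf_coev[OF D], of g] t] by (simp_all add: wrefl_def reflexivity_def ev_alt_tw_def)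
qed

text \<open>\<open>alpha_adjunct\<close> with the contraction as \<open>K\<close> and the exterior
  product on the dual as its transpose \<open>M\<close>, by
  \<open>wcontract_adjoint\<close>.\<close>

lemma Dlow:
  "Dlow C V i (i + j) \<in> Hom C (wedge C i (dual C V)) (wedge C j V \<otimes>\<^sub>o wedge C (i + j) (dual C V))"
  "pos k [wedge C i (dual C V)] s \<Longrightarrow>
     ap k (b12 (wedge C i (dual C V)) (wedge C j V) (wedge C (i + j) (dual C V)) (Dlow C V i (i + j))) s
   = ap (Suc k) (wm (dual C V) i j) (ap (Suc k) (Sw (wedge C j (dual C V)) (wedge C i (dual C V)))
       (ap k (b02 (wedge C j V) (wedge C j (dual C V)) (wc j)) s))"
proof -
  have eq: "Dlow C V i (i + j) = Inv C (alpha C (wedge C (i + j) V) (wedge C (i + j) (dual C V)) (ev_alt C (i + j) V) (wedge C j V)) \<cdot>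
     adjunct C (Ihom C (wedge C (i + j) V) (wedge C j V)) (wedge C (i + j) V) (Evl C (wedge C (i + j) V) (wedge C j V)) (wedge C i (dual C V))
       (wcontract C (dual C V) V (ev_pow C i V) i (i + j))"
    by (simp add: Dlow_def iota_star_def Let_def)
  have D: "dual C V \<in> Obj C" using V by simp
  note a = alpha_adjunct[OF perf_wc[of "i + j"] perf_wc[of j] _ wcontract_Hom[OF D V ev_pow_Hom[OF V]] _
     wcontract_adjoint[OF pairing_ev_pow[OF V], of j i, folded ev_alt_eq_alt]]
  show "Dlow C V i (i + j) \<in> Hom C (wedge C i (dual C V)) (wedge C j V \<otimes>\<^sub>o wedge C (i + j) (dual C V))"
    unfolding eq using V by (intro a(1)) (simp_all add: in_Hom_iff)
  show "ap k (b12 (wedge C i (dual C V)) (wedge C j V) (wedge C (i + j) (dual C V)) (Dlow C V i (i + j))) s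
   = ap (Suc k) (wm (dual C V) i j) (ap (Suc k) (Sw (wedge C j (dual C V)) (wedge C i (dual C V)))
       (ap k (b02 (wedge C j V) (wedge C j (dual C V)) (wc j)) s))" if "pos k [wedge C i (dual C V)] s"
    unfolding eq using V that by (intro a(2)) (simp_all add: in_Hom_iff)
qed

text \<open>The contraction is now transposed with respect to twisted pairings, but the target pairs
  the double dual with the dual. Evaluation after the reflexivity map is the twisted pairing, so the
  transpose is the exterior product followed by \<open>wrefl\<close>.\<close>

lemma Dup:
  "Dup C V i (i + j) \<in> Hom C (wedge C i V) (wedge C j (dual C V) \<otimes>\<^sub>o wedge C (i + j) (dual C (dual C V)))"
  "pos k [wedge C i V] s \<Longrightarrow>
     ap k (b12 (wedge C i V) (wedge C j (dual C V)) (wedge C (i + j) (dual C (dual C V))) (Dup C V i (i + j))) s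
   = ap (Suc k) (b21 (wedge C i V) (wedge C j V) (wedge C (i + j) (dual C (dual C V))) (wrefl C (i + j) V \<cdot> wmult C V i j))
       (ap (Suc k) (Sw (wedge C j V) (wedge C i V))
       (ap k (b02 (wedge C j (dual C V)) (wedge C j V) (Sym C (wedge C j V) (wedge C j (dual C V)) \<cdot> wc j)) s))"
proof -
  let ?D = "dual C V" and ?A = "wedge C i V" and ?B = "wedge C j V" and ?B' = "wedge C j (dual C V)" and ?g = "i + j"
  let ?W = "wedge C ?g V" and ?W' = "wedge C ?g (dual C V)" and ?W'' = "wedge C ?g (dual C (dual C V))"
  let ?K = "wcontract C V (dual C V) (ev_pow_tw C i V) i (i + j)" and ?r = "wrefl C ?g V" and ?M = "wrefl C (i + j) V \<cdot> wmult C V i j"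
  have eq: "Dup C V i ?g = Inv C (alpha C ?W' ?W'' (ev_alt C ?g ?D) ?B') \<cdot> adjunct C (Ihom C ?W' ?B') ?W' (Evl C ?W' ?B') ?A ?K"
    by (simp add: Dup_def iota_def Let_def)
  have D: "dual C V \<in> Obj C" using V by simp
  note P = pairing_twist[OF pairing_ev_pow[OF V]]
  note r = wrefl[of ?g, unfolded in_Hom_iff]
  have M: "?M \<in> Hom C (?A \<otimes>\<^sub>o ?B) ?W''" using V r by (simp add: in_Hom_iff)
  let ?s = "start [?B, ?A, ?W']"
  let ?u = "ap 0 (wm V i j) (ap 0 (Sw ?B ?A) ?s)"
  have u: "vs ?u" "fst ?u = [?W, ?W']" using V by simp_all
  have tw: "twist C ?B' ?B (ev_alt C j V) = ev_alt_tw C j V" by (simp add: ev_alt_tw_def)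
  have K: "?K \<in> Hom C (?A \<otimes>\<^sub>o ?W') ?B'"
    using V by (intro wcontract_Hom ev_pow_tw_Hom) simp_all
  have "ap 0 (b20 ?B ?B' (ev_alt_tw C j V)) (ap p1 (b21 ?A ?W' ?B' ?K) ?s) = ap 0 (b20 ?W ?W' (ev_alt_tw C ?g V)) ?u"
    using wcontract_adjoint[OF P, of j i] V by (simp add: ev_alt_tw_eq_alt ev_pow_tw_def)
  also have "\<dots> = ap 0 (Tn (Lf ?W) (Lf ?W'), Ut, ev_alt C ?g ?D \<cdot> (?r \<otimes>\<^sub>a Id C ?W')) ?u" using r(2) by simp
  also have "\<dots> = ap 0 (ea ?g ?D) (ap 0 (b11 ?W ?W'' ?r) ?u)"
    using V u r(1) by (simp add: ap_Comp[of _ "Tn (Lf ?W'') (Lf ?W')"] ap_Tar)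
  also have "ap 0 (b11 ?W ?W'' ?r) ?u = ap 0 (b21 ?A ?B ?W'' ?M) (ap 0 (Sw ?B ?A) ?s)"
    using V r(1) by (simp add: ap_Comp[of _ "Lf ?W"])
  finally have adj: "ap 0 (b20 ?B ?B' (twist C ?B' ?B (ev_alt C j V))) (ap p1 (b21 ?A ?W' ?B' ?K) ?s)
     = ap 0 (ea ?g ?D) (ap 0 (b21 ?A ?B ?W'' ?M) (ap 0 (Sw ?B ?A) ?s))" unfolding tw .
  note a = alpha_adjunct[OF perf_ev_alt[OF D perf_coev[OF D], of ?g] perf_twist[OF perf_wc[of j]] _ K M adj, folded eq]
  have A: "?A \<in> Obj C" using V by simp
  show "Dup C V i ?g \<in> Hom C ?A (?B' \<otimes>\<^sub>o ?W'')" by (rule a(1)[OF A])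
  show "ap k (b12 ?A ?B' ?W'' (Dup C V i ?g)) s = ap (Suc k) (b21 ?A ?B ?W'' ?M) (ap (Suc k) (Sw ?B ?A)
       (ap k (b02 ?B' ?B (Sym C ?B ?B' \<cdot> wc j)) s))" if "pos k [?A] s"
    using that by (rule a(2)[OF A])
qed

end

section \<open>The identities for complementary degrees i and j\<close>

context
  fixes V :: 'a
  assumes V: "V \<in> Obj C"
begin

lemma rank_eq: "twist C (dual C V) V (ev C V) \<cdot> coev C V = rank C V"
  by (simp add: rank_def)

lemma rank_Hom: "rank C V \<in> Hom C \<bbbI> \<bbbI>"
  using rk_Hom[OF V perf_coev[OF V]] by (simp add: rank_def)

lemmas trace = trace_wedge[OF V perf_coev[OF V], unfolded rank_eq]

lemma wrefl_twist:
  "twist C (wedge C g (dual C (dual C V))) (wedge C g (dual C V)) (ev_alt C g (dual C V)) \<cdot> (Id C (wedge C g (dual C V)) \<otimes>\<^sub>a wrefl C g V)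
    = ev_alt C g V"
proof -
  let ?W = "wedge C g V" and ?W' = "wedge C g (dual C V)" and ?W'' = "wedge C g (dual C (dual C V))" and ?r = "wrefl C g V"
  note r = wrefl[OF V, of g] wrefl(1)[OF V, of g, unfolded in_Hom_iff]
  have "twist C ?W'' ?W' (ev_alt C g (dual C V)) \<cdot> (Id C ?W' \<otimes>\<^sub>a ?r) = (ev_alt C g (dual C V) \<cdot> (?r \<otimes>\<^sub>a Id C ?W')) \<cdot> Sym C ?W' ?W"
    using V r(3) Sym_nat[of "Id C ?W'" ?r] by (simp add: twist_def)
  then show ?thesis unfolding r(2) using V by (simp add: ev_alt_tw_def twist_def Sym_Sym)
qed

context
  fixes i j g :: nat and z :: 'b and q :: rat
  assumes g: "g = i + j" "g = j + i" and z: "z = sc (rank C V) i j" and q: "q = (- 1) ^ (i * j)"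
begin

lemma qq: "q * q = 1"
  by (simp add: q power_mult_distrib[symmetric])

lemma zH: "z \<in> Hom C \<bbbI> \<bbbI>"
  unfolding z by (rule sc_Hom[OF rank_Hom])

text \<open>\<open>g\<close> is kept as a name for both \<open>i + j\<close> and
  \<open>j + i\<close>, so that products and Poincare morphisms of either order have literally the
  same target.\<close>

lemma wmult_Hom:
  "X \<in> Obj C \<Longrightarrow> wmult C X i j \<in> Hom C (wedge C i X \<otimes>\<^sub>o wedge C j X) (wedge C g X)"
  "X \<in> Obj C \<Longrightarrow> wmult C X j i \<in> Hom C (wedge C j X \<otimes>\<^sub>o wedge C i X) (wedge C g X)"
  unfolding g(1) by (simp_all add: in_Hom_iff g(1)[unfolded g(2)])

lemma wmult_flip: "X \<in> Obj C \<Longrightarrow> wmult C X i j = Scl C q (wmult C X j i \<cdot> Sym C (wedge C i X) (wedge C j X))"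
  unfolding q by (rule wmult_commute)

lemmas Dlow_i = Dlow[OF V, where i = i and j = j, folded g(1)]
lemmas Dlow_j = Dlow[OF V, where i = j and j = i, folded g(2)]
lemmas Dup_i = Dup[OF V, where i = i and j = j, folded g(1)]
lemmas Dup_j = Dup[OF V, where i = j and j = i, folded g(2)]
lemmas trace_ij = trace[of i j, folded g(1) z]
lemmas wrefl_g = wrefl[OF V, of g, unfolded ev_alt_tw_def]

lemma V': "dual C V \<in> Obj C" "dual C (dual C V) \<in> Obj C"
  using V by simp_all

lemma wO [simp]: "wedge C n V \<in> Obj C" "wedge C n (dual C V) \<in> Obj C" "wedge C n (dual C (dual C V)) \<in> Obj C"
  using V by simp_all

lemma identity1:
  "ev1324 C (wedge C j (dual C V)) (wedge C g (dual C (dual C V))) (wedge C j V) (wedge C g (dual C V))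
         (ev_alt C j V) (ev_alt C g (dual C V)) \<cdot> (Dup C V i g \<otimes>\<^sub>a Dlow C V i g) = act C z (ev_alt_tw C i V)"
  unfolding ev_alt_tw_def
  by (rule ev1324_trace[OF wO(1,2,1,2) wmult_Hom(1)[OF V] wmult_Hom(1)[OF V'(1)] perf_wc[OF V] ev_alt_Hom[OF V] ev_alt_Hom[OF V] zH
     trace_ij wO(3) wrefl_g(1) ev_alt_Hom[OF V'(1)] wrefl_g(2) Dup_i(1) _ Dlow_i(1)])
    (rule Dup_i(2) Dlow_i(2), assumption)+

lemma identity2:
  "ev13 C (wedge C j V) (wedge C g (dual C V)) (wedge C j (dual C V)) (ev_alt_tw C j V) \<cdot> (Dlow C V i g \<otimes>\<^sub>a Id C (wedge C j (dual C V)))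
     = Scl C q (contract_left C (wedge C i (dual C V)) (wedge C i V) (wedge C g (dual C V)) (ev_alt C i V)
           \<cdot> (Id C (wedge C i (dual C V)) \<otimes>\<^sub>a Dlow C V j g))"
proof -
  have "ev13 C (wedge C j V) (wedge C g (dual C V)) (wedge C j (dual C V)) (ev_alt_tw C j V) \<cdot> (Dlow C V i g \<otimes>\<^sub>a Id C (wedge C j (dual C V)))
     = wmult C (dual C V) i j"
    unfolding ev_alt_tw_def
    by (rule ev13_transpose[OF perf_wc[OF V] wO(2,2) wmult_Hom(1)[OF V'(1)] Dlow_i(1)]) (rule Dlow_i(2))
  moreover have "contract_left C (wedge C i (dual C V)) (wedge C i V) (wedge C g (dual C V)) (ev_alt C i V)
           \<cdot> (Id C (wedge C i (dual C V)) \<otimes>\<^sub>a Dlow C V j g) = wmult C (dual C V) j i \<cdot> Sym C (wedge C i (dual C V)) (wedge C j (dual C V))"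
    by (rule contract_left_transpose[OF perf_wc[OF V] wO(2,2) wmult_Hom(2)[OF V'(1)] Dlow_j(1)]) (rule Dlow_j(2))
  ultimately show ?thesis using wmult_flip[OF V'(1)] by simp
qed

lemma refl_wmult_Hom:
  "wrefl C g V \<cdot> wmult C V i j \<in> Hom C (wedge C i V \<otimes>\<^sub>o wedge C j V) (wedge C g (dual C (dual C V)))"
  "wrefl C g V \<cdot> wmult C V j i \<in> Hom C (wedge C j V \<otimes>\<^sub>o wedge C i V) (wedge C g (dual C (dual C V)))"
  using wmult_Hom[OF V] wrefl_g(1) by (simp_all add: in_Hom_iff)

lemma twist_twist: "twist C (wedge C n V) (wedge C n (dual C V)) (twist C (wedge C n (dual C V)) (wedge C n V) (ev_alt C n V)) = ev_alt C n V"
  using V by (simp add: twist_def Sym_Sym)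

lemma identity2':
  "ev13 C (wedge C j (dual C V)) (wedge C g (dual C (dual C V))) (wedge C j V) (ev_alt C j V) \<cdot> (Dup C V i g \<otimes>\<^sub>a Id C (wedge C j V))
     = Scl C q (contract_left C (wedge C i V) (wedge C i (dual C V)) (wedge C g (dual C (dual C V))) (ev_alt_tw C i V)
           \<cdot> (Id C (wedge C i V) \<otimes>\<^sub>a Dup C V j g))"
proof -
  have "ev13 C (wedge C j (dual C V)) (wedge C g (dual C (dual C V))) (wedge C j V) (ev_alt C j V) \<cdot> (Dup C V i g \<otimes>\<^sub>a Id C (wedge C j V))
     = wrefl C g V \<cdot> wmult C V i j"
    by (rule ev13_transpose[OF perf_twist[OF perf_wc[OF V]] wO(1,3) refl_wmult_Hom(1) Dup_i(1), unfolded twist_twist]) (rule Dup_i(2))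
  moreover have "contract_left C (wedge C i V) (wedge C i (dual C V)) (wedge C g (dual C (dual C V))) (ev_alt_tw C i V)
           \<cdot> (Id C (wedge C i V) \<otimes>\<^sub>a Dup C V j g) = (wrefl C g V \<cdot> wmult C V j i) \<cdot> Sym C (wedge C i V) (wedge C j V)"
    unfolding ev_alt_tw_def
    by (rule contract_left_transpose[OF perf_twist[OF perf_wc[OF V]] wO(1,3) refl_wmult_Hom(2) Dup_j(1)]) (rule Dup_j(2))
  moreover have "wrefl C g V \<cdot> wmult C V i j = Scl C q ((wrefl C g V \<cdot> wmult C V j i) \<cdot> Sym C (wedge C i V) (wedge C j V))"
    unfolding wmult_flip[OF V] using wmult_Hom[OF V] wrefl_g(1) by (simp add: in_Hom_iff)
  ultimately show ?thesis by simp
qed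

lemma identity3:
  "contract_right C (wedge C i V) (wedge C g (dual C V)) (wedge C g (dual C (dual C V))) (ev_alt_tw C g (dual C V))
       \<cdot> (Dlow C V j g \<otimes>\<^sub>a Id C (wedge C g (dual C (dual C V)))) \<cdot> Dup C V i g = Scl C q (act C z (Id C (wedge C i V)))"
  unfolding ev_alt_tw_def
  by (rule contract_right_trace[OF wO(1,2,1,2) wmult_Hom(1)[OF V] wmult_Hom(1)[OF V'(1)] perf_wc[OF V] ev_alt_Hom[OF V] ev_alt_Hom[OF V] zH
     trace_ij wmult_Hom(2)[OF V] wmult_Hom(2)[OF V'(1)] perf_wc[OF V] wmult_flip[OF V] wmult_flip[OF V'(1)] qq
     wO(3) wrefl_g(1) ev_alt_Hom[OF V'(1)] wrefl_g(2) Dup_i(1) _ Dlow_j(1)])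
    (rule Dup_i(2) Dlow_j(2), assumption)+

text \<open>This computes an endomorphism in degree i. The identity in degree g - i follows by
  exchanging i and j, which turns r - i into r - j and the binomial coefficient of g over j into
  that of g over i.\<close>

lemma identity3':
  "contract_right C (wedge C i (dual C V)) (wedge C g (dual C (dual C V))) (wedge C g (dual C V)) (ev_alt C g (dual C V))
       \<cdot> (Dup C V j g \<otimes>\<^sub>a Id C (wedge C g (dual C V))) \<cdot> Dlow C V i g = Scl C q (act C z (Id C (wedge C i (dual C V))))"
  by (rule contract_right_trace'[OF wO(1,2,1,2) wmult_Hom(1)[OF V] wmult_Hom(1)[OF V'(1)] perf_wc[OF V] ev_alt_Hom[OF V] ev_alt_Hom[OF V] zH
     trace_ij wmult_Hom(2)[OF V] wmult_Hom(2)[OF V'(1)] perf_wc[OF V] wmult_flip[OF V] wmult_flip[OF V'(1)] qq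
     wO(3) wrefl_g(1) ev_alt_Hom[OF V'(1)] wrefl_g(2) Dup_j(1) _ Dlow_i(1)])
    (rule Dup_j(2) Dlow_i(2), assumption)+

lemma Id_wmult: "X \<in> Obj C \<Longrightarrow> Id C (wedge C g X) \<cdot> wmult C X i j = wmult C X i j"
  "X \<in> Obj C \<Longrightarrow> Id C (wedge C g X) \<cdot> wmult C X j i = wmult C X j i"
  using wmult_Hom[of X] by (simp_all add: in_Hom_iff)

text \<open>The lower Poincare morphisms already end in the exterior power of the dual, so
  \<open>\<rho>\<close> is the identity.\<close>

lemma identity4':
  "wmult13 C V j i \<cdot> (Dlow C V i g \<otimes>\<^sub>a Dlow C V j g) = act C z (wmult C (dual C V) i j)"
proof -
  have tw: "ev_alt_tw C g V \<in> Hom C (wedge C g V \<otimes>\<^sub>o wedge C g (dual C V)) \<bbbI>"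
    unfolding ev_alt_tw_def using ev_alt_Hom[OF V] by (intro twist_Hom) simp_all
  have t: "ev_alt_tw C g V \<cdot> (Id C (wedge C g V) \<otimes>\<^sub>a Id C (wedge C g (dual C V))) = twist C (wedge C g (dual C V)) (wedge C g V) (ev_alt C g V)"
    using V tw by (simp add: in_Hom_iff ev_alt_tw_def)
  have I: "Id C (wedge C g (dual C V)) \<in> Hom C (wedge C g (dual C V)) (wedge C g (dual C V))" by (rule Id_closed) simp
  show ?thesis
    unfolding wmult13_def Let_def g(2)[symmetric]
    by (rule mult13_trace[OF wO(1,2,1,2) wmult_Hom(1)[OF V] wmult_Hom(1)[OF V'(1)] perf_wc[OF V] ev_alt_Hom[OF V] ev_alt_Hom[OF V] zH
     trace_ij wmult_Hom(2)[OF V] wmult_Hom(2)[OF V'(1)] perf_wc[OF V] wmult_flip[OF V] wmult_flip[OF V'(1)] qq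
     wO(2) I tw t Dlow_i(1) _ Dlow_j(1), unfolded Id_wmult[OF V'(1)]])
     (rule Dlow_i(2) Dlow_j(2), assumption)+
qed

text \<open>The roles of V and its dual are exchanged, which calls for the twisted scalar identity
  \<open>key_twist\<close>; \<open>\<rho>\<close> is the reflexivity map, and twisting the pairing
  of V twice gives it back.\<close>

lemma identity4:
  "wmult13 C (dual C V) j i \<cdot> (Dup C V i g \<otimes>\<^sub>a Dup C V j g) = act C z (wrefl C g V \<cdot> wmult C V i j)"
proof -
  let ?W = "wedge C g V" and ?W' = "wedge C g (dual C V)" and ?W'' = "wedge C g (dual C (dual C V))"
  have tw: "ev_alt_tw C g (dual C V) \<in> Hom C (?W' \<otimes>\<^sub>o ?W'') \<bbbI>"
    unfolding ev_alt_tw_def using ev_alt_Hom[OF V'(1)] by (intro twist_Hom) simp_all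
  have tH: "twist C (wedge C n (dual C V)) (wedge C n V) (ev_alt C n V) \<in> Hom C (wedge C n V \<otimes>\<^sub>o wedge C n (dual C V)) \<bbbI>" for n
    using ev_alt_Hom[OF V] by (intro twist_Hom) simp_all
  have t: "ev_alt_tw C g (dual C V) \<cdot> (Id C ?W' \<otimes>\<^sub>a wrefl C g V) = twist C ?W ?W' (twist C ?W' ?W (ev_alt C g V))"
    unfolding twist_twist using wrefl_twist[of g] by (simp add: ev_alt_tw_def)
  note key = key_twist[OF wO(1,2,1,2) wmult_Hom(1)[OF V] wmult_Hom(1)[OF V'(1)] perf_wc[OF V] ev_alt_Hom[OF V] ev_alt_Hom[OF V] zH trace_ij]
  show ?thesis
    unfolding wmult13_def Let_def g(2)[symmetric]
    by (rule mult13_trace[OF wO(2,1,2,1) wmult_Hom(1)[OF V'(1)] wmult_Hom(1)[OF V] perf_twist[OF perf_wc[OF V]] tH tH zH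
     key wmult_Hom(2)[OF V'(1)] wmult_Hom(2)[OF V] perf_twist[OF perf_wc[OF V]] wmult_flip[OF V'(1)] wmult_flip[OF V] qq
     wO(3) wrefl_g(1) tw t Dup_i(1) _ Dup_j(1)])
     (rule Dup_i(2) Dup_j(2), assumption)+
qed

lemma Scl_act:
  assumes "f \<in> Arr C"
  shows "Scl C p (act C z f) = Scl C (p * inverse (of_nat (g choose j))) (act C (ebinom C (shift C (rank C V) (- of_nat i)) j) f)"
proof -
  have "ebinom C x k \<in> Hom C \<bbbI> \<bbbI>" if "x \<in> Hom C \<bbbI> \<bbbI>" for x k
  proof -
    have "falling C x k \<in> Hom C \<bbbI> \<bbbI>"
      by (induction k) (use that shift_Hom in \<open>auto simp: in_Hom_iff\<close>)
    then show ?thesis by (simp add: ebinom_def in_Hom_iff)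
  qed
  then have e: "ebinom C (shift C (rank C V) (- of_nat i)) j \<in> Hom C \<bbbI> \<bbbI>" by (simp add: shift_Hom rank_Hom)
  then have "act C (ebinom C (shift C (rank C V) (- of_nat i)) j) f \<in> Arr C"
    using assms by (simp add: act_def in_Hom_iff)
  then show ?thesis
    unfolding z sc_eq_ebinom[OF rank_Hom] g(1) using act_Scl(1)[OF e assms] by simp
qed

end

end

end

theorem theorem5p5:
  fixes C :: "('o, 'm) tensor_cat" (structure) and V :: 'o and g i :: nat
  defines "r \<equiv> rank C V"
    and "V' \<equiv> dual C V"
    and "V'' \<equiv> dual C (dual C V)"
  assumes "rigid_pseudo_abelian_tensor_cat C"
    and "V \<in> Obj C"
    and "i \<le> g"
  shows
    "(ev1324 C (wedge C (g - i) V') (wedge C g V'') (wedge C (g - i) V) (wedge C g V')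
         (ev_alt C (g - i) V) (ev_alt C g V')
       \<cdot> (Dup C V i g \<otimes>\<^sub>a Dlow C V i g)
     = Scl C (inverse (of_nat (g choose (g - i))))
         (act C (ebinom C (shift C r (- of_nat i)) (g - i)) (ev_alt_tw C i V)))
     \<and>
     (ev13 C (wedge C (g - i) V) (wedge C g V') (wedge C (g - i) V') (ev_alt_tw C (g - i) V)
       \<cdot> (Dlow C V i g \<otimes>\<^sub>a Id C (wedge C (g - i) V'))
     = Scl C ((- 1) ^ (i * (g - i)))
         (contract_left C (wedge C i V') (wedge C i V) (wedge C g V') (ev_alt C i V)
           \<cdot> (Id C (wedge C i V') \<otimes>\<^sub>a Dlow C V (g - i) g)))
     \<and>
     (ev13 C (wedge C (g - i) V') (wedge C g V'') (wedge C (g - i) V) (ev_alt C (g - i) V)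
       \<cdot> (Dup C V i g \<otimes>\<^sub>a Id C (wedge C (g - i) V))
     = Scl C ((- 1) ^ (i * (g - i)))
         (contract_left C (wedge C i V) (wedge C i V') (wedge C g V'') (ev_alt_tw C i V)
           \<cdot> (Id C (wedge C i V) \<otimes>\<^sub>a Dup C V (g - i) g)))
     \<and>
     (contract_right C (wedge C i V) (wedge C g V') (wedge C g V'') (ev_alt_tw C g V')
       \<cdot> (Dlow C V (g - i) g \<otimes>\<^sub>a Id C (wedge C g V''))
       \<cdot> Dup C V i g
     = Scl C ((- 1) ^ (i * (g - i)) * inverse (of_nat (g choose (g - i))))
         (act C (ebinom C (shift C r (- of_nat i)) (g - i)) (Id C (wedge C i V))))
     \<and>
     (contract_right C (wedge C (g - i) V') (wedge C g V'') (wedge C g V') (ev_alt C g V')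
       \<cdot> (Dup C V i g \<otimes>\<^sub>a Id C (wedge C g V'))
       \<cdot> Dlow C V (g - i) g
     = Scl C ((- 1) ^ (i * (g - i)) * inverse (of_nat (g choose i)))
         (act C (ebinom C (shift C r (of_nat i - of_nat g)) i) (Id C (wedge C (g - i) V'))))
     \<and>
     (wmult13 C V' (g - i) i \<cdot> (Dup C V i g \<otimes>\<^sub>a Dup C V (g - i) g)
     = Scl C (inverse (of_nat (g choose (g - i))))
         (act C (ebinom C (shift C r (- of_nat i)) (g - i))
           (wrefl C g V \<cdot> wmult C V i (g - i))))
     \<and>
     (wmult13 C V (g - i) i \<cdot> (Dlow C V i g \<otimes>\<^sub>a Dlow C V (g - i) g)
     = Scl C (inverse (of_nat (g choose (g - i))))
         (act C (ebinom C (shift C r (- of_nat i)) (g - i)) (wmult C V' i (g - i))))"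
proof -
  interpret rigid_pseudo_abelian_tensor_cat C by fact
  note V = \<open>V \<in> Obj C\<close>
  define j where "j = g - i"
  define q :: rat where "q = (- 1) ^ (i * j)"
  have g: "g = i + j" "g = j + i" using \<open>i \<le> g\<close> by (simp_all add: j_def)
  have gi: "g - i = j" by (simp add: j_def)
  have q': "q = (- 1) ^ (j * i)" by (simp add: q_def mult.commute)
  \<comment> \<open>With g = i + j, the argument r + i - g in the second half of (3) is r -
    j.\<close>
  have r: "shift C (rank C V) (of_nat i - of_nat g) = shift C (rank C V) (- of_nat j)" by (simp add: g)
  note ij = g refl[of "sc (rank C V) i j"] q_def
  \<comment> \<open>The instance with i and j exchanged, for the second half of (3); the sign is
    unchanged, as it depends only on the product.\<close>
  note ji = g(2,1) refl[of "sc (rank C V) j i"] q'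
  have [simp]: "ev_alt_tw C i V \<in> Arr C" using V by (simp add: ev_alt_tw_def twist_def)
  have [simp]: "wrefl C g V \<cdot> wmult C V i j \<in> Arr C" using refl_wmult_Hom(1)[OF V ij] by (simp add: in_Hom_iff)
  have 1: "act C (sc (rank C V) i j) f = Scl C (inverse (of_nat (g choose j))) (act C (ebinom C (shift C (rank C V) (- of_nat i)) j) f)"
    if "f \<in> Arr C" for f
    using Scl_act[OF V ij that, of 1] that sc_Hom[OF rank_Hom[OF V], of i j] by (simp add: act_def in_Hom_iff)
  show ?thesis
    unfolding r_def V'_def V''_def gi q_def[symmetric] r
    using identity1[OF V ij] identity2[OF V ij] identity2'[OF V ij] identity3[OF V ij] identity3'[OF V ji] identity4[OF V ij] identity4'[OF V ij]
      Scl_act[OF V ij, of _ q] Scl_act[OF V ji, of _ q] 1 V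
    by simp
qed

end
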